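(* Let $\varepsilon=\varepsilon(n)$ satisfy $0<\varepsilon<1/10$ and $\varepsilon^3n\to\infty$. Set $\lambda=\lambda(n)=1+\varepsilon$, and let $\lambda_\star<1$ satisfy $\lambda_\star e^{-\lambda_\star}=\lambda e^{-\lambda}$. Then \[ \operatorname{diam}(G(n,\lambda/n)) = \frac{\log(\varepsilon^3 n)}{\log\lambda} + 2\frac{\log(\varepsilon^3 n)}{\log(1/\lambda_\star)} +O_{\mathrm p}(1/\varepsilon). \]
   Context: $G(n,p)$ is the random graph with vertex set $\{1,\dots,n\}$ in which each possible edge is present independently with probability $p$. For a graph $G$, $\operatorname{diam}(G)=\max\{d(x,y): x,y\in V(G),\ d(x,y)<\infty\}$ is the largest graph distance between two vertices in the same component. $X_n=O_{\mathrm p}(f(n))$ means that $X_n/f(n)$ is bounded in probability, i.e. for every $\eta>0$ there is a constant $C$ with $\Pr(|X_n|>C f(n))\le\eta$ for all sufficiently large $n$. *)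

theory Defs
  imports
    "HOL-Probability.Probability"
    "Graph_Theory.Pair_Digraph"
    "Graph_Theory.Shortest_Path"
begin

(* An undirected simple graph is, as everywhere in Graph_Theory, a symmetric loop-free
   digraph: each edge {u, v} contributes the two arcs (u, v) and (v, u). *)

definition possible_edges :: "nat \<Rightarrow> nat set set" where
  "possible_edges n = {e. e \<subseteq> {1..n} \<and> card e = 2}"

definition graph_of_edges :: "nat \<Rightarrow> nat set set \<Rightarrow> (nat, nat \<times> nat) pre_digraph" where
  "graph_of_edges n E = with_proj \<lparr> pverts = {1..n}, parcs = {(u, v). {u, v} \<in> E} \<rparr>"

(* bernoulli_pmf truncates its parameter to [0, 1], so this is also a probability
   distribution for p outside [0, 1]. *)
definition G_np :: "nat \<Rightarrow> real \<Rightarrow> (nat, nat \<times> nat) pre_digraph pmf" where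
  "G_np n p =
     map_pmf (\<lambda>present. graph_of_edges n {e \<in> possible_edges n. present e})
       (Pi_pmf (possible_edges n) False (\<lambda>_. bernoulli_pmf p))"

(* Least number of arcs of a walk from x to y; it is \<infinity> iff there is no such walk. *)
definition graph_dist :: "('a, 'b) pre_digraph \<Rightarrow> 'a \<Rightarrow> 'a \<Rightarrow> ereal" where
  "graph_dist G x y = wf_digraph.\<mu> G (\<lambda>_. 1) x y"

(* Meaningful for finite graphs with at least one vertex. *)
definition diam :: "('a, 'b) pre_digraph \<Rightarrow> real" where
  "diam G = real_of_ereal
     (Max {graph_dist G x y | x y. x \<in> verts G \<and> y \<in> verts G \<and> graph_dist G x y < \<infinity>})"

(* X n = O_p(f n), where the random variable X n lives on the probability space M n. *)
definition bigO_in_prob :: "(nat \<Rightarrow> 'a pmf) \<Rightarrow> (nat \<Rightarrow> 'a \<Rightarrow> real) \<Rightarrow> (nat \<Rightarrow> real) \<Rightarrow> bool" where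
  "bigO_in_prob M X f \<longleftrightarrow>
     (\<forall>\<eta>>0. \<exists>C. \<forall>\<^sub>F n in sequentially.
        measure_pmf.prob (M n) {\<omega>. \<bar>X n \<omega>\<bar> > C * f n} \<le> \<eta>)"

lemma finite_possible_edges: "finite (possible_edges n)"
  unfolding possible_edges_def by (rule finite_subset[of _ "Pow {1..n}"]) auto

lemma graph_graph_of_edges:
  assumes "E \<subseteq> possible_edges n"
  shows "graph (graph_of_edges n E)"
proof -
  have sub: "e \<subseteq> {1..n}" and card: "card e = 2" if "e \<in> E" for e
    using assms that by (auto simp: possible_edges_def)
  have "{(u, v). {u, v} \<in> E} \<subseteq> {1..n} \<times> {1..n}"
    using sub by fastforce
  then have fin: "finite {(u, v). {u, v} \<in> E}"
    by (rule finite_subset) auto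
  show ?thesis
  proof unfold_locales
    fix a assume "a \<in> arcs (graph_of_edges n E)"
    then have a: "{fst a, snd a} \<in> E" by (auto simp: graph_of_edges_def)
    show "tail (graph_of_edges n E) a \<in> verts (graph_of_edges n E)"
      and "head (graph_of_edges n E) a \<in> verts (graph_of_edges n E)"
      using sub[OF a] by (auto simp: graph_of_edges_def)
    show "tail (graph_of_edges n E) a \<noteq> head (graph_of_edges n E) a"
      using card[OF a] by (auto simp: graph_of_edges_def)
  next
    show "finite (verts (graph_of_edges n E))" "finite (arcs (graph_of_edges n E))"
      using fin by (auto simp: graph_of_edges_def)
  next
    show "symmetric (graph_of_edges n E)"
      by (auto simp: graph_of_edges_def symmetric_def sym_def insert_commute)
  qed (auto simp: graph_of_edges_def arc_to_ends_def prod_eq_iff)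
qed

lemma graph_G_np: "G \<in> set_pmf (G_np n p) \<Longrightarrow> graph G"
  by (auto simp: G_np_def intro!: graph_graph_of_edges)

lemma graph_dist_eq_INF_length:
  assumes "wf_digraph G"
  shows "graph_dist G x y = (INF w\<in>{w. pre_digraph.awalk G x w y}. ereal (real (length w)))"
proof -
  have cost: "wf_digraph.awalk_cost (\<lambda>_. 1) w = real (length w)" for w :: "'b list"
    by (induction w) (auto simp: wf_digraph.awalk_cost_def[OF assms])
  show ?thesis
    unfolding graph_dist_def wf_digraph.\<mu>_def[OF assms] cost ..
qed

end

theory Submission
  imports Defs "HOL-Real_Asymp.Real_Asymp"
begin

text \<open>Explore a graph from a vertex in breadth-first order and call a level large if it has at least
  \<open>s0 = sqrt (\<epsilon> n)\<close> vertices. Below this size the levels behave like a branching process, and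
  the first large level appears at a distance of about \<open>a0 = ln (\<epsilon>^3 n) / (2 ln \<lambda>)\<close>; the probability that the process
  is alive but not yet large at distance \<open>a0 + r\<close> is of order \<open>\<epsilon> \<lambda>\<^sub>\<star>^r\<close>. Two large levels
  are joined within \<open>g / \<epsilon>\<close> further steps, up to a probability that is doubly exponentially small in \<open>g\<close>.
  With \<open>t = ln (\<epsilon>^3 n) / ln (1 / \<lambda>\<^sub>\<star>)\<close> the diameter is \<open>2 (a0 + t) + O(1 / \<epsilon>)\<close>.

  Upper bound: near the two ends of a longer geodesic there are about \<open>1 / \<epsilon>\<close> vertices each
  from which two disjoint geodesic rays of length \<open>1 / \<epsilon>\<close> start. Two such rays cost
  one more factor \<open>\<epsilon>\<close> than one, so that a first moment over the about \<open>1 / \<epsilon>\<^sup>2\<close> pairs of such vertices suffices.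

  Lower bound: from a fixed set of about \<open>s0\<close> vertices, the levels at distance
  \<open>a0 + t - K / \<epsilon>\<close> still have at least \<open>1 / \<epsilon>\<close> vertices, which gives about
  \<open>1 / \<epsilon>\<^sup>2\<close> vertices in a window of length \<open>1 / \<epsilon>\<close>. By a first moment, most of them have no large level before distance
  \<open>a0 + t - K' / \<epsilon>\<close>, and after that level the exploration survives for another \<open>a0 + t - K'' / \<epsilon>\<close> steps.\<close>

section \<open>Expectations over random subsets\<close>

text \<open>An expectation is a finite sum \<open>rsE\<close>, so conditioning on an exploration is
  a splitting of the edge set, and estimates go by induction over levels in a shrinking vertex set.
  Both bounds live on one scale: the chance of being alive but never large at distance
  \<open>a0 + t\<close> is about \<epsilon> / (\<epsilon>^3 n), so about 1 / \<epsilon>^2 vertices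
  have this property. They are clustered, hence a plain union bound over vertices loses powers of
  \<epsilon>; the two rays bring their number to 1 / \<epsilon>, which a single geodesic supplies.
  In the other direction, levels started from \<open>s0\<close> vertices grow by \<lambda> for
  \<open>a0\<close> steps to size \<epsilon>^2 n; then the giant component is used up, the mean
  offspring drops to \<open>\<lambda>\<^sub>\<star>\<close>, and after \<open>t\<close> more steps 1
  / \<epsilon> vertices remain. The obstacle is that about ln (\<epsilon>^3 n) / \<epsilon>
  generations may cost only a constant factor. Relative errors of the mean must therefore be at most
  of order \<epsilon> / ln (\<epsilon>^3 n), which fixes the logarithms in \<open>be\<close>,
  \<open>y1\<close> and \<open>sat\<close>.\<close>

definition rsE :: "real \<Rightarrow> 'a set \<Rightarrow> ('a set \<Rightarrow> real) \<Rightarrow> real" where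
  "rsE p A f = (\<Sum>X\<in>Pow A. p ^ card X * (1 - p) ^ card (A - X) * f X)"

lemma rsE_empty [simp]: "rsE p {} f = f {}"
  by (simp add: rsE_def)

lemma rsE_insert:
  assumes "finite A" "a \<notin> A"
  shows "rsE p (insert a A) f = p * rsE p A (\<lambda>X. f (insert a X)) + (1 - p) * rsE p A f"
proof -
  have disj: "Pow A \<inter> insert a ` Pow A = {}" using assms by auto
  have inj: "inj_on (insert a) (Pow A)" using assms by (auto simp: inj_on_def)
  have fin: "finite X" if "X \<in> Pow A" for X using that assms finite_subset by blast
  have 1: "p ^ card (insert a X) * (1 - p) ^ card (insert a A - insert a X) * f (insert a X)
      = p * (p ^ card X * (1 - p) ^ card (A - X) * f (insert a X))" if "X \<in> Pow A" for X
  proof -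
    have "insert a A - insert a X = A - X" using that assms by auto
    moreover have "card (insert a X) = Suc (card X)" using that assms fin by (subst card_insert_disjoint) auto
    ultimately show ?thesis by simp
  qed
  have 2: "p ^ card X * (1 - p) ^ card (insert a A - X) * f X
      = (1 - p) * (p ^ card X * (1 - p) ^ card (A - X) * f X)" if "X \<in> Pow A" for X
  proof -
    have "insert a A - X = insert a (A - X)" using that assms by auto
    then have "card (insert a A - X) = Suc (card (A - X))" using that assms by (simp add: card_insert_disjoint)
    then show ?thesis by simp
  qed
  have "rsE p (insert a A) f = (\<Sum>X\<in>Pow A. p ^ card X * (1 - p) ^ card (insert a A - X) * f X)
     + (\<Sum>X\<in>insert a ` Pow A. p ^ card X * (1 - p) ^ card (insert a A - X) * f X)"
    unfolding rsE_def Pow_insert using assms disj by (subst sum.union_disjoint) auto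
  also have "(\<Sum>X\<in>insert a ` Pow A. p ^ card X * (1 - p) ^ card (insert a A - X) * f X)
     = (\<Sum>X\<in>Pow A. p ^ card (insert a X) * (1 - p) ^ card (insert a A - insert a X) * f (insert a X))"
    using inj by (subst sum.reindex) auto
  also have "\<dots> = p * rsE p A (\<lambda>X. f (insert a X))"
    unfolding rsE_def sum_distrib_left using 1 by (intro sum.cong) auto
  also have "(\<Sum>X\<in>Pow A. p ^ card X * (1 - p) ^ card (insert a A - X) * f X) = (1 - p) * rsE p A f"
    unfolding rsE_def sum_distrib_left using 2 by (intro sum.cong) auto
  finally show ?thesis by simp
qed

lemma rsE_cong:
  assumes "A = B" "\<And>X. X \<subseteq> B \<Longrightarrow> f X = g X"
  shows "rsE p A f = rsE p B g"
  unfolding rsE_def using assms by (intro sum.cong) auto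

lemma rsE_mono:
  assumes "0 \<le> p" "p \<le> 1" "\<And>X. X \<subseteq> A \<Longrightarrow> f X \<le> g X"
  shows "rsE p A f \<le> rsE p A g"
  unfolding rsE_def using assms by (intro sum_mono mult_left_mono) auto

lemma rsE_const [simp]: "finite A \<Longrightarrow> rsE p A (\<lambda>_. c) = c"
  by (induction A rule: finite_induct) (auto simp: rsE_insert algebra_simps)

lemma rsE_add: "rsE p A (\<lambda>X. f X + g X) = rsE p A f + rsE p A g"
  by (simp add: rsE_def algebra_simps sum.distrib)

lemma rsE_cmult: "rsE p A (\<lambda>X. c * f X) = c * rsE p A f"
  by (simp add: rsE_def algebra_simps sum_distrib_left)

lemma rsE_cmult_right: "rsE p A (\<lambda>X. f X * c) = rsE p A f * c"
  using rsE_cmult[of p A c f] by (simp add: mult.commute)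

lemma rsE_diff: "rsE p A (\<lambda>X. f X - g X) = rsE p A f - rsE p A g"
  by (simp add: rsE_def algebra_simps sum_subtractf)

lemma rsE_sum: "rsE p A (\<lambda>X. \<Sum>i\<in>I. f i X) = (\<Sum>i\<in>I. rsE p A (f i))"
  unfolding rsE_def sum_distrib_left by (rule sum.swap)

lemma rsE_nonneg:
  assumes "0 \<le> p" "p \<le> 1" "\<And>X. X \<subseteq> A \<Longrightarrow> 0 \<le> f X"
  shows "0 \<le> rsE p A f"
  unfolding rsE_def using assms by (intro sum_nonneg mult_nonneg_nonneg) auto

lemma rsE_le_const:
  assumes "finite A" "0 \<le> p" "p \<le> 1" "\<And>X. X \<subseteq> A \<Longrightarrow> f X \<le> c"
  shows "rsE p A f \<le> c"
  using rsE_mono[of p A f "\<lambda>_. c"] assms by simp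

lemma rsE_Un:
  assumes "finite A" "finite B" "A \<inter> B = {}"
  shows "rsE p (A \<union> B) f = rsE p A (\<lambda>X. rsE p B (\<lambda>Y. f (X \<union> Y)))"
  using assms(1,3)
proof (induction A arbitrary: f rule: finite_induct)
  case (insert a A)
  then show ?case using assms(2) by (simp add: rsE_insert)
qed simp

lemma rsE_power:
  assumes "finite A" 
  shows "rsE p A (\<lambda>X. g ^ card X) = (1 - p + p * g) ^ card A"
  using assms
proof (induction A rule: finite_induct)
  case (insert a A)
  have "rsE p A (\<lambda>X. g ^ card (insert a X)) = rsE p A (\<lambda>X. g * g ^ card X)"
  proof (rule rsE_cong)
    fix X assume "X \<subseteq> A"
    then have "finite X" "a \<notin> X" using insert finite_subset by auto
    then show "g ^ card (insert a X) = g * g ^ card X" by simp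
  qed simp
  then show ?case using insert by (simp add: rsE_insert rsE_cmult algebra_simps)
qed simp

lemma rsE_power_avoid:
  assumes "finite A" "U \<subseteq> A"
  shows "rsE p A (\<lambda>X. of_bool (X \<inter> U = {}) * g ^ card X)
    = (1 - p) ^ card U * (1 - p + p * g) ^ card (A - U)"
proof -
  have fin: "finite U" using assms finite_subset by auto
  have eq: "U \<union> (A - U) = A" using assms by auto
  have "rsE p A (\<lambda>X. of_bool (X \<inter> U = {}) * g ^ card X) =
     rsE p U (\<lambda>X. rsE p (A - U) (\<lambda>Y. of_bool ((X \<union> Y) \<inter> U = {}) * g ^ card (X \<union> Y)))"
    using rsE_Un[of U "A - U" p "\<lambda>X. of_bool (X \<inter> U = {}) * g ^ card X"] fin assms eq by simp
  \<comment> \<open>The indicator of X = {} is written as \<open>0 ^ card X\<close>, so that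
    \<open>rsE_power\<close> with base 0 evaluates the outer expectation.\<close>
  also have "\<dots> = rsE p U (\<lambda>X. 0 ^ card X * (1 - p + p * g) ^ card (A - U))"
  proof (rule rsE_cong)
    fix X assume X: "X \<subseteq> U"
    then have "finite X" using fin finite_subset by auto
    show "rsE p (A - U) (\<lambda>Y. of_bool ((X \<union> Y) \<inter> U = {}) * g ^ card (X \<union> Y)) =
         0 ^ card X * (1 - p + p * g) ^ card (A - U)"
    proof (cases "X = {}")
      case True
      have "rsE p (A - U) (\<lambda>Y. of_bool ((X \<union> Y) \<inter> U = {}) * g ^ card (X \<union> Y)) =
        rsE p (A - U) (\<lambda>Y. g ^ card Y)"
        using True by (intro rsE_cong) auto
      then show ?thesis using True assms by (simp add: rsE_power)
    next
      case False
      then have "rsE p (A - U) (\<lambda>Y. of_bool ((X \<union> Y) \<inter> U = {}) * g ^ card (X \<union> Y)) =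
        rsE p (A - U) (\<lambda>Y. 0)"
        using X by (intro rsE_cong) auto
      then show ?thesis using False \<open>finite X\<close> assms by (simp add: card_gt_0_iff)
    qed
  qed simp
  also have "\<dots> = (1 - p) ^ card U * (1 - p + p * g) ^ card (A - U)"
    using fin by (simp add: rsE_cmult_right rsE_power)
  finally show ?thesis .
qed

lemma rsE_card:
  assumes "finite A" 
  shows "rsE p A (\<lambda>X. real (card X)) = p * card A"
  using assms
proof (induction A rule: finite_induct)
  case (insert a A)
  have "rsE p A (\<lambda>X. real (card (insert a X))) = rsE p A (\<lambda>X. 1 + real (card X))"
  proof (rule rsE_cong)
    fix X assume "X \<subseteq> A"
    then have "finite X" "a \<notin> X" using insert finite_subset by auto
    then show "real (card (insert a X)) = 1 + real (card X)" by simp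
  qed simp
  then show ?case using insert by (simp add: rsE_insert rsE_add algebra_simps)
qed simp

lemma rsE_empty_prob: "finite A \<Longrightarrow> rsE p A (\<lambda>X. of_bool (X = {})) = (1 - p) ^ card A"
  by (induction A rule: finite_induct) (auto simp: rsE_insert)

lemma rsE_superset:
  assumes "finite A" "F \<subseteq> A"
  shows "rsE p A (\<lambda>X. of_bool (F \<subseteq> X)) = p ^ card F"
  using assms
proof (induction A arbitrary: F rule: finite_induct)
  case (insert a A)
  have fF: "finite F" using insert finite_subset by (metis finite.insertI)
  have 1: "F \<subseteq> insert a X \<longleftrightarrow> F - {a} \<subseteq> X" for X by auto
  have sub: "F - {a} \<subseteq> A" using insert by auto
  show ?case
  proof (cases "a \<in> F")
    case True
    have "rsE p A (\<lambda>X. of_bool (F \<subseteq> X)) = rsE p A (\<lambda>X. 0)"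
      using True insert by (intro rsE_cong) auto
    then have "rsE p (insert a A) (\<lambda>X. of_bool (F \<subseteq> X)) = p * p ^ card (F - {a})"
      using insert by (simp add: rsE_insert 1 insert.IH[OF sub])
    then show ?thesis using True fF by (metis card.remove power_Suc)
  next
    case False
    then have "F - {a} = F" by auto
    then show ?thesis using insert.IH[OF sub] insert by (simp add: rsE_insert 1 algebra_simps)
  qed
qed (simp add: rsE_empty)

section \<open>Graphs as edge sets\<close>

definition Edg :: "'a set \<Rightarrow> 'a set set" where
  "Edg V = {e. e \<subseteq> V \<and> card e = 2}"

text \<open>Edges are revealed by vertex: \<open>touch E B\<close>, defined next, is what an
  exploration that has processed B has seen, and \<open>del E B\<close> is the untouched
  remainder.\<close>

definition del :: "'a set set \<Rightarrow> 'a set \<Rightarrow> 'a set set" where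
  "del E B = {e \<in> E. e \<inter> B = {}}"

definition touch :: "'a set set \<Rightarrow> 'a set \<Rightarrow> 'a set set" where
  "touch E B = {e \<in> E. e \<inter> B \<noteq> {}}"

definition nb :: "'a set set \<Rightarrow> 'a set \<Rightarrow> 'a set" where
  "nb E S = {y. \<exists>x\<in>S. {x, y} \<in> E}"

lemma finite_Edg [simp]: "finite V \<Longrightarrow> finite (Edg V)"
  unfolding Edg_def by (rule finite_subset[of _ "Pow V"]) auto

lemma Edg_split: "Edg V = touch (Edg V) B \<union> Edg (V - B)" "touch (Edg V) B \<inter> Edg (V - B) = {}"
  by (auto simp: touch_def Edg_def)

lemma del_subset: "E \<subseteq> Edg V \<Longrightarrow> del E B \<subseteq> Edg (V - B)"
  by (auto simp: del_def Edg_def)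

lemma nb_subset: "E \<subseteq> Edg V \<Longrightarrow> nb E S \<subseteq> V"
  by (auto simp: nb_def Edg_def)

lemma del_empty [simp]: "del E {} = E" by (simp add: del_def)
lemma del_del: "del (del E A) B = del E (A \<union> B)" by (auto simp: del_def)
lemma touch_touch: "touch (touch E A) A = touch E A" by (auto simp: touch_def)

lemma rsE_touch_del:
  assumes "finite V" "\<And>E. E \<subseteq> Edg V \<Longrightarrow> f E = g (touch E B) (del E B)"
  shows "rsE p (Edg V) f = rsE p (touch (Edg V) B) (\<lambda>X. rsE p (Edg (V - B)) (\<lambda>Y. g X Y))"
proof -
  have "rsE p (Edg V) f = rsE p (touch (Edg V) B \<union> Edg (V - B)) f"
    using Edg_split(1) by metis
  also have "\<dots> = rsE p (touch (Edg V) B) (\<lambda>X. rsE p (Edg (V - B)) (\<lambda>Y. f (X \<union> Y)))"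
    using assms(1) Edg_split(2)[of V B]
    by (intro rsE_Un) (auto simp: touch_def)
  also have "\<dots> = rsE p (touch (Edg V) B) (\<lambda>X. rsE p (Edg (V - B)) (\<lambda>Y. g X Y))"
  proof (intro rsE_cong refl)
    fix X Y assume XY: "X \<subseteq> touch (Edg V) B" "Y \<subseteq> Edg (V - B)"
    have "X \<union> Y \<subseteq> Edg V" using XY by (auto simp: touch_def Edg_def)
    moreover have "touch (X \<union> Y) B = X" "del (X \<union> Y) B = Y" using XY by (auto simp: touch_def del_def Edg_def)
    ultimately show "f (X \<union> Y) = g X Y" using assms(2) by metis
  qed
  finally show ?thesis .
qed

lemma rsE_indep:
  assumes "finite V" "\<And>E. E \<subseteq> Edg V \<Longrightarrow> f E = f (touch E B)"
  shows "rsE p (Edg V) (\<lambda>E. f E * g (del E B)) = rsE p (Edg V) f * rsE p (Edg (V - B)) g"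
proof -
  have 1: "rsE p (Edg V) (\<lambda>E. f E * g (del E B)) = rsE p (touch (Edg V) B) (\<lambda>X. rsE p (Edg (V - B)) (\<lambda>Y. f X * g Y))"
    using assms by (intro rsE_touch_del) auto
  have 2: "rsE p (Edg V) f = rsE p (touch (Edg V) B) (\<lambda>X. rsE p (Edg (V - B)) (\<lambda>Y. f X))"
    using assms by (intro rsE_touch_del) auto
  show ?thesis unfolding 1 2 using assms by (simp add: rsE_cmult rsE_cmult_right)
qed

text \<open>Each w sees a star of \<open>card P\<close> possible edges, empty with probability
  \<open>(1 - p) ^ card P\<close>; the stars of distinct w are disjoint, so the hit vertices form a
  random subset with independent membership. The induction adds one star.\<close>

lemma rsE_nb:
  assumes "finite P" "finite W" "P \<inter> W = {}"
  shows "rsE p {e. \<exists>u\<in>P. \<exists>w\<in>W. e = {u, w}} (\<lambda>E. g (nb E P \<inter> W)) = rsE (1 - (1 - p) ^ card P) W g"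
  using assms(2,3)
proof (induction W arbitrary: g rule: finite_induct)
  case empty
  then show ?case by simp
next
  case (insert w W)
  let ?B = "{e. \<exists>u\<in>P. \<exists>w\<in>W. e = {u, w}}"
  let ?s = "(\<lambda>u. {u, w}) ` P"
  let ?q = "1 - (1 - p) ^ card P"
  have eq: "{e. \<exists>u\<in>P. \<exists>w'\<in>insert w W. e = {u, w'}} = ?s \<union> ?B" by auto
  have finB: "finite ?B"
    by (rule finite_subset[of _ "Pow (P \<union> W)"]) (use assms insert in auto)
  have disj: "?s \<inter> ?B = {}" using insert by (auto simp: doubleton_eq_iff)
  have inj: "inj_on (\<lambda>u. {u, w}) P" by (auto simp: inj_on_def doubleton_eq_iff)
  have *: "nb (X \<union> Y) P \<inter> insert w W = (if X = {} then nb Y P \<inter> W else insert w (nb Y P \<inter> W))"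
    if "X \<subseteq> ?s" "Y \<subseteq> ?B" for X Y
  proof -
    have a: "w \<in> nb (X \<union> Y) P \<longleftrightarrow> X \<noteq> {}"
    proof
      assume "w \<in> nb (X \<union> Y) P"
      then obtain x where "x \<in> P" "{x, w} \<in> X \<union> Y" by (auto simp: nb_def)
      then show "X \<noteq> {}" using that insert by (auto simp: doubleton_eq_iff)
    next
      assume "X \<noteq> {}" then show "w \<in> nb (X \<union> Y) P" using that by (auto simp: nb_def)
    qed
    have b: "nb (X \<union> Y) P \<inter> W = nb Y P \<inter> W"
    proof -
      have "{x, y} \<notin> X" if "x \<in> P" "y \<in> W" for x y
        using \<open>X \<subseteq> ?s\<close> that insert by (auto simp: doubleton_eq_iff)
      then show ?thesis by (auto simp: nb_def)
    qed
    show ?thesis unfolding Int_insert_right a b by simp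
  qed
  have "rsE p (?s \<union> ?B) (\<lambda>E. g (nb E P \<inter> insert w W)) =
    rsE p ?s (\<lambda>X. rsE p ?B (\<lambda>Y. g (nb (X \<union> Y) P \<inter> insert w W)))"
    by (rule rsE_Un[OF _ finB disj]) (simp add: assms)
  also have "\<dots> = rsE p ?s (\<lambda>X. rsE p ?B (\<lambda>Y. g (if X = {} then nb Y P \<inter> W else insert w (nb Y P \<inter> W))))"
    by (intro rsE_cong refl) (simp only: *)
  also have "\<dots> = rsE p ?s (\<lambda>X. rsE ?q W g * of_bool (X = {}) + rsE ?q W (\<lambda>T. g (insert w T)) * (1 - of_bool (X = {})))"
  proof (intro rsE_cong refl)
    fix X
    show "rsE p ?B (\<lambda>Y. g (if X = {} then nb Y P \<inter> W else insert w (nb Y P \<inter> W))) =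
        rsE ?q W g * of_bool (X = {}) + rsE ?q W (\<lambda>T. g (insert w T)) * (1 - of_bool (X = {}))"
      using insert.IH[of g] insert.IH[of "\<lambda>T. g (insert w T)"] insert.prems by (cases "X = {}") auto
  qed
  also have "\<dots> = rsE ?q W g * (1 - ?q) + rsE ?q W (\<lambda>T. g (insert w T)) * ?q"
    using assms inj by (simp add: rsE_add rsE_cmult rsE_diff rsE_empty_prob card_image)
  also have "\<dots> = rsE ?q (insert w W) g"
    using insert by (simp add: rsE_insert)
  finally show ?case unfolding eq .
qed

text \<open>P is the set being processed, S the set already discovered. P = S advances a whole
  breadth-first level; a singleton P processes one vertex, as needed for the size of
  \<open>reach\<close>.\<close>

lemma rsE_step:
  assumes V: "finite V" "P \<subseteq> S" "S \<subseteq> V"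
  shows "rsE p (Edg V) (\<lambda>E. g (nb E P - S) (del E P))
    = rsE (1 - (1 - p) ^ card P) (V - S) (\<lambda>T. rsE p (Edg (V - P)) (g T))"
proof -
  let ?W = "V - S"
  let ?B = "{e. \<exists>u\<in>P. \<exists>w\<in>?W. e = {u, w}}"
  \<comment> \<open>These are the edges from P into S. They discover nothing and are integrated
    out.\<close>
  let ?O = "touch (Edg V) P - ?B"
  define G where "G = (\<lambda>T. rsE p (Edg (V - P)) (g T))"
  have fin: "finite P" "finite S" using finite_subset[OF _ V(1)] V by auto
  have finT: "finite (touch (Edg V) P)"
    by (rule finite_subset[of _ "Edg V"]) (use V in \<open>auto simp: touch_def\<close>)
  have nbeq: "nb E P - S = nb (touch E P) P \<inter> ?W" if "E \<subseteq> Edg V" for E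
    using nb_subset[OF that] by (auto simp: nb_def touch_def)
  have "rsE p (Edg V) (\<lambda>E. g (nb E P - S) (del E P)) = 
     rsE p (touch (Edg V) P) (\<lambda>X. rsE p (Edg (V - P)) (\<lambda>Y. g (nb X P \<inter> ?W) Y))"
    using V nbeq by (intro rsE_touch_del) (auto simp: touch_touch)
  also have "\<dots> = rsE p (touch (Edg V) P) (\<lambda>X. G (nb X P \<inter> ?W))" unfolding G_def ..
  also have "\<dots> = rsE p (?O \<union> ?B) (\<lambda>X. G (nb X P \<inter> ?W))"
  proof (rule rsE_cong)
    have "card {u, w} = 2" if "u \<in> P" "w \<in> ?W" for u w
    proof -
      have "u \<noteq> w" using that V by auto
      then show ?thesis by simp
    qed
    then show "touch (Edg V) P = ?O \<union> ?B"
      using V by (auto simp: touch_def Edg_def)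
  qed simp
  also have "\<dots> = rsE p ?O (\<lambda>X. rsE p ?B (\<lambda>Y. G (nb (X \<union> Y) P \<inter> ?W)))"
  proof (rule rsE_Un)
    show "finite ?O" by (intro finite_Diff finT)
    have "?B \<subseteq> Pow V" using V by blast
    then show "finite ?B" using V finite_subset by blast
    show "?O \<inter> ?B = {}" by blast
  qed
  also have "\<dots> = rsE p ?O (\<lambda>X. rsE p ?B (\<lambda>Y. G (nb Y P \<inter> ?W)))"
  proof (intro rsE_cong refl)
    fix X Y assume X: "X \<subseteq> ?O"
    have "{x, y} \<notin> X" if "x \<in> P" "y \<in> ?W" for x y using X that by auto
    then have "nb (X \<union> Y) P \<inter> ?W = nb Y P \<inter> ?W" by (auto simp: nb_def)
    then show "G (nb (X \<union> Y) P \<inter> ?W) = G (nb Y P \<inter> ?W)" by simp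
  qed
  also have "\<dots> = rsE p ?O (\<lambda>X. rsE (1 - (1 - p) ^ card P) ?W G)"
  proof -
    have "P \<inter> ?W = {}" using V by blast
    then have "rsE p ?B (\<lambda>Y. G (nb Y P \<inter> ?W)) = rsE (1 - (1 - p) ^ card P) ?W G"
      using fin V by (intro rsE_nb) (simp_all)
    then show ?thesis by simp
  qed
  also have "\<dots> = rsE (1 - (1 - p) ^ card P) ?W G"
  proof (rule rsE_const)
    show "finite ?O" by (intro finite_Diff finT)
  qed
  finally show ?thesis unfolding G_def .
qed

section \<open>Breadth-first levels and their Markov property\<close>

fun wlk :: "'a set set \<Rightarrow> nat \<Rightarrow> 'a \<Rightarrow> 'a \<Rightarrow> bool" where
  "wlk E 0 x y \<longleftrightarrow> x = y"
| "wlk E (Suc k) x y \<longleftrightarrow> (\<exists>z. {x, z} \<in> E \<and> wlk E k z y)"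

definition lev :: "'a set set \<Rightarrow> 'a set \<Rightarrow> nat \<Rightarrow> 'a set" where
  "lev E S k = {y. (\<exists>x\<in>S. wlk E k x y) \<and> (\<forall>j<k. \<forall>x\<in>S. \<not> wlk E j x y)}"

text \<open>The ball omits level k: the edges meeting it determine level k, and all edges avoiding
  it, in particular those from level k onwards, are still unrevealed.\<close>

definition bl :: "'a set set \<Rightarrow> 'a set \<Rightarrow> nat \<Rightarrow> 'a set" where
  "bl E S k = (\<Union>j<k. lev E S j)"

lemma wlk_mono: "wlk E k x y \<Longrightarrow> E \<subseteq> F \<Longrightarrow> wlk F k x y"
  by (induction k arbitrary: x) auto

lemma wlk_add: "wlk E (j + k) x z \<longleftrightarrow> (\<exists>y. wlk E j x y \<and> wlk E k y z)"
  by (induction j arbitrary: x) auto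

lemma wlk_sym: "wlk E k x y \<Longrightarrow> wlk E k y x"
proof (induction k arbitrary: x)
  case (Suc k)
  then obtain z where "{x, z} \<in> E" "wlk E k z y" by auto
  then have "wlk E k y z" "wlk E (Suc 0) z x" using Suc by (auto simp: insert_commute)
  then have "wlk E (k + Suc 0) y x" using wlk_add[of E k "Suc 0" y x] by blast
  then show ?case by simp
qed simp

lemma del_le: "del E B \<subseteq> E" by (auto simp: del_def)

lemma lev_0 [simp]: "lev E S 0 = S" by (auto simp: lev_def)

lemma lev_unique: "y \<in> lev E S j \<Longrightarrow> y \<in> lev E S k \<Longrightarrow> j = k"
  by (cases j k rule: linorder_cases) (auto simp: lev_def)

lemma lev_disjoint: "j \<noteq> k \<Longrightarrow> lev E S j \<inter> lev E S k = {}"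
  by (auto dest: lev_unique)

lemma wlk_imp_lev:
  assumes "x \<in> S" "wlk E k x y"
  shows "\<exists>j\<le>k. y \<in> lev E S j"
proof -
  let ?P = "\<lambda>j. \<exists>x\<in>S. wlk E j x y"
  define j where "j = (LEAST j. ?P j)"
  have P: "?P k" using assms by auto
  have "?P j" unfolding j_def using P by (rule LeastI)
  moreover have "j \<le> k" unfolding j_def using P by (rule Least_le)
  moreover have "\<not> ?P i" if "i < j" for i using that not_less_Least unfolding j_def by blast
  ultimately show ?thesis unfolding lev_def by auto
qed

lemma wlk_del:
  assumes "wlk E k z y" "\<And>j x. j \<le> k \<Longrightarrow> x \<in> S \<Longrightarrow> \<not> wlk E j x y"
  shows "wlk (del E S) k z y"
  using assms
proof (induction k arbitrary: z)
  case (Suc k)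
  then obtain z' where z: "{z, z'} \<in> E" "wlk E k z' y" by auto
  have "z \<notin> S" using Suc.prems by blast
  moreover have "z' \<notin> S" using z Suc.prems(2)[of k z'] by auto
  moreover have "wlk (del E S) k z' y" using z Suc by simp
  ultimately show ?case using z by (auto simp: del_def)
qed simp

text \<open>A shortest walk never returns to S. The recursion trades a level for a smaller graph, so
  that inductions over levels generalise over V and S instead of tracking a history.\<close>

lemma lev_Suc: "lev E S (Suc k) = lev (del E S) (nb E S - S) k"
proof -
  have sub: "y \<in> lev (del E S) (nb E S - S) k" if y: "y \<in> lev E S (Suc k)" for y k
  proof -
    from y obtain x z where x: "x \<in> S" "{x, z} \<in> E" "wlk E k z y" by (auto simp: lev_def)
    have no: "\<not> wlk E j x y" if "j \<le> k" "x \<in> S" for j x using y that by (auto simp: lev_def)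
    have "z \<notin> S" using no[of k z] x by auto
    then have "z \<in> nb E S - S" using x by (auto simp: nb_def)
    moreover have "wlk (del E S) k z y" using wlk_del[OF x(3) no] by simp
    moreover have "\<not> wlk (del E S) j z' y" if jz: "j < k" "z' \<in> nb E S - S" for j z'
    proof
      assume "wlk (del E S) j z' y"
      then have w: "wlk E j z' y" using wlk_mono del_le by metis
      obtain x' where "x' \<in> S" "{x', z'} \<in> E" using jz by (auto simp: nb_def)
      then show False using no[of "Suc j" x'] jz w by auto
    qed
    ultimately show ?thesis unfolding lev_def by blast
  qed
  have "y \<in> lev E S (Suc k)" if y: "y \<in> lev (del E S) (nb E S - S) k" for y
  proof -
    from y obtain z where z: "z \<in> nb E S - S" "wlk (del E S) k z y" by (auto simp: lev_def)
    then have w: "wlk E k z y" using wlk_mono del_le by metis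
    obtain x where x: "x \<in> S" "{x, z} \<in> E" using z by (auto simp: nb_def)
    then have "wlk E (Suc k) x y" using w by auto
    then obtain j where j: "j \<le> Suc k" "y \<in> lev E S j" using wlk_imp_lev x by metis
    have nS: "y \<notin> S"
    proof (cases k)
      case 0 then show ?thesis using z by simp
    next
      case (Suc k')
      then obtain u where "wlk (del E S) k' z u" "wlk (del E S) (Suc 0) u y"
        using z(2) wlk_add[of "del E S" k' 1 z y] by auto
      then have "{u, y} \<in> del E S" by simp
      then show ?thesis by (auto simp: del_def)
    qed
    show ?thesis
    proof (cases j)
      case 0 then show ?thesis using j nS by simp
    next
      case (Suc j')
      then have "y \<in> lev (del E S) (nb E S - S) j'" using sub j by auto
      then have "j' = k" using y lev_unique by metis
      then show ?thesis using j Suc by simp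
    qed
  qed
  then show ?thesis using sub by blast
qed

lemma bl_0 [simp]: "bl E S 0 = {}" by (simp add: bl_def)

lemma bl_Suc: "bl E S (Suc k) = bl E S k \<union> lev E S k"
  by (auto simp: bl_def less_Suc_eq)

lemma bl_Suc': "bl E S (Suc k) = S \<union> bl (del E S) (nb E S - S) k"
proof -
  have "bl E S (Suc k) = (\<Union>j\<in>insert 0 (Suc ` {..<k}). lev E S j)"
    unfolding bl_def lessThan_Suc_eq_insert_0 ..
  then show ?thesis by (simp add: lev_Suc bl_def)
qed

lemma bl_mono: "j \<le> k \<Longrightarrow> bl E S j \<subseteq> bl E S k"
  by (force simp: bl_def)

lemma lev_subset:
  assumes "E \<subseteq> Edg V" "S \<subseteq> V"
  shows "lev E S k \<subseteq> V"
  using assms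
proof (induction k arbitrary: E S V)
  case (Suc k)
  have "nb E S - S \<subseteq> V - S" using nb_subset[OF Suc.prems(1)] by auto
  then have "lev (del E S) (nb E S - S) k \<subseteq> V - S" using Suc.IH del_subset[OF Suc.prems(1)] by blast
  then show ?case by (auto simp: lev_Suc)
qed simp

lemma bl_subset: "E \<subseteq> Edg V \<Longrightarrow> S \<subseteq> V \<Longrightarrow> bl E S k \<subseteq> V"
  unfolding bl_def using lev_subset by blast

lemma lev_empty [simp]: "lev E {} k = {}" by (simp add: lev_def)

lemma lev_add: "lev E S (j + k) = lev (del E (bl E S j)) (lev E S j) k"
proof (induction j arbitrary: E S)
  case (Suc j)
  show ?case by (simp add: lev_Suc Suc bl_Suc' del_del)
qed simp

lemma lev_empty_mono: "lev E S j = {} \<Longrightarrow> j \<le> k \<Longrightarrow> lev E S k = {}"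
  using lev_add[of E S j "k - j"] by simp

lemma lev_bl_disjoint: "lev E S k \<inter> bl E S k = {}"
  by (auto simp: bl_def dest: lev_unique)

lemma touch_eq_mono:
  assumes "touch E B = touch E' B" "A \<subseteq> B"
  shows "touch E A = touch E' A"
proof -
  have "touch F A = touch (touch F B) A" for F using assms(2) by (auto simp: touch_def)
  then show ?thesis using assms by metis
qed

text \<open>A level arises from the edges at the preceding one, which still lies in the ball; hence
  level k itself is covered although the ball stops before it.\<close>

lemma lev_local:
  assumes "touch E (bl E S k) = touch E' (bl E S k)" "j \<le> k"
  shows "lev E' S j = lev E S j"
  using assms
proof (induction k arbitrary: E E' S j)
  case (Suc k)
  have t: "touch E S = touch E' S"
    using Suc.prems(1) by (rule touch_eq_mono) (auto simp: bl_Suc')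
  have nbt: "nb F S = nb (touch F S) S" for F by (auto simp: nb_def touch_def)
  have nb: "nb E' S = nb E S" using t nbt by metis
  have dt: "touch (del F S) A = del (touch F A) S" for F A by (auto simp: del_def touch_def)
  have t2: "touch E (bl (del E S) (nb E S - S) k) = touch E' (bl (del E S) (nb E S - S) k)"
    using Suc.prems(1) by (rule touch_eq_mono) (auto simp: bl_Suc')
  have IH: "lev (del E' S) (nb E S - S) i = lev (del E S) (nb E S - S) i" if "i \<le> k" for i
    using that t2 by (intro Suc.IH) (simp_all add: dt)
  show ?case
  proof (cases j)
    case (Suc i)
    then show ?thesis using IH[of i] Suc.prems nb by (simp add: lev_Suc)
  qed simp
qed simp

lemma bl_local:
  assumes "touch E (bl E S k) = touch E' (bl E S k)" "j \<le> Suc k"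
  shows "bl E' S j = bl E S j"
  unfolding bl_def using lev_local[OF assms(1)] assms(2) by (intro SUP_cong) auto

section \<open>Functionals determined by an explored ball\<close>

text \<open>Measurability with respect to the exploration up to level k, expressed without
  \<sigma>-algebras: two edge sets that agree on what the exploration of one of them reveals give
  the same value.\<close>

definition local_at :: "nat \<Rightarrow> 'a set \<Rightarrow> ('a set set \<Rightarrow> 'b) \<Rightarrow> bool" where
  "local_at k S f \<longleftrightarrow> (\<forall>E E'. touch E (bl E S k) = touch E' (bl E S k) \<longrightarrow> f E' = f E)"

lemma local_at_const [intro]: "local_at k S (\<lambda>_. c)" by (simp add: local_at_def)

lemma local_at_comp: "local_at k S f \<Longrightarrow> local_at k S g \<Longrightarrow> local_at k S (\<lambda>E. h (f E) (g E))"
  unfolding local_at_def by metis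

lemma local_at_comp1: "local_at k S f \<Longrightarrow> local_at k S (\<lambda>E. h (f E))"
  unfolding local_at_def by metis

lemma local_at_lev: "j \<le> k \<Longrightarrow> local_at k S (\<lambda>E. lev E S j)"
  unfolding local_at_def using lev_local by blast

lemma local_at_bl: "j \<le> Suc k \<Longrightarrow> local_at k S (\<lambda>E. bl E S j)"
  unfolding local_at_def using bl_local by blast

lemma local_at_All: "(\<And>i. i \<in> I \<Longrightarrow> local_at k S (\<lambda>E. f i E)) \<Longrightarrow> local_at k S (\<lambda>E. \<forall>i\<in>I. f i E)"
  unfolding local_at_def by metis

lemma local_at_mono:
  assumes "local_at j S f" "j \<le> k"
  shows "local_at k S f"
  unfolding local_at_def
proof (intro allI impI)
  fix E E' assume "touch E (bl E S k) = touch E' (bl E S k)"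
  then have "touch E (bl E S j) = touch E' (bl E S j)"
    by (rule touch_eq_mono) (rule bl_mono[OF assms(2)])
  then show "f E' = f E" by (rule assms(1)[unfolded local_at_def, rule_format])
qed

text \<open>Spatial Markov property: given the explored ball, the rest is a fresh random graph. The
  random ball is split over its possible values B and T; for fixed values the event depends only on
  edges meeting B, and \<open>rsE_indep\<close> applies.\<close>

lemma rsE_markov:
  fixes f :: "'a set set \<Rightarrow> real"
  assumes V: "finite V" "S \<subseteq> V" and loc: "local_at k S f"
  shows "rsE p (Edg V) (\<lambda>E. f E * \<Psi> (bl E S k) (lev E S k) (del E (bl E S k)))
    = rsE p (Edg V) (\<lambda>E. f E * rsE p (Edg (V - bl E S k)) (\<Psi> (bl E S k) (lev E S k)))"
proof -
  define g where "g = (\<lambda>B T E. f E * of_bool (bl E S k = B \<and> lev E S k = T))"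
  have decomp: "f E * F (bl E S k) (lev E S k) E = (\<Sum>B\<in>Pow V. \<Sum>T\<in>Pow V. g B T E * F B T E)"
    if "E \<subseteq> Edg V" for E and F :: "'a set \<Rightarrow> 'a set \<Rightarrow> 'a set set \<Rightarrow> real"
  proof -
    have s: "bl E S k \<in> Pow V" "lev E S k \<in> Pow V"
      using lev_subset[OF that V(2)] bl_subset[OF that V(2)] by simp_all
    have inner: "(\<Sum>T\<in>Pow V. g B T E * F B T E) = (if B = bl E S k then f E * F B (lev E S k) E else 0)" for B
    proof -
      have "g B T E * F B T E = (if T = lev E S k then (if B = bl E S k then f E * F B T E else 0) else 0)" for T
        by (simp add: g_def)
      then have "(\<Sum>T\<in>Pow V. g B T E * F B T E) =
          (\<Sum>T\<in>Pow V. if T = lev E S k then (if B = bl E S k then f E * F B T E else 0) else 0)"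
        by simp
      also have "\<dots> = (if B = bl E S k then f E * F B (lev E S k) E else 0)"
        by (subst sum.delta) (use s V in auto)
      finally show ?thesis .
    qed
    show ?thesis unfolding inner by (subst sum.delta) (use s V in auto)
  qed
  have gl: "g B T E = g B T (touch E B)" for B T E
  proof (cases "bl E S k = B")
    case True
    have t: "touch E (bl E S k) = touch (touch E B) (bl E S k)" using True by (simp add: touch_touch)
    have "f (touch E B) = f E" using loc t unfolding local_at_def by blast
    then show ?thesis using bl_local[OF t, of k] lev_local[OF t, of k] by (simp add: g_def)
  next
    case False
    \<comment> \<open>Locality is used backwards here: if the exploration of
      \<open>touch E B\<close> filled B, then the one of E would fill B too.\<close>
    have "bl (touch E B) S k \<noteq> B"
    proof
      assume b: "bl (touch E B) S k = B"
      then have t: "touch (touch E B) (bl (touch E B) S k) = touch E (bl (touch E B) S k)"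
        by (simp add: touch_touch)
      show False using bl_local[OF t, of k] b False by simp
    qed
    then show ?thesis using False by (simp add: g_def)
  qed
  have "rsE p (Edg V) (\<lambda>E. f E * \<Psi> (bl E S k) (lev E S k) (del E (bl E S k)))
    = rsE p (Edg V) (\<lambda>E. \<Sum>B\<in>Pow V. \<Sum>T\<in>Pow V. g B T E * \<Psi> B T (del E B))"
    using decomp[where F = "\<lambda>B T E. \<Psi> B T (del E B)"] by (intro rsE_cong) auto
  also have "\<dots> = (\<Sum>B\<in>Pow V. \<Sum>T\<in>Pow V. rsE p (Edg V) (\<lambda>E. g B T E * \<Psi> B T (del E B)))"
    by (simp add: rsE_sum)
  also have "\<dots> = (\<Sum>B\<in>Pow V. \<Sum>T\<in>Pow V. rsE p (Edg V) (g B T) * rsE p (Edg (V - B)) (\<Psi> B T))"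
    using gl V by (intro sum.cong refl rsE_indep) auto
  also have "\<dots> = (\<Sum>B\<in>Pow V. \<Sum>T\<in>Pow V. rsE p (Edg V) (\<lambda>E. g B T E * rsE p (Edg (V - B)) (\<Psi> B T)))"
    by (simp add: rsE_cmult_right)
  also have "\<dots> = rsE p (Edg V) (\<lambda>E. \<Sum>B\<in>Pow V. \<Sum>T\<in>Pow V. g B T E * rsE p (Edg (V - B)) (\<Psi> B T))"
    by (simp add: rsE_sum)
  also have "\<dots> = rsE p (Edg V) (\<lambda>E. f E * rsE p (Edg (V - bl E S k)) (\<Psi> (bl E S k) (lev E S k)))"
    using decomp[where F = "\<lambda>B T E. rsE p (Edg (V - B)) (\<Psi> B T)"] by (intro rsE_cong) auto
  finally show ?thesis .
qed

lemma lev_path: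
  assumes "y \<in> lev E S k"
  shows "\<exists>f. f 0 \<in> S \<and> f k = y \<and> (\<forall>i<k. {f i, f (Suc i)} \<in> E) \<and> (\<forall>i\<le>k. f i \<in> lev E S i)"
  using assms
proof (induction k arbitrary: E S)
  case 0
  then show ?case by (intro exI[of _ "\<lambda>_. y"]) auto
next
  case (Suc k)
  then have "y \<in> lev (del E S) (nb E S - S) k" by (simp add: lev_Suc)
  then obtain f where f: "f 0 \<in> nb E S - S" "f k = y" "\<And>i. i < k \<Longrightarrow> {f i, f (Suc i)} \<in> del E S"
      "\<And>i. i \<le> k \<Longrightarrow> f i \<in> lev (del E S) (nb E S - S) i"
    using Suc.IH by metis
  obtain x where x: "x \<in> S" "{x, f 0} \<in> E" using f by (auto simp: nb_def)
  define g where "g = (\<lambda>i. case i of 0 \<Rightarrow> x | Suc j \<Rightarrow> f j)"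
  have "{g i, g (Suc i)} \<in> E" if "i < Suc k" for i
    using that x f(3) del_le by (cases i) (fastforce simp: g_def)+
  moreover have "g i \<in> lev E S i" if "i \<le> Suc k" for i
    using that x f(4) by (cases i) (auto simp: g_def lev_Suc)
  ultimately show ?case using x f(2) by (intro exI[of _ g]) (auto simp: g_def)
qed

lemma path_wlk:
  assumes "\<And>i. a \<le> i \<Longrightarrow> i < a + k \<Longrightarrow> {f i, f (Suc i)} \<in> E"
  shows "wlk E k (f a) (f (a + k))"
  using assms
proof (induction k arbitrary: a)
  case (Suc k)
  have "wlk E k (f (Suc a)) (f (Suc a + k))" using Suc.prems by (intro Suc.IH) auto
  moreover have "{f a, f (Suc a)} \<in> E" using Suc.prems[of a] by simp
  ultimately show ?case by auto
qed simp

text \<open>A geodesic to level j stays within the levels up to j, all of which avoid B, so it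
  survives the deletion; and a deletion creates no shorter walk.\<close>

lemma lev_del_eq:
  assumes "\<And>j. j \<le> k \<Longrightarrow> lev E S j \<inter> B = {}" "j \<le> k"
  shows "lev (del E B) S j = lev E S j"
proof -
  have sub: "y \<in> lev (del E B) S i" if "y \<in> lev E S i" "i \<le> k" for y i
  proof -
    obtain f where f: "f 0 \<in> S" "f i = y" "\<And>j. j < i \<Longrightarrow> {f j, f (Suc j)} \<in> E"
      "\<And>j. j \<le> i \<Longrightarrow> f j \<in> lev E S j" using lev_path[OF \<open>y \<in> lev E S i\<close>] by metis
    have "{f j, f (Suc j)} \<in> del E B" if "j < i" for j
      using f(3)[OF that] f(4)[of j] f(4)[of "Suc j"] assms(1)[of j] assms(1)[of "Suc j"] that \<open>i \<le> k\<close>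
      by (auto simp: del_def)
    then have "wlk (del E B) i (f 0) (f (0 + i))" by (intro path_wlk) auto
    moreover have "\<not> wlk (del E B) j x y" if "j < i" "x \<in> S" for j x
      using \<open>y \<in> lev E S i\<close> that wlk_mono[OF _ del_le, of E B j x y] by (auto simp: lev_def)
    ultimately show ?thesis using f by (auto simp: lev_def)
  qed
  have "y \<in> lev E S j" if y: "y \<in> lev (del E B) S j" for y
  proof -
    obtain x where "x \<in> S" "wlk (del E B) j x y" using y by (auto simp: lev_def)
    then obtain i where i: "i \<le> j" "y \<in> lev E S i" using wlk_imp_lev wlk_mono[OF _ del_le] by metis
    then have "y \<in> lev (del E B) S i" using sub assms(2) by auto
    then show ?thesis using i y lev_unique by metis
  qed
  then show ?thesis using sub assms(2) by blast
qed

lemma lev_single_iff: "y \<in> lev E {x} k \<longleftrightarrow> wlk E k x y \<and> (\<forall>j<k. \<not> wlk E j x y)"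
  by (auto simp: lev_def)

lemma lev_sym: "y \<in> lev E {x} k \<Longrightarrow> x \<in> lev E {y} k"
  unfolding lev_single_iff using wlk_sym by metis

lemma geodesic_lev:
  assumes y: "f k \<in> lev E {f 0} k" and f: "\<And>i. i < k \<Longrightarrow> {f i, f (Suc i)} \<in> E"
    and ij: "i \<le> j" "j \<le> k"
  shows "f j \<in> lev E {f i} (j - i)"
proof -
  have w: "wlk E (b - a) (f a) (f b)" if "a \<le> b" "b \<le> k" for a b
    using path_wlk[of a "b - a" f E] f that by simp
  have "\<not> wlk E l (f i) (f j)" if "l < j - i" for l
  proof
    assume a: "wlk E l (f i) (f j)"
    have "wlk E (i + l) (f 0) (f j)" using w[of 0 i] a ij wlk_add[of E i l "f 0" "f j"] by auto
    then have "wlk E (i + l + (k - j)) (f 0) (f k)" using w[of j k] ij wlk_add[of E "i + l" "k - j" "f 0" "f k"] by auto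
    moreover have "i + l + (k - j) < k" using that ij by auto
    ultimately show False using y by (auto simp: lev_single_iff)
  qed
  then show ?thesis using w[of i j] ij by (auto simp: lev_single_iff)
qed

section \<open>Branching process estimates for level sizes\<close>

lemma q_bounds:
  fixes p :: real
  assumes "0 \<le> p" "p \<le> 1"
  shows "0 \<le> 1 - (1 - p) ^ x" "1 - (1 - p) ^ x \<le> 1" "1 - (1 - p) ^ x \<le> p * real x"
proof -
  show "0 \<le> 1 - (1 - p) ^ x" "1 - (1 - p) ^ x \<le> 1" using assms by (auto simp: power_le_one)
  show "1 - (1 - p) ^ x \<le> p * real x"
    using Bernoulli_inequality[of "- p" x] assms by (simp add: mult.commute)
qed

lemma rsE_lev_Suc:
  assumes "finite V" "S \<subseteq> V"
  shows "rsE p (Edg V) (\<lambda>E. g (del E S) (nb E S - S))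
    = rsE (1 - (1 - p) ^ card S) (V - S) (\<lambda>T. rsE p (Edg (V - S)) (\<lambda>E. g E T))"
  using rsE_step[OF assms(1) order_refl assms(2), of p "\<lambda>T E. g E T"] .

lemma rsE_pow_le:
  assumes "finite A" "0 \<le> q" "q \<le> 1" "0 \<le> g" "g \<le> 1"
  shows "rsE q A (\<lambda>T. g ^ card T) \<le> exp (- (q * (1 - g)) * card A)"
proof -
  have "rsE q A (\<lambda>T. g ^ card T) = (1 - q + q * g) ^ card A" using assms by (simp add: rsE_power)
  also have "1 - q + q * g = 1 + - (q * (1 - g))" by (simp add: algebra_simps)
  also have "(1 + - (q * (1 - g))) ^ card A \<le> exp (- (q * (1 - g))) ^ card A"
  proof (rule power_mono)
    show "1 + - (q * (1 - g)) \<le> exp (- (q * (1 - g)))" by (rule exp_ge_add_one_self)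
    have "q * (1 - g) \<le> 1 * 1" using assms by (intro mult_mono) auto
    then show "0 \<le> 1 + - (q * (1 - g))" by simp
  qed
  finally show ?thesis by (simp add: exp_of_nat_mult[symmetric] mult.commute)
qed

lemma card_lev_mean:
  fixes p m :: real
  assumes "finite V" "S \<subseteq> V" "0 \<le> p" "p \<le> 1" "p * card V \<le> m"
  shows "rsE p (Edg V) (\<lambda>E. real (card (lev E S k))) \<le> m ^ k * card S"
  using assms
proof (induction k arbitrary: V S)
  case 0
  then show ?case by simp
next
  case (Suc k)
  let ?q = "1 - (1 - p) ^ card S"
  have m: "0 \<le> m" using Suc.prems by (meson mult_nonneg_nonneg of_nat_0_le_iff order_trans)
  have q: "0 \<le> ?q" "?q \<le> 1" "?q \<le> p * card S" using q_bounds Suc.prems by auto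
  have le: "card (V - S) \<le> card V" using Suc.prems by (simp add: card_mono)
  have m': "p * card (V - S) \<le> m"
    using Suc.prems le by (meson mult_left_mono of_nat_mono order_trans)
  have "rsE p (Edg V) (\<lambda>E. card (lev E S (Suc k)))
    = rsE ?q (V - S) (\<lambda>T. rsE p (Edg (V - S)) (\<lambda>E. card (lev E T k)))"
    unfolding lev_Suc using Suc.prems by (rule_tac rsE_lev_Suc)
  also have "\<dots> \<le> rsE ?q (V - S) (\<lambda>T. m ^ k * card T)"
    using Suc.prems m' q by (intro rsE_mono Suc.IH) auto
  also have "\<dots> = m ^ k * (?q * card (V - S))"
    using Suc.prems by (simp add: rsE_cmult rsE_card)
  also have "\<dots> \<le> m ^ k * (m * card S)"
  proof (intro mult_left_mono)
    have "?q * card (V - S) \<le> (p * card S) * card (V - S)"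
      using q by (intro mult_right_mono) auto
    also have "\<dots> = (p * card (V - S)) * card S" by simp
    also have "\<dots> \<le> m * card S"
      using m' by (intro mult_right_mono) auto
    finally show "?q * card (V - S) \<le> m * card S" .
  qed (use m in auto)
  finally show ?case by (simp add: algebra_simps)
qed

text \<open>Iterates of the survival recursion of a Poisson branching process with mean \<open>l\<close>: with \<open>y = 1\<close>,
  \<open>orb l k y\<close> is the probability that generation \<open>k\<close> is not empty.\<close>

definition orb :: "real \<Rightarrow> nat \<Rightarrow> real \<Rightarrow> real" where
  "orb l k y = ((\<lambda>y. 1 - exp (- l * y)) ^^ k) y"

lemma orb_0 [simp]: "orb l 0 y = y" by (simp add: orb_def)

lemma orb_Suc: "orb l (Suc k) y = 1 - exp (- l * orb l k y)" by (simp add: orb_def)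

lemma orb_range: "0 \<le> l \<Longrightarrow> 0 \<le> y \<Longrightarrow> y \<le> 1 \<Longrightarrow> 0 \<le> orb l k y \<and> orb l k y \<le> 1"
  by (induction k) (auto simp: orb_Suc)

lemma orb_mono: "0 \<le> l \<Longrightarrow> x \<le> y \<Longrightarrow> orb l k x \<le> orb l k y"
  by (induction k) (auto simp: orb_Suc mult_left_mono)

lemma orb_add: "orb l (j + k) y = orb l j (orb l k y)"
  by (simp add: orb_def funpow_add)

lemma orb_one_antimono:
  assumes "0 \<le> l" "j \<le> k"
  shows "orb l k 1 \<le> orb l j 1"
proof -
  have "orb l (k - j) 1 \<le> 1" using orb_range[of l 1] assms by auto
  then have "orb l j (orb l (k - j) 1) \<le> orb l j 1" using assms orb_mono by auto
  then show ?thesis using assms orb_add[of l j "k - j" 1] by simp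
qed

lemma exp_weight:
  fixes z t :: real
  assumes "0 \<le> t" "t \<le> 1"
  shows "exp (t * z) \<le> 1 - (1 - exp z) * t"
  using convex_onD[OF exp_convex, of t 0 z] assms by (simp add: algebra_simps)

text \<open>Domination by a Poisson branching process: a possible edge is replaced by a Poisson
  number of edges of mean \<open>- ln (1 - p)\<close>, which is zero with the same probability. For
  generating functions this is the convexity bound \<open>exp_weight\<close>.\<close>

lemma lev_extinct_prob:
  assumes "finite V" "S \<subseteq> V" "0 \<le> p" "p < 1" "real (card V) * - ln (1 - p) \<le> l"
  shows "rsE p (Edg V) (\<lambda>E. of_bool (lev E S k = {})) \<ge> (1 - orb l k 1) ^ card S"
  using assms
proof (induction k arbitrary: V S)
  case 0
  then have "finite S" using finite_subset by auto
  then show ?case using 0 by (simp add: power_0_left)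
next
  case (Suc k)
  let ?q = "1 - (1 - p) ^ card S" and ?y = "orb l k 1" and ?N = "card (V - S)"
  have lnp: "0 \<le> - ln (1 - p)" using Suc.prems by auto
  have le: "card (V - S) \<le> card V" using Suc.prems by (simp add: card_mono)
  have l': "real ?N * - ln (1 - p) \<le> l"
    using mult_right_mono[OF _ lnp, of "real ?N" "real (card V)"] le Suc.prems by simp
  have l0: "0 \<le> l" using l' lnp by (meson mult_nonneg_nonneg of_nat_0_le_iff order_trans)
  have y: "0 \<le> ?y" "?y \<le> 1" using orb_range[OF l0, of 1 k] by auto
  have q: "0 \<le> ?q" "?q \<le> 1" using q_bounds Suc.prems by auto
  have "exp (?y * (card S * ln (1 - p))) \<le> 1 - (1 - exp (card S * ln (1 - p))) * ?y"
    using y by (intro exp_weight) auto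
  also have "exp (card S * ln (1 - p)) = (1 - p) ^ card S"
    using Suc.prems by (simp add: exp_of_nat_mult)
  finally have *: "exp (?y * (card S * ln (1 - p))) \<le> 1 - ?q + ?q * (1 - ?y)" by (simp add: algebra_simps)
  have "(1 - orb l (Suc k) 1) ^ card S = exp (- l * ?y) ^ card S" by (simp add: orb_Suc)
  also have "\<dots> = exp (- (l * (?y * card S)))" by (simp add: exp_of_nat_mult[symmetric] algebra_simps)
  also have "\<dots> \<le> exp (- ((real ?N * - ln (1 - p)) * (?y * card S)))"
    using l' y by (simp only: exp_le_cancel_iff neg_le_iff_le) (intro mult_right_mono, auto)
  also have "\<dots> = exp (?y * (card S * ln (1 - p))) ^ ?N"
    by (simp add: exp_of_nat_mult[symmetric] algebra_simps)
  also have "\<dots> \<le> (1 - ?q + ?q * (1 - ?y)) ^ ?N" using * by (intro power_mono) auto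
  also have "\<dots> = rsE ?q (V - S) (\<lambda>T. (1 - ?y) ^ card T)" using Suc.prems by (simp add: rsE_power)
  also have "\<dots> \<le> rsE ?q (V - S) (\<lambda>T. rsE p (Edg (V - S)) (\<lambda>E. of_bool (lev E T k = {})))"
    using Suc.prems l' q by (intro rsE_mono Suc.IH) auto
  also have "\<dots> = rsE p (Edg V) (\<lambda>E. of_bool (lev E S (Suc k) = {}))"
    unfolding lev_Suc using Suc.prems(1,2) by (rule rsE_lev_Suc[symmetric])
  finally show ?case .
qed

lemma lev_survive_prob:
  assumes "finite V" "S \<subseteq> V" "0 \<le> p" "p < 1" "real (card V) * - ln (1 - p) \<le> l"
  shows "rsE p (Edg V) (\<lambda>E. of_bool (lev E S k \<noteq> {})) \<le> card S * orb l k 1"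
proof -
  have l0: "0 \<le> l" using assms by (smt (verit) ln_le_zero_iff mult_nonneg_nonneg of_nat_0_le_iff)
  have y: "0 \<le> orb l k 1" "orb l k 1 \<le> 1" using orb_range[OF l0, of 1 k] by auto
  have "rsE p (Edg V) (\<lambda>E. of_bool (lev E S k \<noteq> {})) = rsE p (Edg V) (\<lambda>E. 1 - of_bool (lev E S k = {}))"
    by (intro rsE_cong) auto
  also have "\<dots> \<le> 1 - (1 - orb l k 1) ^ card S"
    using lev_extinct_prob[OF assms, of k] assms(1) by (simp add: rsE_diff)
  also have "\<dots> \<le> card S * orb l k 1"
    using Bernoulli_inequality[of "- orb l k 1" "card S"] y by simp
  finally show ?thesis .
qed

section \<open>Laplace transforms of explorations whose levels stay small\<close>

text \<open>The drift bound \<open>step\<close> is available only for levels below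
  \<open>s0\<close>, since 1 - (1 - p)^x falls behind p x. Levels below \<open>s0\<close> use up at
  most \<open>s0\<close> vertices each, which \<open>Nlow + s0 * H \<le> card V\<close> pays
  for.\<close>

lemma laplace_capped:
  fixes p s0 Nlow l s :: real
  assumes step: "\<And>(N::nat) (x::nat). Nlow \<le> N \<Longrightarrow> N \<le> n \<Longrightarrow> x < s0 \<Longrightarrow> l * x \<le> (1 - (1 - p) ^ x) * N"
    and p: "0 \<le> p" "p \<le> 1" and s: "0 \<le> s" "s \<le> 1" and l: "0 \<le> l" and s0: "0 \<le> s0"
    and V: "finite V" "S \<subseteq> V" "card V \<le> n" "Nlow + s0 * H \<le> card V"
  shows "rsE p (Edg V) (\<lambda>E. of_bool (\<forall>j<H. card (lev E S j) < s0) * s ^ card (lev E S H))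
    \<le> (1 - orb l H (1 - s)) ^ card S"
  using V
proof (induction H arbitrary: V S)
  case 0
  then show ?case by simp
next
  case (Suc H)
  let ?q = "1 - (1 - p) ^ card S" and ?y = "orb l H (1 - s)" and ?N = "card (V - S)"
  have y: "0 \<le> ?y" "?y \<le> 1" using orb_range[OF l, of "1 - s" H] s by auto
  have y': "orb l (Suc H) (1 - s) \<le> 1" using orb_range[OF l, of "1 - s" "Suc H"] s by auto
  have q: "0 \<le> ?q" "?q \<le> 1" using q_bounds p by auto
  show ?case
  proof (cases "card S < s0")
    case False
    have "rsE p (Edg V) (\<lambda>E. of_bool (\<forall>j<Suc H. card (lev E S j) < s0) * s ^ card (lev E S (Suc H)))
      = rsE p (Edg V) (\<lambda>E. 0)"
      using False by (intro rsE_cong refl) (auto intro!: exI[of _ 0])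
    then show ?thesis using Suc.prems y' by simp
  next
    case True
    have fS: "finite S" using Suc.prems finite_subset by auto
    have cN: "real ?N = real (card V) - card S"
      using Suc.prems fS by (simp add: card_Diff_subset card_mono of_nat_diff)
    have N: "Nlow + s0 * H \<le> ?N" using Suc.prems True cN by (simp add: algebra_simps)
    have Nn: "?N \<le> n" using Suc.prems by (meson card_mono Diff_subset order_trans)
    have NN: "Nlow \<le> ?N" using N s0 by (smt (verit) mult_nonneg_nonneg of_nat_0_le_iff)
    have "rsE p (Edg V) (\<lambda>E. of_bool (\<forall>j<Suc H. card (lev E S j) < s0) * s ^ card (lev E S (Suc H)))
      = rsE p (Edg V) (\<lambda>E. of_bool (\<forall>j<H. card (lev (del E S) (nb E S - S) j) < s0) *
           s ^ card (lev (del E S) (nb E S - S) H))"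
      using True by (intro rsE_cong refl) (simp add: All_less_Suc2 lev_Suc)
    also have "\<dots> = rsE ?q (V - S) (\<lambda>T. rsE p (Edg (V - S)) (\<lambda>E.
         of_bool (\<forall>j<H. card (lev E T j) < s0) * s ^ card (lev E T H)))"
      using Suc.prems(1,2) by (rule rsE_lev_Suc)
    also have "\<dots> \<le> rsE ?q (V - S) (\<lambda>T. (1 - ?y) ^ card T)"
      using Suc.prems q N Nn by (intro rsE_mono Suc.IH) auto
    also have "\<dots> \<le> exp (- (?q * (1 - (1 - ?y))) * ?N)"
      using Suc.prems q y by (intro rsE_pow_le) auto
    also have "\<dots> \<le> exp (- (l * ?y * card S))"
      using mult_right_mono[OF step[OF NN Nn True] y(1)] by (simp add: algebra_simps)
    also have "\<dots> = (1 - orb l (Suc H) (1 - s)) ^ card S"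
      by (simp add: orb_Suc exp_of_nat_mult[symmetric] algebra_simps)
    finally show ?thesis .
  qed
qed

text \<open>Increments are compared, not values: the derivative in c of the binomial generating
  function is at most \<open>\<kappa>\<close> times that of the Poisson one. The exponent N - 1 of
  the derivative is the reason for \<open>real N - 1\<close> in the hypothesis.\<close>

lemma pow_diff_le:
  fixes q l \<kappa> a b :: real
  assumes q: "0 \<le> q" "q \<le> 1" and N: "l * x \<le> q * (real N - 1)" "q * N \<le> \<kappa> * l * x" "1 \<le> N"
    and ab: "0 \<le> b" "b \<le> a" "a \<le> 1"
  shows "(1 - q + q * a) ^ N - (1 - q + q * b) ^ N \<le> \<kappa> * (exp (- l * (1 - a) * x) - exp (- l * (1 - b) * x))"
proof -
  define D where "D = (\<lambda>c. \<kappa> * exp (- l * (1 - c) * x) - (1 - q + q * c) ^ N)"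
  have "D b \<le> D a"
  proof (rule DERIV_nonneg_imp_nondecreasing[OF ab(2)])
    fix c assume c: "b \<le> c" "c \<le> a"
    let ?D = "\<kappa> * (exp (- l * (1 - c) * x) * (l * x)) - real N * (1 - q + q * c) ^ (N - 1) * q"
    have "(D has_real_derivative ?D) (at c)"
      unfolding D_def by (auto intro!: derivative_eq_intros simp: algebra_simps)
    moreover have "0 \<le> ?D"
    proof -
      have nn: "0 \<le> 1 - q + q * c"
        using q c ab by (smt (verit) mult_nonneg_nonneg)
      have "(1 - q + q * c) ^ (N - 1) = (1 + - (q * (1 - c))) ^ (N - 1)" by (simp add: algebra_simps)
      also have "\<dots> \<le> exp (- (q * (1 - c))) ^ (N - 1)"
        using nn by (intro power_mono exp_ge_add_one_self) (simp add: algebra_simps)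
      also have "\<dots> = exp (- ((q * (real N - 1)) * (1 - c)))"
        using N(3) by (simp add: exp_of_nat_mult[symmetric] of_nat_diff algebra_simps)
      also have "\<dots> \<le> exp (- (l * x * (1 - c)))"
        using mult_right_mono[OF N(1), of "1 - c"] c ab by simp
      finally have 1: "(1 - q + q * c) ^ (N - 1) \<le> exp (- l * (1 - c) * x)" by (simp add: algebra_simps)
      have "real N * (1 - q + q * c) ^ (N - 1) * q = (q * N) * (1 - q + q * c) ^ (N - 1)" by simp
      also have "\<dots> \<le> (q * N) * exp (- l * (1 - c) * x)" using 1 q by (intro mult_left_mono) auto
      also have "\<dots> \<le> (\<kappa> * l * x) * exp (- l * (1 - c) * x)" using N(2) by (intro mult_right_mono) auto
      finally show ?thesis by (simp add: algebra_simps)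
    qed
    ultimately show "\<exists>y. (D has_real_derivative y) (at c) \<and> 0 \<le> y" by blast
  qed
  then show ?thesis unfolding D_def by (simp add: algebra_simps)
qed

text \<open>For the branching process, E [s^Z_H; Z_L > 0] is the difference of a Laplace transform
  and an extinction probability. The two nearly cancel, so separate bounds would be too weak; the
  induction carries the difference itself and pays one factor \<open>\<kappa>\<close> per generation
  up to L.\<close>

lemma tube_laplace:
  fixes p s0 Nlow l s \<kappa> :: real
  assumes step: "\<And>(N::nat) (x::nat). Nlow \<le> N \<Longrightarrow> N \<le> n \<Longrightarrow> x < s0 \<Longrightarrow>
       l * x \<le> (1 - (1 - p) ^ x) * (real N - 1) \<and> (1 - (1 - p) ^ x) * N \<le> \<kappa> * l * x"
    and p: "0 \<le> p" "p \<le> 1" and s: "0 \<le> s" "s \<le> 1" and l: "0 \<le> l" and s0: "0 \<le> s0"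
    and \<kappa>: "1 \<le> \<kappa>" and N1: "1 \<le> Nlow"
    and V: "finite V" "S \<subseteq> V" "card V \<le> n" "Nlow + s0 * H \<le> card V" and LH: "L \<le> H"
  shows "rsE p (Edg V) (\<lambda>E. of_bool (lev E S L \<noteq> {} \<and> (\<forall>j<H. card (lev E S j) < s0)) * s ^ card (lev E S H))
    \<le> \<kappa> ^ L * ((1 - orb l H (1 - s)) ^ card S - (1 - orb l L 1) ^ card S)"
  using V LH
proof (induction L arbitrary: V S H)
  case 0
  have step': "l * x \<le> (1 - (1 - p) ^ x) * N" if "Nlow \<le> N" "N \<le> n" "x < s0" for N x :: nat
    using step[OF that] q_bounds(1)[OF p, of x] by (simp add: algebra_simps)
  have fS: "finite S" using 0 finite_subset by auto
  show ?case
  proof (cases "S = {}")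
    case True
    have "rsE p (Edg V) (\<lambda>E. of_bool (lev E S 0 \<noteq> {} \<and> (\<forall>j<H. card (lev E S j) < s0)) * s ^ card (lev E S H))
      = rsE p (Edg V) (\<lambda>E. 0)" using True by (intro rsE_cong) auto
    then show ?thesis using 0 True by simp
  next
    case False
    have "rsE p (Edg V) (\<lambda>E. of_bool (lev E S 0 \<noteq> {} \<and> (\<forall>j<H. card (lev E S j) < s0)) * s ^ card (lev E S H))
      = rsE p (Edg V) (\<lambda>E. of_bool (\<forall>j<H. card (lev E S j) < s0) * s ^ card (lev E S H))"
      using False by (intro rsE_cong) auto
    also have "\<dots> \<le> (1 - orb l H (1 - s)) ^ card S"
      using step' p s l s0 0 by (intro laplace_capped[where Nlow = Nlow and n = n]) auto
    finally show ?thesis using False fS by (simp add: power_0_left)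
  qed
next
  case (Suc L)
  then obtain H' where H: "H = Suc H'" "L \<le> H'" by (cases H) auto
  let ?q = "1 - (1 - p) ^ card S" and ?N = "card (V - S)"
  let ?a = "1 - orb l H' (1 - s)" and ?b = "1 - orb l L 1"
  have ab: "0 \<le> ?b" "?b \<le> ?a" "?a \<le> 1"
  proof -
    show "0 \<le> ?b" using orb_range[OF l, of 1 L] by auto
    have "orb l H' (1 - s) \<le> orb l H' 1" using orb_mono[OF l] s by auto
    also have "\<dots> \<le> orb l L 1" using orb_one_antimono[OF l H(2)] .
    finally show "?b \<le> ?a" by simp
    show "?a \<le> 1" using orb_range[OF l, of "1 - s" H'] s by auto
  qed
  have ab': "(1 - orb l H (1 - s)) = exp (- l * (1 - ?a))" "(1 - orb l (Suc L) 1) = exp (- l * (1 - ?b))"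
    by (simp_all add: H orb_Suc)
  have ab2: "(1 - orb l (Suc L) 1) ^ card S \<le> (1 - orb l H (1 - s)) ^ card S"
    unfolding ab' using ab l by (intro power_mono) (auto simp: mult_left_mono)
  have q: "0 \<le> ?q" "?q \<le> 1" using q_bounds p by auto
  show ?case
  proof (cases "card S < s0")
    case False
    have "rsE p (Edg V) (\<lambda>E. of_bool (lev E S (Suc L) \<noteq> {} \<and> (\<forall>j<H. card (lev E S j) < s0)) * s ^ card (lev E S H))
      = rsE p (Edg V) (\<lambda>E. 0)"
      using False H by (intro rsE_cong refl) (auto intro!: exI[of _ 0])
    then show ?thesis using Suc.prems ab2 \<kappa> by simp
  next
    case True
    have fS: "finite S" using Suc.prems finite_subset by auto
    have cN: "real ?N = real (card V) - card S"
      using Suc.prems fS by (simp add: card_Diff_subset card_mono of_nat_diff)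
    have N: "Nlow + s0 * H' \<le> ?N" using Suc.prems True cN H by (simp add: algebra_simps)
    have Nn: "?N \<le> n" using Suc.prems by (meson card_mono Diff_subset order_trans)
    have NN: "Nlow \<le> ?N" using N s0 by (smt (verit) mult_nonneg_nonneg of_nat_0_le_iff)
    have "rsE p (Edg V) (\<lambda>E. of_bool (lev E S (Suc L) \<noteq> {} \<and> (\<forall>j<H. card (lev E S j) < s0)) * s ^ card (lev E S H))
      = rsE p (Edg V) (\<lambda>E. of_bool (lev (del E S) (nb E S - S) L \<noteq> {} \<and>
          (\<forall>j<H'. card (lev (del E S) (nb E S - S) j) < s0)) *
           s ^ card (lev (del E S) (nb E S - S) H'))"
      using True by (intro rsE_cong refl) (simp add: H All_less_Suc2 lev_Suc)
    also have "\<dots> = rsE ?q (V - S) (\<lambda>T. rsE p (Edg (V - S)) (\<lambda>E.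
         of_bool (lev E T L \<noteq> {} \<and> (\<forall>j<H'. card (lev E T j) < s0)) * s ^ card (lev E T H')))"
      using Suc.prems(1,2) by (rule rsE_lev_Suc)
    also have "\<dots> \<le> rsE ?q (V - S) (\<lambda>T. \<kappa> ^ L * (?a ^ card T - ?b ^ card T))"
      using Suc.prems q N Nn H by (intro rsE_mono Suc.IH) auto
    also have "\<dots> = \<kappa> ^ L * ((1 - ?q + ?q * ?a) ^ ?N - (1 - ?q + ?q * ?b) ^ ?N)"
      using Suc.prems by (simp add: rsE_cmult rsE_diff rsE_power)
    also have "\<dots> \<le> \<kappa> ^ L * (\<kappa> * (exp (- l * (1 - ?a) * card S) - exp (- l * (1 - ?b) * card S)))"
    proof (intro mult_left_mono pow_diff_le)
      show "l * card S \<le> ?q * (real ?N - 1)" "?q * ?N \<le> \<kappa> * l * card S"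
        using step[OF NN Nn True] by auto
      show "1 \<le> ?N" using NN N1 by simp
    qed (use q ab \<kappa> in auto)
    also have "\<dots> = \<kappa> ^ Suc L * ((1 - orb l H (1 - s)) ^ card S - (1 - orb l (Suc L) 1) ^ card S)"
      unfolding ab' by (simp add: exp_of_nat_mult[symmetric] algebra_simps)
    finally show ?thesis .
  qed
qed

lemma power_diff_bound:
  fixes a b :: real
  assumes "0 \<le> b" "b \<le> a" "a \<le> 1"
  shows "a ^ k - b ^ k \<le> k * (a - b)"
proof (induction k)
  case (Suc k)
  have "a ^ Suc k - b ^ Suc k = a * (a ^ k - b ^ k) + (a - b) * b ^ k" by (simp add: algebra_simps)
  also have "\<dots> \<le> 1 * (a ^ k - b ^ k) + (a - b) * 1"
    using assms by (intro add_mono mult_right_mono mult_left_mono power_le_one) (auto intro: power_mono)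
  also have "\<dots> \<le> Suc k * (a - b)" using Suc by (simp add: algebra_simps)
  finally show ?case .
qed simp

lemma pow_threshold:
  fixes s0 :: real
  assumes "2 \<le> s0" "real m < s0"
  shows "1 \<le> 8 * (1 - 1 / s0) ^ m"
proof -
  have s: "0 \<le> 1 / s0" "1 / s0 \<le> 1 / 2" using assms by (auto simp: field_simps)
  have "ln (1 - 1 / s0) \<ge> - (1 / s0) - 2 * (1 / s0)\<^sup>2"
    using s by (intro ln_one_minus_pos_lower_bound) auto
  moreover have "2 * (1 / s0)\<^sup>2 \<le> 1 / s0"
    using assms by (simp add: power2_eq_square field_simps)
  ultimately have l: "ln (1 - 1 / s0) \<ge> - (2 / s0)" by simp
  have "- 2 \<le> m * - (2 / s0)" using assms by (simp add: field_simps)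
  also have "\<dots> \<le> m * ln (1 - 1 / s0)" using l by (intro mult_left_mono) auto
  finally have "exp (- 2) \<le> exp (m * ln (1 - 1 / s0))" by simp
  also have "\<dots> = (1 - 1 / s0) ^ m" using s by (simp add: exp_of_nat_mult)
  finally have "exp (- 2) \<le> (1 - 1 / s0) ^ m" .
  moreover have "1 / 8 \<le> exp (- 2 :: real)"
  proof -
    have "exp (2::real) = exp 1 ^ 2" by (simp add: exp_of_nat_mult[symmetric])
    also have "\<dots> \<le> 2.75 ^ 2" using e_less_272 by (intro power_mono) auto
    also have "\<dots> \<le> (8::real)" by (simp add: power2_eq_square)
    finally show ?thesis by (simp add: exp_minus field_simps)
  qed
  ultimately show ?thesis by simp
qed

text \<open>Weighting by \<open>s ^ card (lev E S H)\<close> with s = 1 - 1 / s0 costs only a factor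
  8 when that level is below \<open>s0\<close>, and turns the event into the difference controlled
  by \<open>tube_laplace\<close>.\<close>

lemma tube_prob:
  fixes p s0 Nlow l \<kappa> :: real
  assumes step: "\<And>(N::nat) (x::nat). Nlow \<le> N \<Longrightarrow> N \<le> n \<Longrightarrow> x < s0 \<Longrightarrow>
       l * x \<le> (1 - (1 - p) ^ x) * (real N - 1) \<and> (1 - (1 - p) ^ x) * N \<le> \<kappa> * l * x"
    and p: "0 \<le> p" "p \<le> 1" and l: "0 \<le> l" and s0: "2 \<le> s0"
    and \<kappa>: "1 \<le> \<kappa>" and N1: "1 \<le> Nlow"
    and V: "finite V" "S \<subseteq> V" "card V \<le> n" "Nlow + s0 * H \<le> card V" and LH: "L \<le> H"
  shows "rsE p (Edg V) (\<lambda>E. of_bool (lev E S L \<noteq> {} \<and> (\<forall>j\<le>H. card (lev E S j) < s0)))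
    \<le> 8 * \<kappa> ^ L * card S * (orb l L 1 - orb l H (1 / s0))"
proof -
  define s where "s = 1 - 1 / s0"
  have s: "0 \<le> s" "s \<le> 1" using s0 by (auto simp: s_def)
  have ss: "1 - s = 1 / s0" by (simp add: s_def)
  have o: "orb l H (1 - s) \<le> orb l L 1"
    using orb_mono[OF l, of "1 - s" 1 H] orb_one_antimono[OF l LH] s by auto
  have "rsE p (Edg V) (\<lambda>E. of_bool (lev E S L \<noteq> {} \<and> (\<forall>j\<le>H. card (lev E S j) < s0)))
    \<le> rsE p (Edg V) (\<lambda>E. 8 * (of_bool (lev E S L \<noteq> {} \<and> (\<forall>j<H. card (lev E S j) < s0)) * s ^ card (lev E S H)))"
  proof (rule rsE_mono[OF p])
    fix E
    show "of_bool (lev E S L \<noteq> {} \<and> (\<forall>j\<le>H. card (lev E S j) < s0))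
      \<le> 8 * (of_bool (lev E S L \<noteq> {} \<and> (\<forall>j<H. card (lev E S j) < s0)) * s ^ card (lev E S H))"
    proof (cases "lev E S L \<noteq> {} \<and> (\<forall>j\<le>H. card (lev E S j) < s0)")
      case True
      then show ?thesis using pow_threshold[OF s0, of "card (lev E S H)"] by (simp add: s_def)
    next
      case False
      have "0 \<le> 8 * (of_bool (lev E S L \<noteq> {} \<and> (\<forall>j<H. card (lev E S j) < s0)) * s ^ card (lev E S H))"
        using s by simp
      then show ?thesis using False by (simp only: of_bool_eq)
    qed
  qed
  also have "\<dots> \<le> 8 * (\<kappa> ^ L * ((1 - orb l H (1 - s)) ^ card S - (1 - orb l L 1) ^ card S))"
    unfolding rsE_cmult using tube_laplace[OF step p s l _ \<kappa> N1 V LH] s0 by simp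
  also have "\<dots> \<le> 8 * (\<kappa> ^ L * (card S * ((1 - orb l H (1 - s)) - (1 - orb l L 1))))"
  proof (intro mult_left_mono power_diff_bound)
    show "0 \<le> 1 - orb l L 1" using orb_range[OF l, of 1 L] by auto
    show "1 - orb l L 1 \<le> 1 - orb l H (1 - s)" using o by simp
    show "1 - orb l H (1 - s) \<le> 1" using orb_range[OF l, of "1 - s" H] s by auto
  qed (use \<kappa> in auto)
  finally show ?thesis unfolding ss by (simp add: algebra_simps)
qed

section \<open>Missing a given target set\<close>

text \<open>\<open>\<theta>\<close> is the rate at which one explored vertex hits the target, g the
  growth factor: starting from one vertex, missing the target for k levels has probability at most
  \<open>exp (- ny \<theta> g k)\<close>, up to the error term in \<open>no_hit\<close>.\<close>

fun ny :: "real \<Rightarrow> real \<Rightarrow> nat \<Rightarrow> real" where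
  "ny \<theta> g 0 = 0"
| "ny \<theta> g (Suc k) = \<theta> + g * (1 - exp (- ny \<theta> g k))"

lemma ny_nonneg: "0 \<le> \<theta> \<Longrightarrow> 0 \<le> g \<Longrightarrow> 0 \<le> ny \<theta> g k"
  by (induction k) auto

text \<open>Levels are not capped here. Either enough vertices remain and the recursion for
  \<open>ny\<close> applies, or about \<open>card V - card U - Nl\<close> vertices have been
  processed, each of which had to miss U; this is the second summand.\<close>

lemma no_hit:
  fixes p g \<theta> Nl :: real
  assumes step: "\<And>(N::nat) (x::nat). Nl \<le> N \<Longrightarrow> N + x \<le> n \<Longrightarrow> g * x \<le> (1 - (1 - p) ^ x) * N"
    and p: "0 \<le> p" "p \<le> 1" and g: "0 \<le> g" and \<theta>: "0 \<le> \<theta>" "\<theta> \<le> p * card U"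
    and V: "finite V" "S \<subseteq> V" "U \<subseteq> V" "S \<inter> U = {}" "card V \<le> n"
  shows "rsE p (Edg V) (\<lambda>E. of_bool (\<forall>j\<le>k. lev E S j \<inter> U = {}))
    \<le> exp (- (card S * ny \<theta> g k)) + exp (- (\<theta> * (real (card V) - card U - Nl)))"
  using V
proof (induction k arbitrary: V S)
  case 0
  then show ?case by simp
next
  case (Suc k)
  let ?q = "1 - (1 - p) ^ card S" and ?y = "ny \<theta> g k" and ?N = "card (V - S - U)"
  let ?c = "exp (- (\<theta> * (real (card (V - S)) - card U - Nl)))"
  have q: "0 \<le> ?q" "?q \<le> 1" using q_bounds p by auto
  have fin: "finite S" "finite U"
    using finite_subset[OF _ Suc.prems(1)] Suc.prems(2,3) by simp_all
  have cS: "real (card (V - S)) = real (card V) - card S"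
    using Suc.prems fin by (simp add: card_Diff_subset card_mono of_nat_diff)
  have UVS: "U \<subseteq> V - S" using Suc.prems by auto
  have cN: "real ?N = real (card V) - card S - card U"
    using cS card_Diff_subset[OF fin(2) UVS] card_mono[OF _ UVS] Suc.prems by (simp add: of_nat_diff)
  have y: "0 \<le> ?y" using ny_nonneg \<theta> g by auto
  have "(1 - ?q) ^ card U = (1 - p) ^ (card S * card U)" by (simp add: power_mult)
  also have "\<dots> \<le> exp (- p) ^ (card S * card U)"
    using p exp_ge_add_one_self[of "- p"] by (intro power_mono) auto
  also have "\<dots> = exp (- ((p * card U) * card S))"
    by (simp add: exp_of_nat_mult[symmetric] algebra_simps)
  also have "\<dots> \<le> exp (- (\<theta> * card S))"
    using mult_right_mono[OF \<theta>(2), of "card S"] by simp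
  finally have U: "(1 - ?q) ^ card U \<le> exp (- (\<theta> * card S))" .
  have U0: "0 \<le> (1 - ?q) ^ card U" using q by simp
  have "rsE p (Edg V) (\<lambda>E. of_bool (\<forall>j\<le>Suc k. lev E S j \<inter> U = {}))
    = rsE p (Edg V) (\<lambda>E. of_bool (\<forall>j\<le>k. lev (del E S) (nb E S - S) j \<inter> U = {}))"
    using Suc.prems by (intro rsE_cong refl) (simp add: less_Suc_eq_le[symmetric] All_less_Suc2 lev_Suc)
  also have "\<dots> = rsE ?q (V - S) (\<lambda>T. rsE p (Edg (V - S)) (\<lambda>E. of_bool (\<forall>j\<le>k. lev E T j \<inter> U = {})))"
    using Suc.prems(1,2) by (rule rsE_lev_Suc)
  finally have eq: "rsE p (Edg V) (\<lambda>E. of_bool (\<forall>j\<le>Suc k. lev E S j \<inter> U = {}))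
    = rsE ?q (V - S) (\<lambda>T. rsE p (Edg (V - S)) (\<lambda>E. of_bool (\<forall>j\<le>k. lev E T j \<inter> U = {})))" .
  have z: "rsE p (Edg (V - S)) (\<lambda>E. of_bool (\<forall>j\<le>k. lev E T j \<inter> U = {})) = 0" if "T \<inter> U \<noteq> {}" for T
  proof -
    have "rsE p (Edg (V - S)) (\<lambda>E. of_bool (\<forall>j\<le>k. lev E T j \<inter> U = {})) = rsE p (Edg (V - S)) (\<lambda>E. 0)"
      using that by (intro rsE_cong refl) (auto intro!: exI[of _ 0])
    then show ?thesis using Suc.prems by simp
  qed
  show ?case
  proof (cases "Nl \<le> ?N")
    \<comment> \<open>The current level alone then exceeds \<open>card V - card U - Nl\<close>, so
      one step gives the error term.\<close>
    case False
    have "rsE ?q (V - S) (\<lambda>T. rsE p (Edg (V - S)) (\<lambda>E. of_bool (\<forall>j\<le>k. lev E T j \<inter> U = {})))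
      \<le> rsE ?q (V - S) (\<lambda>T. of_bool (T \<inter> U = {}) * 1 ^ card T)"
    proof (rule rsE_mono[OF q])
      fix T
      show "rsE p (Edg (V - S)) (\<lambda>E. of_bool (\<forall>j\<le>k. lev E T j \<inter> U = {})) \<le> of_bool (T \<inter> U = {}) * 1 ^ card T"
        using z[of T] Suc.prems p by (cases "T \<inter> U = {}") (auto intro!: rsE_le_const)
    qed
    also have "\<dots> = (1 - ?q) ^ card U" using Suc.prems UVS by (subst rsE_power_avoid) auto
    also have "\<dots> \<le> exp (- (\<theta> * card S))" by (rule U)
    also have "\<dots> \<le> exp (- (\<theta> * (real (card V) - card U - Nl)))"
      using False cN \<theta> by (simp add: mult_left_mono)
    finally show ?thesis unfolding eq by (smt (verit) exp_gt_zero)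
  next
    case True
    have st: "g * card S \<le> ?q * ?N"
      using cN Suc.prems(5) True by (intro step) linarith+
    have "rsE ?q (V - S) (\<lambda>T. rsE p (Edg (V - S)) (\<lambda>E. of_bool (\<forall>j\<le>k. lev E T j \<inter> U = {})))
      \<le> rsE ?q (V - S) (\<lambda>T. of_bool (T \<inter> U = {}) * exp (- ?y) ^ card T + ?c * (of_bool (T \<inter> U = {}) * 1 ^ card T))"
    proof (rule rsE_mono[OF q])
      fix T assume T: "T \<subseteq> V - S"
      show "rsE p (Edg (V - S)) (\<lambda>E. of_bool (\<forall>j\<le>k. lev E T j \<inter> U = {}))
        \<le> of_bool (T \<inter> U = {}) * exp (- ?y) ^ card T + ?c * (of_bool (T \<inter> U = {}) * 1 ^ card T)"
      proof (cases "T \<inter> U = {}")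
        case True
        have "card (V - S) \<le> n" using Suc.prems by (meson card_mono Diff_subset order_trans)
        then have "rsE p (Edg (V - S)) (\<lambda>E. of_bool (\<forall>j\<le>k. lev E T j \<inter> U = {}))
          \<le> exp (- (card T * ny \<theta> g k)) + ?c"
          using Suc.prems T True by (intro Suc.IH) auto
        then show ?thesis using True by (simp add: exp_of_nat_mult[symmetric])
      qed (simp add: z)
    qed
    also have "\<dots> = (1 - ?q) ^ card U * (1 - ?q + ?q * exp (- ?y)) ^ ?N + ?c * (1 - ?q) ^ card U"
    proof -
      have a1: "rsE ?q (V - S) (\<lambda>T. of_bool (T \<inter> U = {}) * 1 ^ card T) = (1 - ?q) ^ card U"
        using Suc.prems UVS by (subst rsE_power_avoid) auto
      have a2: "rsE ?q (V - S) (\<lambda>T. of_bool (T \<inter> U = {}) * exp (- ?y) ^ card T) =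
          (1 - ?q) ^ card U * (1 - ?q + ?q * exp (- ?y)) ^ ?N"
        using Suc.prems UVS by (subst rsE_power_avoid) auto
      show ?thesis unfolding rsE_add rsE_cmult a1 a2 ..
    qed
    also have "\<dots> \<le> exp (- (\<theta> * card S)) * exp (- (g * card S * (1 - exp (- ?y)))) + ?c * exp (- (\<theta> * card S))"
    proof (intro add_mono mult_mono)
      have "(1 - ?q + ?q * exp (- ?y)) ^ ?N = rsE ?q (V - S - U) (\<lambda>T. exp (- ?y) ^ card T)"
        using Suc.prems by (simp add: rsE_power)
      also have "\<dots> \<le> exp (- (?q * (1 - exp (- ?y))) * ?N)"
        using Suc.prems q y by (intro rsE_pow_le) auto
      also have "\<dots> \<le> exp (- (g * card S * (1 - exp (- ?y))))"
        using mult_right_mono[OF st, of "1 - exp (- ?y)"] y by (simp add: algebra_simps)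
      finally show "(1 - ?q + ?q * exp (- ?y)) ^ ?N \<le> exp (- (g * card S * (1 - exp (- ?y))))" .
      have "0 \<le> (1 - ?q) + ?q * exp (- ?y)" using q by (intro add_nonneg_nonneg mult_nonneg_nonneg) auto
      then show "0 \<le> (1 - ?q + ?q * exp (- ?y)) ^ ?N" by simp
    qed (use U U0 in auto)
    also have "\<dots> = exp (- (card S * ny \<theta> g (Suc k))) + exp (- (\<theta> * (real (card V) - card U - Nl)))"
      by (simp add: exp_add[symmetric] cS algebra_simps)
    finally show ?thesis unfolding eq .
  qed
qed

section \<open>Lower bounds for the Laplace exponent\<close>

text \<open>Laplace exponent of a branching process at generation k from one vertex, bounded below,
  with weight \<open>\<omega>\<close> per vertex and inhomogeneous means \<open>p * Nl i\<close>.
  Time is shifted inside Nl because the recursion peels off the first level, as in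
  \<open>lev_Suc\<close>.\<close>

fun lg :: "real \<Rightarrow> real \<Rightarrow> (nat \<Rightarrow> real) \<Rightarrow> nat \<Rightarrow> real" where
  "lg p \<omega> Nl 0 = \<omega>"
| "lg p \<omega> Nl (Suc k) = p * Nl 0 * (1 - exp (- lg p \<omega> (\<lambda>i. Nl (Suc i)) k))"

lemma lg_nonneg: "0 \<le> p \<Longrightarrow> 0 \<le> \<omega> \<Longrightarrow> (\<And>i. 0 \<le> Nl i) \<Longrightarrow> 0 \<le> lg p \<omega> Nl k"
  by (induction k arbitrary: Nl) auto

lemma q_lower_exp:
  fixes p :: real
  assumes "0 \<le> p" "p \<le> 1"
  shows "p * x * exp (- (p * real x)) \<le> 1 - (1 - p) ^ x"
proof -
  have "(1 - p) ^ x \<le> exp (- p) ^ x" using assms exp_ge_add_one_self[of "- p"] by (intro power_mono) auto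
  also have "\<dots> = exp (- (p * x))" by (simp add: exp_of_nat_mult[symmetric] algebra_simps)
  finally have 1: "(1 - p) ^ x \<le> exp (- (p * x))" .
  have "(1 + p * x) * exp (- (p * x)) \<le> exp (p * x) * exp (- (p * x))"
    by (intro mult_right_mono exp_ge_add_one_self) auto
  then have "p * x * exp (- (p * x)) \<le> 1 - exp (- (p * x))" by (simp add: exp_minus algebra_simps)
  with 1 show ?thesis by simp
qed

text \<open>The factor \<open>exp (- p (|V| - vmin))\<close> absorbs the difference between
  \<open>1 - (1 - p)\<^sup>x\<close> and \<open>p x\<close>: every level of size \<open>x\<close> loses a factor \<open>exp (- p x)\<close>
  and shrinks \<open>V\<close> by \<open>x\<close>.\<close>

lemma laplace_lower:
  fixes p \<omega> vmin :: real
  assumes p: "0 \<le> p" "p \<le> 1" and \<omega>: "0 \<le> \<omega>" and vmin: "0 \<le> vmin"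
    and V: "finite V" "S \<subseteq> V" "vmin \<le> card V" "\<And>i. vmin \<le> Nl i"
  shows "rsE p (Edg V) (\<lambda>E. of_bool (\<forall>i<k. Nl i \<le> real (card V) - card (bl E S (Suc i))) *
        exp (- (\<omega> * card (lev E S k))))
    \<le> exp (- (card S * lg p \<omega> Nl k * exp (- (p * (card V - vmin)))))"
  using V
proof (induction k arbitrary: V S Nl)
  case 0
  have "exp (- (p * (card V - vmin))) \<le> 1" using 0 p by simp
  then have "\<omega> * card S * exp (- (p * (card V - vmin))) \<le> \<omega> * card S * 1"
    using \<omega> by (intro mult_left_mono) auto
  then show ?case using 0 by (simp add: algebra_simps)
next
  case (Suc k)
  let ?q = "1 - (1 - p) ^ card S" and ?N = "card (V - S)" and ?Nl = "\<lambda>i. Nl (Suc i)"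
  let ?y = "lg p \<omega> ?Nl k"
  have q: "0 \<le> ?q" "?q \<le> 1" using q_bounds p by auto
  have fin: "finite S" using Suc.prems finite_subset by auto
  have cN: "real ?N = real (card V) - card S"
    using Suc.prems fin by (simp add: card_Diff_subset card_mono of_nat_diff)
  have Nl0: "0 \<le> Nl i" for i using Suc.prems(4)[of i] vmin by simp
  have y: "0 \<le> ?y" using lg_nonneg p \<omega> Nl0 by auto
  show ?case
  proof (cases "Nl 0 \<le> ?N")
    case False
    have "rsE p (Edg V) (\<lambda>E. of_bool (\<forall>i<Suc k. Nl i \<le> real (card V) - card (bl E S (Suc i))) *
        exp (- (\<omega> * card (lev E S (Suc k))))) = rsE p (Edg V) (\<lambda>E. 0)"
      using False cN by (intro rsE_cong refl) (auto simp: bl_Suc intro!: exI[of _ 0])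
    then show ?thesis using Suc.prems by simp
  next
    case True
    define E' where "E' = exp (- (p * (card (V - S) - vmin)))"
    have V': "vmin \<le> card (V - S)" using True Suc.prems(4)[of 0] by simp
    have E': "0 \<le> E'" "E' \<le> 1" using V' p by (auto simp: E'_def)
    have card_bl: "real (card V) - card (bl E S (Suc (Suc i))) =
        real (card (V - S)) - card (bl (del E S) (nb E S - S) (Suc i))" if "E \<subseteq> Edg V" for E i
    proof -
      have "nb E S - S \<subseteq> V - S" using nb_subset[OF that] by auto
      then have sub: "bl (del E S) (nb E S - S) (Suc i) \<subseteq> V - S"
        by (intro bl_subset del_subset that)
      then have "finite (bl (del E S) (nb E S - S) (Suc i))" using Suc.prems finite_subset by blast
      then have "card (bl E S (Suc (Suc i))) = card S + card (bl (del E S) (nb E S - S) (Suc i))"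
        unfolding bl_Suc'[of E S "Suc i"] using sub fin by (intro card_Un_disjoint) auto
      then show ?thesis using cN by simp
    qed
    have "rsE p (Edg V) (\<lambda>E. of_bool (\<forall>i<Suc k. Nl i \<le> real (card V) - card (bl E S (Suc i))) *
        exp (- (\<omega> * card (lev E S (Suc k)))))
      = rsE p (Edg V) (\<lambda>E. of_bool (\<forall>i<k. ?Nl i \<le> real (card (V - S)) - card (bl (del E S) (nb E S - S) (Suc i))) *
        exp (- (\<omega> * card (lev (del E S) (nb E S - S) k))))"
    proof (rule rsE_cong[OF refl])
      fix E assume E: "E \<subseteq> Edg V"
      have "Nl 0 \<le> real (card V) - card (bl E S (Suc 0))" using True cN by (simp add: bl_Suc)
      then show "of_bool (\<forall>i<Suc k. Nl i \<le> real (card V) - card (bl E S (Suc i))) *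
        exp (- (\<omega> * card (lev E S (Suc k)))) = of_bool (\<forall>i<k. ?Nl i \<le> real (card (V - S)) - card (bl (del E S) (nb E S - S) (Suc i))) *
        exp (- (\<omega> * card (lev (del E S) (nb E S - S) k)))"
        unfolding All_less_Suc2 lev_Suc by (simp only: card_bl[OF E] simp_thms)
    qed
    also have "\<dots> = rsE ?q (V - S) (\<lambda>T. rsE p (Edg (V - S)) (\<lambda>E.
        of_bool (\<forall>i<k. ?Nl i \<le> real (card (V - S)) - card (bl E T (Suc i))) * exp (- (\<omega> * card (lev E T k)))))"
      using Suc.prems(1,2) by (rule rsE_lev_Suc)
    also have "\<dots> \<le> rsE ?q (V - S) (\<lambda>T. exp (- (?y * E')) ^ card T)"
    proof (rule rsE_mono[OF q])
      fix T assume T: "T \<subseteq> V - S"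
      have "rsE p (Edg (V - S)) (\<lambda>E. of_bool (\<forall>i<k. ?Nl i \<le> real (card (V - S)) - card (bl E T (Suc i))) *
           exp (- (\<omega> * card (lev E T k)))) \<le> exp (- (card T * lg p \<omega> ?Nl k * exp (- (p * (card (V - S) - vmin)))))"
        using Suc.prems T V' by (intro Suc.IH) auto
      then show "rsE p (Edg (V - S)) (\<lambda>E. of_bool (\<forall>i<k. ?Nl i \<le> real (card (V - S)) - card (bl E T (Suc i))) *
           exp (- (\<omega> * card (lev E T k)))) \<le> exp (- (?y * E')) ^ card T"
        by (simp add: E'_def exp_of_nat_mult[symmetric] algebra_simps)
    qed
    also have "\<dots> \<le> exp (- (?q * (1 - exp (- (?y * E')))) * ?N)"
      using Suc.prems q y E' by (intro rsE_pow_le) auto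
    also have "\<dots> \<le> exp (- (card S * lg p \<omega> Nl (Suc k) * exp (- (p * (card V - vmin)))))"
    proof -
      have w: "E' * (1 - exp (- ?y)) \<le> 1 - exp (- (?y * E'))"
        using exp_weight[OF E', of "- ?y"] by (simp add: algebra_simps)
      have EE: "exp (- (p * card S)) * E' = exp (- (p * (card V - vmin)))"
        unfolding E'_def exp_add[symmetric] cN by (simp add: algebra_simps)
      have "card S * lg p \<omega> Nl (Suc k) * exp (- (p * (card V - vmin)))
        = (p * card S * exp (- (p * card S))) * (E' * (1 - exp (- ?y))) * Nl 0"
        unfolding EE[symmetric] by simp
      also have "\<dots> \<le> ?q * (1 - exp (- (?y * E'))) * ?N"
        using q_lower_exp[OF p, of "card S"] w q True Nl0 E' y p
        by (intro mult_mono) auto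
      finally show ?thesis by simp
    qed
    finally show ?thesis .
  qed
qed

section \<open>Size of the reached set and of a single level\<close>

definition reach :: "'a set set \<Rightarrow> 'a set \<Rightarrow> 'a set" where
  "reach E S = {y. \<exists>k. \<exists>x\<in>S. wlk E k x y}"

lemma reach_closed: "x \<in> reach E S \<Longrightarrow> {x, z} \<in> E \<Longrightarrow> z \<in> reach E S"
proof -
  assume "x \<in> reach E S" and e: "{x, z} \<in> E"
  then obtain k u where u: "u \<in> S" "wlk E k u x" by (auto simp: reach_def)
  have "wlk E (Suc 0) x z" using e by simp
  then have "wlk E (k + Suc 0) u z" using u wlk_add[of E k "Suc 0" u z] by blast
  then show ?thesis using u(1) unfolding reach_def by blast
qed

lemma reach_base: "S \<subseteq> reach E S"
proof
  fix x assume "x \<in> S"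
  moreover have "wlk E 0 x x" by simp
  ultimately show "x \<in> reach E S" unfolding reach_def by blast
qed

lemma bl_subset_reach: "bl E S k \<subseteq> reach E S"
  by (auto simp: bl_def reach_def lev_def)

lemma reach_subset: "E \<subseteq> Edg V \<Longrightarrow> S \<subseteq> V \<Longrightarrow> reach E S \<subseteq> V"
proof
  fix y assume E: "E \<subseteq> Edg V" and S: "S \<subseteq> V" and "y \<in> reach E S"
  then obtain k x where "x \<in> S" "wlk E k x y" by (auto simp: reach_def)
  then obtain j where "y \<in> lev E S j" using wlk_imp_lev by metis
  then show "y \<in> V" using lev_subset[OF E S] by auto
qed

lemma reach_explore_one:
  assumes "s \<in> S"
  shows "reach E S \<subseteq> insert s (reach (del E {s}) ((S - {s}) \<union> (nb E {s} - S)))"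
    (is "_ \<subseteq> insert s ?R")
proof
  have cl: "z \<in> insert s ?R" if "x \<in> insert s ?R" "{x, z} \<in> E" for x z
  proof (cases "x = s \<or> z = s")
    case True
    then show ?thesis
    proof
      assume "x = s"
      then have "z \<in> insert s ((S - {s}) \<union> (nb E {s} - S))" using that assms by (auto simp: nb_def)
      then show ?thesis using reach_base[of "(S - {s}) \<union> (nb E {s} - S)" "del E {s}"] by blast
    qed simp
  next
    case False
    then have "x \<in> ?R" "{x, z} \<in> del E {s}" using that by (auto simp: del_def)
    then have "z \<in> ?R" by (rule reach_closed)
    then show ?thesis by simp
  qed
  have *: "y \<in> insert s ?R" if "wlk E k x y" "x \<in> insert s ?R" for k x y
    using that
  proof (induction k arbitrary: x)
    case (Suc k)
    then obtain z where "{x, z} \<in> E" "wlk E k z y" by auto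
    then show ?case using Suc.IH cl[OF Suc.prems(2)] by blast
  qed simp
  fix y assume "y \<in> reach E S"
  then obtain k x where kx: "x \<in> S" "wlk E k x y" by (auto simp: reach_def)
  have "x \<in> insert s ?R" using kx(1) reach_base[of "(S - {s}) \<union> (nb E {s} - S)" "del E {s}"] by blast
  then show "y \<in> insert s ?R" using * kx(2) by blast
qed

text \<open>To reach j vertices, j of them are processed one at a time, and a vertex outside S is
  found with probability \<open>1 - (1 - p) ^ j\<close>. The bound is the Chernoff bound for
  \<open>card S\<close> plus that binomial variable, obtained without setting up the exploration as
  a process.\<close>

lemma reach_tail:
  fixes p \<theta> :: real
  assumes p: "0 \<le> p" "p \<le> 1" and \<theta>: "0 \<le> \<theta>" and V: "finite V" "S \<subseteq> V"
  shows "rsE p (Edg V) (\<lambda>E. of_bool (j \<le> card (reach E S)))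
    \<le> exp (\<theta> * (real (card S) - j)) * (1 + (1 - (1 - p) ^ j) * (exp \<theta> - 1)) ^ card (V - S)"
  using V
proof (induction j arbitrary: V S)
  case 0
  then show ?case using \<theta> by simp
next
  case (Suc j)
  let ?b = "1 + (1 - (1 - p) ^ j) * (exp \<theta> - 1)" and ?N = "card (V - S)"
  have fin: "finite S" using Suc.prems finite_subset by auto
  have e1: "0 \<le> exp \<theta> - 1" using \<theta> by simp
  have b: "1 \<le> ?b" using e1 q_bounds[OF p, of j] by simp
  show ?case
  proof (cases "S = {}")
    case True
    have "rsE p (Edg V) (\<lambda>E. of_bool (Suc j \<le> card (reach E S))) = rsE p (Edg V) (\<lambda>E. 0)"
      using True by (intro rsE_cong) (auto simp: reach_def)
    moreover have "0 \<le> 1 + (1 - (1 - p) ^ Suc j) * (exp \<theta> - 1)"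
      using e1 q_bounds[OF p, of "Suc j"] by (intro add_nonneg_nonneg mult_nonneg_nonneg) auto
    ultimately show ?thesis using Suc.prems by simp
  next
    case False
    then obtain s where s: "s \<in> S" by auto
    have cS: "card (S - {s}) = card S - 1" "1 \<le> card S" using s fin by (auto simp: Suc_le_eq card_gt_0_iff)
    have "rsE p (Edg V) (\<lambda>E. of_bool (Suc j \<le> card (reach E S)))
      \<le> rsE p (Edg V) (\<lambda>E. of_bool (j \<le> card (reach (del E {s}) ((S - {s}) \<union> (nb E {s} - S)))))"
    proof (rule rsE_mono[OF p])
      fix E assume E: "E \<subseteq> Edg V"
      let ?R = "reach (del E {s}) ((S - {s}) \<union> (nb E {s} - S))"
      have "?R \<subseteq> V - {s}"
        by (intro reach_subset del_subset E) (use Suc.prems nb_subset[OF E] s in auto)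
      then have "finite ?R" using Suc.prems finite_subset by blast
      then have "card (reach E S) \<le> Suc (card ?R)"
        using card_mono[OF _ reach_explore_one[OF s, of E]] card_insert_le_m1[of "Suc (card ?R)" ?R s] by auto
      then show "(of_bool (Suc j \<le> card (reach E S)) :: real) \<le> of_bool (j \<le> card ?R)" by auto
    qed
    also have "\<dots> = rsE (1 - (1 - p) ^ card {s}) (V - S) (\<lambda>T. rsE p (Edg (V - {s}))
        (\<lambda>E. of_bool (j \<le> card (reach E ((S - {s}) \<union> T)))))"
      using s Suc.prems by (intro rsE_step) auto
    also have "\<dots> = rsE p (V - S) (\<lambda>T. rsE p (Edg (V - {s})) (\<lambda>E. of_bool (j \<le> card (reach E ((S - {s}) \<union> T)))))"
      by simp
    also have "\<dots> \<le> rsE p (V - S) (\<lambda>T. exp (\<theta> * (real (card S) - Suc j)) * ?b ^ ?N * (exp \<theta> / ?b) ^ card T)"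
    proof (rule rsE_mono[OF p])
      fix T assume T: "T \<subseteq> V - S"
      have fT: "finite T" using finite_subset[OF T] Suc.prems by simp
      have Teq: "V - {s} - ((S - {s}) \<union> T) = V - S - T" using s by auto
      have cT: "card (V - S - T) = ?N - card T" "card T \<le> ?N"
        using T fT Suc.prems by (auto simp: card_Diff_subset card_mono)
      have cST: "card ((S - {s}) \<union> T) = card S - 1 + card T"
        using T fT fin cS by (subst card_Un_disjoint) auto
      have "rsE p (Edg (V - {s})) (\<lambda>E. of_bool (j \<le> card (reach E ((S - {s}) \<union> T))))
        \<le> exp (\<theta> * (real (card ((S - {s}) \<union> T)) - j)) * ?b ^ card (V - {s} - ((S - {s}) \<union> T))"
        using Suc.prems T s by (intro Suc.IH) auto
      also have "\<dots> = exp (\<theta> * (real (card S) - Suc j) + \<theta> * card T) * ?b ^ (?N - card T)"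
        unfolding Teq cST cT using cS by (simp add: of_nat_diff algebra_simps)
      also have "\<dots> = exp (\<theta> * (real (card S) - Suc j)) * ?b ^ ?N * (exp \<theta> / ?b) ^ card T"
      proof -
        have 1: "?b ^ (?N - card T) = ?b ^ ?N / ?b ^ card T" using cT b by (intro power_diff) auto
        have 2: "exp (\<theta> * card T) = exp \<theta> ^ card T"
          by (simp only: exp_of_nat_mult[symmetric] mult.commute)
        show ?thesis unfolding 1 exp_add 2 power_divide by (simp only: times_divide_eq_right times_divide_eq_left ac_simps)
      qed
      finally show "rsE p (Edg (V - {s})) (\<lambda>E. of_bool (j \<le> card (reach E ((S - {s}) \<union> T))))
        \<le> exp (\<theta> * (real (card S) - Suc j)) * ?b ^ ?N * (exp \<theta> / ?b) ^ card T" .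
    qed
    also have "\<dots> = exp (\<theta> * (real (card S) - Suc j)) * (?b ^ ?N * (1 - p + p * (exp \<theta> / ?b)) ^ ?N)"
      using Suc.prems by (simp add: rsE_cmult rsE_power)
    also have "?b ^ ?N * (1 - p + p * (exp \<theta> / ?b)) ^ ?N = (?b * (1 - p + p * (exp \<theta> / ?b))) ^ ?N"
      by (simp only: power_mult_distrib)
    \<comment> \<open>With the normalisation by \<open>?b\<close> the induction closes with
      equality: being missed j times and then once more has probability
      \<open>(1 - p) ^ Suc j\<close>.\<close>
    also have "?b * (1 - p + p * (exp \<theta> / ?b)) = ?b * (1 - p) + p * exp \<theta>"
      using b by (simp only: distrib_left times_divide_eq_right) (simp add: field_simps)
    also have "\<dots> = 1 + (1 - (1 - p) ^ Suc j) * (exp \<theta> - 1)" by (simp add: algebra_simps)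
    finally show ?thesis .
  qed
qed

lemma overshoot:
  fixes p :: real
  assumes p: "0 \<le> p" "p \<le> 1" and V: "finite V" "S \<subseteq> V"
  shows "rsE p (Edg V) (\<lambda>E. of_bool (m \<le> card (lev E S 1))) \<le> exp (p * card V * card S) / 2 ^ m"
proof -
  let ?q = "1 - (1 - p) ^ card S" and ?N = "card (V - S)"
  have q: "0 \<le> ?q" "?q \<le> 1" "?q \<le> p * card S" using q_bounds p by auto
  have le: "real ?N \<le> card V" using V by (simp add: card_mono)
  have "rsE p (Edg V) (\<lambda>E. of_bool (m \<le> card (lev E S 1)))
     = rsE p (Edg V) (\<lambda>E. of_bool (m \<le> card (nb E S - S)))"
    unfolding One_nat_def lev_Suc by simp
  also have "\<dots> = rsE ?q (V - S) (\<lambda>T. rsE p (Edg (V - S)) (\<lambda>E. of_bool (m \<le> card T)))"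
    using V by (rule rsE_lev_Suc)
  also have "\<dots> = rsE ?q (V - S) (\<lambda>T. of_bool (m \<le> card T))" using V by simp
  also have "\<dots> \<le> rsE ?q (V - S) (\<lambda>T. 1 / 2 ^ m * 2 ^ card T)"
    using q by (intro rsE_mono) (auto simp: field_simps power_increasing)
  also have "\<dots> = 1 / 2 ^ m * (1 + ?q) ^ ?N" using V by (simp only: rsE_cmult) (simp add: rsE_power)
  also have "\<dots> \<le> 1 / 2 ^ m * exp ?q ^ ?N"
    using q by (intro mult_left_mono power_mono exp_ge_add_one_self) auto
  also have "\<dots> = 1 / 2 ^ m * exp (?q * ?N)" by (simp add: exp_of_nat_mult[symmetric] mult.commute)
  also have "\<dots> \<le> 1 / 2 ^ m * exp (p * card S * card V)"
    using q le p by (intro mult_left_mono) (auto intro!: mult_mono)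
  finally show ?thesis by (simp add: algebra_simps)
qed

section \<open>Pairs of disjoint geodesic rays\<close>

definition geo_ray :: "'a set set \<Rightarrow> 'a \<Rightarrow> nat \<Rightarrow> (nat \<Rightarrow> 'a) \<Rightarrow> bool" where
  "geo_ray E v h f \<longleftrightarrow> f 0 = v \<and> (\<forall>i<h. {f i, f (Suc i)} \<in> E) \<and> (\<forall>i\<le>h. f i \<in> lev E {v} i)"

text \<open>Comparing vertices of equal index is enough: the i-th vertex of a ray lies at distance i
  from v, so two rays can meet only at equal indices.\<close>

definition two_rays :: "'a set set \<Rightarrow> 'a \<Rightarrow> nat \<Rightarrow> bool" where
  "two_rays E v h \<longleftrightarrow> (\<exists>f g. geo_ray E v h f \<and> geo_ray E v h g \<and> (\<forall>i. 1 \<le> i \<and> i \<le> h \<longrightarrow> f i \<noteq> g i))"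

lemma geo_ray_local:
  assumes t: "touch E (bl E {v} h) = touch E' (bl E {v} h)" and f: "geo_ray E v h f"
  shows "geo_ray E' v h f"
proof -
  have "{f i, f (Suc i)} \<in> E'" if "i < h" for i
  proof -
    have "f i \<in> lev E {v} i" "{f i, f (Suc i)} \<in> E"
      using f that by (simp_all add: geo_ray_def)
    then have "f i \<in> bl E {v} h" "{f i, f (Suc i)} \<in> E"
      using that unfolding bl_def by blast+
    then have "{f i, f (Suc i)} \<in> touch E (bl E {v} h)" by (auto simp: touch_def)
    then show ?thesis unfolding t by (auto simp: touch_def)
  qed
  then show ?thesis using f lev_local[OF t] by (auto simp: geo_ray_def)
qed

lemma two_rays_local: "local_at h {v} (\<lambda>E. two_rays E v h)"
  unfolding local_at_def
proof (intro allI impI)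
  fix E E' assume t: "touch E (bl E {v} h) = touch E' (bl E {v} h)"
  have b: "bl E' {v} h = bl E {v} h" using bl_local[OF t] by simp
  have t': "touch E' (bl E' {v} h) = touch E (bl E' {v} h)" unfolding b using t by simp
  show "two_rays E' v h = two_rays E v h"
    unfolding two_rays_def using geo_ray_local[OF t] geo_ray_local[OF t'] by blast
qed

lemma geo_ray_inj: "geo_ray E v h f \<Longrightarrow> geo_ray E v h g \<Longrightarrow> i \<le> h \<Longrightarrow> j \<le> h \<Longrightarrow> f i = g j \<Longrightarrow> i = j"
  unfolding geo_ray_def by (metis lev_unique)

lemma lev_geo_ray: "z \<in> lev E {v} h \<Longrightarrow> \<exists>f. geo_ray E v h f \<and> f h = z"
  using lev_path[of z E "{v}" h] by (auto simp: geo_ray_def)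

text \<open>Leaving an arbitrary geodesic ray to \<open>z\<close> at its last contact with the two given rays
  gives a ray to \<open>z\<close> that is disjoint from one of them.\<close>

lemma two_rays_end:
  assumes "two_rays E v h" "z \<in> lev E {v} h"
  shows "\<exists>r q. geo_ray E v h r \<and> geo_ray E v h q \<and> r h = z \<and> (\<forall>i. 1 \<le> i \<and> i \<le> h \<longrightarrow> r i \<noteq> q i)"
proof -
  obtain f g where fg: "geo_ray E v h f" "geo_ray E v h g" "\<And>i. 1 \<le> i \<Longrightarrow> i \<le> h \<Longrightarrow> f i \<noteq> g i"
    using assms(1) by (auto simp: two_rays_def)
  obtain r where r: "geo_ray E v h r" "r h = z" using lev_geo_ray[OF assms(2)] by auto
  define I where "I = {i. i \<le> h \<and> (r i = f i \<or> r i = g i)}"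
  have I: "finite I" "0 \<in> I" using r fg by (auto simp: I_def geo_ray_def)
  define m where "m = Max I"
  have mI: "m \<in> I" unfolding m_def using I by (intro Max_in) auto
  have nI: "r i \<noteq> f i \<and> r i \<noteq> g i" if "m < i" "i \<le> h" for i
  proof (rule ccontr)
    assume "\<not> ?thesis"
    then have "i \<in> I" using that by (auto simp: I_def)
    then have "i \<le> m" unfolding m_def using I by (intro Max_ge) auto
    then show False using that by simp
  qed
  have main: ?thesis if p: "geo_ray E v h p" "geo_ray E v h q" "r m = p m" "\<And>i. 1 \<le> i \<Longrightarrow> i \<le> h \<Longrightarrow> p i \<noteq> q i"
      "\<And>i. m < i \<Longrightarrow> i \<le> h \<Longrightarrow> r i \<noteq> q i" for p q
  proof -
    define s where "s = (\<lambda>i. if i \<le> m then p i else r i)"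
    have mh: "m \<le> h" using mI by (simp add: I_def)
    have "{s i, s (Suc i)} \<in> E" if "i < h" for i
    proof -
      consider "Suc i \<le> m" | "i = m" | "m < i" by linarith
      then show ?thesis
      proof cases
        case 2
        then have "s i = r i" "s (Suc i) = r (Suc i)" using p(3) by (auto simp: s_def)
        then show ?thesis using r(1) \<open>i < h\<close> by (simp add: geo_ray_def)
      qed (use p(1) r(1) \<open>i < h\<close> in \<open>auto simp: s_def geo_ray_def\<close>)
    qed
    then have "geo_ray E v h s" using p(1) r(1) by (auto simp: geo_ray_def s_def)
    moreover have "s h = z" using r(2) p(3) mh by (cases "h = m") (auto simp: s_def)
    moreover have "s i \<noteq> q i" if "1 \<le> i" "i \<le> h" for i
      using p(4)[OF that] p(5)[of i] that by (auto simp: s_def)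
    ultimately show ?thesis using p(2) by blast
  qed
  show ?thesis
  proof (cases "r m = f m")
    case True
    then show ?thesis using main[OF fg(1,2)] fg(3) nI by blast
  next
    case False
    then have "r m = g m" using mI by (auto simp: I_def)
    then show ?thesis using main[OF fg(2,1)] fg(3) nI by metis
  qed
qed

text \<open>The start v is kept apart from xs because only \<open>set xs\<close> is removed when the
  second ray is looked for; v must survive.\<close>

definition path_edges :: "'a \<Rightarrow> 'a list \<Rightarrow> 'a set set" where
  "path_edges v xs = (\<lambda>i. {(v # xs) ! i, xs ! i}) ` {..<length xs}"

lemma card_path_edges:
  assumes "distinct (v # xs)"
  shows "card (path_edges v xs) = length xs"
proof -
  have "inj_on (\<lambda>i. {(v # xs) ! i, xs ! i}) {..<length xs}"
  proof (rule inj_onI)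
    fix i j assume ij: "i \<in> {..<length xs}" "j \<in> {..<length xs}"
      and eq: "{(v # xs) ! i, xs ! i} = {(v # xs) ! j, xs ! j}"
    have *: "a = b" if "(v # xs) ! a = (v # xs) ! b" "a \<le> length xs" "b \<le> length xs" for a b
      using nth_eq_iff_index_eq[OF assms, of a b] that by simp
    have "xs ! k = (v # xs) ! Suc k" for k by simp
    then have "{(v # xs) ! i, (v # xs) ! Suc i} = {(v # xs) ! j, (v # xs) ! Suc j}" using eq by simp
    then have "(v # xs) ! i = (v # xs) ! j \<or> ((v # xs) ! i = (v # xs) ! Suc j \<and> (v # xs) ! Suc i = (v # xs) ! j)"
      unfolding doubleton_eq_iff by blast
    then show "i = j"
    proof
      assume "(v # xs) ! i = (v # xs) ! j"
      then show ?thesis using *[of i j] ij by simp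
    next
      assume "(v # xs) ! i = (v # xs) ! Suc j \<and> (v # xs) ! Suc i = (v # xs) ! j"
      then have "i = Suc j" "Suc i = j" using *[of i "Suc j"] *[of "Suc i" j] ij by auto
      then show ?thesis by simp
    qed
  qed
  then show ?thesis by (simp add: path_edges_def card_image)
qed

lemma path_edges_subset:
  assumes "distinct (v # xs)" "v \<in> V" "set xs \<subseteq> V"
  shows "path_edges v xs \<subseteq> Edg V"
proof
  fix e assume "e \<in> path_edges v xs"
  then obtain i where i: "i < length xs" "e = {(v # xs) ! i, xs ! i}" by (auto simp: path_edges_def)
  have "(v # xs) ! i \<noteq> (v # xs) ! Suc i"
    using nth_eq_iff_index_eq[OF assms(1), of i "Suc i"] i by simp
  then have ne: "(v # xs) ! i \<noteq> xs ! i" by simp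
  have "(v # xs) ! i \<in> set (v # xs)" using i by (intro nth_mem) simp
  moreover have "xs ! i \<in> set xs" using i by simp
  ultimately have "e \<subseteq> V" using i(2) assms by auto
  then show "e \<in> Edg V" using ne i(2) by (simp add: Edg_def)
qed

lemma two_rays_list:
  assumes E: "E \<subseteq> Edg V" and v: "v \<in> V" and two: "two_rays E v h" "z \<in> lev E {v} h"
  shows "\<exists>xs. set xs \<subseteq> V \<and> length xs = h \<and> distinct (v # xs) \<and> path_edges v xs \<subseteq> E \<and>
    (v # xs) ! h = z \<and> lev (del E (set xs)) {v} h \<noteq> {}"
proof -
  obtain r q where rq: "geo_ray E v h r" "geo_ray E v h q" "r h = z"
    "\<And>i. 1 \<le> i \<Longrightarrow> i \<le> h \<Longrightarrow> r i \<noteq> q i" using two_rays_end[OF two] by auto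
  define xs where "xs = map r [1..<Suc h]"
  have r0: "r 0 = v" "q 0 = v" using rq by (auto simp: geo_ray_def)
  have vxs: "v # xs = map r [0..<Suc h]"
    unfolding xs_def r0(1)[symmetric] by (simp add: upt_conv_Cons del: upt_Suc)
  have len: "length xs = h" by (simp add: xs_def)
  have nth: "(v # xs) ! i = r i" if "i \<le> h" for i
    unfolding vxs using that by (simp del: upt_Suc)
  have nth': "xs ! i = r (Suc i)" if "i < h" for i
    unfolding xs_def using that by (simp del: upt_Suc)
  have setxs: "set xs = r ` {1..h}" by (auto simp: xs_def)
  have rV: "r i \<in> V" if "i \<le> h" for i
    using that rq(1) lev_subset[OF E, of "{v}" i] v by (auto simp: geo_ray_def)
  have "set xs \<subseteq> V" unfolding setxs using rV by auto
  moreover have "distinct (v # xs)"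
    unfolding vxs distinct_map using geo_ray_inj[OF rq(1) rq(1)] by (auto simp: inj_on_def)
  moreover have "path_edges v xs \<subseteq> E"
    using rq(1) nth nth' len by (auto simp: path_edges_def geo_ray_def)
  moreover have "(v # xs) ! h = z" using nth[of h] rq(3) by simp
  moreover have "q h \<in> lev (del E (set xs)) {v} h"
  proof -
    have nq: "q i \<notin> set xs" if "i \<le> h" for i
    proof
      assume "q i \<in> set xs"
      then obtain j where j: "1 \<le> j" "j \<le> h" "r j = q i" unfolding setxs by auto
      then have "j = i" using geo_ray_inj[OF rq(1,2)] that by auto
      then show False using j rq(4)[of i] by auto
    qed
    have "{q i, q (Suc i)} \<in> del E (set xs)" if "i < h" for i
      using nq[of i] nq[of "Suc i"] that rq(2) by (auto simp: del_def geo_ray_def)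
    then have "wlk (del E (set xs)) h (q 0) (q (0 + h))" by (intro path_wlk) auto
    moreover have "\<not> wlk (del E (set xs)) j v (q h)" if "j < h" for j
      using rq(2) that wlk_mono[OF _ del_le, of E "set xs" j v "q h"]
      by (auto simp: geo_ray_def lev_single_iff)
    ultimately show ?thesis by (simp add: lev_single_iff r0)
  qed
  ultimately show ?thesis using len by blast
qed

text \<open>First moment over all rays to a vertex z of level h: at most \<open>card V ^ h\<close>
  candidates, each present with probability \<open>p ^ h\<close>. Given one, a second ray must exist
  in the graph without it, at the price of the survival probability \<open>orb l h 1\<close>; this
  is where the additional \<epsilon> comes from.\<close>

lemma two_rays_mean:
  fixes p l :: real
  assumes V: "finite V" "v \<in> V" and p: "0 \<le> p" "p < 1" and l: "real (card V) * - ln (1 - p) \<le> l"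
  shows "rsE p (Edg V) (\<lambda>E. of_bool (two_rays E v h) * real (card (lev E {v} h)))
    \<le> (p * card V) ^ h * orb l h 1"
proof -
  define XS where "XS = {xs. set xs \<subseteq> V \<and> length xs = h \<and> distinct (v # xs)}"
  define ok where "ok = (\<lambda>E xs. path_edges v xs \<subseteq> E \<and> lev (del E (set xs)) {v} h \<noteq> {})"
  have XS: "XS \<subseteq> {xs. set xs \<subseteq> V \<and> length xs = h}" by (auto simp: XS_def)
  have fin: "finite XS" by (rule finite_subset[OF XS]) (simp add: finite_lists_length_eq V)
  have "card XS \<le> card {xs. set xs \<subseteq> V \<and> length xs = h}"
    using XS by (intro card_mono finite_lists_length_eq V)
  then have cXS: "card XS \<le> card V ^ h" by (simp add: card_lists_length_eq V)
  have lnp: "0 \<le> - ln (1 - p)" using p by auto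
  have l0: "0 \<le> l" using l lnp by (smt (verit) mult_nonneg_nonneg of_nat_0_le_iff)
  have o: "0 \<le> orb l h 1" using orb_range[OF l0, of 1 h] by auto
  have "rsE p (Edg V) (\<lambda>E. of_bool (two_rays E v h) * real (card (lev E {v} h)))
    \<le> rsE p (Edg V) (\<lambda>E. \<Sum>xs\<in>XS. of_bool (ok E xs))"
  proof (rule rsE_mono)
    fix E assume E: "E \<subseteq> Edg V"
    show "of_bool (two_rays E v h) * real (card (lev E {v} h)) \<le> (\<Sum>xs\<in>XS. of_bool (ok E xs))"
    proof (cases "two_rays E v h")
      case True
      have "lev E {v} h \<subseteq> (\<lambda>xs. (v # xs) ! h) ` {xs \<in> XS. ok E xs}"
      proof
        fix z assume "z \<in> lev E {v} h"
        from two_rays_list[OF E V(2) True this] obtain xs where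
          "set xs \<subseteq> V" "length xs = h" "distinct (v # xs)" "path_edges v xs \<subseteq> E"
          "(v # xs) ! h = z" "lev (del E (set xs)) {v} h \<noteq> {}" by blast
        then show "z \<in> (\<lambda>xs. (v # xs) ! h) ` {xs \<in> XS. ok E xs}"
          unfolding XS_def ok_def by blast
      qed
      then have "card (lev E {v} h) \<le> card {xs \<in> XS. ok E xs}"
      proof -
        assume sub: "lev E {v} h \<subseteq> (\<lambda>xs. (v # xs) ! h) ` {xs \<in> XS. ok E xs}"
        have f: "finite {xs \<in> XS. ok E xs}" using fin by simp
        show ?thesis by (rule order_trans[OF card_mono[OF finite_imageI[OF f] sub] card_image_le[OF f]])
      qed
      also have "\<dots> = (\<Sum>xs\<in>XS. of_bool (ok E xs))"
        using fin by (simp add: sum.If_cases of_bool_def Int_def)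
      finally have "real (card (lev E {v} h)) \<le> real (\<Sum>xs\<in>XS. of_bool (ok E xs))"
        by (simp only: of_nat_le_iff)
      then show ?thesis using True by (simp add: of_nat_sum)
    qed (simp add: sum_nonneg)
  qed (use p in auto)
  also have "\<dots> = (\<Sum>xs\<in>XS. rsE p (Edg V) (\<lambda>E. of_bool (ok E xs)))" by (rule rsE_sum)
  also have "\<dots> \<le> (\<Sum>xs\<in>XS. p ^ h * orb l h 1)"
  proof (rule sum_mono)
    fix xs assume xs: "xs \<in> XS"
    have xs': "set xs \<subseteq> V" "length xs = h" "distinct (v # xs)" using xs by (auto simp: XS_def)
    \<comment> \<open>Every path edge contains its later endpoint, a vertex of xs. Hence the
      presence of the path is independent of \<open>del E (set xs)\<close>.\<close>
    have te: "path_edges v xs \<subseteq> E \<longleftrightarrow> path_edges v xs \<subseteq> touch E (set xs)" for E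
      by (auto simp: path_edges_def touch_def)
    have "rsE p (Edg V) (\<lambda>E. of_bool (ok E xs)) = rsE p (Edg V) (\<lambda>E. of_bool (path_edges v xs \<subseteq> E) *
         (\<lambda>F. of_bool (lev F {v} h \<noteq> {})) (del E (set xs)))"
      by (intro rsE_cong) (auto simp: ok_def)
    also have "\<dots> = rsE p (Edg V) (\<lambda>E. of_bool (path_edges v xs \<subseteq> E)) *
        rsE p (Edg (V - set xs)) (\<lambda>F. of_bool (lev F {v} h \<noteq> {}))"
      using V(1) te by (intro rsE_indep) auto
    also have "\<dots> \<le> p ^ h * (card {v} * orb l h 1)"
    proof (intro mult_mono lev_survive_prob)
      show "rsE p (Edg V) (\<lambda>E. of_bool (path_edges v xs \<subseteq> E)) \<le> p ^ h"
        using rsE_superset[OF finite_Edg[OF V(1)] path_edges_subset[OF xs'(3) V(2) xs'(1)], of p]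
          card_path_edges[OF xs'(3)] xs'(2) by simp
      have "card (V - set xs) \<le> card V" using V by (simp add: card_mono)
      then show "real (card (V - set xs)) * - ln (1 - p) \<le> l"
        using l mult_right_mono[OF _ lnp, of "real (card (V - set xs))" "card V"] by simp
      show "0 \<le> rsE p (Edg (V - set xs)) (\<lambda>F. of_bool (lev F {v} h \<noteq> {}))"
        using p by (intro rsE_nonneg) auto
    qed (use V p xs' in auto)
    finally show "rsE p (Edg V) (\<lambda>E. of_bool (ok E xs)) \<le> p ^ h * orb l h 1" by simp
  qed
  also have "\<dots> = card XS * (p ^ h * orb l h 1)" by simp
  also have "\<dots> \<le> card V ^ h * (p ^ h * orb l h 1)"
    using cXS p o by (intro mult_right_mono) auto
  finally show ?thesis by (simp add: power_mult_distrib algebra_simps)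
qed

section \<open>Elementary inequalities\<close>

text \<open>In reciprocals: the map y to 1 - exp (- l y) takes 1 / y to at least 1 / (l y) + 1 / 2.
  The increment 1 / 2 per step drives \<open>orb_recip_lower\<close>.\<close>

lemma one_minus_exp_upper:
  fixes w :: real
  assumes "0 \<le> w"
  shows "1 - exp (- w) \<le> w / (1 + w / 2)"
proof -
  define f where "f = (\<lambda>w::real. w / 2 + (1 + w / 2) * exp (- w))"
  have "f 0 \<le> f w"
  proof (rule DERIV_nonneg_imp_nondecreasing[OF assms])
    fix x :: real assume x: "0 \<le> x" "x \<le> w"
    have "(f has_real_derivative (1 / 2 - (1 / 2) * ((1 + x) * exp (- x)))) (at x)"
      unfolding f_def by (auto intro!: derivative_eq_intros simp: field_simps)
    moreover have "(1 + x) * exp (- x) \<le> exp x * exp (- x)" by (intro mult_right_mono exp_ge_add_one_self) auto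
    then have "(1 + x) * exp (- x) \<le> 1" by (simp add: exp_minus)
    ultimately show "\<exists>y. (f has_real_derivative y) (at x) \<and> 0 \<le> y" by fastforce
  qed
  then have "1 \<le> w / 2 + (1 + w / 2) * exp (- w)" by (simp add: f_def)
  moreover have "(1 - exp (- w)) * (1 + w / 2) = 1 + w / 2 - (1 + w / 2) * exp (- w)"
    by (simp only: left_diff_distrib mult_1_left mult.commute)
  ultimately have "(1 - exp (- w)) * (1 + w / 2) \<le> w" by linarith
  moreover have "0 < 1 + w / 2" using assms by linarith
  ultimately show ?thesis by (simp only: pos_le_divide_eq)
qed

lemma one_minus_exp_lower:
  fixes w :: real
  assumes "0 \<le> w"
  shows "w - w\<^sup>2 / 2 \<le> 1 - exp (- w)"
proof -
  define f where "f = (\<lambda>w::real. 1 - exp (- w) - w + w\<^sup>2 / 2)"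
  have "f 0 \<le> f w"
  proof (rule DERIV_nonneg_imp_nondecreasing[OF assms])
    fix x :: real assume x: "0 \<le> x" "x \<le> w"
    have "(f has_real_derivative (exp (- x) - 1 + x)) (at x)"
      unfolding f_def by (auto intro!: derivative_eq_intros simp: algebra_simps)
    moreover have "0 \<le> exp (- x) - 1 + x" using exp_ge_add_one_self[of "- x"] by simp
    ultimately show "\<exists>y. (f has_real_derivative y) (at x) \<and> 0 \<le> y" by blast
  qed
  then show ?thesis by (simp add: f_def)
qed

lemma q_lower_quad:
  fixes p :: real
  assumes "0 \<le> p" "p \<le> 1"
  shows "p * x * (1 - p * real x / 2) \<le> 1 - (1 - p) ^ x"
proof -
  have "(1 - p) ^ x \<le> exp (- p) ^ x" using assms exp_ge_add_one_self[of "- p"] by (intro power_mono) auto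
  also have "\<dots> = exp (- (p * x))" by (simp add: exp_of_nat_mult[symmetric] algebra_simps)
  finally have "1 - exp (- (p * x)) \<le> 1 - (1 - p) ^ x" by simp
  moreover have "p * x - (p * x)\<^sup>2 / 2 \<le> 1 - exp (- (p * x))" using assms by (intro one_minus_exp_lower) auto
  ultimately show ?thesis by (simp add: power2_eq_square algebra_simps)
qed

lemma exp_symmetric_bound:
  fixes w :: real
  assumes "0 < w"
  shows "w\<^sup>2 * exp (- w) \<le> (1 - exp (- w))\<^sup>2"
proof -
  define f where "f = (\<lambda>x::real. exp x - exp (- x) - 2 * x)"
  have "0 \<le> w / 2" using assms by simp
  then have "f 0 \<le> f (w / 2)"
  proof (rule DERIV_nonneg_imp_nondecreasing)
    fix x :: real assume x: "0 \<le> x" "x \<le> w / 2"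
    have "(f has_real_derivative (exp x + exp (- x) - 2)) (at x)"
      unfolding f_def by (auto intro!: derivative_eq_intros)
    moreover have "0 \<le> exp x + exp (- x) - 2"
      using exp_ge_add_one_self[of x] exp_ge_add_one_self[of "-x"] by linarith
    ultimately show "\<exists>y. (f has_real_derivative y) (at x) \<and> 0 \<le> y" by blast
  qed
  then have "w \<le> exp (w / 2) - exp (- (w / 2))" by (simp add: f_def)
  then have "w * exp (- (w / 2)) \<le> (exp (w / 2) - exp (- (w / 2))) * exp (- (w / 2))" by (intro mult_right_mono) auto
  also have "\<dots> = 1 - exp (- w)" by (simp add: left_diff_distrib exp_add[symmetric])
  finally have "(w * exp (- (w / 2)))\<^sup>2 \<le> (1 - exp (- w))\<^sup>2" using assms by (intro power_mono) auto
  moreover have "(w * exp (- (w / 2)))\<^sup>2 = w\<^sup>2 * exp (- w)"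
    by (simp add: power_mult_distrib power2_eq_square[of "exp _"] exp_add[symmetric])
  ultimately show ?thesis by simp
qed

text \<open>Makes the relative gap of an orbit to the fixed point contract by the exact factor 1 /
  l, see \<open>orb_lo_early\<close>. The derivative has the right sign by
  \<open>exp_symmetric_bound\<close>, that is, by w / 2 \<le> sinh (w / 2).\<close>

lemma recip_gap_mono:
  fixes v w :: real
  assumes "0 < v" "v \<le> w"
  shows "1 / (1 - exp (- v)) - 1 / v \<le> 1 / (1 - exp (- w)) - 1 / w"
proof -
  define f where "f = (\<lambda>x::real. 1 / (1 - exp (- x)) - 1 / x)"
  have "f v \<le> f w"
  proof (rule DERIV_nonneg_imp_nondecreasing[OF assms(2), where f = f])
    fix x :: real assume x: "v \<le> x" "x \<le> w"
    then have x0: "0 < x" using assms by simp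
    have ne: "1 - exp (- x) > 0" using x0 by simp
    have "(f has_real_derivative (- exp (- x) / (1 - exp (- x))\<^sup>2 + 1 / x\<^sup>2)) (at x)"
      unfolding f_def using x0 ne by (auto intro!: derivative_eq_intros simp: power2_eq_square)
    moreover have "exp (- x) / (1 - exp (- x))\<^sup>2 \<le> 1 / x\<^sup>2"
      using exp_symmetric_bound[OF x0] x0 ne by (simp add: field_simps)
    then have "0 \<le> - exp (- x) / (1 - exp (- x))\<^sup>2 + 1 / x\<^sup>2" by simp
    ultimately show "\<exists>y. (f has_real_derivative y) (at x) \<and> 0 \<le> y" by blast
  qed
  then show ?thesis by (simp add: f_def)
qed

text \<open>- ln (1 - y) / y is the Poisson mean whose survival probability is y. The bounds
  translate a change of survival probability into a change of mean, up to constants.\<close>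

lemma log_ratio_bounds:
  fixes a b :: real
  assumes "0 < a" "a \<le> b" "b \<le> 1 / 5"
  shows "(b - a) / 2 \<le> - ln (1 - b) / b + ln (1 - a) / a" "- ln (1 - b) / b + ln (1 - a) / a \<le> b - a"
proof -
  have lo: "y\<^sup>2 / 2 \<le> y / (1 - y) + ln (1 - y)" and hi: "y / (1 - y) + ln (1 - y) \<le> y\<^sup>2"
    if y: "0 \<le> y" "y \<le> 1 / 5" for y :: real
  proof -
    define f where "f = (\<lambda>c y::real. y / (1 - y) + ln (1 - y) - c * y\<^sup>2)"
    have d: "(f c has_real_derivative (x / (1 - x)\<^sup>2 - 2 * c * x)) (at x)" if "0 \<le> x" "x \<le> 1 / 5" for c x
    proof -
      have "(f c has_real_derivative ((1 * (1 - x) - x * (- 1)) / ((1 - x) * (1 - x)) + (- 1) * inverse (1 - x) - c * (2 * x))) (at x)"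
        unfolding f_def using that by (auto intro!: derivative_eq_intros simp: power2_eq_square field_simps)
      also have "(1 * (1 - x) - x * (- 1)) / ((1 - x) * (1 - x)) + (- 1) * inverse (1 - x) - c * (2 * x) = x / (1 - x)\<^sup>2 - 2 * c * x"
        using that by (simp add: power2_eq_square divide_simps) (simp add: algebra_simps)?
      finally show ?thesis .
    qed
    have "f (1 / 2) 0 \<le> f (1 / 2) y"
    proof (rule DERIV_nonneg_imp_nondecreasing[OF y(1)])
      fix x assume x: "0 \<le> x" "x \<le> y"
      have "(1 - x)\<^sup>2 \<le> 1" using x y by (intro power_le_one) auto
      moreover have "0 < (1 - x)\<^sup>2" using x y by simp
      ultimately have "x \<le> x / (1 - x)\<^sup>2" using x by (simp add: field_simps mult_left_le)
      then show "\<exists>z. (f (1 / 2) has_real_derivative z) (at x) \<and> 0 \<le> z"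
        using d[of x "1 / 2"] x y by (intro exI[of _ "x / (1 - x)\<^sup>2 - 2 * (1 / 2) * x"] conjI) auto
    qed
    then show "y\<^sup>2 / 2 \<le> y / (1 - y) + ln (1 - y)" by (simp add: f_def)
    have "f 1 y \<le> f 1 0"
    proof (rule DERIV_nonpos_imp_nonincreasing[OF y(1)])
      fix x assume x: "0 \<le> x" "x \<le> y"
      have "(4 / 5)\<^sup>2 \<le> (1 - x)\<^sup>2" using x y by (intro power_mono) auto
      then have "1 / 2 \<le> (1 - x)\<^sup>2" by (simp add: power2_eq_square)
      then have "x * 1 \<le> x * (2 * (1 - x)\<^sup>2)" using x by (intro mult_left_mono) auto
      moreover have "0 < (1 - x)\<^sup>2" using x y by simp
      ultimately have "x / (1 - x)\<^sup>2 \<le> 2 * x" by (simp add: field_simps)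
      then show "\<exists>z. (f 1 has_real_derivative z) (at x) \<and> z \<le> 0"
        using d[of x 1] x y by (intro exI[of _ "x / (1 - x)\<^sup>2 - 2 * 1 * x"] conjI) auto
    qed
    then show "y / (1 - y) + ln (1 - y) \<le> y\<^sup>2" by (simp add: f_def)
  qed
  define H where "H = (\<lambda>y::real. - ln (1 - y) / y)"
  have dH: "(H has_real_derivative ((y / (1 - y) + ln (1 - y)) / y\<^sup>2)) (at y)" if "0 < y" "y \<le> 1 / 5" for y
    unfolding H_def using that
    by (auto intro!: derivative_eq_intros simp: power2_eq_square field_simps)
  have "H a - a / 2 \<le> H b - b / 2"
  proof (rule DERIV_nonneg_imp_nondecreasing[OF assms(2)])
    fix x assume x: "a \<le> x" "x \<le> b"
    have "((\<lambda>y. H y - y / 2) has_real_derivative ((x / (1 - x) + ln (1 - x)) / x\<^sup>2 - 1 / 2)) (at x)"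
      by (rule DERIV_diff[OF dH]) (use x assms in \<open>auto intro!: derivative_eq_intros\<close>)
    moreover have "0 \<le> (x / (1 - x) + ln (1 - x)) / x\<^sup>2 - 1 / 2"
      using lo[of x] x assms by (simp add: field_simps)
    ultimately show "\<exists>y. ((\<lambda>y. H y - y / 2) has_real_derivative y) (at x) \<and> 0 \<le> y" by blast
  qed
  then show "(b - a) / 2 \<le> - ln (1 - b) / b + ln (1 - a) / a" by (simp add: H_def field_simps)
  have "a - H a \<le> b - H b"
  proof (rule DERIV_nonneg_imp_nondecreasing[OF assms(2)])
    fix x assume x: "a \<le> x" "x \<le> b"
    have "((\<lambda>y. y - H y) has_real_derivative (1 - (x / (1 - x) + ln (1 - x)) / x\<^sup>2)) (at x)"
      by (rule DERIV_diff[OF _ dH]) (use x assms in \<open>auto intro!: derivative_eq_intros\<close>)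
    moreover have "0 \<le> 1 - (x / (1 - x) + ln (1 - x)) / x\<^sup>2"
      using hi[of x] x assms by (simp add: field_simps)
    ultimately show "\<exists>y. ((\<lambda>y. y - H y) has_real_derivative y) (at x) \<and> 0 \<le> y" by blast
  qed
  then show "- ln (1 - b) / b + ln (1 - a) / a \<le> b - a" by (simp add: H_def)
qed

lemma two_ln_le:
  fixes x :: real
  assumes "1 \<le> x"
  shows "2 * ln x \<le> x - 1 / x"
proof -
  have "1 - 1 / 1 - 2 * ln 1 \<le> x - 1 / x - 2 * ln x"
  proof (rule DERIV_nonneg_imp_nondecreasing[OF assms])
    fix y :: real assume y: "1 \<le> y" "y \<le> x"
    have "((\<lambda>x. x - 1 / x - 2 * ln x) has_real_derivative (1 + 1 / y\<^sup>2 - 2 * (1 / y))) (at y)"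
      using y by (auto intro!: derivative_eq_intros simp: power2_eq_square)
    moreover have "0 \<le> (1 - 1 / y)\<^sup>2" by simp
    then have "0 \<le> 1 + 1 / y\<^sup>2 - 2 * (1 / y)" by (simp add: power2_diff power_divide)
    ultimately show "\<exists>z. ((\<lambda>x. x - 1 / x - 2 * ln x) has_real_derivative z) (at y) \<and> 0 \<le> z" by blast
  qed
  then show ?thesis by simp
qed

lemma two_le_ln_diff:
  fixes x :: real
  assumes "0 \<le> x" "x < 1"
  shows "2 * x \<le> ln (1 + x) - ln (1 - x)"
proof -
  have "ln (1 + 0) - ln (1 - 0) - 2 * 0 \<le> ln (1 + x) - ln (1 - x) - 2 * x"
  proof (rule DERIV_nonneg_imp_nondecreasing[OF assms(1)])
    fix y :: real assume y: "0 \<le> y" "y \<le> x"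
    have "((\<lambda>x. ln (1 + x) - ln (1 - x) - 2 * x) has_real_derivative (1 / (1 + y) + 1 / (1 - y) - 2)) (at y)"
    proof -
      have "y * y < 1 * 1" using y assms by (intro mult_strict_mono) auto
      then have "1 - y * y \<noteq> 0" by simp
      then show ?thesis using y assms by (auto intro!: derivative_eq_intros simp: field_simps)
    qed
    moreover have "0 \<le> 1 / (1 + y) + 1 / (1 - y) - 2"
    proof -
      have "1 / (1 + y) + 1 / (1 - y) = 2 / ((1 + y) * (1 - y))"
        using y assms by (subst add_frac_eq) auto
      moreover have "(1 + y) * (1 - y) = 1 - y * y" by (simp add: algebra_simps)
      moreover have "y * y < 1 * 1" using y assms by (intro mult_strict_mono) auto
      ultimately show ?thesis by (simp add: le_divide_eq)
    qed
    ultimately show "\<exists>z. ((\<lambda>x. ln (1 + x) - ln (1 - x) - 2 * x) has_real_derivative z) (at y) \<and> 0 \<le> z" by blast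
  qed
  then show ?thesis by simp
qed

lemma minus_ln_strict:
  fixes a b :: real
  assumes "0 < a" "a < b" "b \<le> 1"
  shows "b - ln b < a - ln a"
proof -
  have r: "0 < a / b" "a / b \<noteq> 1" using assms by auto
  have "ln (a / b) < a / b - 1"
    using ln_le_minus_one[OF r(1)] ln_eq_minus_one[OF r(1)] r(2) by linarith
  then have "ln a - ln b < (a - b) / b" using assms by (simp add: ln_div field_simps)
  also have "(a - b) / b \<le> a - b" using assms by (simp add: divide_simps) (simp add: mult_left_le_one_le algebra_simps mult_le_cancel_left2)?
  finally show ?thesis by simp
qed

text \<open>The defining equation says that x - ln x takes the same value at \<open>ls\<close> and
  at \<open>lam\<close>. This function is strictly decreasing on (0, 1], so evaluating it at 1 / lam
  and at 1 - e locates \<open>ls\<close>.\<close>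

lemma conjugate_bounds:
  fixes e lam ls :: real
  assumes e: "0 < e" "e < 1" and lam: "lam = 1 + e" and ls: "ls < 1" "ls * exp (- ls) = lam * exp (- lam)"
  shows "0 < ls" "ls - ln ls = lam - ln lam" "ls \<le> 1 / lam" "1 - e \<le> ls"
proof -
  have "0 < ls * exp (- ls)" unfolding ls(2) using lam e by simp
  then show pos: "0 < ls" by (simp add: zero_less_mult_iff)
  have "ln (ls * exp (- ls)) = ln (lam * exp (- lam))" using ls by simp
  then show eq: "ls - ln ls = lam - ln lam" using pos lam e by (simp add: ln_mult)
  show "ls \<le> 1 / lam"
  proof (rule ccontr)
    assume "\<not> ?thesis"
    then have "ls - ln ls < 1 / lam - ln (1 / lam)"
      using ls lam e by (intro minus_ln_strict) auto
    also have "1 / lam - ln (1 / lam) = 1 / lam + ln lam" using lam e by (simp add: ln_div)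
    finally show False using eq two_ln_le[of lam] lam e by simp
  qed
  show "1 - e \<le> ls"
  proof (rule ccontr)
    assume "\<not> ?thesis"
    then have "(1 - e) - ln (1 - e) < ls - ln ls" using pos e by (intro minus_ln_strict) auto
    then show False using eq two_le_ln_diff[of e] lam e by simp
  qed
qed

text \<open>Kolmogorov's estimate for a nearly critical process: for k of order 1 / \<epsilon> the
  power of l is bounded, and survival to generation k has probability of order at most
  \<epsilon>.\<close>

lemma orb_recip_lower:
  fixes l :: real
  assumes "1 \<le> l"
  shows "0 < orb l k 1 \<and> k / 2 / l ^ k \<le> 1 / orb l k 1"
proof (induction k)
  case 0
  then show ?case by simp
next
  case (Suc k)
  let ?y = "orb l k 1"
  have y: "0 < ?y" using Suc by simp
  have ly: "0 < l * ?y" using y assms by simp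
  have eq: "orb l (Suc k) 1 = 1 - exp (- (l * ?y))" by (simp add: orb_Suc)
  have le: "orb l (Suc k) 1 \<le> l * ?y / (1 + l * ?y / 2)"
    unfolding eq using ly by (intro one_minus_exp_upper) auto
  have pos: "0 < orb l (Suc k) 1" unfolding eq using ly by simp
  have "0 < 1 + l * ?y / 2" using ly by linarith
  then have "1 / (l * ?y / (1 + l * ?y / 2)) \<le> 1 / orb l (Suc k) 1"
    using pos ly by (intro divide_left_mono[OF le]) auto
  moreover have "1 / (l * ?y / (1 + l * ?y / 2)) = (1 / ?y) / l + 1 / 2"
    using y assms by (simp add: field_simps)
  moreover have "real (Suc k) / 2 / l ^ Suc k \<le> (1 / ?y) / l + 1 / 2"
  proof -
    define L where "L = l ^ Suc k"
    have a: "1 / L \<le> 1" unfolding L_def using assms by (simp add: one_le_power del: power_Suc)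
    have b: "k / 2 / L \<le> (1 / ?y) / l"
    proof -
      have "k / 2 / l ^ k / l \<le> 1 / ?y / l" using Suc assms by (intro divide_right_mono) auto
      then show ?thesis by (simp add: L_def mult.commute)
    qed
    have "real (Suc k) / 2 / L = k / 2 / L + (1 / L) / 2"
      by (simp add: add_divide_distrib)
    also have "\<dots> \<le> (1 / ?y) / l + 1 / 2" by (rule add_mono[OF b]) (use a in simp)
    finally show ?thesis unfolding L_def .
  qed
  ultimately show ?case using pos by simp
qed

section \<open>Constants and orbits of the survival recursion\<close>

text \<open>In the constants below, \<open>s0\<close> is the size of a large level, \<open>a0\<close> the typical distance of the first large level,
  \<open>h\<close> the unit of length, \<open>be\<close> a bound for the number of explored vertices that can be neglected,
  \<open>ys\<close> the survival probability and \<open>nu\<close> the rate of decay of the process conditioned to die.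
  \<open>l1\<close> is a slightly smaller mean, with survival probability \<open>y1\<close>, whose process bounds the exploration from below while
  at least \<open>Nlow\<close> vertices are unexplored; \<open>kap\<close> is the price of that comparison per generation.\<close>

locale weakly_supercritical =
  fixes n :: nat and e lam ls :: real
  assumes e0: "0 < e" and e1: "e < 1 / 10" and lam: "lam = 1 + e"
    and ls1: "ls < 1" and lseq: "ls * exp (- ls) = lam * exp (- lam)"
    and ell_ge: "100 \<le> ln (e ^ 3 * real n)"
    and big: "10 ^ 5 * (ln (e ^ 3 * real n))\<^sup>2 \<le> sqrt (e ^ 3 * real n)"
begin

definition Lam :: real where "Lam = e ^ 3 * real n"
definition ell :: real where "ell = ln Lam"
definition sL :: real where "sL = sqrt Lam"
definition p :: real where "p = lam / real n"
definition mu :: real where "mu = ln lam"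
definition nu :: real where "nu = - ln ls"
definition s0 :: real where "s0 = sqrt (e * real n)"
definition a0 :: real where "a0 = ell / (2 * mu)"
definition h :: nat where "h = nat \<lceil>1 / e\<rceil>"
definition be :: real where "be = e * real n / (1000 * ell)"
definition ys :: real where "ys = 1 - ls / lam"
text \<open>The survival probability is perturbed first and the mean \<open>l1\<close> is read off
  from it, so that \<open>y1\<close> is an exact fixed point and no equation has to be solved. The
  relative change 1 / (10 ell) moves the mean by order e / ell.\<close>

definition y1 :: real where "y1 = ys * (1 - 1 / (10 * ell))"
definition l1 :: real where "l1 = - ln (1 - y1) / y1"
definition kap :: real where "kap = lam / l1"
definition Nlow :: real where "Nlow = real n - 10 * be"
definition lp :: real where "lp = real n * - ln (1 - p)"

lemma lamb: "1 < lam" "lam < 11 / 10" "0 < lam" "lam \<noteq> 0" "1 \<le> lam" "lam \<le> 2"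
  using lam e0 e1 by auto

lemma ell100: "100 \<le> ell" using ell_ge by (simp add: ell_def Lam_def)

lemma sL_ge: "10 ^ 5 * ell\<^sup>2 \<le> sL" using big by (simp add: ell_def Lam_def sL_def)

lemma sL_ge': "10 ^ 7 * ell \<le> sL" "10 ^ 9 \<le> sL"
proof -
  have "100 * ell \<le> ell * ell" using ell100 by (intro mult_right_mono) auto
  then have "10 ^ 5 * (100 * ell) \<le> 10 ^ 5 * ell\<^sup>2" by (simp add: power2_eq_square)
  then show "10 ^ 7 * ell \<le> sL" using sL_ge by simp
  then show "10 ^ 9 \<le> sL" using ell100 by simp
qed

lemma n_pos: "0 < real n"
proof (rule ccontr)
  assume "\<not> ?thesis"
  then have n0: "real n \<le> 0" by linarith
  have "Lam \<le> 0" unfolding Lam_def using e0 n0 by (intro mult_nonneg_nonpos) auto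
  moreover have "0 \<le> Lam" unfolding Lam_def using e0 by simp
  ultimately have "Lam = 0" by linarith
  then have "ell = 0" unfolding ell_def by simp
  then show False using ell100 by linarith
qed

lemma Lam_pos: "0 < Lam" using n_pos e0 by (simp add: Lam_def)

lemma sL_sq: "sL * sL = Lam" "sL\<^sup>2 = Lam" using Lam_pos by (simp_all add: sL_def)

lemma sL_pos: "0 < sL" using Lam_pos by (simp add: sL_def)

lemma exp_ell: "exp ell = Lam" using Lam_pos by (simp add: ell_def)

lemma sL_exp: "sL = exp (ell / 2)"
proof -
  have "exp (ell / 2) * exp (ell / 2) = Lam" unfolding exp_add[symmetric] by (simp add: exp_ell)
  then have "exp (ell / 2) = sqrt Lam" by (metis abs_of_nonneg exp_ge_zero real_sqrt_abs2)
  then show ?thesis by (simp add: sL_def)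
qed

lemma s0_sq: "s0 * s0 = e * n" using n_pos e0 by (simp add: s0_def)

lemma s0_pos: "0 < s0" using n_pos e0 by (simp add: s0_def)

lemma e_s0: "e * s0 = sL"
proof -
  have "(e * s0) * (e * s0) = e * e * (s0 * s0)" by simp
  also have "\<dots> = Lam" unfolding s0_sq by (simp add: Lam_def power3_eq_cube)
  finally have "sqrt Lam = e * s0" using e0 s0_pos by (metis abs_of_pos mult_pos_pos real_sqrt_abs2)
  then show ?thesis by (simp add: sL_def)
qed

lemma s0_eq: "s0 = sL / e" using e_s0 e0 by (simp add: field_simps)

lemma s0_sL: "s0 * sL = Lam / e" unfolding s0_eq using sL_sq by simp

lemma n_eq: "real n = Lam / e ^ 3" using e0 by (simp add: Lam_def)

lemma s0_ge: "10 ^ 10 \<le> s0"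
proof -
  have "10 * sL \<le> sL / e" using e0 e1 sL_pos by (simp add: field_simps)
  then show ?thesis using sL_ge'(2) unfolding s0_eq by simp
qed

lemma s0_div_n: "s0 / n = e\<^sup>2 / sL"
proof -
  have "s0 * sL = e\<^sup>2 * n" unfolding s0_sL n_eq using e0 by (simp add: power2_eq_square power3_eq_cube)
  then show ?thesis using n_pos sL_pos by (simp add: field_simps)
qed

lemma s0_div_n_le: "s0 / n \<le> e / (10 ^ 7 * ell)"
proof -
  have "e\<^sup>2 / sL \<le> e / sL" using e0 e1 sL_pos by (intro divide_right_mono) (auto simp: power2_eq_square)
  also have "\<dots> \<le> e / (10 ^ 7 * ell)" using sL_ge'(1) ell100 e0 by (intro divide_left_mono) (auto intro!: mult_pos_pos sL_pos)
  finally show ?thesis unfolding s0_div_n .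
qed

lemma inv_n_le: "1 / n \<le> e / (10 ^ 7 * ell)" "1 / n \<le> e / 10 ^ 9"
proof -
  have 1: "1 / n \<le> s0 / n" using s0_ge n_pos by (intro divide_right_mono) auto
  then show "1 / n \<le> e / (10 ^ 7 * ell)" using s0_div_n_le by simp
  also have "\<dots> \<le> e / (10 ^ 9)" using ell100 e0 by (intro divide_left_mono) auto
  finally show "1 / n \<le> e / 10 ^ 9" .
qed

lemma p_n: "p * n = lam" using n_pos by (simp add: p_def)

lemma p_le: "p \<le> e / 10 ^ 8"
proof -
  have "p = lam * (1 / n)" by (simp add: p_def)
  also have "\<dots> \<le> 2 * (e / 10 ^ 9)" using inv_n_le(2) e0 lamb by (intro mult_mono) auto
  also have "\<dots> \<le> e / 10 ^ 8" using e0 by simp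
  finally show ?thesis .
qed

lemma p0: "0 < p" using n_pos lamb by (simp add: p_def)
lemma p1: "p < 1" "p \<le> 1" "0 \<le> p" using p_le p0 e1 by auto

lemma h_bounds: "1 / e \<le> h" "h \<le> 1 / e + 1" "1 \<le> e * h" "e * h \<le> 11 / 10" "1 \<le> h"
proof -
  have c: "real h = of_int \<lceil>1 / e\<rceil>" using e0 by (simp add: h_def)
  show 1: "1 / e \<le> h" unfolding c by simp
  show 2: "h \<le> 1 / e + 1" unfolding c by linarith
  show "1 \<le> e * h" using 1 e0 by (simp add: field_simps)
  have "e * h \<le> e * (1 / e + 1)" using 2 e0 by (intro mult_left_mono) auto
  also have "\<dots> = 1 + e" using e0 by (simp add: field_simps)
  finally show "e * h \<le> 11 / 10" using e1 by simp
  have "0 < real h" using 1 e0 by (smt (verit) divide_pos_pos)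
  then show "1 \<le> h" by simp
qed

lemma ls_facts: "0 < ls" "ls \<le> 1 / lam" "1 - e \<le> ls" "9 / 10 \<le> ls"
proof -
  show "0 < ls" "ls \<le> 1 / lam" "1 - e \<le> ls"
    using conjugate_bounds[OF e0 _ lam ls1 lseq] e1 by auto
  then show "9 / 10 \<le> ls" using e1 by simp
qed

lemma mu_bounds: "9 / 10 * e \<le> mu" "mu \<le> e" "0 < mu"
proof -
  have "e - e\<^sup>2 \<le> ln (1 + e)" using e0 e1 by (intro ln_one_plus_pos_lower_bound) auto
  then have "e - e\<^sup>2 \<le> mu" unfolding mu_def by (simp only: lam)
  moreover have "e\<^sup>2 \<le> 1 / 10 * e" unfolding power2_eq_square using e0 e1 by (intro mult_right_mono) auto
  ultimately show 1: "9 / 10 * e \<le> mu" by simp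
  then show "0 < mu" using e0 by simp
  have "ln (1 + e) \<le> e" using ln_add_one_self_le_self[of e] e0 by simp
  then show "mu \<le> e" unfolding mu_def by (simp only: lam)
qed

lemma nu_bounds: "mu \<le> nu" "9 / 10 * e \<le> nu" "nu \<le> 6 / 5 * e" "0 < nu"
proof -
  have "ln ls \<le> ln (1 / lam)" using ls_facts lamb by (subst ln_le_cancel_iff) auto
  then show 1: "mu \<le> nu" using lamb by (simp add: mu_def nu_def ln_div)
  then show "9 / 10 * e \<le> nu" "0 < nu" using mu_bounds by auto
  have "- e - 2 * e\<^sup>2 \<le> ln (1 - e)" using e0 e1 by (intro ln_one_minus_pos_lower_bound) auto
  also have "\<dots> \<le> ln ls" using ls_facts e1 by (subst ln_le_cancel_iff) auto
  finally have "nu \<le> e + 2 * e\<^sup>2" by (simp add: nu_def)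
  moreover have "e\<^sup>2 \<le> 1 / 10 * e" unfolding power2_eq_square using e0 e1 by (intro mult_right_mono) auto
  ultimately show "nu \<le> 6 / 5 * e" by simp
qed

lemma exp_mu: "exp mu = lam" using lamb by (simp add: mu_def)
lemma exp_nu: "exp (- nu) = ls" using ls_facts by (simp add: nu_def)

lemma lam_pow: "lam ^ k = exp (mu * k)" using exp_of_nat_mult[of k mu] exp_mu by (simp add: mult.commute)
lemma ls_pow: "ls ^ k = exp (- nu * k)" using exp_of_nat_mult[of k "- nu"] exp_nu by (simp add: mult.commute)

lemma nu_h: "nu * h \<le> 33 / 25" "9 / 10 \<le> nu * h" "mu * h \<le> 11 / 10" "9 / 10 \<le> mu * h"
proof -
  have "nu * h \<le> (6 / 5 * e) * h" using nu_bounds by (intro mult_right_mono) auto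
  also have "\<dots> = 6 / 5 * (e * h)" by simp
  also have "\<dots> \<le> 6 / 5 * (11 / 10)" using h_bounds by (intro mult_left_mono) auto
  finally show "nu * h \<le> 33 / 25" by simp
  have "mu * h \<le> e * h" using mu_bounds by (intro mult_right_mono) auto
  then show "mu * h \<le> 11 / 10" using h_bounds by linarith
  have "9 / 10 * 1 \<le> 9 / 10 * (e * h)" using h_bounds by (intro mult_left_mono) auto
  also have "\<dots> = (9 / 10 * e) * h" by simp
  also have "\<dots> \<le> mu * h" using mu_bounds by (intro mult_right_mono) auto
  finally show 1: "9 / 10 \<le> mu * h" by simp
  have "mu * h \<le> nu * h" using nu_bounds by (intro mult_right_mono) auto
  then show "9 / 10 \<le> nu * h" using 1 by simp
qed

lemma a0_bounds: "0 < a0" "a0 * e \<le> 5 / 9 * ell" "mu * a0 = ell / 2" "ell / 2 \<le> nu * a0" "nu * a0 \<le> 2 / 3 * ell"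
proof -
  show 0: "0 < a0" using ell100 mu_bounds by (simp add: a0_def)
  show 1: "mu * a0 = ell / 2" using mu_bounds by (simp add: a0_def)
  have "9 / 10 * e * a0 \<le> mu * a0" using mu_bounds 0 by (intro mult_right_mono) auto
  then show 2: "a0 * e \<le> 5 / 9 * ell" using 1 by (simp add: algebra_simps)
  have "mu * a0 \<le> nu * a0" using nu_bounds 0 by (intro mult_right_mono) auto
  then show "ell / 2 \<le> nu * a0" using 1 by simp
  have "nu * a0 \<le> (6 / 5 * e) * a0" using nu_bounds 0 by (intro mult_right_mono) auto
  also have "\<dots> = 6 / 5 * (a0 * e)" by simp
  also have "\<dots> \<le> 6 / 5 * (5 / 9 * ell)" using 2 by (intro mult_left_mono) auto
  finally show "nu * a0 \<le> 2 / 3 * ell" by simp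
qed

text \<open>The last equation is the fixed point equation ys = 1 - exp (- lam ys). The one before it
  is duality: outside the giant component the mean offspring is \<open>ls\<close>.\<close>

lemma ys_bounds: "e \<le> ys" "ys \<le> 2 * e" "lam * (1 - ys) = ls" "lam * ys = - ln (1 - ys)"
proof -
  have l0: "0 < lam" by (rule lamb)
  have "ls / lam \<le> 1 / lam / lam" using ls_facts l0 by (intro divide_right_mono) auto
  moreover have "1 / lam / lam \<le> 1 - e"
  proof -
    have "(1 - e) * (lam * lam) = 1 + e - e * e - e * e * e" by (simp add: lam algebra_simps)
    moreover have "e * e \<le> e * (1 / 10)" using e0 e1 by (intro mult_left_mono) auto
    moreover have "e * e * e \<le> e * e * (1 / 10)" using e0 e1 by (intro mult_left_mono) auto
    ultimately have "1 \<le> (1 - e) * (lam * lam)" using e0 by linarith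
    then show ?thesis using l0 by (simp add: field_simps)
  qed
  ultimately show "e \<le> ys" by (simp add: ys_def)
  have "1 - 2 * e \<le> ls / lam"
  proof -
    have "(1 - 2 * e) * lam = 1 - e - 2 * (e * e)" by (simp add: lam algebra_simps)
    then have "(1 - 2 * e) * lam \<le> ls" using ls_facts(3) e0 mult_pos_pos[OF e0 e0] by linarith
    then show ?thesis using l0 by (simp add: field_simps)
  qed
  then show "ys \<le> 2 * e" by (simp add: ys_def)
  show "lam * (1 - ys) = ls" using l0 by (simp add: ys_def)
  have "- ln (1 - ys) = ln lam - ln ls" using ls_facts l0 by (simp add: ys_def ln_div)
  also have "\<dots> = lam - ls" using conjugate_bounds(2)[OF e0 _ lam ls1 lseq] e1 by simp
  also have "\<dots> = lam * ys" using l0 by (simp add: ys_def field_simps)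
  finally show "lam * ys = - ln (1 - ys)" by simp
qed

lemma y1_bounds: "9 / 10 * e \<le> y1" "y1 \<le> ys" "y1 \<le> 2 * e" "0 < y1" "y1 < 1" "ys - y1 = ys / (10 * ell)"
proof -
  have f: "99 / 100 \<le> 1 - 1 / (10 * ell)" "1 - 1 / (10 * ell) \<le> 1" using ell100 by (auto simp: field_simps)
  have "e * (99 / 100) \<le> y1" unfolding y1_def using ys_bounds e0 f by (intro mult_mono) auto
  then show "9 / 10 * e \<le> y1" "0 < y1" using e0 by auto
  show "y1 \<le> ys" unfolding y1_def using f ys_bounds e0 by (intro mult_left_le) auto
  then show "y1 \<le> 2 * e" "y1 < 1" using ys_bounds e1 by auto
  show "ys - y1 = ys / (10 * ell)" by (simp add: y1_def algebra_simps)
qed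

text \<open>Both directions matter: the gap to \<open>lam\<close> is large enough to absorb the loss
  of vertices in \<open>tube_step\<close>, and small enough for \<open>kap_pow\<close> to lose only
  a constant.\<close>

lemma l1_bounds: "e / (20 * ell) \<le> lam - l1" "lam - l1 \<le> e / (5 * ell)" "1 + 9 / 10 * e \<le> l1" "l1 \<le> lam"
proof -
  have yspos: "ys > 0" "ys \<le> 1 / 5" using ys_bounds e0 e1 by linarith+
  have lr: "lam = - (ln (1 - ys) / ys)"
  proof -
    have "lam = lam * ys / ys" using yspos by simp
    also have "\<dots> = - (ln (1 - ys) / ys)" unfolding ys_bounds(4) by simp
    finally show ?thesis .
  qed
  have lr1: "l1 = - (ln (1 - y1) / y1)" unfolding l1_def by simp
  have "(ys - y1) / 2 \<le> - (ln (1 - ys) / ys) + ln (1 - y1) / y1"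
    "- (ln (1 - ys) / ys) + ln (1 - y1) / y1 \<le> ys - y1"
    using log_ratio_bounds[OF y1_bounds(4) y1_bounds(2) yspos(2)] by simp_all
  then have "(ys - y1) / 2 \<le> lam - l1" "lam - l1 \<le> ys - y1"
    using lr lr1 by linarith+
  then have a: "ys / (10 * ell) / 2 \<le> lam - l1" "lam - l1 \<le> ys / (10 * ell)" unfolding y1_bounds(6) by auto
  have "e / (20 * ell) \<le> ys / (20 * ell)" using ys_bounds ell100 by (intro divide_right_mono) auto
  then show 1: "e / (20 * ell) \<le> lam - l1" using a by simp
  have "ys / (10 * ell) \<le> 2 * e / (10 * ell)" using ys_bounds ell100 by (intro divide_right_mono) auto
  then show 2: "lam - l1 \<le> e / (5 * ell)" using a by simp
  have "e / (5 * ell) \<le> e / 500" using ell100 e0 by (intro divide_left_mono) auto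
  then show "1 + 9 / 10 * e \<le> l1" using 2 lam e0 by linarith
  have "0 \<le> e / (20 * ell)" using e0 ell100 by simp
  then show "l1 \<le> lam" using 1 by simp
qed

lemma l1_pos: "0 < l1" "1 \<le> l1" using l1_bounds e0 by auto

lemma l1_fix: "exp (- (l1 * y1)) = 1 - y1" using y1_bounds by (simp add: l1_def)

text \<open>5 ell / e is the time horizon of a single exploration; all comparisons of means are
  calibrated to it.\<close>

lemma kap_pow:
  assumes "real k * e \<le> 5 * ell"
  shows "1 \<le> kap" "kap ^ k \<le> exp 1" "lam ^ k \<le> exp 1 * l1 ^ k"
proof -
  show 1: "1 \<le> kap" using l1_bounds l1_pos by (simp add: kap_def)
  have "kap = 1 + (lam - l1) / l1" using l1_pos by (simp add: kap_def field_simps)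
  also have "(lam - l1) / l1 \<le> e / (5 * ell) / 1"
    using l1_bounds l1_pos e0 ell100 by (intro frac_le) auto
  finally have "kap \<le> 1 + e / (5 * ell)" by simp
  also have "\<dots> \<le> exp (e / (5 * ell))" by (rule exp_ge_add_one_self)
  finally have "kap ^ k \<le> exp (e / (5 * ell)) ^ k" using 1 by (intro power_mono) auto
  also have "\<dots> = exp (real k * e / (5 * ell))" by (simp add: exp_of_nat_mult[symmetric])
  also have "\<dots> \<le> exp 1" using assms ell100 by simp
  finally show "kap ^ k \<le> exp 1" .
  then show "lam ^ k \<le> exp 1 * l1 ^ k" using l1_pos by (simp add: kap_def power_divide field_simps)
qed

text \<open>Derivative at its fixed point \<open>y1\<close> of the survival recursion with mean
  \<open>l1\<close>, hence its rate of convergence.\<close>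

definition L1 :: real where "L1 = l1 * (1 - y1)"

lemma L1_pos: "0 < L1" using l1_pos y1_bounds by (simp add: L1_def)

lemma L1_pow:
  assumes "real k * e \<le> 5 * ell"
  shows "L1 ^ k \<le> exp 5 * exp (- nu * k)"
proof -
  have "L1 \<le> lam * (1 - y1)" unfolding L1_def using l1_bounds y1_bounds by (intro mult_right_mono) auto
  also have "\<dots> = ls + lam * (ys - y1)" using ys_bounds(3) by (simp add: algebra_simps)
  also have "lam * (ys - y1) \<le> 11 / 10 * (2 * e / (10 * ell))"
    unfolding y1_bounds(6) using lamb e0 ys_bounds ell100 by (intro mult_mono divide_right_mono) auto
  also have "11 / 10 * (2 * e / (10 * ell)) \<le> ls * (e / ell)"
  proof -
    have "11 / 10 * (2 * e / (10 * ell)) = 22 / 100 * (e / ell)" by simp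
    also have "\<dots> \<le> ls * (e / ell)" using ls_facts e0 ell100 by (intro mult_right_mono) auto
    finally show ?thesis .
  qed
  finally have "L1 \<le> ls * (1 + e / ell)" by (simp add: algebra_simps)
  also have "\<dots> \<le> ls * exp (e / ell)" using ls_facts by (intro mult_left_mono exp_ge_add_one_self) auto
  finally have "L1 ^ k \<le> (ls * exp (e / ell)) ^ k" using L1_pos by (intro power_mono) auto
  also have "\<dots> = exp (- nu * k) * exp (real k * e / ell)"
    unfolding power_mult_distrib ls_pow by (simp add: exp_of_nat_mult[symmetric])
  also have "\<dots> \<le> exp (- nu * k) * exp 5" using assms ell100 by (simp add: field_simps)
  finally show ?thesis by (simp add: mult.commute)
qed

lemma exp_le_4: "exp (33 / 25) \<le> (4::real)"
proof -
  have "(exp 1 :: real) ^ 4 \<le> (11 / 4) ^ 4" using e_less_272 by (intro power_mono) auto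
  then have "exp (4 / 3 :: real) ^ 3 \<le> (11 / 4) ^ 4" by (simp add: exp_of_nat_mult[symmetric])
  also have "(11 / 4) ^ 4 \<le> (4::real) ^ 3" by (simp add: power4_eq_xxxx power3_eq_cube)
  finally have le: "exp (4 / 3 :: real) ^ 3 \<le> 4 ^ 3" .
  have "exp (4 / 3 :: real) \<le> 4"
    by (rule power_le_imp_le_base[of _ "Suc (Suc 0)"]) (use le in \<open>simp_all add: numeral_3_eq_3\<close>)
  moreover have "exp (33 / 25 :: real) \<le> exp (4 / 3)" by simp
  ultimately show ?thesis by linarith
qed

lemma orb_h_le:
  assumes "1 \<le> l" "l \<le> 1 + 6 / 5 * e"
  shows "orb l h 1 \<le> 8 * e"
proof -
  have "l \<le> exp (6 / 5 * e)" using assms exp_ge_add_one_self[of "6 / 5 * e"] by linarith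
  then have "l ^ h \<le> exp (6 / 5 * e) ^ h"
    using assms by (intro power_mono) auto
  also have "\<dots> = exp (6 / 5 * (e * h))" by (simp add: exp_of_nat_mult[symmetric] algebra_simps)
  also have "\<dots> \<le> exp (33 / 25)" using h_bounds by simp
  finally have lh: "l ^ h \<le> 4" using exp_le_4 by linarith
  have "1 / e / 2 / 4 \<le> h / 2 / l ^ h"
    using h_bounds lh assms e0 by (intro frac_le divide_right_mono) auto
  also have "\<dots> \<le> 1 / orb l h 1" using orb_recip_lower[OF assms(1), of h] by simp
  finally have "1 / (8 * e) \<le> 1 / orb l h 1" by simp
  then show ?thesis using orb_recip_lower[OF assms(1), of h] e0 by (simp add: field_simps)
qed

lemma lp_bounds: "1 \<le> lp" "lp \<le> 1 + 6 / 5 * e"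
proof -
  have "p \<le> - ln (1 - p)" using ln_le_minus_one[of "1 - p"] p1 by simp
  then have "n * p \<le> lp" unfolding lp_def by (intro mult_left_mono) auto
  then show "1 \<le> lp" using p_n lamb by (simp add: mult.commute)
  have "- p - 2 * p\<^sup>2 \<le> ln (1 - p)" using p0 p_le e1 by (intro ln_one_minus_pos_lower_bound) auto
  then have "lp \<le> n * (p + 2 * p\<^sup>2)" unfolding lp_def by (intro mult_left_mono) auto
  also have "\<dots> = lam + 2 * lam * p" using p_n by (simp add: power2_eq_square algebra_simps)
  finally have a: "lp \<le> lam + 2 * lam * p" .
  have "2 * lam * p \<le> 4 * (e / 10 ^ 8)" using lamb p_le p0 by (intro mult_mono) auto
  also have "\<dots> \<le> e / 5" using e0 by simp
  finally show "lp \<le> 1 + 6 / 5 * e" using lam e0 a by linarith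
qed

lemma orb_hi0:
  assumes "h \<le> k"
  shows "orb l1 k 1 \<le> 8 * e"
proof -
  have "l1 \<le> 1 + 6 / 5 * e" using l1_bounds(4) lam e0 by linarith
  then have "orb l1 h 1 \<le> 8 * e" using l1_pos by (intro orb_h_le) auto
  then show ?thesis using orb_one_antimono[OF _ assms, of l1] l1_pos by linarith
qed

text \<open>Approach to the fixed point from above. After h steps the orbit is of order e, and from
  there concavity of 1 - exp (- l1 y) bounds the gap by the linearisation at
  \<open>y1\<close>.\<close>

lemma orb_hi:
  assumes "h \<le> k" "real k * e \<le> 5 * ell"
  shows "orb l1 k 1 - y1 \<le> exp 9 * e * exp (- nu * k)"
proof -
  have step: "orb l1 (h + j) 1 - y1 \<le> 8 * e * L1 ^ j" for j
  proof (induction j)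
    case 0
    then show ?case using orb_hi0[of h] y1_bounds by simp
  next
    case (Suc j)
    let ?y = "orb l1 (h + j) 1"
    have "orb l1 (h + Suc j) 1 - y1 = exp (- (l1 * y1)) - exp (- (l1 * ?y))"
      by (simp add: orb_Suc l1_fix)
    also have "\<dots> = (1 - y1) * (1 - exp (- (l1 * (?y - y1))))"
      unfolding l1_fix[symmetric] by (simp add: right_diff_distrib exp_add[symmetric])
    also have "\<dots> \<le> (1 - y1) * (l1 * (?y - y1))"
      using y1_bounds exp_ge_add_one_self[of "- (l1 * (?y - y1))"] by (intro mult_left_mono) auto
    also have "\<dots> = L1 * (?y - y1)" by (simp add: L1_def)
    also have "\<dots> \<le> L1 * (8 * e * L1 ^ j)" using Suc L1_pos by (intro mult_left_mono) auto
    finally show ?case by (simp add: ac_simps)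
  qed
  define j where "j = k - h"
  have k: "k = h + j" using assms by (simp add: j_def)
  have je: "real j * e \<le> 5 * ell" using assms e0 by (smt (verit) k mult_right_mono of_nat_0_le_iff of_nat_add)
  have "orb l1 k 1 - y1 \<le> 8 * e * (exp 5 * exp (- nu * j))"
    using step[of j] mult_left_mono[OF L1_pow[OF je], of "8 * e"] e0 unfolding k by linarith
  also have "exp (- nu * j) = exp (nu * h) * exp (- nu * k)" unfolding k by (simp add: exp_add[symmetric] algebra_simps)
  also have "8 * e * (exp 5 * (exp (nu * h) * exp (- nu * k))) \<le> 8 * e * (exp 5 * (4 * exp (- nu * k)))"
  proof -
    have "exp (nu * h) \<le> exp (33 / 25)" using nu_h by simp
    then have "exp (nu * h) \<le> 4" using exp_le_4 by linarith
    then show ?thesis using e0 by (intro mult_left_mono mult_right_mono) auto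
  qed
  also have "\<dots> = 32 * exp 5 * e * exp (- nu * k)" by simp
  also have "32 * exp 5 * e * exp (- nu * k) \<le> exp 9 * e * exp (- nu * k)"
  proof -
    have "(1 + 1 + 1\<^sup>2 / 2 :: real) \<le> exp 1" by (intro exp_lower_Taylor_quadratic) simp
    then have "(5 / 2 :: real) \<le> exp 1" by simp
    then have "(5 / 2 :: real) ^ 4 \<le> exp 1 ^ 4" by (intro power_mono) auto
    moreover have "exp (1::real) ^ 4 = exp 4" by (simp add: exp_of_nat_mult[symmetric])
    moreover have "32 \<le> (5 / 2 :: real) ^ 4" by (simp add: power4_eq_xxxx)
    ultimately have "32 \<le> exp (4::real)" by linarith
    then have "32 * exp 5 \<le> exp 4 * exp (5::real)" by (intro mult_right_mono) auto
    then have "32 * exp 5 \<le> exp (9::real)" by (simp add: exp_add[symmetric])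
    then show ?thesis using e0 by (intro mult_right_mono) auto
  qed
  finally show ?thesis .
qed

lemma orb_s0_range: "0 < orb l1 k (1 / s0) \<and> orb l1 k (1 / s0) \<le> y1"
proof (induction k)
  case 0
  have "1 / s0 = e / sL" using e_s0 e0 s0_pos by (simp add: s0_eq)
  also have "\<dots> \<le> e / 10 ^ 9" using sL_ge'(2) e0 by (intro divide_left_mono) auto
  also have "\<dots> \<le> y1" using y1_bounds e0 by simp
  finally show ?case using s0_pos by simp
next
  case (Suc k)
  let ?y = "orb l1 k (1 / s0)"
  have "0 < l1 * ?y" using Suc l1_pos by simp
  then have "0 < orb l1 (Suc k) (1 / s0)" by (simp add: orb_Suc)
  moreover have "exp (- (l1 * y1)) \<le> exp (- (l1 * ?y))" using Suc l1_pos by simp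
  then have "orb l1 (Suc k) (1 / s0) \<le> y1" unfolding l1_fix by (simp add: orb_Suc)
  ultimately show ?case by simp
qed

text \<open>Approach from below, started at 1 / s0. In the variable y1 / y - 1 the recursion
  contracts by 1 / l1 from the very start, also while y is far from \<open>y1\<close> and
  linearisation at \<open>y1\<close> is useless.\<close>

lemma orb_lo_early: "y1 - orb l1 k (1 / s0) \<le> 4 * e * sL / l1 ^ k"
proof -
  have r: "y1 / orb l1 k (1 / s0) - 1 \<le> 2 * sL / l1 ^ k" for k
  proof (induction k)
    case 0
    have "y1 * s0 \<le> 2 * e * s0" using y1_bounds s0_pos by (intro mult_right_mono) auto
    also have "\<dots> = 2 * sL" using e_s0 by simp
    finally show ?case by simp
  next
    case (Suc k)
    let ?y = "orb l1 k (1 / s0)" and ?y' = "orb l1 (Suc k) (1 / s0)"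
    have y: "0 < ?y" "?y \<le> y1" using orb_s0_range[of k] by auto
    have "1 / (1 - exp (- (l1 * ?y))) - 1 / (l1 * ?y) \<le> 1 / (1 - exp (- (l1 * y1))) - 1 / (l1 * y1)"
      using y l1_pos by (intro recip_gap_mono) auto
    then have "1 / ?y' - 1 / (l1 * ?y) \<le> 1 / y1 - 1 / (l1 * y1)"
      unfolding l1_fix by (simp add: orb_Suc)
    then have "y1 * (1 / ?y' - 1 / (l1 * ?y)) \<le> y1 * (1 / y1 - 1 / (l1 * y1))"
      using y1_bounds by (intro mult_left_mono) auto
    then have "y1 / ?y' - y1 / ?y / l1 \<le> 1 - 1 / l1"
      using y1_bounds(4) by (simp add: right_diff_distrib mult.commute)
    then have "y1 / ?y' - 1 \<le> (y1 / ?y - 1) / l1" by (simp add: diff_divide_distrib)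
    also have "\<dots> \<le> 2 * sL / l1 ^ k / l1" using Suc l1_pos by (intro divide_right_mono) auto
    finally show ?case by (simp add: mult.commute)
  qed
  let ?y = "orb l1 k (1 / s0)"
  have y: "0 < ?y" "?y \<le> y1" using orb_s0_range[of k] by auto
  have "y1 - ?y = ?y * (y1 / ?y - 1)" using y by (simp add: right_diff_distrib)
  also have "\<dots> \<le> (2 * e) * (2 * sL / l1 ^ k)"
    using y y1_bounds r[of k] e0 by (intro mult_mono) auto
  finally show ?thesis by simp
qed

text \<open>The orbit needs about \<open>a0\<close> steps to climb from 1 / s0 to order e. Later
  steps contract the gap d by \<open>L1\<close> up to factors exp (l1 d), whose product stays
  bounded because the gaps are already summable by \<open>orb_lo_early\<close>.\<close>

lemma orb_lo:
  assumes "real k * e \<le> 5 * ell"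
  shows "y1 - orb l1 k (1 / s0) \<le> exp 26 * e * exp (- nu * (real k - a0))"
proof -
  define k0 where "k0 = nat \<lceil>a0\<rceil>"
  have k0: "a0 \<le> k0" "k0 \<le> a0 + 1" using a0_bounds by (auto simp: k0_def)
  define d where "d = (\<lambda>k. y1 - orb l1 k (1 / s0))"
  have dd: "0 \<le> d k" "d k \<le> 2 * e" for k using orb_s0_range[of k] y1_bounds by (auto simp: d_def)
  show ?thesis
  proof (cases "k0 \<le> k")
    case False
    then have "real k < a0" using k0 by (simp add: k0_def)
    then have "1 \<le> exp (- nu * (real k - a0))" using nu_bounds by (simp add: mult_le_0_iff)
    moreover have "2 \<le> exp (26::real)" using exp_ge_add_one_self[of "26::real"] by simp
    ultimately have "2 * 1 \<le> exp 26 * exp (- nu * (real k - a0))" by (intro mult_mono) auto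
    then have "2 * e \<le> exp 26 * exp (- nu * (real k - a0)) * e" using e0 by simp
    then show ?thesis using dd(2)[of k] by (simp add: d_def ac_simps)
  next
    case True
    define j where "j = k - k0"
    have k: "k = k0 + j" using True by (simp add: j_def)
    have ke: "real k0 * e \<le> 5 * ell" "real j * e \<le> 5 * ell"
      using assms e0 unfolding k by (auto simp: algebra_simps) (smt (verit) mult_nonneg_nonneg of_nat_0_le_iff)+
    have "mu * a0 \<le> mu * k0" using k0(1) mu_bounds by (intro mult_left_mono) auto
    then have "sL \<le> lam ^ k0" unfolding sL_exp lam_pow using a0_bounds(3) by simp
    also have "\<dots> \<le> exp 1 * l1 ^ k0" using kap_pow(3)[OF ke(1)] .
    also have "\<dots> \<le> 3 * l1 ^ k0" using exp_le l1_pos by (intro mult_right_mono) auto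
    finally have "sL / l1 ^ k0 \<le> 3" using l1_pos by (simp add: field_simps)
    then have e3: "4 * e * (sL / l1 ^ k0) \<le> 4 * e * 3" using e0 by (intro mult_left_mono) auto
    have early: "d (k0 + i) \<le> 12 * e / l1 ^ i" for i
    proof -
      have "d (k0 + i) \<le> 4 * e * sL / l1 ^ (k0 + i)" using orb_lo_early by (simp add: d_def)
      also have "\<dots> = 4 * e * (sL / l1 ^ k0) / l1 ^ i" by (simp add: power_add)
      also have "\<dots> \<le> 4 * e * 3 / l1 ^ i" using e3 l1_pos by (intro divide_right_mono) auto
      finally show ?thesis by simp
    qed
    have step: "d (k0 + i) \<le> 12 * e * L1 ^ i * exp (\<Sum>m<i. l1 * (12 * e / l1 ^ m))" for i
    proof (induction i)
      case 0
      then show ?case using early[of 0] by simp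
    next
      case (Suc i)
      let ?y = "orb l1 (k0 + i) (1 / s0)"
      have dy: "l1 * y1 = l1 * ?y + l1 * d (k0 + i)" by (simp add: d_def algebra_simps)
      have "d (k0 + Suc i) = exp (- (l1 * ?y)) - exp (- (l1 * y1))"
        unfolding l1_fix by (simp add: d_def orb_Suc)
      also have "\<dots> = (1 - y1) * (exp (l1 * d (k0 + i)) - 1)"
        unfolding l1_fix[symmetric] dy by (simp add: right_diff_distrib exp_add[symmetric])
      also have "\<dots> \<le> (1 - y1) * (l1 * d (k0 + i) * exp (l1 * d (k0 + i)))"
      proof (intro mult_left_mono)
        let ?x = "l1 * d (k0 + i)"
        have "(1 - ?x) * exp ?x \<le> exp (- ?x) * exp ?x"
          using exp_ge_add_one_self[of "- ?x"] by (intro mult_right_mono) auto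
        then show "exp ?x - 1 \<le> ?x * exp ?x" by (simp add: exp_minus algebra_simps)
      qed (use y1_bounds in auto)
      also have "\<dots> = L1 * (d (k0 + i) * exp (l1 * d (k0 + i)))" by (simp add: L1_def)
      also have "\<dots> \<le> L1 * ((12 * e * L1 ^ i * exp (\<Sum>m<i. l1 * (12 * e / l1 ^ m))) * exp (l1 * (12 * e / l1 ^ i)))"
      proof -
        have "l1 * d (k0 + i) \<le> l1 * (12 * e / l1 ^ i)" using early[of i] l1_pos by (intro mult_left_mono) auto
        then show ?thesis using L1_pos e0 Suc dd
          by (intro mult_left_mono mult_mono) auto
      qed
      also have "\<dots> = 12 * e * L1 ^ Suc i * exp (\<Sum>m<Suc i. l1 * (12 * e / l1 ^ m))"
        by (simp add: exp_add)
      finally show ?case .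
    qed
    have l1e: "l1 - 1 > 0" "9 / 10 * e \<le> l1 - 1" using l1_bounds e0 by auto
    have "(\<Sum>m<j. l1 * (12 * e / l1 ^ m)) = 12 * e * l1 * (\<Sum>m<j. (1 / l1) ^ m)"
      by (simp add: sum_distrib_left power_divide algebra_simps)
    also have "(\<Sum>m<j. (1 / l1) ^ m) \<le> l1 / (l1 - 1)"
    proof -
      have "(\<Sum>m<j. (1 / l1) ^ m) \<le> (\<Sum>m. (1 / l1) ^ m)"
        using l1_bounds e0 by (intro sum_le_suminf summable_geometric) auto
      also have "\<dots> = 1 / (1 - 1 / l1)" using l1_bounds e0 by (intro suminf_geometric) auto
      also have "\<dots> = l1 / (l1 - 1)" using l1_pos l1e by (simp add: field_simps)
      finally show ?thesis .
    qed
    also have "l1 / (l1 - 1) \<le> (11 / 10) / (9 / 10 * e)"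
      using l1e l1_bounds lamb e0 by (intro frac_le) auto
    also have "12 * e * l1 * ((11 / 10) / (9 / 10 * e)) = 12 * (11 / 9) * l1" using e0 by simp
    also have "\<dots> \<le> 17" using l1_bounds lamb by simp
    finally have S: "(\<Sum>m<j. l1 * (12 * e / l1 ^ m)) \<le> 17"
      using e0 l1_pos by (simp add: mult_left_mono)
    have "d k \<le> 12 * e * (exp 5 * exp (- nu * j)) * exp 17"
    proof -
      have "d k \<le> 12 * e * L1 ^ j * exp (\<Sum>m<j. l1 * (12 * e / l1 ^ m))" unfolding k by (rule step)
      also have "\<dots> \<le> 12 * e * (exp 5 * exp (- nu * j)) * exp 17"
        using L1_pow[OF ke(2)] S e0 L1_pos by (intro mult_mono) auto
      finally show ?thesis .
    qed
    also have "\<dots> = 12 * exp 22 * e * exp (- nu * j)" by (simp add: exp_add[symmetric])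
    also have "exp (- nu * j) \<le> exp (1 - nu * (real k - a0))"
    proof -
      have "nu * (k0 - a0) \<le> nu * 1" using k0 nu_bounds by (intro mult_left_mono) auto
      then have "nu * k0 \<le> 1 + nu * a0" using nu_bounds e1 by (simp add: algebra_simps)
      then show ?thesis unfolding k by (simp add: algebra_simps)
    qed
    also have "12 * exp 22 * e * exp (1 - nu * (real k - a0)) = 12 * exp 23 * e * exp (- nu * (real k - a0))"
      by (simp add: exp_add[symmetric])
    also have "\<dots> \<le> exp 3 * exp 23 * e * exp (- nu * (real k - a0))"
    proof -
      have "(1 + 1 + 1\<^sup>2 / 2 :: real) \<le> exp 1" by (intro exp_lower_Taylor_quadratic) simp
      then have "(5 / 2 :: real) ^ 3 \<le> exp 1 ^ 3" by (intro power_mono) auto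
      moreover have "exp (1::real) ^ 3 = exp 3" by (simp add: exp_of_nat_mult[symmetric])
      ultimately have "12 \<le> exp (3::real)" by (simp add: power3_eq_cube)
      then show ?thesis using e0 by (intro mult_right_mono) auto
    qed
    also have "\<dots> = exp 26 * e * exp (- nu * (real k - a0))" by (simp add: exp_add[symmetric])
    finally show ?thesis using e0 by (simp add: d_def)
  qed
qed

section \<open>Vertex budgets and drift conditions\<close>

lemma be_pos: "0 < be" using n_pos e0 ell100 by (simp add: be_def)

lemma be_le: "be \<le> e * n / 10 ^ 5"
  unfolding be_def using ell100 e0 n_pos by (intro divide_left_mono) auto

lemma ell_e: "1000 \<le> ell / e" using ell100 e0 e1 by (simp add: field_simps)

text \<open>All levels below \<open>s0\<close> over the whole time horizon together fit into
  \<open>be\<close>. This uses the square of ell in the assumption \<open>big\<close>: one ell for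
  the number of levels, one for the denominator of \<open>be\<close>.\<close>

lemma budget:
  assumes "real k * e \<le> 5 * ell"
  shows "s0 * (k + 2) \<le> be"
proof -
  have k: "real k \<le> 5 * (ell / e)" using assms e0 by (simp add: field_simps)
  have "s0 * (real k + 2) \<le> s0 * (6 * (ell / e))" using k ell_e s0_pos by (intro mult_left_mono) auto
  also have "\<dots> = 6 * ell * (s0 * s0) / (e * s0)" using s0_pos by simp
  also have "\<dots> = 6 * ell * (e * n) / sL" unfolding s0_sq e_s0 ..
  also have "\<dots> \<le> 6 * ell * (e * n) / (10 ^ 5 * ell\<^sup>2)"
    using sL_ge ell100 e0 n_pos sL_pos by (intro divide_left_mono) auto
  also have "\<dots> = 6 / 100 * be" using ell100 by (simp add: be_def power2_eq_square field_simps)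
  also have "\<dots> \<le> be" using be_pos by simp
  finally show ?thesis by (simp add: add.commute)
qed

lemma budget': "s0 + 2 \<le> be"
proof -
  have "s0 + 2 \<le> s0 * 2" using s0_ge by simp
  then show ?thesis using budget[of 0] ell100 by simp
qed

lemma Nlow_ge: "1 \<le> Nlow"
proof -
  have "10 * be \<le> e * n / 10000" using be_le by simp
  also have "\<dots> \<le> n / 100000" using e1 n_pos by simp
  finally have "10 * be \<le> n / 100000" .
  moreover have "1000000000 \<le> e * n" using inv_n_le(2) n_pos by (simp add: field_simps)
  moreover have "e * n \<le> 1 * real n" using e1 by (intro mult_right_mono) auto
  ultimately show ?thesis unfolding Nlow_def by linarith
qed

text \<open>The slack e / (20 ell) in \<open>l1\<close> is spent on the 10 be lost vertices, a share
  e / (100 ell) of n, on the quadratic term of 1 - (1 - p)^x, and on the - 1 in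
  \<open>real N - 1\<close>; the last two are far smaller.\<close>

lemma tube_step:
  fixes N x :: nat
  assumes "Nlow \<le> N" "N \<le> n" "x < s0"
  shows "l1 * x \<le> (1 - (1 - p) ^ x) * (real N - 1) \<and> (1 - (1 - p) ^ x) * N \<le> kap * l1 * x"
proof
  have "(1 - (1 - p) ^ x) * N \<le> (p * x) * n" using q_bounds[OF p1(3,2)] assms p1 by (intro mult_mono) auto
  also have "\<dots> = kap * l1 * x" using p_n l1_pos by (simp add: kap_def mult.commute mult.left_commute)
  finally show "(1 - (1 - p) ^ x) * N \<le> kap * l1 * x" .
  define u where "u = e / ell"
  have u: "0 < u" "u \<le> 1 / 1000" using e0 e1 ell100 ell_e by (auto simp: u_def field_simps)
  have ps: "p * s0 \<le> 2 * (u / 10 ^ 7)"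
  proof -
    have "p * s0 = lam * (s0 / n)" by (simp add: p_def)
    also have "\<dots> \<le> 2 * (e / (10 ^ 7 * ell))" using s0_div_n_le lamb s0_pos by (intro mult_mono) auto
    finally show ?thesis by (simp add: u_def)
  qed
  have N: "n * (1 - u / 100 - u / 10 ^ 7) \<le> real N - 1"
  proof -
    have "n * (u / 10 ^ 7) \<ge> 1" using inv_n_le(1) n_pos by (simp add: u_def field_simps)
    moreover have "n * (u / 100) = 10 * be" using ell100 by (simp add: u_def be_def mult.commute)
    ultimately show ?thesis using assms by (simp add: Nlow_def algebra_simps)
  qed
  have "l1 * x \<le> (lam - u / 20) * x" using l1_bounds(1) by (intro mult_right_mono) (auto simp: u_def)
  also have "\<dots> \<le> (lam * ((1 - u / 10 ^ 7) * (1 - u / 100 - u / 10 ^ 7))) * x"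
  proof (intro mult_right_mono)
    have "1 - u / 50 \<le> (1 - u / 10 ^ 7) * (1 - u / 100 - u / 10 ^ 7)"
      using u by (simp add: algebra_simps)
    then have "lam * (1 - u / 50) \<le> lam * ((1 - u / 10 ^ 7) * (1 - u / 100 - u / 10 ^ 7))"
      using lamb by (intro mult_left_mono) auto
    moreover have "lam * (u / 50) \<le> 2 * (u / 50)" using lamb u by (intro mult_right_mono) auto
    moreover have "lam * (1 - u / 50) = lam - lam * (u / 50)" by (simp add: right_diff_distrib)
    ultimately show "lam - u / 20 \<le> lam * ((1 - u / 10 ^ 7) * (1 - u / 100 - u / 10 ^ 7))"
      using u(1) by linarith
  qed auto
  also have "\<dots> = ((p * n) * ((1 - u / 10 ^ 7) * (1 - u / 100 - u / 10 ^ 7))) * x" by (simp only: p_n)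
  also have "\<dots> = (p * x * (1 - u / 10 ^ 7)) * (n * (1 - u / 100 - u / 10 ^ 7))"
    by (simp only: ac_simps)
  also have "\<dots> \<le> (1 - (1 - p) ^ x) * (real N - 1)"
  proof (intro mult_mono N)
    have "p * x \<le> p * s0" using assms p0 by (intro mult_left_mono) auto
    then have "p * x \<le> 2 * (u / 10 ^ 7)" using ps by linarith
    then have "1 - u / 10 ^ 7 \<le> 1 - p * x / 2" by linarith
    then have "p * x * (1 - u / 10 ^ 7) \<le> p * x * (1 - p * x / 2)" using p0 by (intro mult_left_mono) auto
    also have "\<dots> \<le> 1 - (1 - p) ^ x" using p1 by (intro q_lower_quad) auto
    finally show "p * x * (1 - u / 10 ^ 7) \<le> 1 - (1 - p) ^ x" .
    show "0 \<le> 1 - (1 - p) ^ x" using q_bounds p1 by auto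
    show "0 \<le> n * (1 - u / 100 - u / 10 ^ 7)" using u n_pos by (intro mult_nonneg_nonneg) auto
  qed
  finally show "l1 * x \<le> (1 - (1 - p) ^ x) * (real N - 1)" .
qed

text \<open>Joining two large sets takes only a few blocks of length h, so a constant share of the
  growth rate may be given up: n e / 8 vertices may be used, and growth by 1 + 3 / 4 e
  remains.\<close>

lemma nc_step:
  fixes N x :: nat
  assumes "n * (1 - e / 8) \<le> N" "N + x \<le> n"
  shows "(1 + 3 / 4 * e) * x \<le> (1 - (1 - p) ^ x) * N"
proof -
  have x: "x \<le> n * e / 8" using assms by (simp add: algebra_simps flip: of_nat_add)
  have px: "p * x / 2 \<le> 7 / 100 * e"
  proof -
    have "p * x \<le> p * (n * e / 8)" using x p0 by (intro mult_left_mono) auto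
    also have "\<dots> = (p * n) * e / 8" by simp
    also have "\<dots> = lam * e / 8" unfolding p_n ..
    also have "\<dots> \<le> 11 / 10 * e / 8" using lamb e0 by (intro divide_right_mono mult_right_mono) auto
    finally have "p * x \<le> 11 / 10 * e / 8" .
    then show ?thesis using e0 by linarith
  qed
  have "1 + 3 / 4 * e \<le> lam * ((1 - 7 / 100 * e) * (1 - e / 8))"
  proof -
    have "1 - e / 5 \<le> (1 - 7 / 100 * e) * (1 - e / 8)" using e0 by (simp add: algebra_simps)
    then have "lam * (1 - e / 5) \<le> lam * ((1 - 7 / 100 * e) * (1 - e / 8))" using lamb by (intro mult_left_mono) auto
    moreover have "lam * (1 - e / 5) = 1 + 4 / 5 * e - e * e / 5" unfolding lam by (simp add: field_simps)
    moreover have "e * e \<le> 1 / 10 * e" using e0 e1 by (intro mult_right_mono) auto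
    ultimately show ?thesis using e0 by linarith
  qed
  then have "(1 + 3 / 4 * e) * x \<le> lam * ((1 - 7 / 100 * e) * (1 - e / 8)) * x"
    by (intro mult_right_mono) auto
  also have "\<dots> = (p * n) * ((1 - 7 / 100 * e) * (1 - e / 8)) * x" by (simp only: p_n)
  also have "\<dots> = (p * x * (1 - 7 / 100 * e)) * (n * (1 - e / 8))" by (simp only: ac_simps)
  also have "\<dots> \<le> (1 - (1 - p) ^ x) * N"
  proof (intro mult_mono assms(1))
    have "p * x * (1 - 7 / 100 * e) \<le> p * x * (1 - p * x / 2)" using p0 px by (intro mult_left_mono) auto
    also have "\<dots> \<le> 1 - (1 - p) ^ x" using p1 by (intro q_lower_quad) auto
    finally show "p * x * (1 - 7 / 100 * e) \<le> 1 - (1 - p) ^ x" .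
    show "0 \<le> 1 - (1 - p) ^ x" using q_bounds p1 by auto
    show "0 \<le> n * (1 - e / 8)" using e1 n_pos by (intro mult_nonneg_nonneg) auto
  qed
  finally show ?thesis .
qed

text \<open>The second argument of the minimum solves the linear recursion with growth 1 + e / 2.
  The true recursion grows at least as fast below e / 4 and never falls back once it is
  above.\<close>

lemma ny_lower: "min (e / 4) (2 * (p * s0 / e) * ((1 + e / 2) ^ k - 1)) \<le> ny (p * s0) (1 + 3 / 4 * e) k"
proof (induction k)
  case 0
  then show ?case using e0 by simp
next
  case (Suc k)
  let ?t = "p * s0" and ?y = "ny (p * s0) (1 + 3 / 4 * e) k" and ?w = "2 * (p * s0 / e) * ((1 + e / 2) ^ k - 1)"
  have t: "0 \<le> ?t" using p0 s0_pos by simp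
  have y: "0 \<le> ?y" using ny_nonneg t e0 by auto
  have w': "2 * (p * s0 / e) * ((1 + e / 2) ^ Suc k - 1) = ?t + (1 + e / 2) * ?w"
    using e0 by (simp add: field_simps)
  have grow: "(1 + e / 2) * z \<le> (1 + 3 / 4 * e) * (1 - exp (- z))" if z: "0 \<le> z" "z \<le> e / 4" for z
  proof -
    have "1 + e / 2 \<le> (1 + 3 / 4 * e) * (1 - e / 8)"
    proof -
      have "e * e \<le> 1 / 10 * e" using e0 e1 by (intro mult_right_mono) auto
      moreover have "(1 + 3 / 4 * e) * (1 - e / 8) = 1 + 5 / 8 * e - 3 / 32 * (e * e)"
        by (simp add: field_simps)
      ultimately show ?thesis using e0 by linarith
    qed
    then have "(1 + e / 2) * z \<le> (1 + 3 / 4 * e) * (1 - e / 8) * z" using z by (intro mult_right_mono) auto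
    also have "\<dots> = (1 + 3 / 4 * e) * (z * (1 - e / 8))" by simp
    also have "\<dots> \<le> (1 + 3 / 4 * e) * (1 - exp (- z))"
    proof (intro mult_left_mono)
      have "z * (1 - e / 8) \<le> z * (1 - z / 2)" using z by (intro mult_left_mono) auto
      also have "\<dots> = z - z\<^sup>2 / 2" by (simp add: power2_eq_square algebra_simps)
      also have "\<dots> \<le> 1 - exp (- z)" using z by (intro one_minus_exp_lower)
      finally show "z * (1 - e / 8) \<le> 1 - exp (- z)" .
    qed (use e0 in auto)
    finally show ?thesis .
  qed
  show ?case
  proof (cases "e / 4 \<le> ?y")
    case True
    have "e / 4 \<le> (1 + e / 2) * (e / 4)" using e0 by (simp add: algebra_simps)
    also have "\<dots> \<le> (1 + 3 / 4 * e) * (1 - exp (- (e / 4)))" using e0 by (intro grow) auto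
    also have "\<dots> \<le> (1 + 3 / 4 * e) * (1 - exp (- ?y))" using True e0 by (intro mult_left_mono) auto
    also have "\<dots> \<le> ny (p * s0) (1 + 3 / 4 * e) (Suc k)" using t by simp
    finally show ?thesis by simp
  next
    case False
    then have "?w \<le> ?y" using Suc by simp
    then have "(1 + e / 2) * ?w \<le> (1 + e / 2) * ?y" using e0 by (intro mult_left_mono) auto
    also have "\<dots> \<le> (1 + 3 / 4 * e) * (1 - exp (- ?y))" using grow[of ?y] y False by simp
    finally show ?thesis unfolding w' by simp
  qed
qed

text \<open>A block of length h multiplies by at least 3 / 2. Two blocks are required because (3 /
  2)^j \<ge> 2 is what absorbs the - 1 of the linear solution.\<close>

lemma ny_growth:
  assumes "2 \<le> j" "j * h \<le> k"
  shows "min (sL / 4) ((3 / 2) ^ j) \<le> s0 * ny (p * s0) (1 + 3 / 4 * e) k"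
proof -
  have "1 + real h * (e / 2) \<le> (1 + e / 2) ^ h" using e0 by (intro Bernoulli_inequality) auto
  moreover have "1 \<le> real h * e" using h_bounds by (simp add: mult.commute)
  ultimately have h: "3 / 2 \<le> (1 + e / 2) ^ h" by simp
  have "(3 / 2) ^ j \<le> ((1 + e / 2) ^ h) ^ j" using h by (intro power_mono) auto
  also have "\<dots> = (1 + e / 2) ^ (j * h)" by (simp add: power_mult[symmetric] mult.commute)
  also have "\<dots> \<le> (1 + e / 2) ^ k" using assms e0 by (intro power_increasing) auto
  finally have g: "(3 / 2) ^ j \<le> (1 + e / 2) ^ k" .
  have "(3 / 2 :: real) ^ 2 \<le> (3 / 2) ^ j" using assms by (intro power_increasing) auto
  then have j2: "2 \<le> (3 / 2 :: real) ^ j" by (simp add: power2_eq_square)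
  have ps: "s0 * (p * s0 / e) = lam"
  proof -
    have "s0 * (p * s0 / e) = p * (s0 * s0) / e" by simp
    also have "\<dots> = p * n" unfolding s0_sq using e0 by simp
    finally show ?thesis using p_n by simp
  qed
  have "s0 * (2 * (p * s0 / e) * ((1 + e / 2) ^ k - 1)) = 2 * (s0 * (p * s0 / e)) * ((1 + e / 2) ^ k - 1)" by simp
  also have "\<dots> = 2 * lam * ((1 + e / 2) ^ k - 1)" unfolding ps ..
  also have "\<dots> \<ge> 2 * 1 * ((3 / 2) ^ j - 1)" using lamb g j2 by (intro mult_mono) auto
  finally have 0: "2 * 1 * ((3 / 2) ^ j - 1) \<le> s0 * (2 * (p * s0 / e) * ((1 + e / 2) ^ k - 1))" .
  have "G \<le> 2 * 1 * (G - 1)" if "2 \<le> G" for G :: real using that by simp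
  then have 1: "(3 / 2) ^ j \<le> s0 * (2 * (p * s0 / e) * ((1 + e / 2) ^ k - 1))"
    using order_trans[OF _ 0] j2 by blast
  have 2: "s0 * (e / 4) = sL / 4" using e_s0 by (simp add: mult.commute)
  have "min (sL / 4) ((3 / 2) ^ j) \<le> s0 * min (e / 4) (2 * (p * s0 / e) * ((1 + e / 2) ^ k - 1))"
    using 1 2 s0_pos by (simp add: min_mult_distrib_left min.coboundedI2)
  also have "\<dots> \<le> s0 * ny (p * s0) (1 + 3 / 4 * e) k" using s0_pos by (intro mult_left_mono ny_lower) auto
  finally show ?thesis .
qed

end

section \<open>Reaching a large level\<close>

lemma of_bool_imp: "(P \<Longrightarrow> Q) \<Longrightarrow> (of_bool P :: real) \<le> of_bool Q"
  by auto

lemma rsE_of_bool_mono: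
  assumes "0 \<le> q" "q \<le> 1" "\<And>X. X \<subseteq> A \<Longrightarrow> P X \<Longrightarrow> Q X"
  shows "rsE q A (\<lambda>X. of_bool (P X)) \<le> rsE q A (\<lambda>X. of_bool (Q X))"
  using assms by (intro rsE_mono of_bool_imp)

context weakly_supercritical begin

lemma p_card_le: "card V \<le> n \<Longrightarrow> p * card V \<le> lam"
  using mult_left_mono[of "real (card V)" n p] p_n p0 by simp

lemma lp_card_le: "card V \<le> n \<Longrightarrow> real (card V) * - ln (1 - p) \<le> lp"
  unfolding lp_def using p1 p0 by (intro mult_right_mono) auto

text \<open>Two sets of size \<open>s0\<close> have about p s0^2 = lam e edges between them, so over
  h levels the expected number of connections is of order one. It then grows geometrically per
  block, whence the double exponential, until it saturates at order \<open>sL\<close>.\<close>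

lemma no_connect:
  assumes V: "finite V" "S \<subseteq> V" "U \<subseteq> V" "S \<inter> U = {}" "card V \<le> n" "n - 6 * be \<le> card V"
    and big: "s0 \<le> card S" "s0 \<le> card U" and j: "2 \<le> j" "j * h \<le> k"
  shows "rsE p (Edg V) (\<lambda>E. of_bool (\<forall>i\<le>k. lev E S i \<inter> U = {})) \<le> exp (- ((3 / 2) ^ j)) + 2 * exp (- (sL / 16))"
proof -
  \<comment> \<open>The target is trimmed to about \<open>s0\<close> vertices, since
    \<open>card U\<close> is subtracted in the error term of \<open>no_hit\<close>.\<close>
  have "nat \<lceil>s0\<rceil> \<le> card U" using big by (simp add: nat_le_iff ceiling_le_iff)
  then obtain U0 where U0: "U0 \<subseteq> U" "card U0 = nat \<lceil>s0\<rceil>" using obtain_subset_with_card_n by metis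
  have cU0: "s0 \<le> card U0" "card U0 \<le> s0 + 1"
    unfolding U0(2) using s0_pos by (simp_all add: of_nat_nat)
  let ?y = "ny (p * s0) (1 + 3 / 4 * e) k" and ?X = "real (card V) - card U0 - n * (1 - e / 8)"
  have "rsE p (Edg V) (\<lambda>E. of_bool (\<forall>i\<le>k. lev E S i \<inter> U = {}))
    \<le> rsE p (Edg V) (\<lambda>E. of_bool (\<forall>i\<le>k. lev E S i \<inter> U0 = {}))"
    using U0 p1 by (intro rsE_mono) auto
  also have "\<dots> \<le> exp (- (card S * ?y)) + exp (- (p * s0 * ?X))"
  proof (rule no_hit[where n = n])
    show "p * s0 \<le> p * card U0" using cU0 p0 by (intro mult_left_mono) auto
    show "(1 + 3 / 4 * e) * x \<le> (1 - (1 - p) ^ x) * N" if "n * (1 - e / 8) \<le> N" "N + x \<le> n" for N x :: nat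
      using that by (rule nc_step)
  qed (use V U0 p1 p0 s0_pos e0 in auto)
  also have "\<dots> \<le> (exp (- ((3 / 2) ^ j)) + exp (- (sL / 16))) + exp (- (sL / 16))"
  proof (intro add_mono)
    have "min (sL / 4) ((3 / 2) ^ j) \<le> s0 * ?y" using j by (rule ny_growth)
    also have "\<dots> \<le> card S * ?y" using big ny_nonneg p0 s0_pos e0 by (intro mult_right_mono) auto
    finally have "exp (- (card S * ?y)) \<le> exp (- min (sL / 4) ((3 / 2) ^ j))" by simp
    also have "\<dots> \<le> exp (- (sL / 4)) + exp (- ((3 / 2) ^ j))" by (simp add: min_def)
    also have "exp (- (sL / 4)) \<le> exp (- (sL / 16))" using sL_pos by simp
    finally show "exp (- (card S * ?y)) \<le> exp (- ((3 / 2) ^ j)) + exp (- (sL / 16))" by simp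
    have "7 * be \<le> e * n / 16" using be_le be_pos by simp
    then have "e * n / 16 \<le> ?X" using V cU0 budget' by (simp add: algebra_simps)
    then have le: "p * s0 * (e * n / 16) \<le> p * s0 * ?X" using p0 s0_pos by (intro mult_left_mono) auto
    have "sL / 16 \<le> lam * sL / 16" using lamb sL_pos by simp
    also have "\<dots> = (p * n) * (e * s0) / 16" by (simp only: p_n e_s0)
    also have "\<dots> = p * s0 * (e * n / 16)" by simp
    also note le
    finally show "exp (- (p * s0 * ?X)) \<le> exp (- (sL / 16))" by (simp only: exp_le_cancel_iff neg_le_iff_le)
  qed
  finally show ?thesis by simp
qed

text \<open>There are two ways to be alive at L without a large level up to H: a process doomed to
  die that lasts until L, or a surviving one that grows slowly up to H. They are the gaps of
  \<open>orb_hi\<close> and \<open>orb_lo\<close> to the common fixed point \<open>y1\<close>, which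
  cancels.\<close>

lemma tube_bound:
  assumes V: "finite V" "S \<subseteq> V" "card V \<le> n" "n - 7 * be \<le> card V"
    and t: "real H * e \<le> 5 * ell" "h \<le> L" "L \<le> H"
  shows "rsE p (Edg V) (\<lambda>E. of_bool (lev E S L \<noteq> {} \<and> (\<forall>j\<le>H. card (lev E S j) < s0)))
    \<le> exp 35 * e * (exp (- nu * L) + exp (- nu * (real H - a0))) * card S"
proof -
  have Le: "real L * e \<le> 5 * ell"
  proof -
    have "real L * e \<le> real H * e" using t e0 by (intro mult_right_mono) auto
    then show ?thesis using t by linarith
  qed
  have "s0 * H \<le> be" using budget[OF t(1)] s0_pos by (simp add: algebra_simps)
  then have Nl: "Nlow + s0 * H \<le> card V" using V be_pos by (simp add: Nlow_def)
  have "rsE p (Edg V) (\<lambda>E. of_bool (lev E S L \<noteq> {} \<and> (\<forall>j\<le>H. card (lev E S j) < s0)))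
    \<le> 8 * kap ^ L * card S * (orb l1 L 1 - orb l1 H (1 / s0))"
    using tube_step p1 l1_pos s0_ge kap_pow(1)[OF Le] Nlow_ge V Nl t
    by (intro tube_prob[where n = n and Nlow = Nlow]) auto
  also have "\<dots> \<le> 8 * kap ^ L * card S * (exp 9 * e * exp (- nu * L) + exp 26 * e * exp (- nu * (real H - a0)))"
    using orb_hi[OF t(2) Le] orb_lo[OF t(1)] kap_pow(1)[OF Le] by (intro mult_left_mono) auto
  also have "\<dots> \<le> 8 * exp 1 * card S * (exp 26 * e * (exp (- nu * L) + exp (- nu * (real H - a0))))"
  proof (intro mult_mono)
    have "exp 9 * e * exp (- nu * L) \<le> exp 26 * e * exp (- nu * L)" using e0 by (intro mult_right_mono) auto
    then show "exp 9 * e * exp (- nu * L) + exp 26 * e * exp (- nu * (real H - a0))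
      \<le> exp 26 * e * (exp (- nu * L) + exp (- nu * (real H - a0)))" by (simp add: distrib_left)
    show "kap ^ L \<le> exp 1" by (rule kap_pow(2)[OF Le])
  qed (use e0 kap_pow(1)[OF Le] in auto)
  also have "\<dots> = 8 * (exp 27 * e * (exp (- nu * L) + exp (- nu * (real H - a0))) * card S)"
  proof -
    have "exp 27 = exp 1 * exp (26::real)" by (simp add: exp_add[symmetric])
    then show ?thesis by (simp only: ac_simps)
  qed
  also have "\<dots> \<le> exp 8 * (exp 27 * e * (exp (- nu * L) + exp (- nu * (real H - a0))) * card S)"
    using exp_ge_add_one_self[of "8::real"] e0 by (intro mult_right_mono) auto
  also have "\<dots> = (exp 8 * exp 27) * e * (exp (- nu * L) + exp (- nu * (real H - a0))) * card S"
    by (simp only: mult.assoc)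
  finally show ?thesis by (simp add: exp_add[symmetric])
qed

lemma tube_after:
  assumes V: "finite V" "S \<subseteq> V" "card V \<le> n" "n - 6 * be \<le> card V"
    and A: "local_at g S A"
    and t: "real H * e \<le> 5 * ell" "g + h \<le> L" "L \<le> H"
  shows "rsE p (Edg V) (\<lambda>E. of_bool (A E \<and> card (bl E S g) \<le> be \<and> lev E S L \<noteq> {} \<and>
        (\<forall>j. g \<le> j \<and> j \<le> H \<longrightarrow> card (lev E S j) < s0)))
    \<le> exp 35 * e * (exp (- nu * (real L - g)) + exp (- nu * (real H - g - a0))) *
      rsE p (Edg V) (\<lambda>E. of_bool (A E) * real (card (lev E S g)))"
proof -
  define f :: "'a set set \<Rightarrow> real" where "f = (\<lambda>E. of_bool (A E \<and> card (bl E S g) \<le> be))"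
  define C where "C = exp 35 * e * (exp (- nu * (real L - g)) + exp (- nu * (real H - g - a0)))"
  define \<Psi> :: "'a set \<Rightarrow> 'a set \<Rightarrow> 'a set set \<Rightarrow> real"
    where "\<Psi> = (\<lambda>B T F. of_bool (lev F T (L - g) \<noteq> {} \<and> (\<forall>j\<le>H - g. card (lev F T j) < s0)))"
  have C0: "0 \<le> C" using e0 by (simp add: C_def)
  have loc: "local_at g S f"
    unfolding f_def
    by (rule local_at_comp[OF A local_at_bl, where h = "\<lambda>a b. of_bool (a \<and> real (card b) \<le> be)"]) simp
  have ev: "(\<forall>j. g \<le> j \<and> j \<le> H \<longrightarrow> card (lev E S j) < s0) \<longleftrightarrow>
      (\<forall>j\<le>H - g. card (lev (del E (bl E S g)) (lev E S g) j) < s0)" for E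
  proof -
    have "(\<forall>j. g \<le> j \<and> j \<le> H \<longrightarrow> P j) \<longleftrightarrow> (\<forall>j\<le>H - g. P (g + j))" for P :: "nat \<Rightarrow> bool"
    proof
      assume a: "\<forall>j\<le>H - g. P (g + j)"
      show "\<forall>j. g \<le> j \<and> j \<le> H \<longrightarrow> P j"
      proof (intro allI impI)
        fix j assume gj: "g \<le> j \<and> j \<le> H"
        then have "P (g + (j - g))" using a diff_le_mono by blast
        then show "P j" using gj by simp
      qed
    qed (use t in auto)
    then show ?thesis by (simp add: lev_add)
  qed
  have "lev E S L = lev (del E (bl E S g)) (lev E S g) (L - g)" for E
    using lev_add[of E S g "L - g"] t by simp
  then have "rsE p (Edg V) (\<lambda>E. of_bool (A E \<and> card (bl E S g) \<le> be \<and> lev E S L \<noteq> {} \<and>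
        (\<forall>j. g \<le> j \<and> j \<le> H \<longrightarrow> card (lev E S j) < s0)))
    = rsE p (Edg V) (\<lambda>E. f E * \<Psi> (bl E S g) (lev E S g) (del E (bl E S g)))"
    unfolding ev f_def \<Psi>_def by (intro rsE_cong refl) simp
  also have "\<dots> = rsE p (Edg V) (\<lambda>E. f E * rsE p (Edg (V - bl E S g)) (\<Psi> (bl E S g) (lev E S g)))"
    using V(1,2) loc by (rule rsE_markov)
  also have "\<dots> \<le> rsE p (Edg V) (\<lambda>E. C * (of_bool (A E) * real (card (lev E S g))))"
  proof (rule rsE_mono)
    fix E assume E: "E \<subseteq> Edg V"
    show "f E * rsE p (Edg (V - bl E S g)) (\<Psi> (bl E S g) (lev E S g)) \<le> C * (of_bool (A E) * real (card (lev E S g)))"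
    proof (cases "A E \<and> card (bl E S g) \<le> be")
      case True
      have bV: "bl E S g \<subseteq> V" using bl_subset[OF E V(2)] .
      then have fb: "finite (bl E S g)" using V finite_subset by auto
      have c: "real (card (V - bl E S g)) = real (card V) - card (bl E S g)"
        using bV fb V by (simp add: card_Diff_subset card_mono of_nat_diff)
      have He: "real (H - g) * e \<le> 5 * ell"
      proof -
        have "real (H - g) * e \<le> real H * e" using e0 by (intro mult_right_mono) auto
        then show ?thesis using t by linarith
      qed
      have "rsE p (Edg (V - bl E S g)) (\<Psi> (bl E S g) (lev E S g))
        \<le> exp 35 * e * (exp (- nu * real (L - g)) + exp (- nu * (real (H - g) - a0))) * card (lev E S g)"
        unfolding \<Psi>_def
      proof (rule tube_bound)
        show "lev E S g \<subseteq> V - bl E S g" using lev_subset[OF E V(2), of g] lev_bl_disjoint[of E S g] by blast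
        show "card (V - bl E S g) \<le> n" using V by (meson card_mono Diff_subset order_trans)
        show "n - 7 * be \<le> card (V - bl E S g)" unfolding c using V True by linarith
      qed (use V t He in auto)
      also have "\<dots> = C * card (lev E S g)" unfolding C_def using t by (simp add: of_nat_diff)
      finally show ?thesis using True by (simp add: f_def)
    next
      case False
      then have "f E = 0" unfolding f_def by simp
      then show ?thesis using C0 by simp
    qed
  qed (use p1 in auto)
  finally show ?thesis unfolding C_def rsE_cmult .
qed

lemma lam_h: "lam ^ h \<le> 4"
proof -
  have "lam ^ h \<le> exp (33 / 25)" unfolding lam_pow using nu_h by simp
  then show ?thesis using exp_le_4 by linarith
qed

lemma exp_nu_h: "exp (nu * h) \<le> 4"
proof -
  have "exp (nu * h) \<le> exp (33 / 25)" using nu_h by simp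
  then show ?thesis using exp_le_4 by linarith
qed

lemma h_a0: "3 * real h \<le> a0"
proof -
  have "3 * real h \<le> 3 * (2 / e)"
    using h_bounds e0 e1 by (simp add: field_simps)
  also have "\<dots> \<le> 50 / e" using e0 by (simp add: field_simps)
  also have "\<dots> \<le> a0"
  proof -
    have "mu * a0 \<le> e * a0" using mu_bounds a0_bounds by (intro mult_right_mono) auto
    then have "50 \<le> e * a0" using a0_bounds ell100 by linarith
    then show ?thesis using e0 by (simp add: field_simps)
  qed
  finally show ?thesis .
qed

lemma orb_lp_h: "0 \<le> orb lp h 1" "orb lp h 1 \<le> 8 * e"
  using orb_h_le[OF lp_bounds] orb_range[of lp 1 h] lp_bounds by auto

lemma alive_after:
  fixes A :: "'a set set \<Rightarrow> bool"
  assumes V: "finite V" "S \<subseteq> V" "card V \<le> n" and A: "local_at g S A"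
  shows "rsE p (Edg V) (\<lambda>E. of_bool (A E \<and> lev E S (g + h) \<noteq> {}))
    \<le> 8 * e * rsE p (Edg V) (\<lambda>E. of_bool (A E) * real (card (lev E S g)))"
    and "rsE p (Edg V) (\<lambda>E. of_bool (A E) * real (card (lev E S (g + h))))
    \<le> 4 * rsE p (Edg V) (\<lambda>E. of_bool (A E) * real (card (lev E S g)))"
proof -
  define f :: "'a set set \<Rightarrow> real" where "f = (\<lambda>E. of_bool (A E))"
  have loc: "local_at g S f" unfolding f_def using A by (rule local_at_comp1)
  have sub: "lev E S g \<subseteq> V - bl E S g" "card (V - bl E S g) \<le> n" if "E \<subseteq> Edg V" for E
    using lev_subset[OF that V(2), of g] lev_bl_disjoint[of E S g] V
    by (blast, meson card_mono Diff_subset order_trans)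
  have "rsE p (Edg V) (\<lambda>E. of_bool (A E \<and> lev E S (g + h) \<noteq> {})) =
     rsE p (Edg V) (\<lambda>E. f E * (\<lambda>B T F. of_bool (lev F T h \<noteq> {})) (bl E S g) (lev E S g) (del E (bl E S g)))"
    by (intro rsE_cong refl) (simp add: f_def lev_add)
  also have "\<dots> = rsE p (Edg V) (\<lambda>E. f E * rsE p (Edg (V - bl E S g)) (\<lambda>F. of_bool (lev F (lev E S g) h \<noteq> {})))"
    using V(1,2) loc by (rule rsE_markov)
  also have "\<dots> \<le> rsE p (Edg V) (\<lambda>E. f E * (card (lev E S g) * (8 * e)))"
  proof (intro rsE_mono mult_left_mono)
    fix E assume E: "E \<subseteq> Edg V"
    have "rsE p (Edg (V - bl E S g)) (\<lambda>F. of_bool (lev F (lev E S g) h \<noteq> {})) \<le> card (lev E S g) * orb lp h 1"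
      using sub[OF E] V p1 by (intro lev_survive_prob lp_card_le) auto
    also have "\<dots> \<le> card (lev E S g) * (8 * e)" using orb_lp_h by (intro mult_left_mono) auto
    finally show "rsE p (Edg (V - bl E S g)) (\<lambda>F. of_bool (lev F (lev E S g) h \<noteq> {})) \<le> card (lev E S g) * (8 * e)" .
  qed (use p1 in \<open>auto simp: f_def\<close>)
  also have "\<dots> = rsE p (Edg V) (\<lambda>E. 8 * e * (of_bool (A E) * real (card (lev E S g))))"
    by (intro rsE_cong refl) (simp add: f_def)
  finally show "rsE p (Edg V) (\<lambda>E. of_bool (A E \<and> lev E S (g + h) \<noteq> {}))
    \<le> 8 * e * rsE p (Edg V) (\<lambda>E. of_bool (A E) * real (card (lev E S g)))" unfolding rsE_cmult .
  have "rsE p (Edg V) (\<lambda>E. of_bool (A E) * real (card (lev E S (g + h)))) =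
     rsE p (Edg V) (\<lambda>E. f E * (\<lambda>B T F. real (card (lev F T h))) (bl E S g) (lev E S g) (del E (bl E S g)))"
    by (intro rsE_cong refl) (simp add: f_def lev_add)
  also have "\<dots> = rsE p (Edg V) (\<lambda>E. f E * rsE p (Edg (V - bl E S g)) (\<lambda>F. real (card (lev F (lev E S g) h))))"
    using V(1,2) loc by (rule rsE_markov)
  also have "\<dots> \<le> rsE p (Edg V) (\<lambda>E. f E * (4 * card (lev E S g)))"
  proof (intro rsE_mono mult_left_mono)
    fix E assume E: "E \<subseteq> Edg V"
    have "rsE p (Edg (V - bl E S g)) (\<lambda>F. real (card (lev F (lev E S g) h))) \<le> lam ^ h * card (lev E S g)"
      using sub[OF E] V p1 by (intro card_lev_mean p_card_le) auto
    also have "\<dots> \<le> 4 * real (card (lev E S g))" using lam_h by (intro mult_right_mono) auto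
    finally show "rsE p (Edg (V - bl E S g)) (\<lambda>F. real (card (lev F (lev E S g) h))) \<le> 4 * card (lev E S g)" by simp
  qed (use p1 in \<open>auto simp: f_def\<close>)
  also have "\<dots> = rsE p (Edg V) (\<lambda>E. 4 * (of_bool (A E) * real (card (lev E S g))))"
    by (intro rsE_cong refl) (simp add: f_def)
  finally show "rsE p (Edg V) (\<lambda>E. of_bool (A E) * real (card (lev E S (g + h))))
    \<le> 4 * rsE p (Edg V) (\<lambda>E. of_bool (A E) * real (card (lev E S g)))"
    by (simp only: rsE_cmult)
qed

text \<open>Level sizes before g + h are not capped one by one, so that a local event A can be
  imposed there; it enters only through the mean m.\<close>

lemma late_hit:
  assumes V: "finite V" "S \<subseteq> V" "card V \<le> n" "n - 6 * be \<le> card V" and A: "local_at g S A" and g: "g \<le> h"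
    and mean: "rsE p (Edg V) (\<lambda>E. of_bool (A E) * real (card (lev E S g))) \<le> m"
    and k: "g + h \<le> k" "real k * e \<le> 5 * ell"
  shows "rsE p (Edg V) (\<lambda>E. of_bool (A E \<and> card (bl E S (g + h)) \<le> be \<and> lev E S k \<noteq> {} \<and>
        (\<forall>j. g + h \<le> j \<and> j < k \<longrightarrow> card (lev E S j) < s0))) \<le> exp 50 * e * m * exp (- nu * (real k - a0))"
proof -
  have m0: "0 \<le> m" using mean rsE_nonneg[of p "Edg V" "\<lambda>E. of_bool (A E) * real (card (lev E S g))"] p1 by (auto intro: order_trans)
  have gh: "real g \<le> h" using g by simp
  show ?thesis
  proof (cases "k \<le> g + 2 * h")
    case True
    have "rsE p (Edg V) (\<lambda>E. of_bool (A E \<and> card (bl E S (g + h)) \<le> be \<and> lev E S k \<noteq> {} \<and>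
        (\<forall>j. g + h \<le> j \<and> j < k \<longrightarrow> card (lev E S j) < s0)))
      \<le> rsE p (Edg V) (\<lambda>E. of_bool (A E \<and> lev E S (g + h) \<noteq> {}))"
    proof (rule rsE_of_bool_mono[OF p1(3,2)])
      fix E assume "A E \<and> card (bl E S (g + h)) \<le> be \<and> lev E S k \<noteq> {} \<and>
        (\<forall>j. g + h \<le> j \<and> j < k \<longrightarrow> card (lev E S j) < s0)"
      then show "A E \<and> lev E S (g + h) \<noteq> {}" using lev_empty_mono[OF _ k(1), of E S] by blast
    qed
    also have "\<dots> \<le> 8 * e * m"
      using alive_after(1)[OF V(1-3) A] mult_left_mono[OF mean, of "8 * e"] e0 by linarith
    also have "\<dots> \<le> exp 50 * exp (- nu * (real k - a0)) * (e * m)"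
    proof -
      \<comment> \<open>Such a k is below \<open>a0\<close>, so the exponential on the right is at
        least 1, and survival for h levels after g, of order e m, suffices.\<close>
      have "real k \<le> 3 * h" using True gh by linarith
      then have "real k \<le> a0" using h_a0 by linarith
      then have "1 \<le> exp (- nu * (real k - a0))" using nu_bounds by (simp add: mult_le_0_iff)
      moreover have "8 \<le> exp (50::real)" using exp_ge_add_one_self[of "50::real"] by simp
      ultimately have "8 * 1 \<le> exp 50 * exp (- nu * (real k - a0))" by (intro mult_mono) auto
      then have "8 * 1 * (e * m) \<le> exp 50 * exp (- nu * (real k - a0)) * (e * m)"
        using e0 m0 by (intro mult_right_mono) auto
      then show ?thesis by simp
    qed
    finally show ?thesis by (simp add: ac_simps)
  next
    case False
    define k' where "k' = k - 1"
    have k': "k = Suc k'" "g + h + h \<le> k'" using False by (auto simp: k'_def)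
    have k'e: "real k' * e \<le> 5 * ell" using k(2) k' e0 by (simp add: algebra_simps)
    have A': "local_at (g + h) S A" using A by (rule local_at_mono) simp
    have "rsE p (Edg V) (\<lambda>E. of_bool (A E \<and> card (bl E S (g + h)) \<le> be \<and> lev E S k \<noteq> {} \<and>
        (\<forall>j. g + h \<le> j \<and> j < k \<longrightarrow> card (lev E S j) < s0)))
      \<le> rsE p (Edg V) (\<lambda>E. of_bool (A E \<and> card (bl E S (g + h)) \<le> be \<and> lev E S k' \<noteq> {} \<and>
        (\<forall>j. g + h \<le> j \<and> j \<le> k' \<longrightarrow> card (lev E S j) < s0)))"
    proof (rule rsE_of_bool_mono[OF p1(3,2)])
      fix E assume a: "A E \<and> card (bl E S (g + h)) \<le> be \<and> lev E S k \<noteq> {} \<and>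
        (\<forall>j. g + h \<le> j \<and> j < k \<longrightarrow> card (lev E S j) < s0)"
      then have "lev E S k' \<noteq> {}" using lev_empty_mono[of E S k' k] k' by auto
      then show "A E \<and> card (bl E S (g + h)) \<le> be \<and> lev E S k' \<noteq> {} \<and>
        (\<forall>j. g + h \<le> j \<and> j \<le> k' \<longrightarrow> card (lev E S j) < s0)" using a k'(1) by auto
    qed
    also have "\<dots> \<le> exp 35 * e * (exp (- nu * (real k' - (g + h))) + exp (- nu * (real k' - (g + h) - a0))) *
       rsE p (Edg V) (\<lambda>E. of_bool (A E) * real (card (lev E S (g + h))))"
      using tube_after[OF V A' k'e, of k'] k' by simp
    also have "\<dots> \<le> exp 35 * e * (2 * (exp 4 * exp (- nu * (real k - a0)))) * (4 * m)"
    proof (intro mult_mono)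
      have n2: "nu * (g + h + 1) \<le> 4"
      proof -
        have "nu * (real g + h) \<le> nu * (2 * h)" using gh nu_bounds by (intro mult_left_mono) auto
        moreover have "nu * (2 * h) = 2 * (nu * h)" by simp
        ultimately have "nu * (real g + h) \<le> 2 * (33 / 25)" using nu_h(1) by linarith
        then show ?thesis using nu_bounds e1 by (simp add: algebra_simps)
      qed
      have 2: "exp (- nu * (real k' - (g + h) - a0)) \<le> exp 4 * exp (- nu * (real k - a0))"
        unfolding exp_add[symmetric] k'(1) using n2 by (simp add: algebra_simps)
      have "exp (- nu * (real k' - (g + h))) \<le> exp (- nu * (real k' - (g + h) - a0))"
        using nu_bounds a0_bounds by (simp add: mult_left_mono)
      then show "exp (- nu * (real k' - (g + h))) + exp (- nu * (real k' - (g + h) - a0)) \<le> 2 * (exp 4 * exp (- nu * (real k - a0)))"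
        using 2 by linarith
      show "rsE p (Edg V) (\<lambda>E. of_bool (A E) * real (card (lev E S (g + h)))) \<le> 4 * m"
        using alive_after(2)[OF V(1-3) A] mean by linarith
      show "0 \<le> rsE p (Edg V) (\<lambda>E. of_bool (A E) * real (card (lev E S (g + h))))" using p1 by (intro rsE_nonneg) auto
    qed (use e0 in auto)
    also have "\<dots> = 8 * (exp 39 * e * m * exp (- nu * (real k - a0)))"
    proof -
      have "exp 35 * exp 4 = exp (39::real)" by (simp add: exp_add[symmetric])
      then show ?thesis by (simp add: ac_simps)
    qed
    also have "\<dots> \<le> exp 11 * (exp 39 * e * m * exp (- nu * (real k - a0)))"
      using exp_ge_add_one_self[of "11::real"] e0 m0 by (intro mult_right_mono) auto
    also have "\<dots> = (exp 11 * exp 39) * e * m * exp (- nu * (real k - a0))" by (simp only: mult.assoc)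
    finally show ?thesis by (simp add: exp_add[symmetric])
  qed
qed

lemma late_hit_rays:
  assumes V: "finite V" "v \<in> V" "card V \<le> n" "n - 6 * be \<le> card V" and k: "2 * h \<le> k" "real k * e \<le> 5 * ell"
  shows "rsE p (Edg V) (\<lambda>E. of_bool (two_rays E v h \<and> card (bl E {v} (2 * h)) \<le> be \<and> lev E {v} k \<noteq> {} \<and>
        (\<forall>j. 2 * h \<le> j \<and> j < k \<longrightarrow> card (lev E {v} j) < s0))) \<le> exp 50 * 32 * e\<^sup>2 * exp (- nu * (real k - a0))"
proof -
  have "rsE p (Edg V) (\<lambda>E. of_bool (two_rays E v h) * real (card (lev E {v} h)))
    \<le> (p * card V) ^ h * orb lp h 1"
    using V p1 by (intro two_rays_mean lp_card_le) auto
  also have "\<dots> \<le> 4 * (8 * e)"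
  proof (intro mult_mono)
    have "(p * card V) ^ h \<le> lam ^ h" using V p0 p_card_le by (intro power_mono) auto
    then show "(p * card V) ^ h \<le> 4" using lam_h by linarith
  qed (use orb_lp_h p0 in auto)
  finally have m: "rsE p (Edg V) (\<lambda>E. of_bool (two_rays E v h) * real (card (lev E {v} h))) \<le> 32 * e" by simp
  show ?thesis
    using late_hit[OF V(1) _ V(3,4) two_rays_local order_refl m k(1)[unfolded mult_2] k(2)] V(2)
    unfolding mult_2 by (simp add: power2_eq_square ac_simps)
qed

lemma late_hit_single:
  assumes V: "finite V" "v \<in> V" "card V \<le> n" "n - 6 * be \<le> card V" and k: "h \<le> k" "real k * e \<le> 5 * ell"
  shows "rsE p (Edg V) (\<lambda>E. of_bool (card (bl E {v} h) \<le> be \<and> lev E {v} k \<noteq> {} \<and>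
        (\<forall>j. h \<le> j \<and> j < k \<longrightarrow> card (lev E {v} j) < s0))) \<le> exp 50 * e * exp (- nu * (real k - a0))"
  using late_hit[OF V(1) _ V(3,4) local_at_const[of 0 "{v}" True], of 1 k] V k by simp

lemma bl_mean:
  assumes "finite V" "S \<subseteq> V" "card V \<le> n"
  shows "rsE p (Edg V) (\<lambda>E. real (card (bl E S k))) \<le> card S * (lam ^ k / e)"
proof -
  have "rsE p (Edg V) (\<lambda>E. real (card (bl E S k))) \<le> rsE p (Edg V) (\<lambda>E. \<Sum>j<k. real (card (lev E S j)))"
  proof (rule rsE_mono)
    fix E
    have "card (bl E S k) \<le> (\<Sum>j<k. card (lev E S j))" unfolding bl_def by (rule card_UN_le) simp
    then show "real (card (bl E S k)) \<le> (\<Sum>j<k. real (card (lev E S j)))"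
      by (simp flip: of_nat_sum)
  qed (use p1 in auto)
  also have "\<dots> = (\<Sum>j<k. rsE p (Edg V) (\<lambda>E. real (card (lev E S j))))" by (rule rsE_sum)
  also have "\<dots> \<le> (\<Sum>j<k. lam ^ j * card S)"
    using assms p1 by (intro sum_mono card_lev_mean p_card_le) auto
  also have "\<dots> = card S * (\<Sum>j<k. lam ^ j)" by (simp add: sum_distrib_left mult.commute)
  also have "(\<Sum>j<k. lam ^ j) = (lam ^ k - 1) / e" using lamb lam by (subst geometric_sum) auto
  also have "card S * ((lam ^ k - 1) / e) \<le> card S * (lam ^ k / e)"
    using e0 by (intro mult_left_mono divide_right_mono) auto
  finally show ?thesis .
qed

lemma bl_half:
  assumes "v' \<in> bl E {v} (2 * h)"
  shows "bl E {v} (2 * h) \<subseteq> bl E {v'} (4 * h)"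
proof
  fix u assume "u \<in> bl E {v} (2 * h)"
  then obtain j where j: "j < 2 * h" "wlk E j v u" by (auto simp: bl_def lev_single_iff)
  obtain i where i: "i < 2 * h" "wlk E i v v'" using assms by (auto simp: bl_def lev_single_iff)
  have "wlk E (i + j) v' u" using wlk_sym[OF i(2)] j(2) wlk_add[of E i j v' u] by blast
  then obtain m where "m \<le> i + j" "u \<in> lev E {v'} m" using wlk_imp_lev[of v' "{v'}"] by blast
  then show "u \<in> bl E {v'} (4 * h)" using i j unfolding bl_def by (intro UN_I[of m]) auto
qed

text \<open>Large balls come in clusters: every vertex of a large ball of radius 2 h has a ball of
  radius 4 h containing it. One large ball therefore makes the sum of all these sizes at least be^2,
  whereas a union bound would gain only one factor \<open>be\<close> and fail.\<close>

lemma no_big_ball: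
  assumes V: "finite V" "card V \<le> n"
  shows "rsE p (Edg V) (\<lambda>E. of_bool (\<exists>v\<in>V. be < card (bl E {v} (2 * h)))) \<le> 10 ^ 9 * ell\<^sup>2 / Lam"
proof -
  have "rsE p (Edg V) (\<lambda>E. of_bool (\<exists>v\<in>V. be < card (bl E {v} (2 * h))))
    \<le> rsE p (Edg V) (\<lambda>E. (1 / be\<^sup>2) * (\<Sum>v\<in>V. real (card (bl E {v} (4 * h)))))"
  proof (rule rsE_mono)
    fix E assume E: "E \<subseteq> Edg V"
    show "of_bool (\<exists>v\<in>V. be < card (bl E {v} (2 * h))) \<le> (1 / be\<^sup>2) * (\<Sum>v\<in>V. real (card (bl E {v} (4 * h))))"
    proof (cases "\<exists>v\<in>V. be < card (bl E {v} (2 * h))")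
      case True
      then obtain v where v: "v \<in> V" "be < card (bl E {v} (2 * h))" by auto
      let ?B = "bl E {v} (2 * h)"
      have BV: "?B \<subseteq> V" using E v by (intro bl_subset) auto
      have "be\<^sup>2 \<le> real (card ?B) * real (card ?B)" using v be_pos unfolding power2_eq_square by (intro mult_mono) auto
      also have "\<dots> = (\<Sum>v'\<in>?B. real (card ?B))" by simp
      also have "\<dots> \<le> (\<Sum>v'\<in>?B. real (card (bl E {v'} (4 * h))))"
      proof (intro sum_mono of_nat_mono card_mono)
        fix v' assume v': "v' \<in> ?B"
        show "?B \<subseteq> bl E {v'} (4 * h)" using v' by (rule bl_half)
        have "bl E {v'} (4 * h) \<subseteq> V" using E v' BV by (intro bl_subset) auto
        then show "finite (bl E {v'} (4 * h))" using V finite_subset by auto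
      qed
      also have "\<dots> \<le> (\<Sum>v'\<in>V. real (card (bl E {v'} (4 * h))))" using V BV by (intro sum_mono2) auto
      finally show ?thesis using True be_pos by (simp add: field_simps)
    qed (simp add: sum_nonneg)
  qed (use p1 in auto)
  also have "\<dots> = (1 / be\<^sup>2) * (\<Sum>v\<in>V. rsE p (Edg V) (\<lambda>E. real (card (bl E {v} (4 * h)))))"
    unfolding rsE_cmult rsE_sum ..
  also have "\<dots> \<le> (1 / be\<^sup>2) * (\<Sum>v\<in>V. 256 / e)"
  proof (intro mult_left_mono sum_mono)
    fix v assume "v \<in> V"
    then have "rsE p (Edg V) (\<lambda>E. real (card (bl E {v} (4 * h)))) \<le> card {v} * (lam ^ (4 * h) / e)"
      using V by (intro bl_mean) auto
    also have "\<dots> \<le> 256 / e"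
    proof -
      have "lam ^ (4 * h) = (lam ^ h) ^ 4" by (simp add: power_mult[symmetric] mult.commute)
      also have "\<dots> \<le> 4 ^ 4" using lam_h lamb by (intro power_mono) auto
      finally show ?thesis using e0 by (simp add: divide_right_mono)
    qed
    finally show "rsE p (Edg V) (\<lambda>E. real (card (bl E {v} (4 * h)))) \<le> 256 / e" .
  qed auto
  also have "\<dots> = card V * (256 / e / be\<^sup>2)" by simp
  also have "\<dots> \<le> n * (256 / e / be\<^sup>2)" using V e0 by (intro mult_right_mono) auto
  also have "\<dots> = 256 * 10 ^ 6 * ell\<^sup>2 / Lam"
    using n_pos e0 ell100 by (simp add: be_def Lam_def power2_eq_square power3_eq_cube field_simps)
  also have "\<dots> \<le> 10 ^ 9 * ell\<^sup>2 / Lam" using Lam_pos by (intro divide_right_mono mult_right_mono) auto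
  finally show ?thesis .
qed

end

section \<open>Survival after a large level\<close>

lemma geometric_sum_le:
  fixes r :: real
  assumes "0 \<le> r" "r < 1"
  shows "(\<Sum>i<m. r ^ i) \<le> 1 / (1 - r)"
proof -
  have "(\<Sum>i<m. r ^ i) \<le> (\<Sum>i. r ^ i)"
    using assms by (intro sum_le_suminf summable_geometric) auto
  also have "\<dots> = 1 / (1 - r)" using assms by (intro suminf_geometric) auto
  finally show ?thesis .
qed

lemma exp_neg_le: "0 \<le> x \<Longrightarrow> exp (- x) \<le> 1 / (1 + x)" for x :: real
  using exp_ge_add_one_self[of x] by (simp add: exp_minus field_simps)

lemma exp_geometric_le:
  fixes a :: real
  assumes "0 < a"
  shows "(\<Sum>i<m. exp (- (a * real i))) \<le> (1 + a) / a"
proof -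
  have r: "exp (- a) \<le> 1 / (1 + a)" using assms by (intro exp_neg_le) auto
  have "(\<Sum>i<m. exp (- (a * real i))) = (\<Sum>i<m. exp (- a) ^ i)"
    by (simp add: exp_of_nat_mult[symmetric] mult.commute)
  also have "\<dots> \<le> 1 / (1 - exp (- a))" using assms by (intro geometric_sum_le) auto
  also have "\<dots> \<le> 1 / (1 - 1 / (1 + a))" using r assms by (intro divide_left_mono) (auto simp: field_simps)
  also have "\<dots> = (1 + a) / a" using assms by (simp add: field_simps)
  finally show ?thesis .
qed

text \<open>By 1 - exp (- y) \<ge> y / (1 + y), taking reciprocals makes the recursion linear; its
  solution is a sum of inverse products of the means.\<close>

lemma lg_recip:
  fixes p \<omega> :: real
  assumes "0 < p" "0 < \<omega>" "\<And>i. 0 < Nl i"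
  shows "0 < lg p \<omega> Nl k \<and> 1 / lg p \<omega> Nl k \<le> 1 / (\<omega> * (\<Prod>j<k. p * Nl j)) + (\<Sum>i<k. 1 / (\<Prod>j<Suc i. p * Nl j))"
  using assms(3)
proof (induction k arbitrary: Nl)
  case 0
  then show ?case using assms by simp
next
  case (Suc k)
  let ?y = "lg p \<omega> (\<lambda>i. Nl (Suc i)) k" and ?l = "p * Nl 0"
  have y: "0 < ?y" "1 / ?y \<le> 1 / (\<omega> * (\<Prod>j<k. p * Nl (Suc j))) + (\<Sum>i<k. 1 / (\<Prod>j<Suc i. p * Nl (Suc j)))"
    using Suc.IH[of "\<lambda>i. Nl (Suc i)"] Suc.prems by auto
  have l: "0 < ?l" using assms Suc.prems by simp
  have "exp (- ?y) \<le> 1 / (1 + ?y)" using y by (intro exp_neg_le) auto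
  then have "?y / (1 + ?y) \<le> 1 - exp (- ?y)" using y by (simp add: field_simps)
  then have le: "?l * (?y / (1 + ?y)) \<le> lg p \<omega> Nl (Suc k)" using l by (simp add: mult_left_mono del: times_divide_eq_right)
  have pos: "0 < ?l * (?y / (1 + ?y))" by (rule mult_pos_pos[OF l divide_pos_pos]) (use y in auto)
  have "1 / lg p \<omega> Nl (Suc k) \<le> 1 / (?l * (?y / (1 + ?y)))"
    by (rule divide_left_mono[OF le]) (simp, rule mult_pos_pos[OF less_le_trans[OF pos le] pos])
  also have "\<dots> = (1 / ?l) * (1 / ?y) + 1 / ?l"
  proof -
    have "1 / (a * (b / (1 + b))) = (1 / a) * (1 / b) + 1 / a" if "0 < a" "0 < b" for a b :: real
      using that by (simp add: field_simps)
    then show ?thesis using l y(1) .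
  qed
  also have "\<dots> \<le> (1 / ?l) * (1 / (\<omega> * (\<Prod>j<k. p * Nl (Suc j))) + (\<Sum>i<k. 1 / (\<Prod>j<Suc i. p * Nl (Suc j)))) + 1 / ?l"
    using y l by (intro add_right_mono mult_left_mono) auto
  also have "\<dots> = 1 / (\<omega> * (?l * (\<Prod>j<k. p * Nl (Suc j)))) + (1 / ?l + (\<Sum>i<k. 1 / (?l * (\<Prod>j<Suc i. p * Nl (Suc j)))))"
    by (simp add: distrib_left sum_distrib_left mult.left_commute del: prod.lessThan_Suc)
  also have "\<dots> = 1 / (\<omega> * (\<Prod>j<Suc k. p * Nl j)) + (\<Sum>i<Suc k. 1 / (\<Prod>j<Suc i. p * Nl j))"
    by (simp add: prod.lessThan_Suc_shift sum.lessThan_Suc_shift del: prod.lessThan_Suc sum.lessThan_Suc)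
  finally show ?case using pos le by simp
qed

context weakly_supercritical begin

lemma one_minus_exp2: "0 \<le> x \<Longrightarrow> x \<le> 1 / 2 \<Longrightarrow> exp (- (2 * x)) \<le> 1 - x" for x :: real
proof -
  assume x: "0 \<le> x" "x \<le> 1 / 2"
  have "- x - 2 * x\<^sup>2 \<le> ln (1 - x)" using x by (intro ln_one_minus_pos_lower_bound) auto
  moreover have "x * x \<le> x * (1 / 2)" using x by (intro mult_left_mono) auto
  then have "2 * x\<^sup>2 \<le> x" by (simp add: power2_eq_square)
  ultimately have "exp (- (2 * x)) \<le> exp (ln (1 - x))" by simp
  then show ?thesis using x by simp
qed

section \<open>Saturation and growth caps of an exploration\<close>

text \<open>Number of vertices that stay unexplored forever: V is at most 3 be short of n, and the
  giant component takes n ys of it, with a margin n e / ell. Then p sat is close to lam (1 - ys) =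
  ls.\<close>

definition sat :: real where "sat = real n - 3 * be - real n * (ys + e / ell)"

lemma be_frac: "be = n * (e / ell) / 1000" by (simp add: be_def mult.commute)

lemma e_ell: "0 < e / ell" "e / ell \<le> e / 100" "e / ell \<le> 1 / 1000"
proof -
  show "0 < e / ell" using e0 ell100 by simp
  show 1: "e / ell \<le> e / 100" using e0 ell100 by (intro divide_left_mono) auto
  have "e / 100 \<le> 1 / 1000" using e1 by simp
  then show "e / ell \<le> 1 / 1000" by (rule order_trans[OF 1])
qed

lemma sat_ge: "real n * (1 - 3 * e) \<le> sat"
proof -
  define d where "d = e / ell"
  have "ys + d + 3 * d / 1000 \<le> 3 * e"
    using ys_bounds(2) e_ell(1,2) e0 unfolding d_def[symmetric] by linarith
  then have "ys + e / ell + 3 * (e / ell) / 1000 \<le> 3 * e" unfolding d_def .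
  then have "real n * (ys + e / ell + 3 * (e / ell) / 1000) \<le> n * (3 * e)" by (intro mult_left_mono) auto
  then show ?thesis unfolding sat_def be_frac by (simp add: algebra_simps)
qed

lemma sat_pos: "0 < sat"
proof -
  have "0 < real n * (1 - 3 * e)" using n_pos e1 by (intro mult_pos_pos) auto
  then show ?thesis using sat_ge by linarith
qed

text \<open>The reached set has size about n ys because b = n ys nearly solves b = n (1 - (1 -
  p)^b). Above this value the deficit b - n (1 - (1 - p)^b) grows with slope 1 - ls, of order e, and
  \<open>reach_tail\<close> applies.\<close>

lemma saturation:
  assumes V: "finite V" "S \<subseteq> V" "card V \<le> n" and S: "card S \<le> 6 * s0"
  shows "rsE p (Edg V) (\<lambda>E. of_bool (real n * (ys + e / ell) < card (reach E S))) \<le> exp (- (Lam / (100 * ell\<^sup>2)))"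
proof -
  define \<delta> where "\<delta> = e / ell"
  define b where "b = nat \<lceil>real n * (ys + \<delta>)\<rceil>"
  \<comment> \<open>The exponent - \<theta> gap + 3 \<theta>^2 e n is smallest for \<theta> of order
    \<delta>; the fraction 1 / 12 gives - 1 / 15 + 1 / 48 in units of Lam / ell^2.\<close>
  define \<theta> where "\<theta> = \<delta> / 12"
  have \<delta>: "0 < \<delta>" "\<delta> \<le> e / 100" using e_ell by (auto simp: \<delta>_def)
  have \<theta>: "0 < \<theta>" "\<theta> \<le> 1" using \<delta> e1 by (auto simp: \<theta>_def)
  have yd: "0 < ys + \<delta>" "ys + \<delta> \<le> 21 / 10 * e" using ys_bounds \<delta> e0 by auto
  have "0 \<le> real n * (ys + \<delta>)" using yd n_pos by simp
  then have b: "real n * (ys + \<delta>) \<le> b" "b \<le> real n * (ys + \<delta>) + 1"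
    unfolding b_def by (simp_all add: of_nat_nat)
  let ?q = "1 - (1 - p) ^ b"
  have q: "0 \<le> ?q" "?q \<le> 1" using q_bounds[OF p1(3,2)] by auto
  have nq: "n * ?q \<le> n * ys + n * (ls * \<delta>) + 4"
  proof -
    have "ln (1 - p) \<ge> - p - 2 * p\<^sup>2" using p0 p_le e1 by (intro ln_one_minus_pos_lower_bound) auto
    then have "b * ln (1 - p) \<ge> b * (- p - 2 * p\<^sup>2)" by (intro mult_left_mono) auto
    moreover have "b * (p + 2 * p\<^sup>2) \<le> (real n * (ys + \<delta>) + 1) * (p + 2 * p\<^sup>2)" using b p0 by (intro mult_right_mono) auto
    moreover have "(real n * (ys + \<delta>) + 1) * (p + 2 * p\<^sup>2) = (p * n) * (ys + \<delta>) + 2 * p * (p * n) * (ys + \<delta>) + p + 2 * p\<^sup>2"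
      by (simp add: power2_eq_square algebra_simps)
    moreover have "2 * p * (p * n) * (ys + \<delta>) \<le> 2 * p * 2 * (1 / 4)"
      unfolding p_n using lamb yd e1 p0 by (intro mult_mono) auto
    moreover have "2 * p\<^sup>2 \<le> p" using p0 p_le e1 by (simp add: power2_eq_square)
    moreover have "(p * n) * (ys + \<delta>) = lam * ys + lam * \<delta>" unfolding p_n by (simp add: distrib_left)
    ultimately have "- (lam * ys + lam * \<delta> + 3 * p) \<le> b * ln (1 - p)" using p0 by (simp add: algebra_simps)
    then have "exp (- (lam * ys + lam * \<delta> + 3 * p)) \<le> exp (b * ln (1 - p))" by simp
    also have "\<dots> = (1 - p) ^ b" using p1 by (simp add: exp_of_nat_mult)
    finally have 1: "exp (- (lam * ys + lam * \<delta> + 3 * p)) \<le> (1 - p) ^ b" .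
    have "exp (- (lam * ys + lam * \<delta> + 3 * p)) = exp (- (lam * ys)) * exp (- (lam * \<delta> + 3 * p))"
      by (simp add: exp_add[symmetric])
    also have "exp (- (lam * ys)) = 1 - ys" unfolding ys_bounds(4) using ys_bounds e1 by simp
    also have "(1 - ys) * exp (- (lam * \<delta> + 3 * p)) \<ge> (1 - ys) * (1 + - (lam * \<delta> + 3 * p))"
      using ys_bounds e1 by (intro mult_left_mono exp_ge_add_one_self) auto
    finally have 2: "(1 - ys) * (1 + - (lam * \<delta> + 3 * p)) \<le> (1 - p) ^ b" using 1 by linarith
    have "(1 - ys) * (lam * \<delta>) = ls * \<delta>" using ys_bounds(3) by (simp add: mult.commute mult.left_commute flip: mult.assoc)
    moreover have "(1 - ys) * (3 * p) \<le> 1 * (3 * p)" using ys_bounds e0 p0 by (intro mult_right_mono) auto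
    moreover have "(1 - ys) * (1 + - (lam * \<delta> + 3 * p)) = (1 - ys) - (1 - ys) * (lam * \<delta>) - (1 - ys) * (3 * p)"
      by (simp add: algebra_simps)
    ultimately have "?q \<le> ys + ls * \<delta> + 3 * p" using 2 by linarith
    then have "n * ?q \<le> n * (ys + ls * \<delta> + 3 * p)" by (intro mult_left_mono) auto
    also have "\<dots> = n * ys + n * (ls * \<delta>) + 3 * (p * n)" by (simp add: algebra_simps)
    finally show ?thesis unfolding p_n using lamb by linarith
  qed
  have nq3: "n * ?q \<le> 3 * e * n"
  proof -
    have "ls * \<delta> \<le> 1 * \<delta>" using \<delta> ls1 by (intro mult_right_mono) auto
    then have "ls * \<delta> \<le> e / 100" using \<delta> by linarith
    then have "n * (ls * \<delta>) \<le> n * (e / 100)" by (intro mult_left_mono) auto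
    moreover have "n * ys \<le> n * (2 * e)" using ys_bounds by (intro mult_left_mono) auto
    moreover have "4 \<le> e * n / 100"
    proof -
      have "10 ^ 9 \<le> e * n" using inv_n_le(2) n_pos by (simp add: field_simps)
      then show ?thesis by simp
    qed
    moreover have "0 \<le> e * n" using e0 by simp
    ultimately show ?thesis using nq by (simp add: algebra_simps)
  qed
  have gap: "4 / 5 * (e\<^sup>2 * n / ell) \<le> b - n * ?q - card S"
  proof -
    have "ls * lam \<le> 1" using ls_facts lamb by (simp add: field_simps)
    then have "9 / 10 * e \<le> 1 - ls"
    proof -
      have "1 - ls \<ge> 1 - 1 / lam" using ls_facts by simp
      moreover have "1 - 1 / lam = e / lam" using lamb lam by (simp add: field_simps)
      moreover have "e / lam \<ge> e / (11 / 10)" using lamb e0 by (intro divide_left_mono) auto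
      ultimately show ?thesis using e0 by simp
    qed
    then have "n * \<delta> * (9 / 10 * e) \<le> n * \<delta> * (1 - ls)" using \<delta> by (intro mult_left_mono) auto
    moreover have "n * \<delta> * (9 / 10 * e) = 9 / 10 * (e\<^sup>2 * n / ell)" by (simp add: \<delta>_def power2_eq_square field_simps)
    moreover have "100 * s0 \<le> e\<^sup>2 * n / ell"
    proof -
      have "e\<^sup>2 * n = sL * s0" using s0_sL n_eq e0 by (simp add: power2_eq_square power3_eq_cube mult.commute)
      moreover have "100 * ell \<le> sL" using sL_ge'(1) ell100 by simp
      then have "100 * ell * s0 \<le> sL * s0" using s0_pos by (intro mult_right_mono) auto
      ultimately show ?thesis using ell100 by (simp add: field_simps)
    qed
    moreover have "4 \<le> s0" using s0_ge by simp
    moreover have "n * \<delta> * (1 - ls) = n * \<delta> - n * (ls * \<delta>)" by (simp add: algebra_simps)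
    moreover have "n * ys + n * \<delta> \<le> b" using b(1) by (simp add: distrib_left)
    ultimately have "4 / 5 * (e\<^sup>2 * n / ell) \<le> b - (n * ys + n * (ls * \<delta>) + 4) - card S" using S by linarith
    then show ?thesis using nq by linarith
  qed
  have "rsE p (Edg V) (\<lambda>E. of_bool (real n * (ys + e / ell) < card (reach E S)))
     \<le> rsE p (Edg V) (\<lambda>E. of_bool (b \<le> card (reach E S)))"
    by (rule rsE_of_bool_mono[OF p1(3,2)]) (auto simp: b_def \<delta>_def nat_le_iff ceiling_le_iff)
  also have "\<dots> \<le> exp (\<theta> * (real (card S) - b)) * (1 + ?q * (exp \<theta> - 1)) ^ card (V - S)"
    using V p1 \<theta> by (intro reach_tail) auto
  also have "\<dots> \<le> exp (\<theta> * (real (card S) - b)) * exp (?q * (exp \<theta> - 1)) ^ n"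
  proof (intro mult_left_mono)
    have "0 \<le> ?q * (exp \<theta> - 1)" using q \<theta> by (intro mult_nonneg_nonneg) auto
    then have "(1 + ?q * (exp \<theta> - 1)) ^ card (V - S) \<le> (1 + ?q * (exp \<theta> - 1)) ^ n"
      using V by (intro power_increasing) (auto intro: order_trans[OF card_mono[OF V(1) Diff_subset]])
    also have "\<dots> \<le> exp (?q * (exp \<theta> - 1)) ^ n"
      using \<open>0 \<le> ?q * (exp \<theta> - 1)\<close> by (intro power_mono exp_ge_add_one_self) auto
    finally show "(1 + ?q * (exp \<theta> - 1)) ^ card (V - S) \<le> exp (?q * (exp \<theta> - 1)) ^ n" .
  qed auto
  also have "\<dots> = exp (\<theta> * (real (card S) - b) + n * ?q * (exp \<theta> - 1))"
    by (simp add: exp_add exp_of_nat_mult[symmetric])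
  also have "\<dots> \<le> exp (- (Lam / (100 * ell\<^sup>2)))"
  proof -
    have "exp \<theta> \<le> 1 + \<theta> + \<theta>\<^sup>2" using \<theta> by (intro exp_bound) auto
    then have "n * ?q * (exp \<theta> - 1) \<le> n * ?q * (\<theta> + \<theta>\<^sup>2)" using q by (intro mult_left_mono) auto
    also have "\<dots> \<le> \<theta> * (n * ?q) + \<theta>\<^sup>2 * (3 * e * n)"
      using mult_left_mono[OF nq3, of "\<theta>\<^sup>2"] by (simp add: algebra_simps)
    finally have 1: "n * ?q * (exp \<theta> - 1) \<le> \<theta> * (n * ?q) + \<theta>\<^sup>2 * (3 * e * n)" .
    have 2: "\<theta> * (4 / 5 * (e\<^sup>2 * n / ell)) \<le> \<theta> * (b - n * ?q - card S)" using gap \<theta> by (intro mult_left_mono) auto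
    have 3: "\<theta> * (4 / 5 * (e\<^sup>2 * n / ell)) = 1 / 15 * (Lam / ell\<^sup>2)"
      by (simp add: \<theta>_def \<delta>_def Lam_def power2_eq_square power3_eq_cube)
    have 4: "\<theta>\<^sup>2 * (3 * e * n) = 1 / 48 * (Lam / ell\<^sup>2)"
      by (simp add: \<theta>_def \<delta>_def Lam_def power2_eq_square power3_eq_cube)
    have "\<theta> * (real (card S) - b) + n * ?q * (exp \<theta> - 1) \<le> - (1 / 15 * (Lam / ell\<^sup>2)) + 1 / 48 * (Lam / ell\<^sup>2)"
      using 1 2 unfolding 3 4 by (simp add: algebra_simps)
    also have "\<dots> \<le> - (Lam / (100 * ell\<^sup>2))"
    proof -
      have "0 \<le> Lam / ell\<^sup>2" using Lam_pos by simp
      moreover have "Lam / (100 * ell\<^sup>2) = 1 / 100 * (Lam / ell\<^sup>2)" by simp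
      ultimately show ?thesis by linarith
    qed
    finally show ?thesis by simp
  qed
  finally show ?thesis .
qed

text \<open>Cap on the number of vertices explored in j h levels. The mean is of order e n exp (- mu
  (a0 - j h)); halving the exponent makes both the Markov bounds and the caps themselves
  geometrically summable backwards from \<open>a0\<close>.\<close>

definition blk :: "real \<Rightarrow> nat \<Rightarrow> real" where
  "blk c j = c * e * n * exp (- (mu * (a0 - j * h) / 2))"

definition nblk :: nat where "nblk = nat \<lfloor>a0 / h\<rfloor> + 1"

lemma s0_exp_a0: "s0 * exp (mu * a0) = e\<^sup>2 * n"
proof -
  have "exp (mu * a0) = sL" unfolding a0_bounds(3) sL_exp ..
  then have "s0 * exp (mu * a0) = Lam / e" using s0_sL by simp
  also have "\<dots> = e\<^sup>2 * n" using e0 by (simp add: Lam_def power2_eq_square power3_eq_cube)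
  finally show ?thesis .
qed

lemma nblk_bounds: "real nblk * h \<le> a0 + h" "\<And>i. real i \<le> a0 \<Longrightarrow> i div h < nblk"
proof -
  have hp: "0 < real h" using h_bounds by simp
  have fl: "0 \<le> \<lfloor>a0 / h\<rfloor>" using a0_bounds hp by simp
  then have nb: "real nblk = of_int \<lfloor>a0 / h\<rfloor> + 1" by (simp add: nblk_def)
  have "real nblk \<le> a0 / h + 1" unfolding nb by simp
  then have "real nblk * h \<le> (a0 / h + 1) * h" using hp by (intro mult_right_mono) auto
  then show "real nblk * h \<le> a0 + h" using hp by (simp add: distrib_right)
  fix i assume i: "real i \<le> a0"
  have "real (i div h * h) \<le> real i" by (simp only: of_nat_le_iff div_times_less_eq_dividend)
  then have "real (i div h) \<le> real i / h" using hp by (simp add: pos_le_divide_eq)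
  also have "\<dots> \<le> a0 / h" using i hp by (intro divide_right_mono) auto
  also have "\<dots> < real nblk" unfolding nb by linarith
  finally show "i div h < nblk" by simp
qed

lemma growth_caps:
  assumes V: "finite V" "S \<subseteq> V" "card V \<le> n" and S: "card S \<le> 6 * s0" and c: "0 < c"
  shows "rsE p (Edg V) (\<lambda>E. of_bool (\<exists>j\<in>{1..nblk}. blk c j < card (bl E S (j * h)))) \<le> 48 / c"
proof -
  have bp: "0 < blk c j" for j using c e0 n_pos by (simp add: blk_def)
  have "rsE p (Edg V) (\<lambda>E. of_bool (\<exists>j\<in>{1..nblk}. blk c j < card (bl E S (j * h))))
    \<le> rsE p (Edg V) (\<lambda>E. \<Sum>j\<in>{1..nblk}. (1 / blk c j) * real (card (bl E S (j * h))))"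
  proof (rule rsE_mono)
    fix E
    have nn: "0 \<le> (1 / blk c j) * real (card (bl E S (j * h)))" for j using bp[of j] by simp
    show "of_bool (\<exists>j\<in>{1..nblk}. blk c j < card (bl E S (j * h))) \<le> (\<Sum>j\<in>{1..nblk}. (1 / blk c j) * real (card (bl E S (j * h))))"
    proof (cases "\<exists>j\<in>{1..nblk}. blk c j < card (bl E S (j * h))")
      case True
      then obtain j where j: "j \<in> {1..nblk}" "blk c j < card (bl E S (j * h))" by auto
      have "1 \<le> (1 / blk c j) * real (card (bl E S (j * h)))" using j bp[of j] by (simp add: field_simps)
      also have "\<dots> \<le> (\<Sum>j\<in>{1..nblk}. (1 / blk c j) * real (card (bl E S (j * h))))"
        using j nn by (intro member_le_sum) auto
      finally show ?thesis using True by simp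
    next
      case False
      then show ?thesis using nn by (simp add: sum_nonneg)
    qed
  qed (use p1 in auto)
  also have "\<dots> = (\<Sum>j\<in>{1..nblk}. (1 / blk c j) * rsE p (Edg V) (\<lambda>E. real (card (bl E S (j * h)))))"
    unfolding rsE_sum rsE_cmult ..
  also have "\<dots> \<le> (\<Sum>j\<in>{1..nblk}. 6 / c * exp (- (mu * (a0 - j * h) / 2)))"
  proof (rule sum_mono)
    fix j assume "j \<in> {1..nblk}"
    have "rsE p (Edg V) (\<lambda>E. real (card (bl E S (j * h)))) \<le> card S * (lam ^ (j * h) / e)"
      using V by (rule bl_mean)
    also have "\<dots> \<le> 6 * s0 * (lam ^ (j * h) / e)" using S lamb e0 by (intro mult_right_mono) auto
    finally have "(1 / blk c j) * rsE p (Edg V) (\<lambda>E. real (card (bl E S (j * h)))) \<le> (1 / blk c j) * (6 * s0 * (lam ^ (j * h) / e))"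
      using bp[of j] by (intro mult_left_mono) auto
    also have "\<dots> = 6 / c * exp (- (mu * (a0 - j * h) / 2))"
    proof -
      define x where "x = exp (mu * (a0 - j * h) / 2)"
      have x: "0 < x" by (simp add: x_def)
      have xx: "exp (mu * (a0 - j * h)) = x * x" unfolding x_def exp_add[symmetric] by simp
      have "s0 * lam ^ (j * h) * (x * x) = s0 * exp (mu * a0)"
        unfolding lam_pow xx[symmetric] by (simp add: mult.assoc exp_add[symmetric] algebra_simps)
      then have 1: "s0 * lam ^ (j * h) * (x * x) = e\<^sup>2 * n" unfolding s0_exp_a0 .
      have bx: "blk c j = c * e * n / x" by (simp add: blk_def x_def exp_minus field_simps)
      have "(1 / blk c j) * (6 * s0 * (lam ^ (j * h) / e)) = 6 * (s0 * lam ^ (j * h) * (x * x)) / (x * (c * e * n) * e)"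
        unfolding bx using x c e0 n_pos by (simp add: field_simps)
      also have "\<dots> = 6 / c * (1 / x)" unfolding 1 using e0 n_pos c x by (simp add: power2_eq_square)
      finally show ?thesis by (simp add: x_def exp_minus inverse_eq_divide)
    qed
    finally show "(1 / blk c j) * rsE p (Edg V) (\<lambda>E. real (card (bl E S (j * h)))) \<le> 6 / c * exp (- (mu * (a0 - j * h) / 2))" .
  qed
  also have "\<dots> = 6 / c * (\<Sum>j\<in>{1..nblk}. exp (- (mu * (a0 - j * h) / 2)))" by (rule sum_distrib_left[symmetric])
  also have "(\<Sum>j\<in>{1..nblk}. exp (- (mu * (a0 - j * h) / 2))) = (\<Sum>i<nblk. exp (- (mu * (a0 - (nblk - i) * h) / 2)))"
    by (rule sum.reindex_bij_witness[of _ "\<lambda>i. nblk - i" "\<lambda>j. nblk - j"]) auto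
  also have "\<dots> \<le> (\<Sum>i<nblk. 2 * exp (- (mu * h / 2 * real i)))"
  proof (rule sum_mono)
    fix i assume "i \<in> {..<nblk}"
    then have "real (nblk - i) * h = real nblk * h - real i * h" by (simp add: of_nat_diff left_diff_distrib)
    then have "mu * (real i * h - h) \<le> mu * (a0 - (nblk - i) * h)"
      using nblk_bounds(1) mu_bounds by (intro mult_left_mono) auto
    then have "- (mu * (a0 - (nblk - i) * h) / 2) \<le> - (mu * (real i * h - h) / 2)" by simp
    also have "\<dots> = mu * h / 2 + - (mu * h / 2 * real i)" by (simp add: field_simps)
    finally have "exp (- (mu * (a0 - (nblk - i) * h) / 2)) \<le> exp (mu * h / 2 + - (mu * h / 2 * real i))"
      by simp
    also have "\<dots> = exp (mu * h / 2) * exp (- (mu * h / 2 * real i))" by (rule exp_add)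
    also have "exp (mu * h / 2) \<le> 2"
    proof -
      have "exp (mu * h / 2) ^ 2 = exp (mu * h)" by (simp add: exp_of_nat_mult[symmetric])
      also have "\<dots> \<le> exp (33 / 25)" using nu_h by simp
      also have "\<dots> \<le> 2 ^ 2" using exp_le_4 by simp
      finally show ?thesis by (rule power2_le_imp_le) simp
    qed
    finally show "exp (- (mu * (a0 - (nblk - i) * h) / 2)) \<le> 2 * exp (- (mu * h / 2 * real i))" by (simp add: mult_right_mono)
  qed
  also have "\<dots> = 2 * (\<Sum>i<nblk. exp (- (mu * h / 2 * real i)))" by (rule sum_distrib_left[symmetric])
  also have "(\<Sum>i<nblk. exp (- (mu * h / 2 * real i))) \<le> (1 + mu * h / 2) / (mu * h / 2)"
    using nu_h by (intro exp_geometric_le) auto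
  also have "(1 + mu * h / 2) / (mu * h / 2) \<le> 4" using nu_h by (simp add: field_simps)
  finally show ?thesis using c by (simp add: mult_left_mono divide_right_mono)
qed

text \<open>Guaranteed number of unexplored vertices after level i, from the growth caps up to
  \<open>a0\<close> and from saturation afterwards. The factor 2 covers the levels inside a block,
  as exp (mu h / 2) \<le> 2.\<close>

definition Nl :: "real \<Rightarrow> real \<Rightarrow> nat \<Rightarrow> real" where
  "Nl c v i = (if real i \<le> a0 then max (v - 2 * c * e * n * exp (- (mu * (a0 - i) / 2))) sat else sat)"

lemma Nl_ge: "sat \<le> Nl c v i" by (simp add: Nl_def)

lemma Nl_late: "ls * exp (- (3 * (e / ell))) \<le> p * Nl c v i"
proof -
  define d where "d = e / ell"
  have d: "0 < d" "d \<le> 1 / 1000" using e_ell by (auto simp: d_def)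
  have "p * sat = (p * n) * (1 - ys) - (p * n) * (d + 3 * d / 1000)"
    unfolding sat_def be_frac d_def by (simp add: algebra_simps)
  also have "\<dots> = ls - lam * (d + 3 * d / 1000)" unfolding p_n ys_bounds(3) ..
  finally have 0: "p * sat = ls - lam * (d + 3 * d / 1000)" .
  have "lam * (d + 3 * d / 1000) \<le> 11 / 10 * (d + 3 * d / 1000)" using lamb d by (intro mult_right_mono) auto
  then have "ls - 11 / 10 * (d + 3 * d / 1000) \<le> p * sat" unfolding 0 by simp
  moreover have "ls - 12 / 10 * d \<le> ls - 11 / 10 * (d + 3 * d / 1000)" using d by simp
  ultimately have 1: "ls - 12 / 10 * d \<le> p * sat" by (rule order_trans[rotated])
  have "ls * exp (- (3 * d)) \<le> ls * (1 - 3 / 2 * d)"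
    using one_minus_exp2[of "3 / 2 * d"] d ls_facts by (intro mult_left_mono) auto
  also have "\<dots> = ls - 3 / 2 * (ls * d)" by (simp add: algebra_simps)
  also have "\<dots> \<le> ls - 12 / 10 * d" using mult_right_mono[of "9 / 10" ls d] ls_facts d by simp
  also note 1
  also have "p * sat \<le> p * Nl c v i" using Nl_ge p0 by (intro mult_left_mono) auto
  finally show ?thesis by (simp add: d_def)
qed

lemma Nl_early:
  assumes "real i \<le> a0" "n - 3 * be \<le> v" and c: "0 < c"
  shows "lam * exp (- (2 * (3 * (e / ell) / 1000 + 2 * c * e * exp (- (mu * (a0 - i) / 2))))) \<le> p * Nl c v i"
proof -
  define x where "x = 3 * (e / ell) / 1000 + 2 * c * e * exp (- (mu * (a0 - i) / 2))"
  have x0: "0 \<le> x" using e_ell c e0 by (simp add: x_def)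
  show ?thesis
  proof (cases "x \<le> 1 / 2")
    case True
    have "n * (1 - x) = n - 3 * be - 2 * c * e * n * exp (- (mu * (a0 - i) / 2))"
      unfolding x_def be_frac by (simp add: algebra_simps)
    also have "\<dots> \<le> Nl c v i" using assms by (simp add: Nl_def)
    finally have "p * (n * (1 - x)) \<le> p * Nl c v i" using p0 by (intro mult_left_mono) auto
    then have "(p * n) * (1 - x) \<le> p * Nl c v i" by (simp only: mult.assoc)
    then have "lam * (1 - x) \<le> p * Nl c v i" unfolding p_n .
    moreover have "lam * exp (- (2 * x)) \<le> lam * (1 - x)" using one_minus_exp2[OF x0 True] lamb by (intro mult_left_mono) auto
    ultimately show ?thesis unfolding x_def by linarith
  next
    \<comment> \<open>Here the cap says nothing and the bound by \<open>sat\<close> takes over,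
      since exp (- 2 x) is at most 1 / 2 and thus below 1 - 3 e.\<close>
    case False
    have "exp (- (2 * x)) \<le> 1 / (1 + 2 * x)" using x0 by (intro exp_neg_le) auto
    also have "\<dots> \<le> 1 / 2" using False by (intro divide_left_mono) auto
    also have "\<dots> \<le> 1 - 3 * e" using e1 by simp
    finally have "lam * exp (- (2 * x)) \<le> lam * (1 - 3 * e)" using lamb by (intro mult_left_mono) auto
    also have "\<dots> = p * (n * (1 - 3 * e))" using p_n by (simp flip: mult.assoc)
    also have "\<dots> \<le> p * Nl c v i" using sat_ge Nl_ge[of c v i] p0 by (intro mult_left_mono) auto
    finally show ?thesis unfolding x_def .
  qed
qed

definition i0 :: nat where "i0 = nat \<lceil>a0\<rceil>"

lemma i0_bounds: "a0 \<le> i0" "real i0 \<le> a0 + 1" "real i0 < a0 + 1" "real i0 * e \<le> ell"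
proof -
  have "0 \<le> a0" using a0_bounds by simp
  then have r: "real i0 = of_int \<lceil>a0\<rceil>" unfolding i0_def by simp
  show "a0 \<le> i0" "real i0 \<le> a0 + 1" "real i0 < a0 + 1" unfolding r by linarith+
  then have "real i0 * e \<le> (a0 + 1) * e" using e0 by (intro mult_right_mono) auto
  then show "real i0 * e \<le> ell" using a0_bounds(2) e1 ell100 by (simp add: algebra_simps)
qed

text \<open>The relative losses sum to at most 1 + 10 c: the caps form a geometric series ending at
  \<open>a0\<close> with ratio exp (- mu / 2), and its sum of order 1 / e cancels their factor
  e.\<close>

lemma early_product:
  assumes "i \<le> i0" "n - 3 * be \<le> v" and c: "0 < c"
  shows "lam ^ i * exp (- (1 + 10 * c)) \<le> (\<Prod>j<i. p * Nl c v j)"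
proof -
  define x where "x = (\<lambda>j::nat. 3 * (e / ell) / 1000 + 2 * c * e * exp (- (mu * (a0 - j) / 2)))"
  have S: "(\<Sum>j<i. 2 * x j) \<le> 1 + 10 * c"
  proof -
    have "(\<Sum>j<i. exp (- (mu * (a0 - j) / 2))) \<le> (\<Sum>j<i0. exp (- (mu * (a0 - j) / 2)))"
      using assms by (intro sum_mono2) auto
    also have "\<dots> = (\<Sum>m<i0. exp (- (mu * (a0 - (i0 - Suc m)) / 2)))" by (rule sum.nat_diff_reindex[symmetric])
    also have "\<dots> \<le> (\<Sum>m<i0. exp (- (mu / 2 * real m)))"
    proof (rule sum_mono)
      fix m assume "m \<in> {..<i0}"
      then have "real (i0 - Suc m) = real i0 - 1 - m" by (simp add: of_nat_diff)
      then have "mu * real m \<le> mu * (a0 - (i0 - Suc m))" using i0_bounds mu_bounds by (intro mult_left_mono) auto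
      then show "exp (- (mu * (a0 - (i0 - Suc m)) / 2)) \<le> exp (- (mu / 2 * real m))" by simp
    qed
    also have "\<dots> \<le> (1 + mu / 2) / (mu / 2)" using mu_bounds by (intro exp_geometric_le) auto
    also have "\<dots> = 2 / mu + 1" using mu_bounds by (simp add: field_simps)
    also have "\<dots> \<le> 2 / (9 / 10 * e) + 1" using mu_bounds e0 by (intro add_right_mono divide_left_mono) auto
    also have "\<dots> \<le> 5 / 2 / e" using e0 e1 by (simp add: field_simps)
    finally have g: "(\<Sum>j<i. exp (- (mu * (a0 - j) / 2))) \<le> 5 / 2 / e" .
    have "(\<Sum>j<i. 2 * x j) = i * (6 * (e / ell) / 1000) + 4 * c * e * (\<Sum>j<i. exp (- (mu * (a0 - j) / 2)))"
      by (simp add: x_def sum.distrib sum_distrib_left algebra_simps)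
    also have "\<dots> \<le> 1 + 4 * c * e * (5 / 2 / e)"
    proof (intro add_mono mult_left_mono g)
      have "real i * e \<le> real i0 * e" using assms e0 by (intro mult_right_mono) auto
      then have "real i * e \<le> ell" using i0_bounds(4) by linarith
      then show "i * (6 * (e / ell) / 1000) \<le> 1" using ell100 by (simp add: field_simps)
    qed (use c e0 in auto)
    also have "\<dots> = 1 + 10 * c" using e0 by simp
    finally show ?thesis .
  qed
  have "lam ^ i * exp (- (1 + 10 * c)) \<le> lam ^ i * exp (- (\<Sum>j<i. 2 * x j))"
    using S lamb by (intro mult_left_mono) auto
  also have "\<dots> = (\<Prod>j<i. lam * exp (- (2 * x j)))"
    by (simp add: prod.distrib exp_sum sum_negf[symmetric] flip: exp_sum)
  also have "\<dots> \<le> (\<Prod>j<i. p * Nl c v j)"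
  proof (rule prod_mono)
    fix j assume "j \<in> {..<i}"
    then have "real j + 1 \<le> i0" using assms by simp
    then have "real j \<le> a0" using i0_bounds by linarith
    then show "0 \<le> lam * exp (- (2 * x j)) \<and> lam * exp (- (2 * x j)) \<le> p * Nl c v j"
      unfolding x_def using Nl_early[OF _ assms(2) c] lamb by simp
  qed
  finally show ?thesis .
qed

text \<open>Growth by a factor \<open>sL\<close> until \<open>a0\<close>, then decay by
  \<open>ls\<close> per level; the margin e / ell in \<open>sat\<close> costs at most exp 15 over
  the time horizon.\<close>

lemma late_product:
  assumes "i0 \<le> i" "n - 3 * be \<le> v" and c: "0 < c" and i: "real i * e \<le> 5 * ell"
  shows "sL * exp (- (16 + 10 * c)) * exp (- (nu * (i - a0))) \<le> (\<Prod>j<i. p * Nl c v j)"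
proof -
  have pos: "0 < p * Nl c v j" for j using Nl_ge[of c v j] sat_pos p0 by simp
  have "sL \<le> lam ^ i0"
  proof -
    have "mu * a0 \<le> mu * i0" using i0_bounds mu_bounds by (intro mult_left_mono) auto
    then show ?thesis unfolding sL_exp lam_pow using a0_bounds(3) by simp
  qed
  then have "sL * exp (- (1 + 10 * c)) \<le> lam ^ i0 * exp (- (1 + 10 * c))" by (intro mult_right_mono) auto
  also have "\<dots> \<le> (\<Prod>j<i0. p * Nl c v j)" using assms by (intro early_product) auto
  finally have 1: "sL * exp (- (1 + 10 * c)) \<le> (\<Prod>j<i0. p * Nl c v j)" .
  have "exp (- (nu * (i - a0))) * exp (- 15) \<le> (ls * exp (- (3 * (e / ell)))) ^ (i - i0)"
  proof -
    have "nu * (i - i0) \<le> nu * (real i - a0)" using assms i0_bounds nu_bounds by (intro mult_left_mono) (auto simp: of_nat_diff)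
    moreover have "3 * (e / ell) * (i - i0) \<le> 15"
    proof -
      have "real (i - i0) * e \<le> real i * e" using e0 by (intro mult_right_mono) auto
      then have "real (i - i0) * e \<le> 5 * ell" using i by linarith
      then show ?thesis using ell100 by (simp add: field_simps)
    qed
    ultimately have "exp (- (nu * (i - a0)) + - 15) \<le> exp (- nu * (i - i0) + - (3 * (e / ell) * (i - i0)))" by simp
    also have "\<dots> = (ls * exp (- (3 * (e / ell)))) ^ (i - i0)"
      unfolding exp_add power_mult_distrib ls_pow by (simp add: exp_of_nat_mult[symmetric] mult.commute)
    finally show ?thesis by (simp only: exp_add)
  qed
  also have "\<dots> = (\<Prod>j\<in>{i0..<i}. ls * exp (- (3 * (e / ell))))" by simp
  also have "\<dots> \<le> (\<Prod>j\<in>{i0..<i}. p * Nl c v j)"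
    using Nl_late ls_facts by (intro prod_mono) auto
  finally have 2: "exp (- (nu * (i - a0))) * exp (- 15) \<le> (\<Prod>j\<in>{i0..<i}. p * Nl c v j)" .
  have "(sL * exp (- (1 + 10 * c))) * (exp (- (nu * (i - a0))) * exp (- 15)) \<le> (\<Prod>j<i0. p * Nl c v j) * (\<Prod>j\<in>{i0..<i}. p * Nl c v j)"
    using 1 2 pos sL_pos by (intro mult_mono prod_nonneg) (auto intro: less_imp_le)
  also have "\<dots> = (\<Prod>j<i. p * Nl c v j)"
  proof -
    have "{..<i} = {..<i0} \<union> {i0..<i}" using assms by auto
    then show ?thesis by (simp add: prod.union_disjoint ivl_disj_int)
  qed
  also have "(sL * exp (- (1 + 10 * c))) * (exp (- (nu * (i - a0))) * exp (- 15)) = sL * (exp (- (1 + 10 * c)) * exp (- 15)) * exp (- (nu * (i - a0)))"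
    by (simp only: ac_simps)
  also have "exp (- (1 + 10 * c)) * exp (- 15) = exp (- (16 + 10 * c))" by (simp add: exp_add[symmetric])
  finally show ?thesis .
qed

lemma exp_mu_h2: "exp (mu * h / 2) \<le> 2"
proof -
  have "exp (mu * h / 2) ^ 2 = exp (mu * h)" by (simp add: exp_of_nat_mult[symmetric])
  also have "\<dots> \<le> exp (33 / 25)" using nu_h by simp
  also have "\<dots> \<le> 2 ^ 2" using exp_le_4 by simp
  finally show ?thesis by (rule power2_le_imp_le) simp
qed

text \<open>In \<open>lg_recip\<close> the early levels contribute order 1 / e and the levels near k
  order exp (nu (k - a0)) / (e sL). With k at K / nu before a0 + t and after multiplication by s0,
  this leaves an exponent of the order of the smaller of \<open>sL\<close> and exp K, up to
  constants depending on c.\<close>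

lemma lg_lower:
  assumes v: "n - 3 * be \<le> v" and c: "0 < c" and k: "i0 \<le> k" "real k * e \<le> 5 * ell" "nu * (k - a0) \<le> ell - K"
  shows "exp (- (16 + 10 * c)) / (1 / sL + 3 * exp (- K)) \<le> s0 * lg p e (Nl c v) k"
proof -
  define D where "D = exp (- (16 + 10 * c))"
  define Q where "Q = exp (nu * (k - a0))"
  have recip_exp: "1 / (A * exp (- x)) = (1 / A) * exp x" for A x :: real
    by (simp add: exp_minus divide_inverse)
  have D: "0 < D" and Q0: "0 < Q" by (simp_all add: D_def Q_def)
  define PP where "PP = (\<lambda>i. \<Prod>j<i. p * Nl c v j)"
  have pos: "0 < Nl c v j" for j using Nl_ge[of c v j] sat_pos by simp
  have early: "D * lam ^ i \<le> PP i" if "i \<le> i0" for i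
  proof -
    have "D * lam ^ i \<le> exp (- (1 + 10 * c)) * lam ^ i" using lamb by (intro mult_right_mono) (auto simp: D_def)
    also have "\<dots> \<le> PP i" unfolding PP_def using early_product[OF that v c] by (simp add: mult.commute)
    finally show ?thesis .
  qed
  have late: "D * sL * exp (- (nu * (i - a0))) \<le> PP i" if "i0 \<le> i" "i \<le> k" for i
  proof -
    have "real i * e \<le> real k * e" using that e0 by (intro mult_right_mono) auto
    then have "real i * e \<le> 5 * ell" using k by linarith
    from late_product[OF that(1) v c this] show ?thesis by (simp add: PP_def D_def ac_simps)
  qed
  have termb: "1 / PP (Suc i) \<le> (1 / D) * (1 / lam) * (1 / lam) ^ i + (1 / (D * sL)) * exp (nu * (Suc i - a0))"
    if "i < k" for i
  proof (cases "Suc i \<le> i0")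
    case True
    have "1 / PP (Suc i) \<le> 1 / (D * lam ^ Suc i)"
      using early[OF True] D lamb by (intro divide_left_mono) (auto intro!: mult_pos_pos less_le_trans[OF _ early[OF True]] simp del: power_Suc)
    also have "\<dots> = (1 / D) * (1 / lam) * (1 / lam) ^ i" by (simp add: power_divide)
    finally show ?thesis using D sL_pos by (simp add: add_increasing2)
  next
    case False
    then have i: "i0 \<le> Suc i" "Suc i \<le> k" using that by auto
    have "0 < D * sL * exp (- (nu * (Suc i - a0)))" using D sL_pos by simp
    then have "1 / PP (Suc i) \<le> 1 / (D * sL * exp (- (nu * (Suc i - a0))))"
      using late[OF i] by (intro divide_left_mono) (auto intro!: mult_pos_pos less_le_trans[OF _ late[OF i]])
    also have "\<dots> = (1 / (D * sL)) * exp (nu * (Suc i - a0))" by (rule recip_exp)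
    finally show ?thesis using D lamb by (simp add: add_increasing)
  qed
  have S1: "(\<Sum>i<k. (1 / lam) ^ i) \<le> lam / e"
  proof -
    have "(\<Sum>i<k. (1 / lam) ^ i) \<le> 1 / (1 - 1 / lam)" using lamb by (intro geometric_sum_le) auto
    also have "1 - 1 / lam = (lam - 1) / lam" using lamb by (simp add: diff_divide_distrib)
    also have "lam - 1 = e" using lam by linarith
    finally show ?thesis using lamb by simp
  qed
  have S2: "(\<Sum>i<k. exp (nu * (Suc i - a0))) \<le> Q * (2 / e)"
  proof -
    have "(\<Sum>i<k. exp (nu * (Suc i - a0))) = (\<Sum>m<k. exp (nu * (Suc (k - Suc m) - a0)))"
      by (rule sum.nat_diff_reindex[symmetric])
    also have "\<dots> = (\<Sum>m<k. Q * exp (- (nu * real m)))"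
    proof (intro sum.cong refl)
      fix m assume "m \<in> {..<k}"
      then have "real (Suc (k - Suc m)) = real k - m" by (simp add: of_nat_diff)
      then show "exp (nu * (Suc (k - Suc m) - a0)) = Q * exp (- (nu * real m))"
        unfolding Q_def exp_add[symmetric] by (simp add: algebra_simps)
    qed
    also have "\<dots> = Q * (\<Sum>m<k. exp (- (nu * real m)))" by (rule sum_distrib_left[symmetric])
    also have "\<dots> \<le> Q * ((1 + nu) / nu)" using nu_bounds Q0 by (intro mult_left_mono exp_geometric_le) auto
    also have "(1 + nu) / nu \<le> 2 / e"
    proof -
      have "(1 + nu) / nu = 1 / nu + 1" using nu_bounds by (simp add: field_simps)
      also have "\<dots> \<le> 1 / (9 / 10 * e) + 1" using nu_bounds e0 by (intro add_right_mono divide_left_mono) auto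
      also have "\<dots> \<le> 2 / e" using e0 e1 by (simp add: field_simps)
      finally show ?thesis .
    qed
    finally show ?thesis using Q0 by (simp add: mult_left_mono)
  qed
  have "(\<Sum>i<k. 1 / PP (Suc i)) \<le> (\<Sum>i<k. (1 / D) * (1 / lam) * (1 / lam) ^ i + (1 / (D * sL)) * exp (nu * (Suc i - a0)))"
    using termb by (intro sum_mono) auto
  also have "\<dots> = (1 / D) * (1 / lam) * (\<Sum>i<k. (1 / lam) ^ i) + (1 / (D * sL)) * (\<Sum>i<k. exp (nu * (Suc i - a0)))"
    by (simp add: sum.distrib sum_distrib_left)
  also have "\<dots> \<le> (1 / D) * (1 / lam) * (lam / e) + (1 / (D * sL)) * (Q * (2 / e))"
    using S1 S2 D lamb sL_pos by (intro add_mono mult_left_mono) auto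
  also have "\<dots> = 1 / (D * e) + 2 * Q / (D * sL * e)" using lamb by simp
  finally have A: "(\<Sum>i<k. 1 / PP (Suc i)) \<le> 1 / (D * e) + 2 * Q / (D * sL * e)" .
  have dk: "0 < D * sL * exp (- (nu * (k - a0)))" using D sL_pos by simp
  have PPk: "0 < PP k" using less_le_trans[OF dk late[OF k(1) order_refl]] .
  have "1 / (e * PP k) \<le> 1 / (e * (D * sL * exp (- (nu * (k - a0)))))"
    by (rule divide_left_mono[OF mult_left_mono[OF late[OF k(1) order_refl]] _ mult_pos_pos[OF mult_pos_pos[OF e0 PPk] mult_pos_pos[OF e0 dk]]]) (use e0 in auto)
  also have "\<dots> = Q / (D * sL * e)"
    using recip_exp[of "e * (D * sL)" "nu * (k - a0)"] by (simp add: Q_def ac_simps)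
    finally have B: "1 / (e * PP k) \<le> Q / (D * sL * e)" .
  have lg: "0 < lg p e (Nl c v) k" "1 / lg p e (Nl c v) k \<le> 1 / (e * PP k) + (\<Sum>i<k. 1 / PP (Suc i))"
    unfolding PP_def using lg_recip[OF p0 e0, of "Nl c v" k] pos by auto
  have "Q \<le> exp (ell - K)" using k by (simp add: Q_def)
  also have "\<dots> = sL * sL * exp (- K)" unfolding sL_sq exp_ell[symmetric] exp_add[symmetric] by simp
  finally have Q: "Q \<le> sL * sL * exp (- K)" .
  have "1 / lg p e (Nl c v) k \<le> 1 / (D * e) + 3 * Q / (D * sL * e)" using lg A B by (simp add: add_divide_distrib)
  also have "\<dots> \<le> 1 / (D * e) + 3 * (sL * sL * exp (- K)) / (D * sL * e)"
    using Q D sL_pos e0 by (intro add_left_mono divide_right_mono) auto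
  also have "\<dots> = (1 / sL + 3 * exp (- K)) * (sL / (D * e))" using sL_pos D e0 by (simp add: field_simps)
  finally have "1 / lg p e (Nl c v) k \<le> (1 / sL + 3 * exp (- K)) * (sL / (D * e))" .
  moreover have x: "0 < 1 / sL + 3 * exp (- K)" using sL_pos by (intro add_pos_pos) auto
  ultimately have "1 \<le> (1 / sL + 3 * exp (- K)) * (sL / (D * e)) * lg p e (Nl c v) k"
    using lg(1) by (simp add: divide_le_eq)
  also have "sL / (D * e) = s0 / D" unfolding e_s0[symmetric] using e0 by simp
  finally have "1 \<le> (1 / sL + 3 * exp (- K)) * (s0 / D) * lg p e (Nl c v) k" .
  then have "D \<le> (s0 * lg p e (Nl c v) k) * (1 / sL + 3 * exp (- K))" using D by (simp add: field_simps)
  then show ?thesis using x by (simp add: D_def pos_divide_le_eq)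
qed

lemma caps_hold:
  assumes V: "finite V" "S \<subseteq> V" "n - 3 * be \<le> card V" and c: "0 < c" and E: "E \<subseteq> Edg V"
    and sat: "card (reach E S) \<le> real n * (ys + e / ell)"
    and gr: "\<And>j. j \<in> {1..nblk} \<Longrightarrow> card (bl E S (j * h)) \<le> blk c j"
  shows "Nl c (card V) i \<le> real (card V) - card (bl E S (Suc i))"
proof -
  have fR: "finite (reach E S)" using finite_subset[OF reach_subset[OF E V(2)] V(1)] .
  have "card (bl E S (Suc i)) \<le> card (reach E S)" using fR bl_subset_reach by (intro card_mono)
  then have 1: "sat \<le> real (card V) - card (bl E S (Suc i))" using sat V unfolding sat_def by linarith
  show ?thesis
  proof (cases "real i \<le> a0")
    case True
    define j where "j = i div h + 1"
    have j: "j \<in> {1..nblk}" using nblk_bounds(2)[OF True] by (simp add: j_def)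
    have hp: "0 < h" using h_bounds by simp
    have jh: "j * h = i div h * h + h" by (simp add: j_def)
    have "i div h * h + i mod h = i" "i mod h < h" using hp by simp_all
    then have ij: "Suc i \<le> j * h" "j * h \<le> i + h" unfolding jh by linarith+
    have "bl E S (j * h) \<subseteq> V" using bl_subset[OF E V(2)] .
    then have "finite (bl E S (j * h))" using V finite_subset by auto
    then have "card (bl E S (Suc i)) \<le> card (bl E S (j * h))" using ij by (intro card_mono bl_mono)
    then have "real (card (bl E S (Suc i))) \<le> blk c j" using gr[OF j] by linarith
    also have "\<dots> \<le> c * e * n * (2 * exp (- (mu * (a0 - i) / 2)))"
      unfolding blk_def
    proof (intro mult_left_mono)
      have "real (j * h) \<le> real (i + h)" using ij(2) by (simp only: of_nat_le_iff)
      then have "real (j * h) \<le> real i + h" by simp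
      then have "mu * (a0 - i) - mu * h \<le> mu * (a0 - j * h)"
        using mult_left_mono[of "a0 - i - h" "a0 - real (j * h)" mu] mu_bounds by (simp add: algebra_simps)
      then have "- (mu * (a0 - j * h) / 2) \<le> mu * h / 2 + - (mu * (a0 - i) / 2)" by linarith
      then have "exp (- (mu * (a0 - j * h) / 2)) \<le> exp (mu * h / 2 + - (mu * (a0 - i) / 2))" by simp
      also have "\<dots> = exp (mu * h / 2) * exp (- (mu * (a0 - i) / 2))" by (rule exp_add)
      also have "\<dots> \<le> 2 * exp (- (mu * (a0 - i) / 2))" using exp_mu_h2 by (intro mult_right_mono) auto
      finally show "exp (- (mu * (a0 - j * h) / 2)) \<le> 2 * exp (- (mu * (a0 - i) / 2))" .
    qed (use c e0 in auto)
    finally have "real (card V) - 2 * c * e * n * exp (- (mu * (a0 - i) / 2)) \<le> real (card V) - card (bl E S (Suc i))"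
      by simp
    then show ?thesis using 1 by (simp add: Nl_def)
  qed (use 1 in \<open>simp add: Nl_def\<close>)
qed

text \<open>The weight \<open>\<omega>\<close> = e makes exp (1 - e card) dominate the indicator of
  a level below 1 / e; failures of the caps are split off beforehand. The factor in
  \<open>laplace_lower\<close> for the used vertices is at least 3 / 5, as these number at most 3 e
  n.\<close>

lemma chain_lives:
  assumes V: "finite V" "S \<subseteq> V" "card V \<le> n" "n - 3 * be \<le> card V" and S: "s0 \<le> card S" "card S \<le> 6 * s0"
    and c: "0 < c" and k: "i0 \<le> k" "real k * e \<le> 5 * ell" "nu * (k - a0) \<le> ell - K"
  shows "rsE p (Edg V) (\<lambda>E. of_bool (card (lev E S k) < 1 / e))
    \<le> 48 / c + exp (- (Lam / (100 * ell\<^sup>2))) + exp (1 - 3 / 5 * (exp (- (16 + 10 * c)) / (1 / sL + 3 * exp (- K))))"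
proof -
  define B1 where "B1 = (\<lambda>E. \<exists>j\<in>{1..nblk}. blk c j < card (bl E S (j * h)))"
  define B2 where "B2 = (\<lambda>E. real n * (ys + e / ell) < card (reach E S))"
  define G where "G = (\<lambda>E. of_bool (\<forall>i<k. Nl c (card V) i \<le> real (card V) - card (bl E S (Suc i))) * exp (- (e * card (lev E S k))))"
  define vmin where "vmin = real n * (1 - 3 * e)"
  have vm: "0 \<le> vmin" "vmin \<le> card V" "\<And>i. vmin \<le> Nl c (card V) i"
  proof -
    show "0 \<le> vmin" using e1 by (simp add: vmin_def)
    show "vmin \<le> Nl c (card V) i" for i using sat_ge Nl_ge[of c "card V" i] by (simp add: vmin_def)
    have "be \<le> e * n" using be_le be_pos by simp
    then have "3 * be \<le> n * (3 * e)" by (simp add: mult.commute)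
    then show "vmin \<le> card V" using V by (simp add: vmin_def algebra_simps)
  qed
  have "rsE p (Edg V) (\<lambda>E. of_bool (card (lev E S k) < 1 / e))
    \<le> rsE p (Edg V) (\<lambda>E. of_bool (B1 E) + of_bool (B2 E) + exp 1 * G E)"
  proof (rule rsE_mono)
    fix E assume E: "E \<subseteq> Edg V"
    have G0: "0 \<le> exp 1 * G E" by (simp add: G_def)
    show "of_bool (card (lev E S k) < 1 / e) \<le> of_bool (B1 E) + of_bool (B2 E) + exp 1 * G E"
    proof (cases "B1 E \<or> B2 E")
      case True
      have "of_bool (card (lev E S k) < 1 / e) \<le> (1::real)" by simp
      also have "1 \<le> of_bool (B1 E) + (of_bool (B2 E) :: real)" using True by auto
      finally show ?thesis using G0 by linarith
    next
      case False
      then have caps: "\<forall>i<k. Nl c (card V) i \<le> real (card V) - card (bl E S (Suc i))"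
        using caps_hold[OF V(1,2,4) c E] unfolding B1_def B2_def by (meson not_less)
      show ?thesis
      proof (cases "card (lev E S k) < 1 / e")
        case True
        then have "e * card (lev E S k) \<le> 1" using e0 by (simp add: field_simps)
        then have "exp 1 * exp (- 1) \<le> exp 1 * exp (- (e * card (lev E S k)))" by (intro mult_left_mono) auto
        then have "1 \<le> exp 1 * G E" using caps by (simp add: G_def exp_add[symmetric])
        then show ?thesis using True by simp
      qed (use G0 in simp)
    qed
  qed (use p1 in auto)
  also have "\<dots> = rsE p (Edg V) (\<lambda>E. of_bool (B1 E)) + rsE p (Edg V) (\<lambda>E. of_bool (B2 E)) + exp 1 * rsE p (Edg V) G"
    by (simp add: rsE_add rsE_cmult)
  also have "\<dots> \<le> 48 / c + exp (- (Lam / (100 * ell\<^sup>2))) + exp 1 * exp (- (3 / 5 * (exp (- (16 + 10 * c)) / (1 / sL + 3 * exp (- K)))))"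
  proof (intro add_mono mult_left_mono)
    show "rsE p (Edg V) (\<lambda>E. of_bool (B1 E)) \<le> 48 / c"
      unfolding B1_def using V(1-3) S(2) c by (rule growth_caps)
    show "rsE p (Edg V) (\<lambda>E. of_bool (B2 E)) \<le> exp (- (Lam / (100 * ell\<^sup>2)))"
      unfolding B2_def using V(1-3) S(2) by (rule saturation)
    have "rsE p (Edg V) G \<le> exp (- (card S * lg p e (Nl c (card V)) k * exp (- (p * (card V - vmin)))))"
      unfolding G_def using p1 e0 vm V by (intro laplace_lower) auto
    also have "\<dots> \<le> exp (- (3 / 5 * (exp (- (16 + 10 * c)) / (1 / sL + 3 * exp (- K)))))"
    proof -
      have lgp: "0 \<le> lg p e (Nl c (card V)) k"
        using lg_nonneg p1 e0 order_trans[OF vm(1) vm(3)] by simp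
      have "p * (card V - vmin) \<le> p * (n * (3 * e))"
        using V p0 by (intro mult_left_mono) (auto simp: vmin_def algebra_simps)
      also have "\<dots> = lam * (3 * e)" using p_n by (simp flip: mult.assoc)
      also have "\<dots> \<le> 11 / 10 * (3 / 10)" using lamb e0 e1 by (intro mult_mono) auto
      finally have "1 - 11 / 10 * (3 / 10) \<le> exp (- (p * (card V - vmin)))"
        using exp_ge_add_one_self[of "- (p * (card V - vmin))"] by linarith
      then have x: "3 / 5 \<le> exp (- (p * (card V - vmin)))" by simp
      have "exp (- (16 + 10 * c)) / (1 / sL + 3 * exp (- K)) \<le> s0 * lg p e (Nl c (card V)) k"
        using V(4) c k by (rule lg_lower)
      also have "\<dots> \<le> card S * lg p e (Nl c (card V)) k" using S lgp by (intro mult_right_mono) auto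
      finally have y: "exp (- (16 + 10 * c)) / (1 / sL + 3 * exp (- K)) \<le> card S * lg p e (Nl c (card V)) k" .
      have "exp (- (16 + 10 * c)) / (1 / sL + 3 * exp (- K)) * (3 / 5) \<le> card S * lg p e (Nl c (card V)) k * exp (- (p * (card V - vmin)))"
        using x y lgp by (intro mult_mono) auto
      then show ?thesis by (simp add: mult.commute)
    qed
    finally show "rsE p (Edg V) G \<le> exp (- (3 / 5 * (exp (- (16 + 10 * c)) / (1 / sL + 3 * exp (- K)))))" .
  qed auto
  finally show ?thesis by (simp add: exp_add[symmetric])
qed

end

section \<open>The upper bound\<close>

text \<open>Lets an event seen from S be read off in the graph from which B has been removed: no
  edge revealed around S has an end in B.\<close>

lemma touch_del_far:
  assumes E: "E \<subseteq> Edg V" and far: "\<And>j. j \<le> k \<Longrightarrow> lev E S j \<inter> B = {}"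
  shows "touch (del E B) (bl E S k) = touch E (bl E S k)"
proof
  show "touch (del E B) (bl E S k) \<subseteq> touch E (bl E S k)" by (auto simp: touch_def del_def)
  show "touch E (bl E S k) \<subseteq> touch (del E B) (bl E S k)"
  proof
    fix d assume d: "d \<in> touch E (bl E S k)"
    then have dE: "d \<in> E" by (simp add: touch_def)
    obtain x where x: "x \<in> d" "x \<in> bl E S k" using d by (auto simp: touch_def)
    obtain y where y: "d = {x, y}" using dE E x(1) by (auto simp: Edg_def card_2_iff)
    obtain j where j: "j < k" "x \<in> lev E S j" using x(2) by (auto simp: bl_def)
    obtain s where s: "s \<in> S" "wlk E j s x" using j(2) by (auto simp: lev_def)
    have "wlk E (j + Suc 0) s y" using s(2) dE y unfolding wlk_add by auto
    then obtain i where i: "i \<le> j + Suc 0" "y \<in> lev E S i" using wlk_imp_lev[OF s(1)] by blast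
    have "x \<notin> B" using far[of j] j by auto
    moreover have "y \<notin> B" using far[of i] i j by auto
    ultimately have "d \<in> del E B" using dE y by (simp add: del_def)
    then show "d \<in> touch (del E B) (bl E S k)" using d by (simp add: touch_def)
  qed
qed

lemma bl_disjoint: "(\<And>i. i < a \<Longrightarrow> X \<inter> lev E S i = {}) \<Longrightarrow> X \<inter> bl E S a = {}"
  unfolding bl_def by blast

text \<open>D carries the conditions on the first g levels, whose sizes are otherwise free. Together
  with \<open>unhit\<close> this classifies an exploration that is alive at a given time by its
  first large level from g on.\<close>

definition first_hit :: "real \<Rightarrow> ('a set set \<Rightarrow> bool) \<Rightarrow> nat \<Rightarrow> 'a \<Rightarrow> nat \<Rightarrow> 'a set set \<Rightarrow> bool" where
  "first_hit s D g w b E \<longleftrightarrow> D E \<and> (\<forall>j. g \<le> j \<and> j < b \<longrightarrow> real (card (lev E {w} j)) < s) \<and> s \<le> real (card (lev E {w} b))"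

definition unhit :: "real \<Rightarrow> ('a set set \<Rightarrow> bool) \<Rightarrow> nat \<Rightarrow> 'a \<Rightarrow> nat \<Rightarrow> 'a set set \<Rightarrow> bool" where
  "unhit s D g w k E \<longleftrightarrow> D E \<and> lev E {w} k \<noteq> {} \<and> (\<forall>j. g \<le> j \<and> j < k \<longrightarrow> real (card (lev E {w} j)) < s)"

lemma first_hit_local:
  assumes "local_at g {w} D" "g \<le> b"
  shows "local_at b {w} (first_hit s D g w b)"
proof -
  have 1: "local_at b {w} D" using assms by (rule local_at_mono)
  have 2: "local_at b {w} (\<lambda>E. \<forall>j\<in>{g..<b}. real (card (lev E {w} j)) < s)"
    by (intro local_at_All local_at_comp1[OF local_at_lev]) simp
  have 3: "local_at b {w} (\<lambda>E. s \<le> real (card (lev E {w} b)))"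
    by (intro local_at_comp1[OF local_at_lev]) simp
  have "local_at b {w} (\<lambda>E. D E \<and> (\<forall>j\<in>{g..<b}. real (card (lev E {w} j)) < s) \<and> s \<le> real (card (lev E {w} b)))"
    by (intro local_at_comp[OF 1 local_at_comp[OF 2 3]])
  moreover have "first_hit s D g w b = (\<lambda>E. D E \<and> (\<forall>j\<in>{g..<b}. real (card (lev E {w} j)) < s) \<and> s \<le> real (card (lev E {w} b)))"
    by (rule ext) (auto simp: first_hit_def)
  ultimately show ?thesis by simp
qed

lemma first_hit_unique:
  assumes "first_hit s D g w b E" "first_hit s D g w b' E" "g \<le> b" "g \<le> b'"
  shows "b = b'"
proof (rule ccontr)
  assume "b \<noteq> b'"
  then consider "b < b'" | "b' < b" by linarith
  then show False
  proof cases
    case 1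
    then have "real (card (lev E {w} b)) < s" using assms unfolding first_hit_def by blast
    then show False using assms(1) unfolding first_hit_def by linarith
  next
    case 2
    then have "real (card (lev E {w} b')) < s" using assms unfolding first_hit_def by blast
    then show False using assms(2) unfolding first_hit_def by linarith
  qed
qed

lemma first_hit_imp_unhit:
  assumes "first_hit s D g w b E" "k \<le> b" "0 < s"
  shows "unhit s D g w k E"
proof -
  have "lev E {w} b \<noteq> {}" using assms by (auto simp: first_hit_def)
  then have "lev E {w} k \<noteq> {}" using lev_empty_mono[OF _ assms(2)] by blast
  then show ?thesis using assms(1,2) by (auto simp: first_hit_def unhit_def)
qed

lemma sum_first_hit_le:
  assumes "g \<le> k" "0 < s"
  shows "(\<Sum>b\<in>{k..<k'}. of_bool (first_hit s D g w b E)) \<le> (of_bool (unhit s D g w k E) :: real)"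
proof (cases "\<exists>b\<in>{k..<k'}. first_hit s D g w b E")
  case True
  then obtain b where b: "b \<in> {k..<k'}" "first_hit s D g w b E" by blast
  have "(\<Sum>b'\<in>{k..<k'}. of_bool (first_hit s D g w b' E)) = (\<Sum>b'\<in>{k..<k'}. if b' = b then 1 else (0::real))"
  proof (rule sum.cong[OF refl])
    fix b' assume "b' \<in> {k..<k'}"
    then have "g \<le> b'" "g \<le> b" using b(1) assms(1) by simp_all
    then have "first_hit s D g w b' E \<longleftrightarrow> b' = b" using first_hit_unique[OF _ b(2)] b(2) by metis
    then show "of_bool (first_hit s D g w b' E) = (if b' = b then 1 else (0::real))" by simp
  qed
  also have "\<dots> = 1" using b(1) by simp
  also have "\<dots> \<le> of_bool (unhit s D g w k E)" using first_hit_imp_unhit[OF b(2) _ assms(2), of k] b(1) by simp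
  finally show ?thesis .
next
  case False
  then have "(\<Sum>b\<in>{k..<k'}. of_bool (first_hit s D g w b E)) = (0::real)" by (intro sum.neutral) auto
  then show ?thesis by simp
qed

lemma first_hit_or_unhit:
  assumes "D E" "lev E {w} k \<noteq> {}"
  shows "unhit s D g w k E \<or> (\<exists>b. g \<le> b \<and> b < k \<and> first_hit s D g w b E)"
proof (cases "\<exists>b. g \<le> b \<and> b < k \<and> s \<le> real (card (lev E {w} b))")
  case True
  define b where "b = (LEAST b. g \<le> b \<and> b < k \<and> s \<le> real (card (lev E {w} b)))"
  have b: "g \<le> b \<and> b < k \<and> s \<le> real (card (lev E {w} b))" unfolding b_def using True by (rule LeastI_ex)
  have "real (card (lev E {w} j)) < s" if "g \<le> j" "j < b" for j
    using not_less_Least[of j "\<lambda>b. g \<le> b \<and> b < k \<and> s \<le> real (card (lev E {w} b))"] that b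
    unfolding b_def[symmetric] by linarith
  then show ?thesis using b assms unfolding first_hit_def by blast
next
  case False
  then show ?thesis using assms by (auto simp: unhit_def not_le)
qed

context weakly_supercritical begin

lemma hit_ball_small:
  assumes E: "E \<subseteq> Edg V" "finite V" "w \<in> V" and hit: "first_hit s0 D g w b E" and D: "card (bl E {w} g) \<le> be"
    and b: "g \<le> b" "real b * e \<le> 5 * ell"
  shows "card (bl E {w} b) \<le> 2 * be"
proof -
  have "bl E {w} b \<subseteq> bl E {w} g \<union> (\<Union>j\<in>{g..<b}. lev E {w} j)"
  proof
    fix x assume "x \<in> bl E {w} b"
    then obtain j where j: "j < b" "x \<in> lev E {w} j" by (auto simp: bl_def)
    show "x \<in> bl E {w} g \<union> (\<Union>j\<in>{g..<b}. lev E {w} j)"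
      by (cases "j < g") (use j in \<open>auto simp: bl_def\<close>)
  qed
  moreover have fin: "finite (bl E {w} g)" "finite (\<Union>j\<in>{g..<b}. lev E {w} j)"
    using bl_subset[OF E(1), of "{w}" g] lev_subset[OF E(1), of "{w}"] E finite_subset[OF _ E(2)] by auto
  ultimately have "card (bl E {w} b) \<le> card (bl E {w} g \<union> (\<Union>j\<in>{g..<b}. lev E {w} j))"
    by (intro card_mono) auto
  also have "\<dots> \<le> card (bl E {w} g) + card (\<Union>j\<in>{g..<b}. lev E {w} j)" by (rule card_Un_le)
  also have "card (\<Union>j\<in>{g..<b}. lev E {w} j) \<le> (\<Sum>j\<in>{g..<b}. card (lev E {w} j))" by (rule card_UN_le) simp
  finally have "real (card (bl E {w} b)) \<le> real (card (bl E {w} g) + (\<Sum>j\<in>{g..<b}. card (lev E {w} j)))"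
    by (simp only: of_nat_le_iff)
  also have "\<dots> = real (card (bl E {w} g)) + (\<Sum>j\<in>{g..<b}. real (card (lev E {w} j)))" by simp
  also have "(\<Sum>j\<in>{g..<b}. real (card (lev E {w} j))) \<le> (\<Sum>j\<in>{g..<b}. s0)"
    using hit by (intro sum_mono) (auto simp: first_hit_def intro: less_imp_le)
  also have "\<dots> = s0 * real (b - g)" by simp
  also have "\<dots> \<le> s0 * (b + 2)" using s0_pos by (intro mult_left_mono) auto
  also have "\<dots> \<le> be" using b(2) by (rule budget)
  finally show ?thesis using D by simp
qed

text \<open>Strong Markov property at the first large level. Hits at distinct times are disjoint and
  all imply \<open>unhit\<close> at k, so a whole block of times costs no more than one. The ball up
  to the hit stays below 2 be by \<open>hit_ball_small\<close>, so nearly all vertices are still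
  fresh.\<close>

lemma hit_markov:
  assumes W: "finite W" "w \<in> W" and D: "local_at g {w} D" "\<And>E. D E \<Longrightarrow> card (bl E {w} g) \<le> be"
    and k: "g \<le> k" "real k' * e \<le> 5 * ell"
    and c: "0 \<le> c" "\<And>b B T. k \<le> b \<Longrightarrow> b < k' \<Longrightarrow> B \<subseteq> W \<Longrightarrow> T \<subseteq> W - B \<Longrightarrow> w \<in> B \<or> w \<in> T \<Longrightarrow> card B \<le> 2 * be \<Longrightarrow> s0 \<le> card T
      \<Longrightarrow> rsE p (Edg (W - B)) (\<Psi> b B T) \<le> c"
  shows "rsE p (Edg W) (\<lambda>E. \<Sum>b\<in>{k..<k'}. of_bool (first_hit s0 D g w b E) * \<Psi> b (bl E {w} b) (lev E {w} b) (del E (bl E {w} b)))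
    \<le> c * rsE p (Edg W) (\<lambda>E. of_bool (unhit s0 D g w k E))"
proof -
  have "rsE p (Edg W) (\<lambda>E. of_bool (first_hit s0 D g w b E) * \<Psi> b (bl E {w} b) (lev E {w} b) (del E (bl E {w} b)))
    \<le> rsE p (Edg W) (\<lambda>E. of_bool (first_hit s0 D g w b E) * c)" if b: "b \<in> {k..<k'}" for b
  proof -
    have gb: "g \<le> b" using b k by simp
    have be5: "real b * e \<le> 5 * ell"
    proof -
      have "real b * e \<le> real k' * e" using b e0 by (intro mult_right_mono) auto
      then show ?thesis using k by linarith
    qed
    have loc: "local_at b {w} (\<lambda>E. of_bool (first_hit s0 D g w b E) :: real)"
      using first_hit_local[OF D(1) gb, of s0] by (rule local_at_comp1)
    have wW: "{w} \<subseteq> W" using W by simp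
    have "rsE p (Edg W) (\<lambda>E. of_bool (first_hit s0 D g w b E) * \<Psi> b (bl E {w} b) (lev E {w} b) (del E (bl E {w} b)))
      = rsE p (Edg W) (\<lambda>E. of_bool (first_hit s0 D g w b E) * rsE p (Edg (W - bl E {w} b)) (\<Psi> b (bl E {w} b) (lev E {w} b)))"
      by (rule rsE_markov[OF W(1) wW loc])
    also have "\<dots> \<le> rsE p (Edg W) (\<lambda>E. of_bool (first_hit s0 D g w b E) * c)"
    proof (rule rsE_mono[OF p1(3,2)])
      fix E assume E: "E \<subseteq> Edg W"
      show "of_bool (first_hit s0 D g w b E) * rsE p (Edg (W - bl E {w} b)) (\<Psi> b (bl E {w} b) (lev E {w} b))
        \<le> of_bool (first_hit s0 D g w b E) * c"
      proof (cases "first_hit s0 D g w b E")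
        case True
        have "rsE p (Edg (W - bl E {w} b)) (\<Psi> b (bl E {w} b) (lev E {w} b)) \<le> c"
        proof (rule c(2))
          show "bl E {w} b \<subseteq> W" by (rule bl_subset[OF E wW])
          show "lev E {w} b \<subseteq> W - bl E {w} b" using lev_subset[OF E wW, of b] lev_bl_disjoint[of E "{w}" b] by blast
          show "w \<in> bl E {w} b \<or> w \<in> lev E {w} b"
          proof (cases b)
            case (Suc b')
            then show ?thesis by (simp add: bl_Suc')
          qed simp
          show "card (bl E {w} b) \<le> 2 * be"
            using hit_ball_small[OF E W True _ gb be5] D(2) True unfolding first_hit_def by blast
          show "s0 \<le> card (lev E {w} b)" using True by (simp add: first_hit_def)
        qed (use b in auto)
        then show ?thesis by (simp add: mult_left_mono)
      qed simp
    qed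
    finally show ?thesis .
  qed
  then have "rsE p (Edg W) (\<lambda>E. \<Sum>b\<in>{k..<k'}. of_bool (first_hit s0 D g w b E) * \<Psi> b (bl E {w} b) (lev E {w} b) (del E (bl E {w} b)))
    \<le> (\<Sum>b\<in>{k..<k'}. rsE p (Edg W) (\<lambda>E. of_bool (first_hit s0 D g w b E) * c))"
    unfolding rsE_sum by (rule sum_mono)
  also have "\<dots> = c * rsE p (Edg W) (\<lambda>E. \<Sum>b\<in>{k..<k'}. of_bool (first_hit s0 D g w b E))"
    unfolding rsE_sum rsE_cmult_right sum_distrib_left by (simp only: mult.commute)
  also have "\<dots> \<le> c * rsE p (Edg W) (\<lambda>E. of_bool (unhit s0 D g w k E))"
    using k s0_pos by (intro mult_left_mono[OF _ c(1)] rsE_mono[OF p1(3,2)] sum_first_hit_le) auto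
  finally show ?thesis .
qed

section \<open>Pairs of distant vertices with late large levels\<close>

definition rays_at :: "'a \<Rightarrow> 'a set set \<Rightarrow> bool" where
  "rays_at v E \<longleftrightarrow> two_rays E v h \<and> card (bl E {v} (2 * h)) \<le> be"

lemma rays_at_local: "local_at (2 * h) {v} (rays_at v)"
proof -
  have 1: "local_at (2 * h) {v} (\<lambda>E. two_rays E v h)" by (rule local_at_mono[OF two_rays_local]) simp
  have 2: "local_at (2 * h) {v} (\<lambda>E. card (bl E {v} (2 * h)) \<le> be)"
    by (rule local_at_comp1[OF local_at_bl]) simp
  show ?thesis using local_at_comp[OF 1 2, where h = "(\<and>)"] unfolding rays_at_def[abs_def] .
qed

lemma unhit_rays:
  assumes "finite V" "v \<in> V" "card V \<le> n" "n - 6 * be \<le> card V" "2 * h \<le> k" "real k * e \<le> 5 * ell"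
  shows "rsE p (Edg V) (\<lambda>E. of_bool (unhit s0 (rays_at v) (2 * h) v k E)) \<le> exp 50 * 32 * e\<^sup>2 * exp (- nu * (real k - a0))"
  using late_hit_rays[OF assms] unfolding unhit_def rays_at_def conj_assoc .

definition far :: "nat \<Rightarrow> 'a \<Rightarrow> 'a \<Rightarrow> 'a set set \<Rightarrow> bool" where
  "far T v w E \<longleftrightarrow> (\<forall>j<T. \<not> wlk E j v w)"

definition nc :: "nat \<Rightarrow> real" where "nc g = exp (- ((3 / 2) ^ g)) + 2 * exp (- (sL / 16))"

definition far_pair :: "nat \<Rightarrow> nat \<Rightarrow> nat \<Rightarrow> 'a \<Rightarrow> 'a \<Rightarrow> 'a set set \<Rightarrow> bool" where
  "far_pair T k k' v w E \<longleftrightarrow> far T v w E \<and> (\<exists>a\<in>{k..<k + h}. first_hit s0 (rays_at v) (2 * h) v a E) \<and>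
     (\<exists>b\<in>{k'..<k' + h}. first_hit s0 (rays_at w) (2 * h) w b E)"

lemma far_disjoint:
  assumes "far T v w E" "i + j < T"
  shows "lev E {w} j \<inter> lev E {v} i = {}"
proof (rule ccontr)
  assume "lev E {w} j \<inter> lev E {v} i \<noteq> {}"
  then obtain x where "wlk E j w x" "wlk E i v x" by (auto simp: lev_single_iff)
  then have "wlk E (i + j) v w" unfolding wlk_add using wlk_sym by metis
  then show False using assms by (simp add: far_def)
qed

text \<open>The three factors come from three successive stages: exploration from v to its first
  large level, exploration from w to its first large level in what is left, and g h further levels
  that miss the large level of v. The distance T keeps the stages apart.\<close>

lemma far_pair_prob:
  assumes V: "finite V" "v \<in> V" "w \<in> V" "card V = n"
    and k: "2 * h \<le> k" "2 * h \<le> k'" "real (k + h) * e \<le> 5 * ell" "real (k' + h) * e \<le> 5 * ell"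
    and g: "2 \<le> g" "g * h + k + k' + 2 * h \<le> T"
  shows "rsE p (Edg V) (\<lambda>E. of_bool (far_pair T k k' v w E))
    \<le> nc g * (exp 50 * 32 * e\<^sup>2 * exp (- nu * (real k' - a0))) * (exp 50 * 32 * e\<^sup>2 * exp (- nu * (real k - a0)))"
proof -
  define q where "q = (\<lambda>k. exp 50 * 32 * e\<^sup>2 * exp (- nu * (real k - a0)))"
  define R where "R = (\<lambda>U b F. of_bool (\<forall>j\<le>g * h + b. lev F {w} j \<inter> U = {}) :: real)"
  define \<Psi>1 where "\<Psi>1 = (\<lambda>(a::nat) B U F. \<Sum>b\<in>{k'..<k' + h}. of_bool (first_hit s0 (rays_at w) (2 * h) w b F) * (R U b F * of_bool (w \<notin> B \<union> U)))"
  have nc0: "0 \<le> nc g" by (simp add: nc_def)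
  have q0: "0 \<le> q j" for j using e0 by (simp add: q_def)
  have hp: "1 \<le> h" by (rule h_bounds)
  have kk: "real k * e \<le> 5 * ell" "real k' * e \<le> 5 * ell"
    using k(3,4) e0 by (auto simp: algebra_simps) (smt (verit) mult_nonneg_nonneg of_nat_0_le_iff)+
  have "rsE p (Edg V) (\<lambda>E. of_bool (far_pair T k k' v w E)) \<le>
    rsE p (Edg V) (\<lambda>E. \<Sum>a\<in>{k..<k + h}. of_bool (first_hit s0 (rays_at v) (2 * h) v a E) * \<Psi>1 a (bl E {v} a) (lev E {v} a) (del E (bl E {v} a)))"
  proof (rule rsE_mono[OF p1(3,2)])
    fix E assume E: "E \<subseteq> Edg V"
    have nn: "0 \<le> \<Psi>1 a B U F" for a B U F unfolding \<Psi>1_def R_def by (intro sum_nonneg) simp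
    show "of_bool (far_pair T k k' v w E) \<le> (\<Sum>a\<in>{k..<k + h}. of_bool (first_hit s0 (rays_at v) (2 * h) v a E) * \<Psi>1 a (bl E {v} a) (lev E {v} a) (del E (bl E {v} a)))"
      (is "_ \<le> (\<Sum>a\<in>_. ?t a)")
    proof (cases "far_pair T k k' v w E")
      case True
      then obtain a b where a: "a \<in> {k..<k + h}" "first_hit s0 (rays_at v) (2 * h) v a E"
        and b: "b \<in> {k'..<k' + h}" "first_hit s0 (rays_at w) (2 * h) w b E" and fa: "far T v w E"
        by (auto simp: far_pair_def)
      define B where "B = bl E {v} a"
      define U where "U = lev E {v} a"
      \<comment> \<open>Blocks have length h, so a + b exceeds k + k' by less than 2 h; this is the
        2 h in the hypothesis on T.\<close>
      have T: "a + (g * h + b) < T" using a b g(2) hp by simp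
      have dB: "lev E {w} j \<inter> B = {}" if "j \<le> g * h + b" for j
        unfolding B_def
      proof (rule bl_disjoint)
        fix i assume "i < a"
        then have "i + j < T" using that T by linarith
        then show "lev E {w} j \<inter> lev E {v} i = {}" by (rule far_disjoint[OF fa])
      qed
      have dU: "lev E {w} j \<inter> U = {}" if "j \<le> g * h + b" for j
        unfolding U_def using far_disjoint[OF fa, of a j] that T by simp
      have wBU: "w \<notin> B \<union> U" using dB[of 0] dU[of 0] by simp
      \<comment> \<open>The exploration from w does not meet B, so its first hit is the same in the
        graph left over by the exploration from v.\<close>
      have tt: "touch E (bl E {w} b) = touch (del E B) (bl E {w} b)"
        by (rule touch_del_far[OF E, symmetric], rule dB) simp
      have gb: "2 * h \<le> b" using b(1) k(2) by simp
      have hb: "first_hit s0 (rays_at w) (2 * h) w b (del E B)"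
        using first_hit_local[OF rays_at_local[of w] gb, of s0] tt b(2) unfolding local_at_def by metis
      have "lev (del E B) {w} j = lev E {w} j" if "j \<le> g * h + b" for j
        using dB that by (rule lev_del_eq)
      then have "R U b (del E B) = 1" unfolding R_def using dU by simp
      then have "1 \<le> of_bool (first_hit s0 (rays_at w) (2 * h) w b (del E B)) * (R U b (del E B) * of_bool (w \<notin> B \<union> U))"
        using hb wBU by simp
      also have "\<dots> \<le> \<Psi>1 a B U (del E B)"
        unfolding \<Psi>1_def
        by (rule member_le_sum[where f = "\<lambda>b. of_bool (first_hit s0 (rays_at w) (2 * h) w b (del E B)) * (R U b (del E B) * of_bool (w \<notin> B \<union> U))"])
          (use b(1) in \<open>simp_all add: R_def\<close>)
      finally have "1 \<le> ?t a" using a(2) by (simp add: B_def U_def)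
      also have "\<dots> \<le> (\<Sum>a\<in>{k..<k + h}. ?t a)"
        by (rule member_le_sum[of a _ ?t]) (use a(1) nn in simp_all)
      finally show ?thesis using True by simp
    next
      case False
      then show ?thesis using nn by (simp add: sum_nonneg)
    qed
  qed
  also have "\<dots> \<le> (nc g * q k') * rsE p (Edg V) (\<lambda>E. of_bool (unhit s0 (rays_at v) (2 * h) v k E))"
  proof (rule hit_markov[OF V(1,2) rays_at_local _ k(1,3)])
    fix a B U assume a: "k \<le> a" "a < k + h" and B: "B \<subseteq> V" "U \<subseteq> V - B" "card B \<le> 2 * be" "s0 \<le> card U"
    let ?W = "V - B"
    have fW: "finite ?W" using V by simp
    have fB: "finite B" using finite_subset[OF B(1) V(1)] .
    have cW: "real (card ?W) = n - card B" using V B fB card_mono[OF V(1) B(1)] by (simp add: card_Diff_subset of_nat_diff)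
    show "rsE p (Edg ?W) (\<Psi>1 a B U) \<le> nc g * q k'"
    proof (cases "w \<in> ?W \<and> w \<notin> U")
      case True
      define \<Psi>2 where "\<Psi>2 = (\<lambda>(b::nat) B' T F. of_bool (U \<inter> B' = {} \<and> (\<forall>j\<le>g * h. lev F T j \<inter> U = {})) :: real)"
      have "rsE p (Edg ?W) (\<Psi>1 a B U) \<le>
        rsE p (Edg ?W) (\<lambda>E. \<Sum>b\<in>{k'..<k' + h}. of_bool (first_hit s0 (rays_at w) (2 * h) w b E) * \<Psi>2 b (bl E {w} b) (lev E {w} b) (del E (bl E {w} b)))"
      proof (rule rsE_mono[OF p1(3,2)])
        fix F
        show "\<Psi>1 a B U F \<le> (\<Sum>b\<in>{k'..<k' + h}. of_bool (first_hit s0 (rays_at w) (2 * h) w b F) * \<Psi>2 b (bl F {w} b) (lev F {w} b) (del F (bl F {w} b)))"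
          unfolding \<Psi>1_def
        proof (intro sum_mono mult_left_mono)
          fix b
          have "U \<inter> bl F {w} b = {} \<and> (\<forall>j\<le>g * h. lev (del F (bl F {w} b)) (lev F {w} b) j \<inter> U = {})"
            if r: "\<forall>j\<le>g * h + b. lev F {w} j \<inter> U = {}"
          proof
            show "U \<inter> bl F {w} b = {}"
            proof (rule bl_disjoint)
              fix i assume "i < b"
              then have "i \<le> g * h + b" by simp
              then show "U \<inter> lev F {w} i = {}" using r by blast
            qed
            show "\<forall>j\<le>g * h. lev (del F (bl F {w} b)) (lev F {w} b) j \<inter> U = {}"
              using r unfolding lev_add[symmetric] by (simp add: add.commute)
          qed
          then show "R U b F * of_bool (w \<notin> B \<union> U) \<le> \<Psi>2 b (bl F {w} b) (lev F {w} b) (del F (bl F {w} b))"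
            unfolding R_def \<Psi>2_def by (auto simp only: of_bool_def split: if_split)
        qed simp
      qed
      also have "\<dots> \<le> nc g * rsE p (Edg ?W) (\<lambda>E. of_bool (unhit s0 (rays_at w) (2 * h) w k' E))"
      proof (rule hit_markov[OF fW _ rays_at_local _ k(2,4) nc0])
        fix b B' T assume B': "B' \<subseteq> ?W" "T \<subseteq> ?W - B'" "card B' \<le> 2 * be" "s0 \<le> card T"
        show "rsE p (Edg (?W - B')) (\<Psi>2 b B' T) \<le> nc g"
        proof (cases "U \<inter> B' = {} \<and> T \<inter> U = {}")
          case True
          have fB': "finite B'" using finite_subset[OF B'(1) fW] .
          have cW': "real (card (?W - B')) = real (card ?W) - card B'"
            using fW B' fB' card_mono[OF fW B'(1)] by (simp add: card_Diff_subset of_nat_diff)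
          have "rsE p (Edg (?W - B')) (\<lambda>E. of_bool (\<forall>i\<le>g * h. lev E T i \<inter> U = {})) \<le> nc g"
            unfolding nc_def
          proof (rule no_connect[OF _ B'(2) _ _ _ _ B'(4) B(4) g(1) order_refl])
            show "n - 6 * be \<le> card (?W - B')" unfolding cW' cW using B'(3) B(3) be_pos by linarith
            show "card (?W - B') \<le> n" using cW' cW by linarith
            show "U \<subseteq> ?W - B'" using B(2) True by blast
          qed (use fW True in auto)
          then show ?thesis using True by (simp add: \<Psi>2_def)
        next
          case False
          then have "\<not> (U \<inter> B' = {} \<and> (\<forall>j\<le>g * h. lev F T j \<inter> U = {}))" for F using lev_0 by fastforce
          then have "\<Psi>2 b B' T = (\<lambda>_. 0)" unfolding \<Psi>2_def by auto
          then show ?thesis using fW nc0 by simp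
        qed
      qed (use True in \<open>auto simp: rays_at_def\<close>)
      also have "\<dots> \<le> nc g * q k'"
      proof (intro mult_left_mono nc0)
        show "rsE p (Edg ?W) (\<lambda>E. of_bool (unhit s0 (rays_at w) (2 * h) w k' E)) \<le> q k'"
          unfolding q_def
        proof (rule unhit_rays[OF fW _ _ _ k(2) kk(2)])
          show "card ?W \<le> n" using cW by linarith
          show "n - 6 * be \<le> card ?W" unfolding cW using B(3) be_pos by linarith
        qed (use True in auto)
      qed
      finally show ?thesis .
    next
      case False
      then have "\<Psi>1 a B U = (\<lambda>_. 0)" unfolding \<Psi>1_def using V(3) by auto
      then show ?thesis using fW nc0 q0 by simp
    qed
  qed (use nc0 q0 in \<open>auto simp: rays_at_def\<close>)
  also have "\<dots> \<le> (nc g * q k') * q k"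
  proof (intro mult_left_mono)
    show "rsE p (Edg V) (\<lambda>E. of_bool (unhit s0 (rays_at v) (2 * h) v k E)) \<le> q k"
      unfolding q_def by (rule unhit_rays) (use V k kk be_pos in auto)
  qed (use nc0 q0 in simp)
  finally show ?thesis unfolding q_def .
qed

end

section \<open>Long geodesics and the first moment\<close>

text \<open>The two rays are the two directions along the geodesic; equal indices k lie at distance
  2 k from each other, so the rays are disjoint.\<close>

lemma geodesic_two_rays:
  assumes y: "f d \<in> lev E {f 0} d" and f: "\<And>i. i < d \<Longrightarrow> {f i, f (Suc i)} \<in> E"
    and i: "r \<le> i" "i + r \<le> d"
  shows "two_rays E (f i) r"
proof -
  have fwd: "f (i + k) \<in> lev E {f i} k" if "k \<le> r" for k
    using geodesic_lev[OF y f, of i "i + k"] that i by simp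
  have bwd: "f (i - k) \<in> lev E {f i} k" if "k \<le> r" for k
    using geodesic_lev[OF y f, of "i - k" i] that i lev_sym[of "f i" E "f (i - k)" k] by simp
  have "geo_ray E (f i) r (\<lambda>k. f (i + k))"
    unfolding geo_ray_def using fwd f i by simp
  moreover have "geo_ray E (f i) r (\<lambda>k. f (i - k))"
    unfolding geo_ray_def
  proof (intro conjI allI impI)
    fix k assume k: "k < r"
    then have "Suc (i - Suc k) = i - k" using i by simp
    then show "{f (i - k), f (i - Suc k)} \<in> E" using f[of "i - Suc k"] k i by (simp add: insert_commute)
  qed (use bwd in auto)
  moreover have "f (i + k) \<noteq> f (i - k)" if "1 \<le> k" "k \<le> r" for k
  proof
    assume eq: "f (i + k) = f (i - k)"
    have "f (i + k) \<in> lev E {f (i - k)} (2 * k)"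
      using geodesic_lev[OF y f, of "i - k" "i + k"] that i by (simp add: mult_2)
    moreover have "f (i + k) \<in> lev E {f (i - k)} 0" using eq by simp
    ultimately show False using lev_unique that by fastforce
  qed
  ultimately show ?thesis unfolding two_rays_def by blast
qed

lemma geodesic_inj:
  assumes y: "f d \<in> lev E {f 0} d" and f: "\<And>i. i < d \<Longrightarrow> {f i, f (Suc i)} \<in> E"
  shows "inj_on f {..d}"
proof (rule inj_onI)
  have le: "a = b" if "a \<le> b" "b \<le> d" "f a = f b" for a b
  proof -
    have "f b \<in> lev E {f a} (b - a)" using geodesic_lev[OF y f that(1,2)] .
    moreover have "f b \<in> lev E {f a} 0" using that by simp
    ultimately have "b - a = 0" by (rule lev_unique)
    then show ?thesis using that by simp
  qed
  fix a b assume "a \<in> {..d}" "b \<in> {..d}" "f a = f b"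
  then show "a = b" using le[of a b] le[of b a] by (cases "a \<le> b") auto
qed

lemma exp_neg_le_pow6:
  fixes x :: real
  assumes "0 < x"
  shows "exp (- x) \<le> 46656 / x ^ 6"
proof -
  have "(x / 6) ^ 6 \<le> exp (x / 6) ^ 6"
    using exp_ge_add_one_self[of "x / 6"] assms by (intro power_mono) (linarith, simp)
  also have "\<dots> = exp x" by (simp add: exp_of_nat_mult[symmetric])
  finally have "x ^ 6 \<le> 46656 * exp x" by (simp add: power_divide)
  then show ?thesis using assms by (simp add: exp_minus field_simps)
qed

text \<open>4^s bounds the gain exp (nu h s) in probability when hits come s blocks earlier; the
  doubly exponential cost of not connecting beats it. The constant 46656 is 6^6 from exp (- x) \<le>
  (6 / x)^6, and (3 / 2)^6 \<ge> 8 gives the ratio 4 / 8.\<close>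

lemma four_pow_exp: "4 ^ s * exp (- ((3 / 2) ^ s)) \<le> 46656 * (1 / 2 :: real) ^ s"
proof -
  have "exp (- ((3 / 2 :: real) ^ s)) \<le> 46656 / ((3 / 2) ^ s) ^ 6" by (rule exp_neg_le_pow6) simp
  also have "\<dots> = 46656 / (((3 / 2) ^ 6) ^ s)" by (simp add: power_mult[symmetric] mult.commute)
  also have "\<dots> \<le> 46656 / (8 ^ s)" by (intro divide_left_mono power_mono) (auto simp: power_divide)
  finally have "4 ^ s * exp (- ((3 / 2) ^ s)) \<le> 4 ^ s * (46656 / (8 ^ s :: real))" by (intro mult_left_mono) auto
  also have "\<dots> = 46656 * (4 / 8) ^ s" by (simp only: power_divide times_divide_eq_right mult.commute)
  finally show ?thesis by simp
qed

lemma half_pow_sum: "(\<Sum>i\<in>{a..<M}. (1 / 2 :: real) ^ (M - i)) \<le> 1"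
proof -
  have "(\<Sum>i\<in>{a..<M}. (1 / 2 :: real) ^ (M - i)) \<le> (\<Sum>i<M. (1 / 2) ^ (M - i))"
    by (intro sum_mono2) auto
  also have "\<dots> = (\<Sum>i<M. 1 / 2 * (1 / 2) ^ (M - Suc i))"
  proof (intro sum.cong refl)
    fix i assume "i \<in> {..<M}"
    then have "M - i = Suc (M - Suc i)" by simp
    then show "(1 / 2 :: real) ^ (M - i) = 1 / 2 * (1 / 2) ^ (M - Suc i)" by simp
  qed
  also have "\<dots> = 1 / 2 * (\<Sum>i<M. (1 / 2) ^ i)"
    unfolding sum_distrib_left[symmetric] by (simp only: sum.nat_diff_reindex)
  also have "\<dots> \<le> 1 / 2 * (1 / (1 - 1 / 2))" by (intro mult_left_mono geometric_sum_le) auto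
  finally show ?thesis by simp
qed

lemma sum_Times: "(\<Sum>z\<in>A \<times> B. g (fst z) (snd z)) = (\<Sum>x\<in>A. \<Sum>y\<in>B. g x y)"
  by (simp add: sum.cartesian_product case_prod_beta)

lemma double_sum:
  fixes f :: "'a \<Rightarrow> real"
  shows "(\<Sum>i\<in>A. \<Sum>j\<in>A. a * (f i * f j) + c) = a * (sum f A * sum f A) + c * (real (card A) * real (card A))"
proof -
  have "sum f A * sum f A = (\<Sum>i\<in>A. \<Sum>j\<in>A. f i * f j)" by (rule sum_product)
  then have "a * (sum f A * sum f A) = (\<Sum>i\<in>A. \<Sum>j\<in>A. a * (f i * f j))" by (simp only: sum_distrib_left)
  then show ?thesis by (simp add: sum.distrib)
qed

context weakly_supercritical begin

text \<open>Positions h to 2 h from each end give h vertices with two rays, where h is at least 1 /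
  e. Each of the h^2 pairs has an end without a large level before M h, or is a
  \<open>far_pair\<close> for some blocks; division by h^2 gives the inequality.\<close>

lemma long_geodesic:
  assumes V: "finite V" "x \<in> V" and E: "E \<subseteq> Edg V" and ball: "\<And>v. v \<in> V \<Longrightarrow> card (bl E {v} (2 * h)) \<le> be"
    and y: "y \<in> lev E {x} d" and T: "T + 4 * h \<le> d" "M * h \<le> T"
  shows "1 \<le> 2 * e * (\<Sum>v\<in>V. of_bool (unhit s0 (rays_at v) (2 * h) v (M * h) E)) +
    e\<^sup>2 * (\<Sum>v\<in>V. \<Sum>w\<in>V. \<Sum>i\<in>{2..<M}. \<Sum>j\<in>{2..<M}. of_bool (far_pair T (i * h) (j * h) v w E))"
proof -
  have hp: "1 \<le> h" by (rule h_bounds)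
  obtain f where f: "f 0 = x" "f d = y" "\<And>i. i < d \<Longrightarrow> {f i, f (Suc i)} \<in> E" "\<And>i. i \<le> d \<Longrightarrow> f i \<in> lev E {x} i"
    using lev_path[OF y] by auto
  have fd: "f d \<in> lev E {f 0} d" using f(1,2) y by simp
  have geo: "f b \<in> lev E {f a} (b - a)" if "a \<le> b" "b \<le> d" for a b
    using geodesic_lev[OF fd f(3)] that by simp
  have fV: "f i \<in> V" if "i \<le> d" for i using f(4)[OF that] lev_subset[OF E, of "{x}" i] V by blast
  have rays: "rays_at (f i) E" if "h \<le> i" "i + h \<le> d" for i
    unfolding rays_at_def using geodesic_two_rays[OF fd f(3) that] ball[of "f i"] fV[of i] that by simp
  define P where "P = f ` {h..<2 * h}"
  define Q where "Q = (\<lambda>j. f (d - j)) ` {h..<2 * h}"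
  define Z1 where "Z1 = {v\<in>V. unhit s0 (rays_at v) (2 * h) v (M * h) E}"
  define Z2 where "Z2 = {vw\<in>V \<times> V. \<exists>i\<in>{2..<M}. \<exists>j\<in>{2..<M}. far_pair T (i * h) (j * h) (fst vw) (snd vw) E}"
  have inj: "inj_on f {..d}" by (rule geodesic_inj[OF fd f(3)])
  have cP: "card P = h" unfolding P_def using inj T by (subst card_image) (auto intro: inj_on_subset)
  have cQ: "card Q = h" unfolding Q_def
  proof (subst card_image)
    show "inj_on (\<lambda>j. f (d - j)) {h..<2 * h}"
    proof (rule inj_onI)
      fix i j assume "i \<in> {h..<2 * h}" "j \<in> {h..<2 * h}" "f (d - i) = f (d - j)"
      then show "i = j" using inj_onD[OF inj, of "d - i" "d - j"] T by auto
    qed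
  qed simp
  have PV: "P \<subseteq> V" "Q \<subseteq> V" unfolding P_def Q_def using fV T by auto
  have block: "\<exists>i\<in>{2..<M}. a \<in> {i * h..<i * h + h}" if "2 * h \<le> a" "a < M * h" for a
  proof
    show "a div h \<in> {2..<M}" using that hp by (simp add: less_mult_imp_div_less less_eq_div_iff_mult_less_eq)
    have "a div h * h + a mod h = a" "a mod h < h" using hp by simp_all
    then show "a \<in> {a div h * h..<a div h * h + h}" unfolding atLeastLessThan_iff by linarith
  qed
  have sub: "P \<times> Q \<subseteq> (Z1 \<times> Q \<union> P \<times> Z1) \<union> Z2"
  proof
    fix vw assume "vw \<in> P \<times> Q"
    then obtain i j where ij: "h \<le> i" "i < 2 * h" "h \<le> j" "j < 2 * h" and vw: "vw = (f i, f (d - j))"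
      by (auto simp: P_def Q_def)
    define v w where "v = f i" and "w = f (d - j)"
    have vwPQ: "v \<in> P" "w \<in> Q" "v \<in> V" "w \<in> V" unfolding v_def w_def using ij fV T by (auto simp: P_def Q_def)
    have rv: "rays_at v E" "rays_at w E" unfolding v_def w_def using ij T by (auto intro!: rays)
    have lv: "lev E {v} (M * h) \<noteq> {}"
      using geo[of i "i + M * h"] ij T unfolding v_def by auto
    have "w \<in> lev E {f (d - j - M * h)} (M * h)"
      using geo[of "d - j - M * h" "d - j"] ij T unfolding w_def by simp
    then have lw: "lev E {w} (M * h) \<noteq> {}" using lev_sym by fastforce
    have "w \<in> lev E {v} (d - j - i)" using geo[of i "d - j"] ij T unfolding v_def w_def by simp
    then have fa: "far T v w E" using ij T unfolding far_def lev_single_iff by simp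
    show "vw \<in> (Z1 \<times> Q \<union> P \<times> Z1) \<union> Z2"
    proof (cases "v \<in> Z1 \<or> w \<in> Z1")
      case True
      then show ?thesis using vw vwPQ unfolding v_def[symmetric] w_def[symmetric] by auto
    next
      case False
      then have nu: "\<not> unhit s0 (rays_at v) (2 * h) v (M * h) E" "\<not> unhit s0 (rays_at w) (2 * h) w (M * h) E"
        using vwPQ by (simp_all add: Z1_def)
      obtain a where a: "2 * h \<le> a" "a < M * h" "first_hit s0 (rays_at v) (2 * h) v a E"
        using first_hit_or_unhit[where D = "rays_at v", OF rv(1) lv, of s0 "2 * h"] nu(1) by blast
      obtain b where b: "2 * h \<le> b" "b < M * h" "first_hit s0 (rays_at w) (2 * h) w b E"
        using first_hit_or_unhit[where D = "rays_at w", OF rv(2) lw, of s0 "2 * h"] nu(2) by blast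
      obtain i' where i': "i' \<in> {2..<M}" "a \<in> {i' * h..<i' * h + h}" using block[OF a(1,2)] by blast
      obtain j' where j': "j' \<in> {2..<M}" "b \<in> {j' * h..<j' * h + h}" using block[OF b(1,2)] by blast
      have "far_pair T (i' * h) (j' * h) v w E" unfolding far_pair_def using fa a(3) b(3) i' j' by blast
      then have "(v, w) \<in> Z2" unfolding Z2_def mem_Collect_eq fst_conv snd_conv using vwPQ(3,4) i'(1) j'(1) by blast
      then show ?thesis using vw by (simp add: v_def w_def)
    qed
  qed
  have fin: "finite P" "finite Q" "finite Z1" "finite Z2"
    using V by (auto simp: P_def Q_def Z1_def Z2_def)
  have "card (P \<times> Q) \<le> card ((Z1 \<times> Q \<union> P \<times> Z1) \<union> Z2)" using sub fin by (intro card_mono) auto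
  also have "\<dots> \<le> card (Z1 \<times> Q \<union> P \<times> Z1) + card Z2" by (rule card_Un_le)
  also have "card (Z1 \<times> Q \<union> P \<times> Z1) \<le> card (Z1 \<times> Q) + card (P \<times> Z1)" by (rule card_Un_le)
  finally have "h * h \<le> 2 * h * card Z1 + card Z2" by (simp add: card_cartesian_product cP cQ mult.commute)
  then have "real (h * h) \<le> real (2 * h * card Z1 + card Z2)" by (simp only: of_nat_le_iff)
  then have c: "real h * h \<le> 2 * h * real (card Z1) + real (card Z2)" by simp
  have z1: "real (card Z1) = (\<Sum>v\<in>V. of_bool (unhit s0 (rays_at v) (2 * h) v (M * h) E))"
    using V by (simp add: Z1_def Collect_conj_eq Int_commute)
  have z2: "real (card Z2) \<le> (\<Sum>v\<in>V. \<Sum>w\<in>V. \<Sum>i\<in>{2..<M}. \<Sum>j\<in>{2..<M}. of_bool (far_pair T (i * h) (j * h) v w E))"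
  proof -
    have "real (card Z2) = (\<Sum>vw\<in>V \<times> V. of_bool (\<exists>i\<in>{2..<M}. \<exists>j\<in>{2..<M}. far_pair T (i * h) (j * h) (fst vw) (snd vw) E))"
      using V by (simp add: Z2_def Collect_conj_eq Int_commute)
    also have "\<dots> \<le> (\<Sum>vw\<in>V \<times> V. \<Sum>i\<in>{2..<M}. \<Sum>j\<in>{2..<M}. of_bool (far_pair T (i * h) (j * h) (fst vw) (snd vw) E))"
    proof (rule sum_mono)
      fix vw
      let ?g = "\<lambda>i j. of_bool (far_pair T (i * h) (j * h) (fst vw) (snd vw) E) :: real"
      show "of_bool (\<exists>i\<in>{2..<M}. \<exists>j\<in>{2..<M}. far_pair T (i * h) (j * h) (fst vw) (snd vw) E)
        \<le> (\<Sum>i\<in>{2..<M}. \<Sum>j\<in>{2..<M}. ?g i j)"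
      proof (cases "\<exists>i\<in>{2..<M}. \<exists>j\<in>{2..<M}. far_pair T (i * h) (j * h) (fst vw) (snd vw) E")
        case True
        then obtain i j where ij: "i \<in> {2..<M}" "j \<in> {2..<M}" "far_pair T (i * h) (j * h) (fst vw) (snd vw) E" by blast
        have "1 = ?g i j" using ij by simp
        also have "\<dots> \<le> (\<Sum>j\<in>{2..<M}. ?g i j)" by (rule member_le_sum[where f = "?g i"]) (use ij in auto)
        also have "\<dots> \<le> (\<Sum>i\<in>{2..<M}. \<Sum>j\<in>{2..<M}. ?g i j)"
          by (rule member_le_sum[where f = "\<lambda>i. \<Sum>j\<in>{2..<M}. ?g i j"]) (use ij in \<open>auto intro: sum_nonneg\<close>)
        finally show ?thesis using True by simp
      qed (simp add: sum_nonneg)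
    qed
    also have "\<dots> = (\<Sum>v\<in>V. \<Sum>w\<in>V. \<Sum>i\<in>{2..<M}. \<Sum>j\<in>{2..<M}. of_bool (far_pair T (i * h) (j * h) v w E))"
      by (rule sum_Times[of "\<lambda>v w. \<Sum>i\<in>{2..<M}. \<Sum>j\<in>{2..<M}. of_bool (far_pair T (i * h) (j * h) v w E)"])
    finally show ?thesis .
  qed
  have he: "1 \<le> e * h" by (rule h_bounds)
  have hh: "0 < real h * h" using hp by simp
  have "1 \<le> 2 * (1 / h) * real (card Z1) + (1 / h) * (1 / h) * real (card Z2)"
  proof -
    have "1 = (1 / (real h * h)) * (real h * h)" using hp by simp
    also have "\<dots> \<le> (1 / (real h * h)) * (2 * h * real (card Z1) + real (card Z2))" using c by (intro mult_left_mono) auto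
    also have "\<dots> = 2 * (1 / h) * real (card Z1) + (1 / h) * (1 / h) * real (card Z2)" using hp by (simp add: field_simps)
    finally show ?thesis .
  qed
  also have "\<dots> \<le> 2 * e * real (card Z1) + e * e * real (card Z2)"
  proof -
    have "1 / h \<le> e" using he hp by (simp add: field_simps)
    then show ?thesis using e0 by (intro add_mono mult_right_mono mult_mono mult_left_mono) auto
  qed
  also have "\<dots> \<le> 2 * e * (\<Sum>v\<in>V. of_bool (unhit s0 (rays_at v) (2 * h) v (M * h) E)) +
    e * e * (\<Sum>v\<in>V. \<Sum>w\<in>V. \<Sum>i\<in>{2..<M}. \<Sum>j\<in>{2..<M}. of_bool (far_pair T (i * h) (j * h) v w E))"
    unfolding z1 using z2 e0 by (intro add_left_mono mult_left_mono) auto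
  finally show ?thesis by (simp only: power2_eq_square)
qed

definition Mup :: "nat \<Rightarrow> nat" where "Mup K = nat \<lceil>(a0 + ell / nu) / h\<rceil> + K"

lemma Mup_bounds:
  shows "a0 + ell / nu + K * h \<le> real (Mup K) * h" "real (Mup K) * h \<le> a0 + ell / nu + K * h + h"
proof -
  have hp: "0 < real h" using h_bounds by simp
  have x0: "0 \<le> (a0 + ell / nu) / h" using a0_bounds nu_bounds ell100 hp by simp
  define x where "x = (a0 + ell / nu) / h"
  have c: "real (Mup K) = of_int \<lceil>x\<rceil> + K" using x0 unfolding x_def by (simp add: Mup_def)
  have "x \<le> of_int \<lceil>x\<rceil>" "of_int \<lceil>x\<rceil> \<le> x + 1" by linarith+
  then have "x * h \<le> of_int \<lceil>x\<rceil> * real h" "of_int \<lceil>x\<rceil> * real h \<le> (x + 1) * h"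
    using hp by (auto intro: mult_right_mono)
  moreover have "x * h = a0 + ell / nu" using hp by (simp add: x_def)
  ultimately show "a0 + ell / nu + K * h \<le> real (Mup K) * h" "real (Mup K) * h \<le> a0 + ell / nu + K * h + h"
    unfolding c by (simp_all add: distrib_right)
qed

lemma t_bounds: "ell / nu * e \<le> 10 / 9 * ell" "0 < ell / nu"
proof -
  show "0 < ell / nu" using ell100 nu_bounds by simp
  have "ell / nu * e \<le> ell / (9 / 10 * e) * e"
    using nu_bounds e0 ell100 by (intro mult_right_mono divide_left_mono) auto
  then show "ell / nu * e \<le> 10 / 9 * ell" using e0 by simp
qed

lemma Mup_facts:
  assumes "real K \<le> ell"
  shows "real (Mup K * h) * e \<le> 5 * ell" "real (Mup K) \<le> 5 * ell" "ell - nu * (Mup K * h - a0) \<le> - (9 / 10 * K)" "2 \<le> Mup K"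
proof -
  have eh: "1 \<le> e * h" "e * h \<le> 11 / 10" by (rule h_bounds)+
  have "real (Mup K) * h * e \<le> (a0 + ell / nu + K * h + h) * e"
    using Mup_bounds(2) e0 by (intro mult_right_mono) auto
  also have "\<dots> = a0 * e + ell / nu * e + K * (e * h) + e * h" by (simp add: algebra_simps)
  also have "K * (e * h) \<le> ell * (11 / 10)" using assms eh by (intro mult_mono) auto
  finally have "real (Mup K) * h * e \<le> a0 * e + ell / nu * e + ell * (11 / 10) + e * h" by simp
  then show 1: "real (Mup K * h) * e \<le> 5 * ell"
    using a0_bounds(2) t_bounds eh ell100 by simp
  have "real (Mup K) * 1 \<le> real (Mup K) * (e * h)" using eh by (intro mult_left_mono) auto
  then show "real (Mup K) \<le> 5 * ell" using 1 by (simp add: mult.commute mult.left_commute)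
  have "nu * (a0 + ell / nu + K * h - a0) \<le> nu * (real (Mup K) * h - a0)"
    using Mup_bounds(1)[of K] nu_bounds by (intro mult_left_mono) auto
  moreover have "nu * (a0 + ell / nu + K * h - a0) = ell + K * (nu * h)" using nu_bounds by (simp add: field_simps)
  moreover have "K * (9 / 10) \<le> K * (nu * h)" using nu_h by (intro mult_left_mono) auto
  ultimately show "ell - nu * (Mup K * h - a0) \<le> - (9 / 10 * K)" by simp
  have hp: "0 < real h" using h_bounds by simp
  have "3 * real h \<le> real (Mup K) * h" using h_a0 Mup_bounds(1)[of K] t_bounds(2) by (smt (verit) mult_nonneg_nonneg of_nat_0_le_iff)
  then have "3 \<le> real (Mup K)" using hp by (simp only: mult_le_cancel_right_pos)
  then show "2 \<le> Mup K" by simp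
qed

text \<open>The hits i and j fall short of M by s blocks in total. The prefactor e^6 n^2 is exp (2
  ell) and is cancelled up to exp (- 2 x) when both equal M; what remains is
  \<open>four_pow_exp\<close>, written as a product so that the double sum over blocks
  converges.\<close>

lemma nc_block:
  assumes ij: "i < M" "j < M" and M: "ell - nu * (M * h - a0) \<le> - x"
  shows "e ^ 6 * (real n)\<^sup>2 * (nc (2 * M - i - j) * exp (- nu * (real (j * h) - a0)) * exp (- nu * (real (i * h) - a0)))
    \<le> 46656 * exp (- (2 * x)) * ((1 / 2) ^ (M - i) * (1 / 2) ^ (M - j)) + 2 * exp (4 * ell) * exp (- (sL / 16))"
proof -
  define s where "s = 2 * M - i - j"
  have s: "s = (M - i) + (M - j)" using ij by (simp add: s_def)
  have rs: "real s = 2 * real M - i - j" unfolding s using ij by (simp add: of_nat_diff)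
  define Q where "Q = exp (2 * ell) * (exp (- nu * (real (j * h) - a0)) * exp (- nu * (real (i * h) - a0)))"
  have "e ^ 6 * (real n)\<^sup>2 = Lam * Lam" by (simp add: Lam_def power2_eq_square eval_nat_numeral)
  also have "\<dots> = exp (2 * ell)" unfolding exp_ell[symmetric] exp_add[symmetric] by simp
  finally have eq: "e ^ 6 * (real n)\<^sup>2 * (nc s * exp (- nu * (real (j * h) - a0)) * exp (- nu * (real (i * h) - a0))) = Q * nc s"
    unfolding Q_def by (simp only: ac_simps)
  have Q1: "Q = exp (2 * (ell - nu * (M * h - a0))) * exp (nu * h * s)"
    unfolding Q_def exp_add[symmetric] rs by (simp add: algebra_simps)
  have "exp (nu * h * s) = exp (nu * h) ^ s" by (simp add: exp_of_nat_mult[symmetric] mult.commute)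
  also have "\<dots> \<le> 4 ^ s" using exp_nu_h by (intro power_mono) auto
  finally have e4: "exp (nu * h * s) \<le> 4 ^ s" .
  have Qa: "Q \<le> exp (- (2 * x)) * 4 ^ s"
    unfolding Q1 using M e4 by (intro mult_mono) auto
  have Qb: "Q \<le> exp (4 * ell)"
  proof -
    have "0 \<le> nu * (real j * h)" "0 \<le> nu * (real i * h)" using nu_bounds by auto
    then have "2 * ell + (- nu * (real (j * h) - a0) + - nu * (real (i * h) - a0)) \<le> 4 * ell"
      using a0_bounds(5) ell100 by (simp add: algebra_simps)
    then show ?thesis unfolding Q_def exp_add[symmetric] by simp
  qed
  have "Q * nc s = Q * exp (- ((3 / 2) ^ s)) + Q * (2 * exp (- (sL / 16)))" by (simp add: nc_def distrib_left)
  also have "\<dots> \<le> (exp (- (2 * x)) * 4 ^ s) * exp (- ((3 / 2) ^ s)) + exp (4 * ell) * (2 * exp (- (sL / 16)))"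
    using Qa Qb by (intro add_mono mult_right_mono) auto
  also have "(exp (- (2 * x)) * 4 ^ s) * exp (- ((3 / 2) ^ s)) = exp (- (2 * x)) * (4 ^ s * exp (- ((3 / 2) ^ s)))"
    by (simp only: mult.assoc)
  also have "\<dots> \<le> exp (- (2 * x)) * (46656 * (1 / 2) ^ s)" by (intro mult_left_mono four_pow_exp) auto
  also have "(1 / 2 :: real) ^ s = (1 / 2) ^ (M - i) * (1 / 2) ^ (M - j)" unfolding s by (rule power_add)
  finally show ?thesis unfolding s_def[symmetric] eq by (simp add: ac_simps)
qed

text \<open>The expectation of the inequality in \<open>long_geodesic\<close>. In the first term e
  meets n e^2, in the second e^2 meets n^2 e^4; these are powers of e^3 n, which the exponential
  decay up to K blocks beyond a0 + t outweighs.\<close>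

lemma upper_tail:
  assumes V: "finite V" "card V = n" and K: "real K \<le> ell"
  shows "rsE p (Edg V) (\<lambda>E. of_bool (\<exists>x\<in>V. \<exists>d\<ge>(2 * Mup K + 6) * h. lev E {x} d \<noteq> {}))
    \<le> 10 ^ 9 * ell\<^sup>2 / Lam + 64 * exp 50 * exp (- (9 / 10 * K)) +
      1024 * exp 100 * (46656 * exp (- (9 / 5 * K)) + 50 * ell\<^sup>2 * exp (4 * ell) * exp (- (sL / 16)))"
proof -
  define M where "M = Mup K"
  define T where "T = 2 * M * h + 2 * h"
  define C :: real where "C = exp 50 * 32"
  define Z where "Z = exp (4 * ell) * exp (- (sL / 16))"
  note Mf = Mup_facts[OF K, folded M_def]
  have Th: "T + 4 * h = (2 * M + 6) * h" "M * h \<le> T" by (simp_all add: T_def algebra_simps)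
  let ?B = "\<lambda>E. \<exists>v\<in>V. be < card (bl E {v} (2 * h))"
  let ?U = "\<lambda>E. \<Sum>v\<in>V. of_bool (unhit s0 (rays_at v) (2 * h) v (M * h) E)"
  let ?P = "\<lambda>E. \<Sum>v\<in>V. \<Sum>w\<in>V. \<Sum>i\<in>{2..<M}. \<Sum>j\<in>{2..<M}. of_bool (far_pair T (i * h) (j * h) v w E)"
  have "rsE p (Edg V) (\<lambda>E. of_bool (\<exists>x\<in>V. \<exists>d\<ge>(2 * M + 6) * h. lev E {x} d \<noteq> {}))
    \<le> rsE p (Edg V) (\<lambda>E. of_bool (?B E) + (2 * e * ?U E + e\<^sup>2 * ?P E))"
  proof (rule rsE_mono[OF p1(3,2)])
    fix E assume E: "E \<subseteq> Edg V"
    have nn: "0 \<le> 2 * e * ?U E + e\<^sup>2 * ?P E" using e0 by (intro add_nonneg_nonneg mult_nonneg_nonneg sum_nonneg) auto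
    show "of_bool (\<exists>x\<in>V. \<exists>d\<ge>(2 * M + 6) * h. lev E {x} d \<noteq> {}) \<le> of_bool (?B E) + (2 * e * ?U E + e\<^sup>2 * ?P E)"
    proof (cases "(\<exists>x\<in>V. \<exists>d\<ge>(2 * M + 6) * h. lev E {x} d \<noteq> {}) \<and> \<not> ?B E")
      case True
      then obtain x d y where x: "x \<in> V" "(2 * M + 6) * h \<le> d" "y \<in> lev E {x} d" by blast
      have ball: "card (bl E {v} (2 * h)) \<le> be" if "v \<in> V" for v using True that by (simp add: not_less)
      have "1 \<le> 2 * e * ?U E + e\<^sup>2 * ?P E"
        by (rule long_geodesic[OF V(1) x(1) E ball x(3)]) (use x(2) Th in simp_all)
      then show ?thesis using True by simp
    next
      case False
      then have "of_bool (\<exists>x\<in>V. \<exists>d\<ge>(2 * M + 6) * h. lev E {x} d \<noteq> {}) \<le> (of_bool (?B E) :: real)" by auto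
      then show ?thesis using nn by linarith
    qed
  qed
  also have "\<dots> = rsE p (Edg V) (\<lambda>E. of_bool (?B E)) + (2 * e * (\<Sum>v\<in>V. rsE p (Edg V) (\<lambda>E. of_bool (unhit s0 (rays_at v) (2 * h) v (M * h) E)))
    + e\<^sup>2 * (\<Sum>v\<in>V. \<Sum>w\<in>V. \<Sum>i\<in>{2..<M}. \<Sum>j\<in>{2..<M}. rsE p (Edg V) (\<lambda>E. of_bool (far_pair T (i * h) (j * h) v w E))))"
    by (simp only: rsE_add rsE_cmult rsE_sum)
  also have "\<dots> \<le> 10 ^ 9 * ell\<^sup>2 / Lam + (2 * C * exp (- (9 / 10 * K)) + C\<^sup>2 * (46656 * exp (- (9 / 5 * K)) + 50 * ell\<^sup>2 * Z))"
  proof (intro add_mono)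
    show "rsE p (Edg V) (\<lambda>E. of_bool (?B E)) \<le> 10 ^ 9 * ell\<^sup>2 / Lam" using V by (intro no_big_ball) auto
    have "2 * e * (\<Sum>v\<in>V. rsE p (Edg V) (\<lambda>E. of_bool (unhit s0 (rays_at v) (2 * h) v (M * h) E)))
      \<le> 2 * e * (\<Sum>v\<in>V. C * e\<^sup>2 * exp (- nu * (real (M * h) - a0)))"
      unfolding C_def using V Mf be_pos e0 by (intro mult_left_mono sum_mono unhit_rays) auto
    also have "\<dots> = 2 * C * (Lam * exp (- nu * (real (M * h) - a0)))"
      using V by (simp add: Lam_def power2_eq_square power3_eq_cube)
    also have "Lam * exp (- nu * (real (M * h) - a0)) = exp (ell - nu * (M * h - a0))"
      unfolding exp_ell[symmetric] exp_add[symmetric] by simp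
    also have "2 * C * exp (ell - nu * (M * h - a0)) \<le> 2 * C * exp (- (9 / 10 * K))"
      using Mf(3) by (intro mult_left_mono) (auto simp: C_def)
    finally show "2 * e * (\<Sum>v\<in>V. rsE p (Edg V) (\<lambda>E. of_bool (unhit s0 (rays_at v) (2 * h) v (M * h) E))) \<le> 2 * C * exp (- (9 / 10 * K))" .
    let ?q = "\<lambda>i j. nc (2 * M - i - j) * (C * e\<^sup>2 * exp (- nu * (real (j * h) - a0))) * (C * e\<^sup>2 * exp (- nu * (real (i * h) - a0)))"
    have "e\<^sup>2 * (\<Sum>v\<in>V. \<Sum>w\<in>V. \<Sum>i\<in>{2..<M}. \<Sum>j\<in>{2..<M}. rsE p (Edg V) (\<lambda>E. of_bool (far_pair T (i * h) (j * h) v w E)))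
      \<le> e\<^sup>2 * (\<Sum>v\<in>V. \<Sum>w\<in>V. \<Sum>i\<in>{2..<M}. \<Sum>j\<in>{2..<M}. ?q i j)"
    proof (intro mult_left_mono sum_mono)
      fix v w i j assume v: "v \<in> V" "w \<in> V" and ij: "i \<in> {2..<M}" "j \<in> {2..<M}"
      have he: "real (i * h + h) * e \<le> 5 * ell" if "i \<in> {2..<M}" for i
      proof -
        have "Suc i * h \<le> M * h" using that by (intro mult_right_mono) auto
        then have "i * h + h \<le> M * h" by simp
          then have "real (i * h + h) \<le> real (M * h)" by (simp only: of_nat_le_iff)
        then have "real (i * h + h) * e \<le> real (M * h) * e" using e0 by (intro mult_right_mono) auto
        then show ?thesis using Mf(1) by linarith
      qed
      have hh: "(2 * M - i - j) * h + i * h + j * h + 2 * h \<le> T"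
      proof -
        have "(2 * M - i - j) * h + i * h + j * h = ((2 * M - i - j) + i + j) * h" by (simp only: distrib_right)
        also have "(2 * M - i - j) + i + j = 2 * M" using ij by simp
        finally show ?thesis by (simp add: T_def)
      qed
      show "rsE p (Edg V) (\<lambda>E. of_bool (far_pair T (i * h) (j * h) v w E)) \<le> ?q i j"
        unfolding C_def using ij by (intro far_pair_prob[OF V(1) v V(2) _ _ he he _ hh]) auto
    qed simp
    also have "\<dots> = C\<^sup>2 * (\<Sum>i\<in>{2..<M}. \<Sum>j\<in>{2..<M}. e ^ 6 * (real n)\<^sup>2 * (nc (2 * M - i - j) * exp (- nu * (real (j * h) - a0)) * exp (- nu * (real (i * h) - a0))))"
      using V by (simp add: sum_distrib_left power2_eq_square eval_nat_numeral ac_simps)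
    also have "\<dots> \<le> C\<^sup>2 * (\<Sum>i\<in>{2..<M}. \<Sum>j\<in>{2..<M}. 46656 * exp (- (2 * (9 / 10 * K))) * ((1 / 2) ^ (M - i) * (1 / 2) ^ (M - j)) + 2 * exp (4 * ell) * exp (- (sL / 16)))"
      using Mf(3) by (intro mult_left_mono sum_mono nc_block) auto
    also have "\<dots> = C\<^sup>2 * (46656 * exp (- (9 / 5 * K)) * ((\<Sum>i\<in>{2..<M}. (1 / 2) ^ (M - i)) * (\<Sum>j\<in>{2..<M}. (1 / 2) ^ (M - j))) + 2 * Z * (real (M - 2) * real (M - 2)))"
      unfolding double_sum by (simp add: Z_def)
    also have "\<dots> \<le> C\<^sup>2 * (46656 * exp (- (9 / 5 * K)) * (1 * 1) + 2 * Z * (5 * ell * (5 * ell)))"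
      using half_pow_sum Mf(2) ell100 by (intro mult_left_mono add_mono mult_mono) (auto intro!: sum_nonneg simp: Z_def)
    also have "\<dots> = C\<^sup>2 * (46656 * exp (- (9 / 5 * K)) + 50 * ell\<^sup>2 * Z)" by (simp add: power2_eq_square)
    finally show "e\<^sup>2 * (\<Sum>v\<in>V. \<Sum>w\<in>V. \<Sum>i\<in>{2..<M}. \<Sum>j\<in>{2..<M}. rsE p (Edg V) (\<lambda>E. of_bool (far_pair T (i * h) (j * h) v w E)))
      \<le> C\<^sup>2 * (46656 * exp (- (9 / 5 * K)) + 50 * ell\<^sup>2 * Z)" .
  qed
  also have "C\<^sup>2 = 1024 * exp 100" by (simp add: C_def power_mult_distrib exp_of_nat_mult[symmetric])
  also have "2 * C = 64 * exp 50" by (simp add: C_def)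
  finally show ?thesis by (simp add: Z_def M_def mult.assoc)
qed

section \<open>The lower bound\<close>

definition ball_ok :: "'a \<Rightarrow> 'a set set \<Rightarrow> bool" where
  "ball_ok v E \<longleftrightarrow> card (bl E {v} h) \<le> be"

lemma ball_ok_local: "local_at h {v} (ball_ok v)"
  unfolding ball_ok_def[abs_def] by (rule local_at_comp1[OF local_at_bl]) simp

lemma unhit_ball:
  assumes "finite V" "v \<in> V" "card V \<le> n" "n - 6 * be \<le> card V" "h \<le> k" "real k * e \<le> 5 * ell"
  shows "rsE p (Edg V) (\<lambda>E. of_bool (unhit s0 (ball_ok v) h v k E)) \<le> exp 50 * e * exp (- nu * (real k - a0))"
  using late_hit_single[OF assms] unfolding unhit_def ball_ok_def .

lemma rsE_ex_first_hit:
  assumes "\<And>E b. E \<subseteq> Edg W \<Longrightarrow> k \<le> b \<Longrightarrow> b < k' \<Longrightarrow> X E b \<Longrightarrow> \<Psi> b (bl E {w} b) (lev E {w} b) (del E (bl E {w} b)) = (1::real)"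
    and "\<And>b B T F. 0 \<le> \<Psi> b B T F"
  shows "rsE p (Edg W) (\<lambda>E. of_bool (\<exists>b\<in>{k..<k'}. first_hit s0 D g w b E \<and> X E b)) \<le>
    rsE p (Edg W) (\<lambda>E. \<Sum>b\<in>{k..<k'}. of_bool (first_hit s0 D g w b E) * \<Psi> b (bl E {w} b) (lev E {w} b) (del E (bl E {w} b)))"
proof (rule rsE_mono[OF p1(3,2)])
  fix E assume E: "E \<subseteq> Edg W"
  let ?t = "\<lambda>b. of_bool (first_hit s0 D g w b E) * \<Psi> b (bl E {w} b) (lev E {w} b) (del E (bl E {w} b))"
  show "of_bool (\<exists>b\<in>{k..<k'}. first_hit s0 D g w b E \<and> X E b) \<le> (\<Sum>b\<in>{k..<k'}. ?t b)"
  proof (cases "\<exists>b\<in>{k..<k'}. first_hit s0 D g w b E \<and> X E b")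
    case True
    then obtain b where b: "b \<in> {k..<k'}" "first_hit s0 D g w b E" "X E b" by blast
    have "1 = ?t b" using b assms(1)[OF E _ _ b(3)] by simp
    also have "\<dots> \<le> (\<Sum>b\<in>{k..<k'}. ?t b)"
      by (rule member_le_sum[OF b(1)]) (use assms(2) in auto)
    finally show ?thesis using True by simp
  next
    case False
    have "0 \<le> (\<Sum>b\<in>{k..<k'}. ?t b)" using assms(2) by (intro sum_nonneg) simp
    then show ?thesis by (simp only: False of_bool_eq(1))
  qed
qed

text \<open>Used for x far from A0: an early large level around x would have to miss A0 for all the
  remaining time, which costs \<open>nc g\<close>.\<close>

lemma hit_avoid:
  assumes V: "finite V" "x \<in> V" "card V = n" and A: "A0 \<subseteq> V" "s0 \<le> card A0"
    and k: "h \<le> k" "real (k + h) * e \<le> 5 * ell" and g: "2 \<le> g" "g * h + k + h \<le> L"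
  shows "rsE p (Edg V) (\<lambda>E. of_bool (\<exists>b\<in>{k..<k + h}. first_hit s0 (ball_ok x) h x b E \<and> (\<forall>j<L. lev E {x} j \<inter> A0 = {})))
    \<le> nc g * (exp 50 * e * exp (- nu * (real k - a0)))"
proof -
  define \<Psi> where "\<Psi> = (\<lambda>(b::nat) B T F. of_bool (A0 \<inter> B = {} \<and> (\<forall>j\<le>g * h. lev F T j \<inter> A0 = {})) :: real)"
  have nc0: "0 \<le> nc g" by (simp add: nc_def)
  have ke: "real k * e \<le> 5 * ell"
  proof -
    have "real k * e \<le> real (k + h) * e" using e0 by (intro mult_right_mono) auto
    then show ?thesis using k by linarith
  qed
  have "rsE p (Edg V) (\<lambda>E. of_bool (\<exists>b\<in>{k..<k + h}. first_hit s0 (ball_ok x) h x b E \<and> (\<forall>j<L. lev E {x} j \<inter> A0 = {})))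
    \<le> rsE p (Edg V) (\<lambda>E. \<Sum>b\<in>{k..<k + h}. of_bool (first_hit s0 (ball_ok x) h x b E) * \<Psi> b (bl E {x} b) (lev E {x} b) (del E (bl E {x} b)))"
  proof (rule rsE_ex_first_hit)
    fix E b assume b: "k \<le> b" "b < k + h" and av: "\<forall>j<L. lev E {x} j \<inter> A0 = {}"
    have "A0 \<inter> bl E {x} b = {}"
    proof (rule bl_disjoint)
      fix i assume "i < b"
      then have "i < L" using b g by linarith
      then show "A0 \<inter> lev E {x} i = {}" using av by blast
    qed
    moreover have "lev (del E (bl E {x} b)) (lev E {x} b) j \<inter> A0 = {}" if "j \<le> g * h" for j
    proof -
      have "b + j < L" using that b g by linarith
      then show ?thesis using av unfolding lev_add[symmetric] by blast
    qed
    ultimately show "\<Psi> b (bl E {x} b) (lev E {x} b) (del E (bl E {x} b)) = 1" by (simp add: \<Psi>_def)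
  qed (simp add: \<Psi>_def)
  also have "\<dots> \<le> nc g * rsE p (Edg V) (\<lambda>E. of_bool (unhit s0 (ball_ok x) h x k E))"
  proof (rule hit_markov[OF V(1,2) ball_ok_local _ k nc0])
    fix b B T assume B: "B \<subseteq> V" "T \<subseteq> V - B" "card B \<le> 2 * be" "s0 \<le> card T"
    let ?W = "V - B"
    have fB: "finite B" using finite_subset[OF B(1) V(1)] .
    have cW: "real (card ?W) = n - card B"
      using V B fB card_mono[OF V(1) B(1)] by (simp add: card_Diff_subset of_nat_diff)
    show "rsE p (Edg ?W) (\<Psi> b B T) \<le> nc g"
    proof (cases "A0 \<inter> B = {} \<and> T \<inter> A0 = {}")
      case True
      have "rsE p (Edg ?W) (\<lambda>E. of_bool (\<forall>i\<le>g * h. lev E T i \<inter> A0 = {})) \<le> nc g"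
        unfolding nc_def
      proof (rule no_connect[OF _ B(2) _ _ _ _ B(4) A(2) g(1) order_refl])
        show "n - 6 * be \<le> card ?W" unfolding cW using B(3) be_pos by linarith
        show "card ?W \<le> n" using cW by linarith
        show "A0 \<subseteq> ?W" using A(1) True by blast
      qed (use V True in auto)
      then show ?thesis using True by (simp add: \<Psi>_def)
    next
      case False
      have "\<not> (A0 \<inter> B = {} \<and> (\<forall>j\<le>g * h. lev F T j \<inter> A0 = {}))" for F
      proof
        assume a: "A0 \<inter> B = {} \<and> (\<forall>j\<le>g * h. lev F T j \<inter> A0 = {})"
        then have "lev F T 0 \<inter> A0 = {}" by blast
        then show False using False a by simp
      qed
      then have "\<Psi> b B T = (\<lambda>_. 0)" unfolding \<Psi>_def by auto
      then show ?thesis using V nc0 by simp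
    qed
  qed (simp add: ball_ok_def)
  also have "\<dots> \<le> nc g * (exp 50 * e * exp (- nu * (real k - a0)))"
    by (intro mult_left_mono unhit_ball nc0) (use V k ke be_pos in auto)
  finally show ?thesis .
qed

text \<open>Bound on the probability that an exploration from a large level is nearly extinct about
  K blocks before a0 + t, see \<open>chain_eta\<close>; it is small once K and \<open>ell\<close>
  are large.\<close>

definition eta :: "nat \<Rightarrow> real" where
  "eta K = 1200 / K + exp (1 - 3 / 20 * exp (K / 2 - 16)) + 1 / ell"

lemma eta_nonneg: "0 \<le> eta K" using ell100 by (simp add: eta_def)

lemma Lam_ge: "10 ^ 10 * ell ^ 4 \<le> Lam"
proof -
  have "(10 ^ 5 * ell\<^sup>2) * (10 ^ 5 * ell\<^sup>2) \<le> sL * sL" using sL_ge sL_pos by (intro mult_mono) auto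
  then show ?thesis unfolding sL_sq by (simp add: eval_nat_numeral)
qed

lemma exp_sat_le: "exp (- (Lam / (100 * ell\<^sup>2))) \<le> 1 / ell"
proof -
  have l1: "1 \<le> ell" "0 < ell" using ell100 by linarith+
  have "ell \<le> Lam / (100 * ell\<^sup>2)"
  proof -
    have "ell ^ 3 \<le> ell ^ 4" using l1 by (intro power_increasing) auto
    then have "100 * ell ^ 3 \<le> 10 ^ 10 * ell ^ 4" using l1 by (intro mult_mono) auto
    then have "ell * (100 * ell\<^sup>2) \<le> Lam" using Lam_ge by (simp add: eval_nat_numeral)
    then show ?thesis using l1 by (simp add: pos_le_divide_eq)
  qed
  then have "exp (- (Lam / (100 * ell\<^sup>2))) \<le> exp (- ell)" by simp
  also have "\<dots> \<le> 1 / (1 + ell)" using l1 by (intro exp_neg_le) auto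
  also have "\<dots> \<le> 1 / ell" using l1 by (intro divide_left_mono) auto
  finally show ?thesis .
qed

lemma chain_eta:
  assumes V: "finite V" "S \<subseteq> V" "card V \<le> n" "n - 3 * be \<le> card V" and S: "s0 \<le> card S" "card S \<le> 6 * s0"
    and K: "1 \<le> K" "real K \<le> ell / 4"
    and k: "i0 \<le> k" "real k * e \<le> 5 * ell" "nu * (k - a0) \<le> ell - 9 / 10 * K"
  shows "rsE p (Edg V) (\<lambda>E. of_bool (card (lev E S k) < 1 / e)) \<le> eta K"
proof -
  \<comment> \<open>The caps cost a factor exp (- 10 c) in the exponent and fail with probability 48
    / c. With this choice exp (9 / 10 K) still leaves exp (K / 2), while 48 / c = 1200 / K tends to
    0.\<close>
  define c where "c = K / 25"
  have c: "0 < c" using K by (simp add: c_def)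
  have 1: "rsE p (Edg V) (\<lambda>E. of_bool (card (lev E S k) < 1 / e))
    \<le> 48 / c + exp (- (Lam / (100 * ell\<^sup>2))) + exp (1 - 3 / 5 * (exp (- (16 + 10 * c)) / (1 / sL + 3 * exp (- (9 / 10 * K)))))"
    by (rule chain_lives[OF V S c k])
  have 2: "48 / c = 1200 / K" by (simp add: c_def)
  have 3: "exp (1 - 3 / 5 * (exp (- (16 + 10 * c)) / (1 / sL + 3 * exp (- (9 / 10 * K))))) \<le> exp (1 - 3 / 20 * exp (K / 2 - 16))"
  proof -
    have "1 / sL = exp (- (ell / 2))" unfolding sL_exp by (simp only: exp_minus inverse_eq_divide)
    also have "\<dots> \<le> exp (- (9 / 10 * K))" using K ell100 by simp
    finally have d: "1 / sL + 3 * exp (- (9 / 10 * K)) \<le> 4 * exp (- (9 / 10 * K))" by simp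
    have d0: "0 < 1 / sL + 3 * exp (- (9 / 10 * K))" using sL_pos by (intro add_pos_pos) auto
    have "exp (K / 2 - 16) / 4 = exp (- (16 + 10 * c)) * exp (9 / 10 * K) / 4"
      by (simp add: c_def exp_add[symmetric])
    also have "\<dots> = exp (- (16 + 10 * c)) / (4 * exp (- (9 / 10 * K)))" by (simp add: exp_minus field_simps)
    also have "\<dots> \<le> exp (- (16 + 10 * c)) / (1 / sL + 3 * exp (- (9 / 10 * K)))"
      using d d0 by (intro divide_left_mono) auto
    finally have "1 - 3 / 5 * (exp (- (16 + 10 * c)) / (1 / sL + 3 * exp (- (9 / 10 * K)))) \<le> 1 - 3 / 20 * exp (K / 2 - 16)"
      by linarith
    then show ?thesis by (simp only: exp_le_cancel_iff)
  qed
  show ?thesis using 1 3 exp_sat_le unfolding 2 eta_def by linarith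
qed

text \<open>The large level must not be too large either: \<open>growth_caps\<close> and
  \<open>saturation\<close> start from at most 6 s0 vertices, hence the condition on its
  size.\<close>

lemma hit_then_die:
  assumes V: "finite V" "x \<in> V" "card V = n" and k: "h \<le> k" "k \<le> k'" "real k' * e \<le> 5 * ell"
    and K: "1 \<le> K" "real K \<le> ell / 4" and L: "i0 \<le> L" "real L * e \<le> 5 * ell" "nu * (L - a0) \<le> ell - 9 / 10 * K"
  shows "rsE p (Edg V) (\<lambda>E. of_bool (\<exists>b\<in>{k..<k'}. first_hit s0 (ball_ok x) h x b E \<and> real (card (lev E {x} b)) \<le> 6 * s0 \<and> lev E {x} (b + L) = {}))
    \<le> eta K * (exp 50 * e * exp (- nu * (real k - a0)))"
proof -
  define \<Psi> where "\<Psi> = (\<lambda>(b::nat) (B::'a set) (T::'a set) F. of_bool (real (card T) \<le> 6 * s0 \<and> card (lev F T L) < 1 / e) :: real)"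
  have ke: "real k * e \<le> 5 * ell"
  proof -
    have "real k * e \<le> real k' * e" using k e0 by (intro mult_right_mono) auto
    then show ?thesis using k by linarith
  qed
  have "rsE p (Edg V) (\<lambda>E. of_bool (\<exists>b\<in>{k..<k'}. first_hit s0 (ball_ok x) h x b E \<and> real (card (lev E {x} b)) \<le> 6 * s0 \<and> lev E {x} (b + L) = {}))
    \<le> rsE p (Edg V) (\<lambda>E. \<Sum>b\<in>{k..<k'}. of_bool (first_hit s0 (ball_ok x) h x b E) * \<Psi> b (bl E {x} b) (lev E {x} b) (del E (bl E {x} b)))"
    by (rule rsE_ex_first_hit) (use e0 in \<open>simp_all add: \<Psi>_def lev_add\<close>)
  also have "\<dots> \<le> eta K * rsE p (Edg V) (\<lambda>E. of_bool (unhit s0 (ball_ok x) h x k E))"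
  proof (rule hit_markov[OF V(1,2) ball_ok_local _ k(1,3) eta_nonneg])
    fix b B T assume B: "B \<subseteq> V" "T \<subseteq> V - B" "card B \<le> 2 * be" "s0 \<le> card T"
    have fB: "finite B" using finite_subset[OF B(1) V(1)] .
    have cW: "real (card (V - B)) = n - card B"
      using V B fB card_mono[OF V(1) B(1)] by (simp add: card_Diff_subset of_nat_diff)
    show "rsE p (Edg (V - B)) (\<Psi> b B T) \<le> eta K"
    proof (cases "real (card T) \<le> 6 * s0")
      case True
      have "rsE p (Edg (V - B)) (\<lambda>E. of_bool (card (lev E T L) < 1 / e)) \<le> eta K"
      proof (rule chain_eta[OF _ B(2) _ _ B(4) True K L])
        show "n - 3 * be \<le> card (V - B)" unfolding cW using B(3) be_pos by linarith
        show "card (V - B) \<le> n" using cW by linarith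
      qed (use V in auto)
      then show ?thesis using True by (simp add: \<Psi>_def)
    next
      case False
      then have "\<Psi> b B T = (\<lambda>_. 0)" unfolding \<Psi>_def by auto
      then show ?thesis using V eta_nonneg by simp
    qed
  qed (simp add: ball_ok_def)
  also have "\<dots> \<le> eta K * (exp 50 * e * exp (- nu * (real k - a0)))"
    by (intro mult_left_mono unhit_ball eta_nonneg) (use V k ke be_pos in auto)
  finally show ?thesis .
qed

text \<open>From a level below \<open>s0\<close> the next one has mean at most 2 s0, and Markov's
  inequality for 2 to the size gives exp (2 s0) against 2^(6 s0) \<ge> exp (3 s0).\<close>

lemma overshoot_level:
  assumes V: "finite V" "x \<in> V" "card V \<le> n"
  shows "rsE p (Edg V) (\<lambda>E. of_bool (card (lev E {x} b) < s0 \<and> 6 * s0 < real (card (lev E {x} (Suc b))))) \<le> exp (- s0)"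
proof -
  define f :: "'a set set \<Rightarrow> real" where "f = (\<lambda>E. of_bool (card (lev E {x} b) < s0))"
  define m where "m = nat \<lceil>6 * s0\<rceil>"
  have m: "6 * s0 \<le> m" using real_nat_ceiling_ge[of "6 * s0"] unfolding m_def .
  have loc: "local_at b {x} f" unfolding f_def by (rule local_at_comp1[OF local_at_lev]) simp
  have "rsE p (Edg V) (\<lambda>E. of_bool (card (lev E {x} b) < s0 \<and> 6 * s0 < real (card (lev E {x} (Suc b)))))
    \<le> rsE p (Edg V) (\<lambda>E. f E * (\<lambda>B T F. of_bool (m \<le> card (lev F T 1))) (bl E {x} b) (lev E {x} b) (del E (bl E {x} b)))"
  proof (rule rsE_mono[OF p1(3,2)])
    fix E
    have "lev E {x} (Suc b) = lev (del E (bl E {x} b)) (lev E {x} b) 1" using lev_add[of E "{x}" b 1] by simp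
    moreover have "m \<le> N" if "6 * s0 < real N" for N using that by (simp add: m_def nat_le_iff ceiling_le_iff)
    ultimately show "of_bool (card (lev E {x} b) < s0 \<and> 6 * s0 < real (card (lev E {x} (Suc b))))
      \<le> f E * (\<lambda>B T F. of_bool (m \<le> card (lev F T 1))) (bl E {x} b) (lev E {x} b) (del E (bl E {x} b))"
      by (auto simp: f_def of_bool_def)
  qed
  also have "\<dots> = rsE p (Edg V) (\<lambda>E. f E * rsE p (Edg (V - bl E {x} b)) (\<lambda>F. of_bool (m \<le> card (lev F (lev E {x} b) 1))))"
    by (rule rsE_markov[OF V(1) _ loc]) (use V in simp)
  also have "\<dots> \<le> rsE p (Edg V) (\<lambda>E. exp (- s0))"
  proof (rule rsE_mono[OF p1(3,2)])
    fix E assume E: "E \<subseteq> Edg V"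
    show "f E * rsE p (Edg (V - bl E {x} b)) (\<lambda>F. of_bool (m \<le> card (lev F (lev E {x} b) 1))) \<le> exp (- s0)"
    proof (cases "card (lev E {x} b) < s0")
      case True
      let ?W = "V - bl E {x} b" and ?S = "lev E {x} b"
      have SW: "?S \<subseteq> ?W" using lev_subset[OF E, of "{x}" b] lev_bl_disjoint[of E "{x}" b] V by blast
      have "card ?W \<le> card V" using V(1) by (intro card_mono) auto
      then have cW: "card ?W \<le> n" using V(3) by linarith
      have "rsE p (Edg ?W) (\<lambda>F. of_bool (m \<le> card (lev F ?S 1))) \<le> exp (p * card ?W * card ?S) / 2 ^ m"
        using overshoot[OF p1(3,2) _ SW] V by simp
      also have "\<dots> \<le> exp (2 * s0) / exp (3 * s0)"
      proof (rule frac_le)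
        have "p * card ?W * card ?S \<le> 2 * s0"
          using p_card_le[OF cW] lamb p0 True by (intro mult_mono) auto
        then show "exp (p * card ?W * card ?S) \<le> exp (2 * s0)" by simp
        have "exp (1 / 2 :: real) ^ 2 = exp 1" by (simp add: exp_of_nat_mult[symmetric])
        also have "\<dots> \<le> 2 ^ 2" using exp_le by simp
        finally have "exp (1 / 2 :: real) \<le> 2" by (rule power2_le_imp_le) simp
        then have "exp (1 / 2 :: real) ^ m \<le> 2 ^ m" by (intro power_mono) auto
        moreover have "exp (1 / 2 :: real) ^ m = exp (m / 2)" by (simp add: exp_of_nat_mult[symmetric])
        moreover have "exp (3 * s0) \<le> exp (real m / 2)" using m by simp
        ultimately show "exp (3 * s0) \<le> 2 ^ m" by linarith
      qed auto
      also have "\<dots> = exp (- s0)" by (simp add: exp_diff[symmetric])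
      finally show ?thesis using True by (simp add: f_def)
    qed (simp add: f_def)
  qed
  finally show ?thesis using V by simp
qed

end

lemma lev_from_set:
  assumes "x \<in> lev E A k"
  shows "\<And>j. j < k \<Longrightarrow> lev E {x} j \<inter> A = {}" "lev E {x} k \<noteq> {}"
proof -
  have x: "\<exists>a\<in>A. wlk E k a x" "\<And>j a. j < k \<Longrightarrow> a \<in> A \<Longrightarrow> \<not> wlk E j a x"
    using assms by (auto simp: lev_def)
  show no: "lev E {x} j \<inter> A = {}" if "j < k" for j
  proof (rule ccontr)
    assume "lev E {x} j \<inter> A \<noteq> {}"
    then obtain a where "a \<in> A" "wlk E j x a" by (auto simp: lev_single_iff)
    then show False using x(2)[OF that] wlk_sym by metis
  qed
  obtain a where a: "a \<in> A" "wlk E k x a" using x(1) wlk_sym by metis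
  obtain j where j: "j \<le> k" "a \<in> lev E {x} j" using wlk_imp_lev[OF _ a(2), of "{x}"] by blast
  have "\<not> j < k" using no[of j] j(2) a(1) by auto
  then have "j = k" using j(1) by simp
  then show "lev E {x} k \<noteq> {}" using j(2) by blast
qed

lemma rsE_of_bool_or4:
  assumes "0 \<le> q" "q \<le> 1" "\<And>X. X \<subseteq> A \<Longrightarrow> P X \<Longrightarrow> P1 X \<or> P2 X \<or> P3 X \<or> P4 X"
  shows "rsE q A (\<lambda>X. of_bool (P X)) \<le> rsE q A (\<lambda>X. of_bool (P1 X)) + rsE q A (\<lambda>X. of_bool (P2 X))
    + rsE q A (\<lambda>X. of_bool (P3 X)) + rsE q A (\<lambda>X. of_bool (P4 X))"
  unfolding rsE_add[symmetric]
proof (rule rsE_mono[OF assms(1,2)])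
  fix X assume "X \<subseteq> A"
  then show "of_bool (P X) \<le> of_bool (P1 X) + of_bool (P2 X) + of_bool (P3 X) + (of_bool (P4 X) :: real)"
    using assms(3)[of X] by (auto simp: of_bool_def)
qed

lemma rsE_of_bool_ex:
  assumes "0 \<le> q" "q \<le> 1" "finite I"
  shows "rsE q A (\<lambda>X. of_bool (\<exists>i\<in>I. P i X)) \<le> (\<Sum>i\<in>I. rsE q A (\<lambda>X. of_bool (P i X)))"
  unfolding rsE_sum[symmetric]
proof (rule rsE_mono[OF assms(1,2)])
  fix X
  show "of_bool (\<exists>i\<in>I. P i X) \<le> (\<Sum>i\<in>I. of_bool (P i X) :: real)"
  proof (cases "\<exists>i\<in>I. P i X")
    case True
    then obtain i where i: "i \<in> I" "P i X" by blast
    have "1 = (of_bool (P i X) :: real)" using i by simp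
    also have "\<dots> \<le> (\<Sum>i\<in>I. of_bool (P i X))" by (rule member_le_sum) (use i assms in auto)
    finally show ?thesis using True by simp
  qed (simp add: sum_nonneg)
qed

context weakly_supercritical begin

section \<open>Vertices at a prescribed distance from a fixed large set\<close>

text \<open>a0 + t in whole blocks of length h, rounded down, where \<open>Mup\<close> rounds up;
  the rounding is within the error O(1 / \<epsilon>).\<close>

definition Nf :: nat where "Nf = nat \<lfloor>(a0 + ell / nu) / h\<rfloor>"

lemma Nf_bounds: "real Nf * h \<le> a0 + ell / nu" "a0 + ell / nu \<le> real Nf * h + h"
proof -
  have hp: "0 < real h" using h_bounds by simp
  have x0: "0 \<le> (a0 + ell / nu) / h" using a0_bounds t_bounds hp by simp
  define x where "x = (a0 + ell / nu) / h"
  have c: "real Nf = of_int \<lfloor>x\<rfloor>" using x0 unfolding x_def by (simp add: Nf_def)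
  have "of_int \<lfloor>x\<rfloor> \<le> x" "x \<le> of_int \<lfloor>x\<rfloor> + 1" by linarith+
  then have "of_int \<lfloor>x\<rfloor> * real h \<le> x * h" "x * h \<le> (of_int \<lfloor>x\<rfloor> + 1) * real h"
    using hp by (auto intro: mult_right_mono)
  moreover have "x * h = a0 + ell / nu" using hp by (simp add: x_def)
  ultimately show "real Nf * h \<le> a0 + ell / nu" "a0 + ell / nu \<le> real Nf * h + h"
    unfolding c by (simp_all add: distrib_right)
qed

lemma Nf_e: "real (Nf * h) * e \<le> 5 / 3 * ell" "real Nf \<le> 5 / 3 * ell"
proof -
  have "real Nf * h * e \<le> (a0 + ell / nu) * e" using Nf_bounds(1) e0 by (intro mult_right_mono) auto
  then show 1: "real (Nf * h) * e \<le> 5 / 3 * ell" using a0_bounds(2) t_bounds(1) unfolding distrib_right of_nat_mult by linarith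
  have "real Nf * 1 \<le> real Nf * (e * h)" using h_bounds by (intro mult_left_mono) auto
  then show "real Nf \<le> 5 / 3 * ell" using 1 by (simp add: mult.commute mult.left_commute)
qed

lemma t_ge:
  assumes "real r \<le> ell / 10"
  shows "(r + 3) * h + 1 \<le> ell / nu"
proof -
  have eh: "e * h \<le> 11 / 10" by (rule h_bounds)
  have "((r + 3) * h + 1) * e = (real r + 3) * (e * h) + e" by (simp add: algebra_simps)
  also have "\<dots> \<le> (ell / 10 + 3) * (11 / 10) + 1" using assms eh e0 e1 ell100 by (intro add_mono mult_mono) auto
  also have "\<dots> \<le> 5 / 6 * ell"
  proof -
    have "(x / 10 + 3) * (11 / 10) + 1 \<le> 5 / 6 * x" if "100 \<le> x" for x :: real using that by (simp add: field_simps)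
    then show ?thesis using ell100 by blast
  qed
  also have "\<dots> \<le> ell / nu * e"
  proof -
    have "ell / (6 / 5 * e) \<le> ell / nu" using nu_bounds ell100 e0 by (intro divide_left_mono) auto
    then have "ell / (6 / 5 * e) * e \<le> ell / nu * e" using e0 by (intro mult_right_mono) auto
    then show ?thesis using e0 by simp
  qed
  finally show ?thesis using e0 by (rule mult_right_le_imp_le)
qed

lemma Nf_sub:
  assumes r: "real r \<le> ell / 10"
  shows "r + 2 \<le> Nf" "real ((Nf - r) * h) = real Nf * h - real r * h" "i0 \<le> (Nf - r) * h"
    "real ((Nf - r) * h) * e \<le> 5 * ell" "nu * (real ((Nf - r) * h) - a0) \<le> ell - 9 / 10 * r"
    "ell - nu * (real ((Nf - r) * h) - a0) \<le> nu * h * (real r + 1)"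
    "exp (ell - nu * (real ((Nf - r) * h) - a0)) \<le> 4 ^ (r + 1)"
proof -
  have hp: "0 < real h" using h_bounds by simp
  have t: "real ((r + 3) * h + 1) \<le> ell / nu" using t_ge[OF r] by simp
  have N: "(real r + 3) * h + 1 + a0 \<le> real Nf * h + h" using t Nf_bounds by simp
  then have "(real r + 2) * h \<le> real Nf * h" using a0_bounds by (simp add: distrib_right)
  then have "real r + 2 \<le> real Nf" using hp by (simp only: mult_le_cancel_right_pos)
  then show 1: "r + 2 \<le> Nf" by simp
  then show 2: "real ((Nf - r) * h) = real Nf * h - real r * h" by (simp add: of_nat_diff left_diff_distrib)
  have "a0 + 1 \<le> real ((Nf - r) * h)" unfolding 2 using N hp by (simp add: distrib_right)
  then have "real i0 \<le> real ((Nf - r) * h)" using i0_bounds(2) by linarith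
  then show "i0 \<le> (Nf - r) * h" by (simp only: of_nat_le_iff)
  have "real ((Nf - r) * h) \<le> real (Nf * h)" unfolding 2 by simp
  then have "real ((Nf - r) * h) * e \<le> real (Nf * h) * e" using e0 by (intro mult_right_mono) auto
  then show "real ((Nf - r) * h) * e \<le> 5 * ell" using Nf_e ell100 by linarith
  have nt: "nu * (ell / nu) = ell" using nu_bounds by simp
  have "nu * (real Nf * h - a0) \<le> nu * (ell / nu)" using Nf_bounds nu_bounds by (intro mult_left_mono) auto
  then have u: "nu * (real Nf * h) - nu * a0 \<le> ell" unfolding nt by (simp add: right_diff_distrib)
  have "nu * (ell / nu - h) \<le> nu * (real Nf * h - a0)" using Nf_bounds nu_bounds by (intro mult_left_mono) auto
  then have l: "ell - nu * h \<le> nu * (real Nf * h) - nu * a0" unfolding right_diff_distrib nt .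
  have m: "nu * (real ((Nf - r) * h) - a0) = nu * (real Nf * h) - nu * a0 - nu * h * r"
    unfolding 2 by (simp add: algebra_simps)
  have "9 / 10 * r \<le> nu * h * r" using nu_h by (intro mult_right_mono) auto
  then show "nu * (real ((Nf - r) * h) - a0) \<le> ell - 9 / 10 * r" unfolding m using u by linarith
  show 3: "ell - nu * (real ((Nf - r) * h) - a0) \<le> nu * h * (real r + 1)" unfolding m using l by (simp add: algebra_simps)
  have "exp (ell - nu * (real ((Nf - r) * h) - a0)) \<le> exp (nu * h * (real r + 1))" using 3 by simp
  also have "\<dots> = exp (nu * h) ^ (r + 1)" unfolding exp_of_nat_mult[symmetric] by (simp add: mult.commute)
  also have "\<dots> \<le> 4 ^ (r + 1)" using exp_nu_h by (intro power_mono) auto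
  finally show "exp (ell - nu * (real ((Nf - r) * h) - a0)) \<le> 4 ^ (r + 1)" .
qed

lemma en_Lam: "e\<^sup>2 * (n * (e * x)) = Lam * x"
  by (simp add: Lam_def power2_eq_square power3_eq_cube)

lemma Lam_exp: "Lam * exp (- nu * (y - a0)) = exp (ell - nu * (y - a0))"
  unfolding exp_ell[symmetric] exp_add[symmetric] by simp

text \<open>Bound for the expected number of vertices alive but without a large level up to block i.
  In units of 1 / e^2 it is of constant order at i = Nf.\<close>

definition pr :: "nat \<Rightarrow> real" where "pr i = n * (exp 50 * e * exp (- nu * (real (i * h) - a0)))"

lemma pr_eq: "e\<^sup>2 * pr i = exp 50 * exp (ell - nu * (real (i * h) - a0))"
proof -
  have "e\<^sup>2 * pr i = exp 50 * (e\<^sup>2 * (n * (e * exp (- nu * (real (i * h) - a0)))))" by (simp add: pr_def)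
  then show ?thesis unfolding en_Lam Lam_exp .
qed

text \<open>Going s blocks back multiplies the number of candidates by order 4^s, against the doubly
  exponential part of \<open>nc s\<close>. Hits more than 4 K blocks early leave over 3 K - 2 blocks
  for a connection, whence 2^(- K); the constant 11943936 is 256 times 6^6.\<close>

lemma early_blocks:
  assumes K: "1 \<le> K" "real (4 * K) \<le> ell / 10"
  shows "e\<^sup>2 * (\<Sum>i\<in>{1..<Nf - 4 * K}. nc (Nf - K - 2 - i) * pr i)
    \<le> exp 50 * (11943936 / 2 ^ K + 10 * ell * exp (2 * ell) * exp (- (sL / 16)))"
proof -
  define M where "M = Nf - 4 * K"
  have N4: "4 * K + 2 \<le> Nf" using Nf_sub(1)[OF K(2)] .
  have tb: "e\<^sup>2 * (nc (Nf - K - 2 - i) * pr i)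
    \<le> exp 50 * (11943936 / 2 ^ K * (1 / 2) ^ (M - i) + 2 * exp (2 * ell) * exp (- (sL / 16)))" if i: "i \<in> {1..<M}" for i
  proof -
    define s where "s = Nf - K - 2 - i"
    define Q where "Q = exp (ell - nu * (real (i * h) - a0))"
    have iN: "i = Nf - (K + 2 + s)" "K + 2 + s \<le> Nf" using i N4 K by (auto simp: s_def M_def)
    have s: "s = (M - i) + (3 * K - 2)" using i N4 K by (auto simp: s_def M_def)
    have Q2: "Q \<le> exp (2 * ell)"
    proof -
      have "0 \<le> nu * real (i * h)" using nu_bounds by simp
      then show ?thesis using a0_bounds(5) ell100 by (simp add: Q_def right_diff_distrib)
    qed
    have Q1: "Q \<le> 4 ^ (K + 3 + s)"
    proof -
      have rN: "real (i * h) = real Nf * h - real (K + 2 + s) * h"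
        unfolding iN(1) using iN(2) by (simp add: of_nat_diff left_diff_distrib)
      have "ell - nu * h = nu * (ell / nu - h)" using nu_bounds by (simp add: field_simps)
      also have "\<dots> \<le> nu * (real Nf * h - a0)" using Nf_bounds nu_bounds by (intro mult_left_mono) auto
      finally have "ell - nu * (real (i * h) - a0) \<le> nu * h * real (K + 3 + s)"
        unfolding rN by (simp add: algebra_simps)
      then have "Q \<le> exp (nu * h * real (K + 3 + s))" unfolding Q_def by simp
      also have "\<dots> = exp (nu * h) ^ (K + 3 + s)" by (simp only: exp_of_nat_mult[symmetric] mult.commute)
      also have "\<dots> \<le> 4 ^ (K + 3 + s)" using exp_nu_h by (intro power_mono) auto
      finally show ?thesis .
    qed
    have "e\<^sup>2 * (nc s * pr i) = nc s * (e\<^sup>2 * pr i)" by simp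
    also have "\<dots> = exp 50 * (Q * exp (- ((3 / 2) ^ s)) + 2 * (Q * exp (- (sL / 16))))"
      unfolding pr_eq Q_def nc_def by (simp add: algebra_simps)
    also have "\<dots> \<le> exp 50 * (4 ^ (K + 3 + s) * exp (- ((3 / 2) ^ s)) + 2 * (exp (2 * ell) * exp (- (sL / 16))))"
      using Q1 Q2 by (intro mult_left_mono add_mono mult_right_mono) auto
    also have "\<dots> \<le> exp 50 * (11943936 / 2 ^ K * (1 / 2) ^ (M - i) + 2 * (exp (2 * ell) * exp (- (sL / 16))))"
    proof (intro mult_left_mono add_right_mono)
      have "4 ^ (K + 3 + s) * exp (- ((3 / 2) ^ s)) = 4 ^ (K + 3) * (4 ^ s * exp (- ((3 / 2 :: real) ^ s)))"
        by (simp only: power_add mult.assoc)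
      also have "\<dots> \<le> 4 ^ (K + 3) * (46656 * (1 / 2) ^ s)" by (intro mult_left_mono four_pow_exp) auto
      also have "\<dots> = 4 ^ (K + 3) * 46656 * (1 / 2) ^ (3 * K - 2) * (1 / 2) ^ (M - i)"
        unfolding s by (simp add: power_add)
      also have "4 ^ (K + 3) * 46656 * (1 / 2 :: real) ^ (3 * K - 2) = 11943936 / 2 ^ K"
      proof -
        obtain j where j: "K = Suc j" using K by (cases K) auto
        have "3 * K - 2 = 3 * j + 1" by (simp add: j)
        then have a: "(1 / 2 :: real) ^ (3 * K - 2) = 1 / 2 * (1 / 8) ^ j" by (simp add: power_mult power_divide)
        have b: "(4::real) ^ (K + 3) = 256 * 4 ^ j" by (simp add: j power_add)
        have c: "(4::real) ^ j * (1 / 8) ^ j = 1 / 2 ^ j" unfolding power_mult_distrib[symmetric] by (simp add: power_one_over)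
        have "4 ^ (K + 3) * 46656 * (1 / 2 :: real) ^ (3 * K - 2) = (256 * 4 ^ j) * 46656 * (1 / 2 * (1 / 8) ^ j)"
          unfolding a b ..
        also have "\<dots> = 5971968 * (4 ^ j * (1 / 8) ^ j)" by simp
        finally show ?thesis unfolding c by (simp add: j)
      qed
      finally show "4 ^ (K + 3 + s) * exp (- ((3 / 2) ^ s)) \<le> 11943936 / 2 ^ K * (1 / 2 :: real) ^ (M - i)" .
    qed auto
    finally show ?thesis unfolding s_def[symmetric] by (simp only: mult.assoc)
  qed
  have "e\<^sup>2 * (\<Sum>i\<in>{1..<M}. nc (Nf - K - 2 - i) * pr i) = (\<Sum>i\<in>{1..<M}. e\<^sup>2 * (nc (Nf - K - 2 - i) * pr i))"
    by (rule sum_distrib_left)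
  also have "\<dots> \<le> (\<Sum>i\<in>{1..<M}. exp 50 * (11943936 / 2 ^ K * (1 / 2) ^ (M - i) + 2 * exp (2 * ell) * exp (- (sL / 16))))"
    by (intro sum_mono tb)
  also have "\<dots> = exp 50 * (11943936 / 2 ^ K * (\<Sum>i\<in>{1..<M}. (1 / 2) ^ (M - i)) + real (M - 1) * (2 * exp (2 * ell) * exp (- (sL / 16))))"
    unfolding sum_distrib_left[symmetric] sum.distrib by simp
  also have "\<dots> \<le> exp 50 * (11943936 / 2 ^ K * 1 + (5 * ell) * (2 * exp (2 * ell) * exp (- (sL / 16))))"
  proof (intro mult_left_mono add_mono mult_right_mono half_pow_sum)
    have "real (M - 1) \<le> real Nf" by (simp add: M_def)
    then show "real (M - 1) \<le> 5 * ell" using Nf_e ell100 by linarith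
  qed auto
  also have "exp 50 * (11943936 / 2 ^ K * 1 + (5 * ell) * (2 * exp (2 * ell) * exp (- (sL / 16))))
    = exp 50 * (11943936 / 2 ^ K + 10 * ell * exp (2 * ell) * exp (- (sL / 16)))" by simp
  finally show ?thesis unfolding M_def .
qed

text \<open>The window of h levels starting here ends K blocks before \<open>Nf\<close>, early
  enough for its levels to be alive with high probability.\<close>

definition Ldist :: "nat \<Rightarrow> nat" where "Ldist K = (Nf - (K + 1)) * h"

text \<open>A first large level no earlier than block Nf - 4 K, then survival for Nf - P blocks. P
  is separate from K because \<open>eta P\<close> must outweigh the 4^(4 K + 1) / e^2 candidates for
  such a level.\<close>

definition Tlow :: "nat \<Rightarrow> nat \<Rightarrow> nat" where "Tlow K P = (Nf - 4 * K) * h + (Nf - P) * h"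

definition short :: "'a set \<Rightarrow> nat \<Rightarrow> nat \<Rightarrow> 'a \<Rightarrow> 'a set set \<Rightarrow> bool" where
  "short A K P x E \<longleftrightarrow> (\<exists>k\<in>{Ldist K..<Ldist K + h}. x \<in> lev E A k) \<and> ball_ok x E \<and> lev E {x} (Tlow K P) = {}"

text \<open>The cases answer where the first large level seen from x is: nowhere up to block Nf + K;
  so early that A should have been met before \<open>Ldist\<close>; late but followed by an early
  death; late with an overshoot above 6 s0.\<close>

lemma short_cases:
  assumes K: "1 \<le> K" "real (4 * K) \<le> ell / 10" and sh: "short A K P x E"
  shows "(ball_ok x E \<and> lev E {x} (Ldist K) \<noteq> {} \<and> (\<forall>j. h \<le> j \<and> j \<le> (Nf + K) * h \<longrightarrow> card (lev E {x} j) < s0)) \<or>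
    (\<exists>i\<in>{1..<Nf - 4 * K}. \<exists>b\<in>{i * h..<i * h + h}. first_hit s0 (ball_ok x) h x b E \<and> (\<forall>j<Ldist K. lev E {x} j \<inter> A = {})) \<or>
    (\<exists>b\<in>{(Nf - 4 * K) * h..<Suc ((Nf + K) * h)}. first_hit s0 (ball_ok x) h x b E \<and> real (card (lev E {x} b)) \<le> 6 * s0 \<and> lev E {x} (b + (Nf - P) * h) = {}) \<or>
    (\<exists>b\<in>{..<(Nf + K) * h}. card (lev E {x} b) < s0 \<and> 6 * s0 < card (lev E {x} (Suc b)))" (is "?c1 \<or> ?c2 \<or> ?c3 \<or> ?c4")
proof -
  let ?m = "(Nf - 4 * K) * h" and ?H = "(Nf + K) * h"
  have hp: "1 \<le> h" by (rule h_bounds)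
  have N4: "4 * K + 2 \<le> Nf" using Nf_sub(1)[OF K(2)] .
  have mh: "2 * h \<le> ?m" using N4 by (intro mult_right_mono) auto
  obtain k where k: "Ldist K \<le> k" "x \<in> lev E A k" using sh by (auto simp: short_def)
  have ok: "ball_ok x E" and dead: "lev E {x} (?m + (Nf - P) * h) = {}" using sh by (auto simp: short_def Tlow_def)
  have av: "\<forall>j<Ldist K. lev E {x} j \<inter> A = {}" using lev_from_set(1)[OF k(2)] k(1) by auto
  have lv: "lev E {x} (Ldist K) \<noteq> {}" using lev_from_set(2)[OF k(2)] lev_empty_mono[OF _ k(1), of E "{x}"] by blast
  show ?thesis
  proof (cases "\<exists>b. h \<le> b \<and> b \<le> ?H \<and> s0 \<le> card (lev E {x} b)")
    case False
    then have "\<forall>j. h \<le> j \<and> j \<le> ?H \<longrightarrow> card (lev E {x} j) < s0" by (meson not_le)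
    then have ?c1 using ok lv by blast
    then show ?thesis ..
  next
    case True
    define b where "b = (LEAST b. h \<le> b \<and> b \<le> ?H \<and> s0 \<le> card (lev E {x} b))"
    have b: "h \<le> b" "b \<le> ?H" "s0 \<le> card (lev E {x} b)" using LeastI_ex[OF True] unfolding b_def by auto
    have least: "card (lev E {x} j) < s0" if "h \<le> j" "j < b" for j
      using not_less_Least[of j "\<lambda>b. h \<le> b \<and> b \<le> ?H \<and> s0 \<le> card (lev E {x} b)"] that b
      unfolding b_def[symmetric] by (meson le_trans less_imp_le_nat not_le)
    then have hit: "first_hit s0 (ball_ok x) h x b E" using ok b(3) by (simp add: first_hit_def)
    show ?thesis
    proof (cases "b < ?m")
      case True
      have "b div h * h + b mod h = b" "b mod h < h" using hp by simp_all
      then have "b \<in> {b div h * h..<b div h * h + h}" unfolding atLeastLessThan_iff by linarith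
      moreover have "b div h \<in> {1..<Nf - 4 * K}"
        using b(1) True hp by (simp add: less_mult_imp_div_less less_eq_div_iff_mult_less_eq Suc_le_eq div_greater_zero_iff)
      ultimately have ?c2 using hit av by blast
      then show ?thesis by blast
    next
      case False
      then have bm: "?m \<le> b" by simp
      show ?thesis
      proof (cases "real (card (lev E {x} b)) \<le> 6 * s0")
        case True
        have "lev E {x} (b + (Nf - P) * h) = {}" using lev_empty_mono[OF dead] bm by simp
        then have ?c3 using hit True bm b(2) by auto
        then show ?thesis by blast
      next
        case False
        obtain b' where b': "b = Suc b'" using bm mh hp by (cases b) auto
        have "h \<le> b'" using bm mh hp b' by linarith
        then have "card (lev E {x} b') < s0" using least[of b'] b' by simp
        then have ?c4 using False b' b(2) by auto
        then show ?thesis by blast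
      qed
    qed
  qed
qed

lemma exp_s0_small: "s0\<^sup>2 * exp (- s0) \<le> 46656 / sL"
proof -
  have s1: "1 \<le> s0" "sL \<le> s0"
  proof -
    show "1 \<le> s0" using s0_ge by simp
    have "sL * 1 \<le> sL * (1 / e)" using sL_pos e0 e1 by (intro mult_left_mono) auto
    then show "sL \<le> s0" unfolding s0_eq by simp
  qed
  have "s0\<^sup>2 * exp (- s0) \<le> s0\<^sup>2 * (46656 / s0 ^ 6)" using s0_pos by (intro mult_left_mono exp_neg_le_pow6) auto
  also have "\<dots> = 46656 / s0 ^ 4" using s0_pos by (simp add: field_simps eval_nat_numeral)
  also have "\<dots> \<le> 46656 / sL"
  proof (rule divide_left_mono)
    have "s0 ^ 1 \<le> s0 ^ 4" using s1 by (intro power_increasing) auto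
    then show "sL \<le> s0 ^ 4" using s1 by simp
  qed (use sL_pos s0_pos in auto)
  finally show ?thesis .
qed

lemma Nf_add:
  assumes "real K \<le> ell / 10"
  shows "real ((Nf + K) * h) * e \<le> 2 * ell"
proof -
  have "real ((Nf + K) * h) * e = real (Nf * h) * e + K * (e * h)" by (simp add: algebra_simps)
  moreover have "K * (e * h) \<le> ell / 10 * (11 / 10)" using h_bounds assms e0 by (intro mult_mono) auto
  ultimately show ?thesis using Nf_e(1) ell100 by linarith
qed

text \<open>The sum runs over all of V, not over the window: membership in the window enters only
  through being alive at \<open>Ldist\<close> and avoiding A before. Each case of
  \<open>short_cases\<close> gives one summand, measured in units of 1 / e^2.\<close>

lemma short_mean:
  assumes V: "finite V" "card V = n" and A: "A \<subseteq> V" "s0 \<le> card A"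
    and K: "2 \<le> K" "real (4 * K) \<le> ell / 10" and P: "1 \<le> P" "real P \<le> ell / 10"
  shows "e\<^sup>2 * (\<Sum>x\<in>V. rsE p (Edg V) (\<lambda>E. of_bool (short A K P x E)))
    \<le> 4 * exp 35 * (4 ^ (K + 3) * exp (- (ell / 2)) + exp (- (9 / 10 * (real K - 2)))) +
      exp 50 * (11943936 / 2 ^ K + 10 * ell * exp (2 * ell) * exp (- (sL / 16))) +
      exp 50 * (eta P * 4 ^ (4 * K + 1)) + 233280 * ell / sL"
proof -
  define H where "H = (Nf + K) * h"
  define m where "m = (Nf - 4 * K) * h"
  define L where "L = Ldist K"
  have hp: "1 \<le> h" by (rule h_bounds)
  have K1: "1 \<le> K" using K by simp
  have Kl: "real (K + 1) \<le> ell / 10" "real (K + 2) \<le> ell / 10" using K by simp_all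
  have N4: "4 * K + 2 \<le> Nf" using Nf_sub(1)[OF K(2)] .
  have H2: "real H * e \<le> 2 * ell" unfolding H_def using Kl by (intro Nf_add) simp
  then have He: "real H * e \<le> 5 * ell" using ell100 by linarith
  have mH: "2 * h \<le> m" "m \<le> H" unfolding m_def H_def using N4 by (intro mult_right_mono; simp)+
  have ih: "h \<le> i * h" "real (i * h + h) * e \<le> 5 * ell" if "i \<in> {1..<Nf - 4 * K}" for i
  proof -
    show "h \<le> i * h" using that by simp
    have "i * h + h \<le> m" using mult_right_mono[of "Suc i" "Nf - 4 * K" h] that by (simp add: m_def)
    then have "i * h + h \<le> H" using mH(2) by linarith
    then have "real (i * h + h) \<le> real H" by (simp only: of_nat_le_iff)
    then have "real (i * h + h) * e \<le> real H * e" using e0 by (intro mult_right_mono) auto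
    then show "real (i * h + h) * e \<le> 5 * ell" using He by linarith
  qed
  define c1 where "c1 = exp 35 * e * (exp (- nu * (real L - h)) + exp (- nu * (real H - h - a0))) * 4"
  define c2 where "c2 = (\<Sum>i\<in>{1..<Nf - 4 * K}. nc (Nf - K - 2 - i) * (exp 50 * e * exp (- nu * (real (i * h) - a0))))"
  define c3 where "c3 = eta P * (exp 50 * e * exp (- nu * (real m - a0)))"
  define c4 where "c4 = real H * exp (- s0)"
  have each: "rsE p (Edg V) (\<lambda>E. of_bool (short A K P x E)) \<le> c1 + c2 + c3 + c4" if x: "x \<in> V" for x
  proof -
    let ?e1 = "\<lambda>E. ball_ok x E \<and> lev E {x} L \<noteq> {} \<and> (\<forall>j. h \<le> j \<and> j \<le> H \<longrightarrow> card (lev E {x} j) < s0)"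
    let ?e2 = "\<lambda>i E. \<exists>b\<in>{i * h..<i * h + h}. first_hit s0 (ball_ok x) h x b E \<and> (\<forall>j<L. lev E {x} j \<inter> A = {})"
    let ?e3 = "\<lambda>E. \<exists>b\<in>{m..<Suc H}. first_hit s0 (ball_ok x) h x b E \<and> real (card (lev E {x} b)) \<le> 6 * s0 \<and> lev E {x} (b + (Nf - P) * h) = {}"
    let ?e4 = "\<lambda>b E. card (lev E {x} b) < s0 \<and> 6 * s0 < card (lev E {x} (Suc b))"
    have "rsE p (Edg V) (\<lambda>E. of_bool (short A K P x E)) \<le> rsE p (Edg V) (\<lambda>E. of_bool (?e1 E)) +
      rsE p (Edg V) (\<lambda>E. of_bool (\<exists>i\<in>{1..<Nf - 4 * K}. ?e2 i E)) + rsE p (Edg V) (\<lambda>E. of_bool (?e3 E)) +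
      rsE p (Edg V) (\<lambda>E. of_bool (\<exists>b\<in>{..<H}. ?e4 b E))"
      by (rule rsE_of_bool_or4[OF p1(3,2)]) (unfold L_def m_def H_def, rule short_cases[OF K1 K(2)])
    moreover have "rsE p (Edg V) (\<lambda>E. of_bool (?e1 E)) \<le> c1"
    proof -
      have mean: "rsE p (Edg V) (\<lambda>E. real (card (lev E {x} h))) \<le> 4"
      proof -
        have "rsE p (Edg V) (\<lambda>E. real (card (lev E {x} h))) \<le> lam ^ h * card {x}"
          using V x p1 by (intro card_lev_mean p_card_le) auto
        then show ?thesis using lam_h by simp
      qed
      have L2: "h + h \<le> L" "L \<le> H"
      proof -
        have "2 * h \<le> (Nf - (K + 1)) * h" using N4 K1 by (intro mult_right_mono) auto
        then show "h + h \<le> L" unfolding L_def Ldist_def mult_2 .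
        have "(Nf - (K + 1)) * h \<le> (Nf + K) * h" by (intro mult_right_mono) auto
        then show "L \<le> H" by (simp add: L_def Ldist_def H_def)
      qed
      have "rsE p (Edg V) (\<lambda>E. of_bool (True \<and> card (bl E {x} h) \<le> be \<and> lev E {x} L \<noteq> {} \<and>
          (\<forall>j. h \<le> j \<and> j \<le> H \<longrightarrow> card (lev E {x} j) < s0)))
        \<le> exp 35 * e * (exp (- nu * (real L - h)) + exp (- nu * (real H - h - a0))) * rsE p (Edg V) (\<lambda>E. of_bool True * real (card (lev E {x} h)))"
        by (rule tube_after[OF V(1) _ _ _ local_at_const He L2]) (use V x be_pos in auto)
      also have "\<dots> \<le> c1" unfolding c1_def using mean e0 by (intro mult_left_mono) auto
      finally show ?thesis by (simp add: ball_ok_def)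
    qed
    moreover have "rsE p (Edg V) (\<lambda>E. of_bool (\<exists>i\<in>{1..<Nf - 4 * K}. ?e2 i E)) \<le> c2"
    proof -
      have "rsE p (Edg V) (\<lambda>E. of_bool (\<exists>i\<in>{1..<Nf - 4 * K}. ?e2 i E)) \<le> (\<Sum>i\<in>{1..<Nf - 4 * K}. rsE p (Edg V) (\<lambda>E. of_bool (?e2 i E)))"
        by (rule rsE_of_bool_ex[OF p1(3,2)]) simp
      also have "\<dots> \<le> c2"
        unfolding c2_def
      proof (rule sum_mono)
        fix i assume i: "i \<in> {1..<Nf - 4 * K}"
        show "rsE p (Edg V) (\<lambda>E. of_bool (?e2 i E)) \<le> nc (Nf - K - 2 - i) * (exp 50 * e * exp (- nu * (real (i * h) - a0)))"
        proof (rule hit_avoid[OF V(1) x V(2) A ih[OF i]])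
          show "2 \<le> Nf - K - 2 - i" using i K N4 by auto
          have "(Nf - K - 2 - i) + i + 1 = Nf - (K + 1)" using i N4 K1 by auto
          then have "(Nf - (K + 1)) * h = ((Nf - K - 2 - i) + i + 1) * h" by (simp only:)
          then show "(Nf - K - 2 - i) * h + i * h + h \<le> L" unfolding L_def Ldist_def distrib_right by (simp only: mult_1)
        qed
      qed
      finally show ?thesis .
    qed
    moreover have "rsE p (Edg V) (\<lambda>E. of_bool (?e3 E)) \<le> c3"
      unfolding c3_def
    proof (rule hit_then_die[OF V(1) x V(2) _ _ _ P(1) _ Nf_sub(3,4,5)[OF P(2)]])
      have "real (Suc H) * e = real H * e + e" by (simp add: distrib_right)
      then show "real (Suc H) * e \<le> 5 * ell" using H2 e1 ell100 by linarith
      show "real P \<le> ell / 4" using P ell100 by linarith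
    qed (use mH hp in auto)
    moreover have "rsE p (Edg V) (\<lambda>E. of_bool (\<exists>b\<in>{..<H}. ?e4 b E)) \<le> c4"
    proof -
      have "rsE p (Edg V) (\<lambda>E. of_bool (\<exists>b\<in>{..<H}. ?e4 b E)) \<le> (\<Sum>b\<in>{..<H}. rsE p (Edg V) (\<lambda>E. of_bool (?e4 b E)))"
        by (rule rsE_of_bool_ex[OF p1(3,2)]) simp
      also have "\<dots> \<le> (\<Sum>b\<in>{..<H}. exp (- s0))"
        using V x by (intro sum_mono overshoot_level) auto
      finally show ?thesis by (simp add: c4_def)
    qed
    ultimately show ?thesis by linarith
  qed
  have "e\<^sup>2 * (\<Sum>x\<in>V. rsE p (Edg V) (\<lambda>E. of_bool (short A K P x E))) \<le> e\<^sup>2 * (\<Sum>x\<in>V. c1 + c2 + c3 + c4)"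
    using each by (intro mult_left_mono sum_mono) auto
  also have "\<dots> = e\<^sup>2 * (n * c1) + e\<^sup>2 * (n * c2) + e\<^sup>2 * (n * c3) + e\<^sup>2 * (n * c4)"
    using V by (simp add: algebra_simps)
  also have "\<dots> \<le> 4 * exp 35 * (4 ^ (K + 3) * exp (- (ell / 2)) + exp (- (9 / 10 * (real K - 2)))) +
      exp 50 * (11943936 / 2 ^ K + 10 * ell * exp (2 * ell) * exp (- (sL / 16))) +
      exp 50 * (eta P * 4 ^ (4 * K + 1)) + 233280 * ell / sL"
  proof (intro add_mono)
    have "e\<^sup>2 * (n * c1) = 4 * exp 35 * (e\<^sup>2 * (n * (e * (exp (- nu * (real L - h)) + exp (- nu * (real H - h - a0))))))"
      by (simp add: c1_def)
    also have "\<dots> = 4 * exp 35 * (Lam * exp (- nu * (real L - h)) + Lam * exp (- nu * (real H - h - a0)))"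
      unfolding en_Lam by (simp only: distrib_left)
    also have "Lam * exp (- nu * (real H - h - a0)) = exp (ell - nu * (real H - h - a0))" by (rule Lam_exp)
    also have "Lam * exp (- nu * (real L - h)) = exp (ell - nu * (real L - h))"
      unfolding exp_ell[symmetric] exp_add[symmetric] by simp
    also have "exp (ell - nu * (real L - h)) \<le> 4 ^ (K + 3) * exp (- (ell / 2))"
    proof -
      have "real L - h = real ((Nf - (K + 2)) * h)"
        unfolding L_def Ldist_def Nf_sub(2)[OF Kl(1)] Nf_sub(2)[OF Kl(2)] by (simp add: algebra_simps)
      then have "exp (ell - nu * (real L - h)) = exp (ell - nu * (real ((Nf - (K + 2)) * h) - a0)) * exp (- (nu * a0))"
        by (simp only: exp_add[symmetric]) (simp add: right_diff_distrib)
      also have "\<dots> \<le> 4 ^ (K + 2 + 1) * exp (- (ell / 2))"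
        using a0_bounds(4) by (intro mult_mono Nf_sub(7)[OF Kl(2)]) auto
      finally show ?thesis by (simp add: eval_nat_numeral)
    qed
    also have "exp (ell - nu * (real H - h - a0)) \<le> exp (- (9 / 10 * (real K - 2)))"
    proof -
      have "ell / nu + (real K - 2) * h \<le> real H - h - a0"
        using Nf_bounds(2) by (simp add: H_def algebra_simps)
      then have "nu * (ell / nu + (real K - 2) * h) \<le> nu * (real H - h - a0)" using nu_bounds by (intro mult_left_mono) auto
      moreover have "nu * (ell / nu + (real K - 2) * h) = ell + (real K - 2) * (nu * h)"
        using nu_bounds by (simp add: field_simps)
      moreover have "(real K - 2) * (9 / 10) \<le> (real K - 2) * (nu * h)" using K nu_h by (intro mult_left_mono) auto
      ultimately have "ell - nu * (real H - h - a0) \<le> - (9 / 10 * (real K - 2))" by linarith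
      then show ?thesis by (simp only: exp_le_cancel_iff)
    qed
    finally show "e\<^sup>2 * (n * c1) \<le> 4 * exp 35 * (4 ^ (K + 3) * exp (- (ell / 2)) + exp (- (9 / 10 * (real K - 2))))"
      by simp
    have "n * c2 = (\<Sum>i\<in>{1..<Nf - 4 * K}. nc (Nf - K - 2 - i) * pr i)"
      unfolding c2_def pr_def sum_distrib_left by (intro sum.cong refl) simp
    then show "e\<^sup>2 * (n * c2) \<le> exp 50 * (11943936 / 2 ^ K + 10 * ell * exp (2 * ell) * exp (- (sL / 16)))"
      using early_blocks[OF K1 K(2)] by simp
    have "e\<^sup>2 * (n * c3) = eta P * (e\<^sup>2 * pr (Nf - 4 * K))" by (simp add: c3_def m_def pr_def)
    also have "\<dots> = exp 50 * (eta P * exp (ell - nu * (real ((Nf - 4 * K) * h) - a0)))" unfolding pr_eq by simp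
    also have "\<dots> \<le> exp 50 * (eta P * 4 ^ (4 * K + 1))"
      using Nf_sub(7)[OF K(2)] eta_nonneg by (intro mult_left_mono) auto
    finally show "e\<^sup>2 * (n * c3) \<le> exp 50 * (eta P * 4 ^ (4 * K + 1))" .
    have "e\<^sup>2 * (n * c4) = (real H * e) * ((s0 * s0) * exp (- s0))"
      unfolding s0_sq by (simp add: c4_def power2_eq_square)
    also have "\<dots> \<le> (5 * ell) * (46656 / sL)"
      by (rule mult_mono[OF He exp_s0_small[unfolded power2_eq_square]]) (use ell100 in auto)
    finally show "e\<^sup>2 * (n * c4) \<le> 233280 * ell / sL" by simp
  qed
  finally show ?thesis .
qed

text \<open>Each of the h levels of the window has at least 1 / e vertices except with probability
  \<open>eta K\<close>. By Markov's inequality for the number of bad levels, more than half of them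
  are good, which gives h / (2 e) \<ge> 1 / (2 e^2) vertices.\<close>

lemma many_far:
  assumes V: "finite V" "card V = n" and A: "A \<subseteq> V" "s0 \<le> card A" "card A \<le> 6 * s0"
    and K: "2 \<le> K" "real (4 * K) \<le> ell / 10"
  shows "rsE p (Edg V) (\<lambda>E. of_bool ((\<Sum>k\<in>{Ldist K..<Ldist K + h}. real (card (lev E A k))) < 1 / (2 * e\<^sup>2))) \<le> 2 * eta K"
proof -
  have hp: "1 \<le> h" by (rule h_bounds)
  have he: "1 \<le> e * h" by (rule h_bounds)
  have Kl: "real (K + 1) \<le> ell / 10" "real K \<le> ell / 10" using K by simp_all
  have NK: "K + 1 + 2 \<le> Nf" using Nf_sub(1)[OF Kl(1)] .
  let ?I = "{Ldist K..<Ldist K + h}"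
  have "rsE p (Edg V) (\<lambda>E. of_bool ((\<Sum>k\<in>?I. real (card (lev E A k))) < 1 / (2 * e\<^sup>2)))
    \<le> rsE p (Edg V) (\<lambda>E. (2 / h) * (\<Sum>k\<in>?I. of_bool (card (lev E A k) < 1 / e)))"
  proof (rule rsE_mono[OF p1(3,2)])
    fix E
    let ?b = "\<Sum>k\<in>?I. of_bool (card (lev E A k) < 1 / e) :: real"
    show "of_bool ((\<Sum>k\<in>?I. real (card (lev E A k))) < 1 / (2 * e\<^sup>2)) \<le> (2 / h) * ?b"
    proof (cases "(\<Sum>k\<in>?I. real (card (lev E A k))) < 1 / (2 * e\<^sup>2)")
      case True
      have "1 / e * (h - ?b) = (\<Sum>k\<in>?I. 1 / e * (1 - of_bool (card (lev E A k) < 1 / e)))"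
        unfolding sum_distrib_left[symmetric] sum_subtractf by simp
      also have "\<dots> \<le> (\<Sum>k\<in>?I. real (card (lev E A k)))" by (intro sum_mono) (auto simp: of_bool_def)
      finally have "1 / e * (h - ?b) < 1 / (2 * e\<^sup>2)" using True by linarith
      then have "e * (1 / e * (h - ?b)) < e * (1 / (2 * e\<^sup>2))" using e0 by (rule mult_strict_left_mono)
      then have "h - ?b < 1 / (2 * e)" using e0 by (simp add: power2_eq_square)
      also have "\<dots> \<le> h / 2" using he e0 by (simp add: field_simps)
      finally have "h / 2 \<le> ?b" by (simp add: field_simps)
      then have "(2 / h) * (h / 2) \<le> (2 / h) * ?b" by (intro mult_left_mono) auto
      then show ?thesis using True hp by simp
    next
      case False
      have "0 \<le> (2 / h) * ?b" by (intro mult_nonneg_nonneg sum_nonneg) auto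
      then show ?thesis by (simp only: False of_bool_eq(1))
    qed
  qed
  also have "\<dots> = (2 / h) * (\<Sum>k\<in>?I. rsE p (Edg V) (\<lambda>E. of_bool (card (lev E A k) < 1 / e)))"
    by (simp only: rsE_cmult rsE_sum)
  also have "\<dots> \<le> (2 / h) * (\<Sum>k\<in>?I. eta K)"
  proof (intro mult_left_mono sum_mono)
    fix k assume k: "k \<in> ?I"
    have kr: "real k \<le> real ((Nf - K) * h)"
    proof -
      have "Ldist K + h = (Suc (Nf - (K + 1))) * h" by (simp add: Ldist_def)
      also have "Suc (Nf - (K + 1)) = Nf - K" using NK by simp
      finally have "k \<le> (Nf - K) * h" using k by simp
      then show ?thesis by (simp only: of_nat_le_iff)
    qed
    show "rsE p (Edg V) (\<lambda>E. of_bool (card (lev E A k) < 1 / e)) \<le> eta K"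
    proof (rule chain_eta[OF V(1) A(1) _ _ A(2,3)])
      show "i0 \<le> k" using Nf_sub(3)[OF Kl(1)] k unfolding Ldist_def by auto
      have "real k * e \<le> real ((Nf - K) * h) * e" using kr e0 by (intro mult_right_mono) auto
      then show "real k * e \<le> 5 * ell" using Nf_sub(4)[OF Kl(2)] by linarith
      have "nu * (real k - a0) \<le> nu * (real ((Nf - K) * h) - a0)" using kr nu_bounds by (intro mult_left_mono) auto
      then show "nu * (real k - a0) \<le> ell - 9 / 10 * K" using Nf_sub(5)[OF Kl(2)] by linarith
    qed (use V K Kl be_pos ell100 in auto)
  qed auto
  also have "\<dots> = 2 * eta K" using hp by simp
  finally show ?thesis .
qed

text \<open>If no vertex has a level at \<open>Tlow\<close>, then every vertex of the window is
  \<open>short\<close>, unless a ball is too big. The window has at least 1 / (2 e^2) vertices with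
  high probability, while the expected number of short ones is a small multiple of 1 / e^2.\<close>

lemma lower_tail:
  assumes V: "finite V" "card V = n"
    and K: "2 \<le> K" "real (4 * K) \<le> ell / 10" and P: "1 \<le> P" "real P \<le> ell / 10"
  shows "rsE p (Edg V) (\<lambda>E. of_bool (\<forall>x\<in>V. lev E {x} (Tlow K P) = {}))
    \<le> 10 ^ 9 * ell\<^sup>2 / Lam + 2 * eta K +
      2 * (4 * exp 35 * (4 ^ (K + 3) * exp (- (ell / 2)) + exp (- (9 / 10 * (real K - 2)))) +
      exp 50 * (11943936 / 2 ^ K + 10 * ell * exp (2 * ell) * exp (- (sL / 16))) +
      exp 50 * (eta P * 4 ^ (4 * K + 1)) + 233280 * ell / sL)"
proof -
  have hp: "1 \<le> h" by (rule h_bounds)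
  have sn: "s0 \<le> n"
  proof -
    have "e * n \<le> 1 * real n" using e1 by (intro mult_right_mono) auto
    then have "e * n / 10 ^ 5 \<le> real n" by simp
    then show ?thesis using budget' be_le by linarith
  qed
  have "nat \<lceil>s0\<rceil> \<le> card V" using sn V by (simp add: nat_le_iff ceiling_le_iff)
  then obtain A where A: "A \<subseteq> V" "card A = nat \<lceil>s0\<rceil>" using obtain_subset_with_card_n by metis
  have cA: "s0 \<le> card A" "card A \<le> 6 * s0"
  proof -
    show "s0 \<le> card A" unfolding A(2) by (rule real_nat_ceiling_ge)
    have "real (card A) \<le> s0 + 1" unfolding A(2) using s0_pos by (simp add: of_nat_nat)
    then show "card A \<le> 6 * s0" using s0_ge by simp
  qed
  let ?I = "{Ldist K..<Ldist K + h}"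
  let ?B = "\<lambda>E. \<exists>v\<in>V. be < card (bl E {v} (2 * h))"
  let ?Y = "\<lambda>E. (\<Sum>k\<in>?I. real (card (lev E A k)))"
  let ?Z = "\<lambda>E. \<Sum>x\<in>V. of_bool (short A K P x E) :: real"
  have "rsE p (Edg V) (\<lambda>E. of_bool (\<forall>x\<in>V. lev E {x} (Tlow K P) = {}))
    \<le> rsE p (Edg V) (\<lambda>E. of_bool (?B E) + of_bool (?Y E < 1 / (2 * e\<^sup>2)) + 2 * (e\<^sup>2 * ?Z E))"
  proof (rule rsE_mono[OF p1(3,2)])
    fix E assume E: "E \<subseteq> Edg V"
    have Z0: "0 \<le> 2 * (e\<^sup>2 * ?Z E)" by (intro mult_nonneg_nonneg sum_nonneg) auto
    show "of_bool (\<forall>x\<in>V. lev E {x} (Tlow K P) = {}) \<le> of_bool (?B E) + of_bool (?Y E < 1 / (2 * e\<^sup>2)) + 2 * (e\<^sup>2 * ?Z E)"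
    proof (cases "?B E \<or> ?Y E < 1 / (2 * e\<^sup>2)")
      case True
      have "of_bool (\<forall>x\<in>V. lev E {x} (Tlow K P) = {}) \<le> (1::real)" by simp
      also have "1 \<le> of_bool (?B E) + (of_bool (?Y E < 1 / (2 * e\<^sup>2)) :: real)" using True by (auto simp: of_bool_def)
      finally show ?thesis using Z0 by linarith
    next
      case False
      show ?thesis
      proof (cases "\<forall>x\<in>V. lev E {x} (Tlow K P) = {}")
        case True
        have lV: "lev E A k \<subseteq> V" for k using lev_subset[OF E A(1)] .
        have sub: "(\<Union>k\<in>?I. lev E A k) \<subseteq> {x\<in>V. short A K P x E}"
        proof
          fix x assume "x \<in> (\<Union>k\<in>?I. lev E A k)"
          then obtain k where k: "k \<in> ?I" "x \<in> lev E A k" by blast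
          then have xV: "x \<in> V" using lV by blast
          have "bl E {x} h \<subseteq> bl E {x} (2 * h)" by (intro bl_mono) simp
          moreover have "finite (bl E {x} (2 * h))" using finite_subset[OF bl_subset[OF E] V(1)] xV by simp
          ultimately have "card (bl E {x} h) \<le> card (bl E {x} (2 * h))" by (intro card_mono)
          moreover have "real (card (bl E {x} (2 * h))) \<le> be" using False xV by (auto simp: not_less)
          ultimately have "ball_ok x E" by (simp add: ball_ok_def)
          then have "short A K P x E" unfolding short_def using k True xV by blast
          then show "x \<in> {x\<in>V. short A K P x E}" using xV by simp
        qed
        have "card (\<Union>k\<in>?I. lev E A k) = (\<Sum>k\<in>?I. card (lev E A k))"
          using lev_disjoint[of _ _ E A] finite_subset[OF lV V(1)] by (intro card_UN_disjoint) auto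
        moreover have "card (\<Union>k\<in>?I. lev E A k) \<le> card {x\<in>V. short A K P x E}" using sub V by (intro card_mono) auto
        ultimately have "(\<Sum>k\<in>?I. card (lev E A k)) \<le> card {x\<in>V. short A K P x E}" by simp
        then have "real (\<Sum>k\<in>?I. card (lev E A k)) \<le> real (card {x\<in>V. short A K P x E})" by (simp only: of_nat_le_iff)
        moreover have "real (card {x\<in>V. short A K P x E}) = ?Z E" using V by (simp add: Collect_conj_eq Int_commute)
        ultimately have "?Y E \<le> ?Z E" by simp
        moreover have "1 / (2 * e\<^sup>2) \<le> ?Y E" using False by linarith
        ultimately have "1 / (2 * e\<^sup>2) \<le> ?Z E" by linarith
        then have "2 * e\<^sup>2 * (1 / (2 * e\<^sup>2)) \<le> 2 * e\<^sup>2 * ?Z E" by (intro mult_left_mono) auto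
        then have "1 \<le> 2 * (e\<^sup>2 * ?Z E)" using e0 by simp
        moreover have "0 \<le> of_bool (?B E) + (of_bool (?Y E < 1 / (2 * e\<^sup>2)) :: real)" by simp
        ultimately have "1 \<le> of_bool (?B E) + of_bool (?Y E < 1 / (2 * e\<^sup>2)) + 2 * (e\<^sup>2 * ?Z E)" by linarith
        moreover have "of_bool (\<forall>x\<in>V. lev E {x} (Tlow K P) = {}) \<le> (1 :: real)" by simp
        ultimately show ?thesis by (rule order_trans[rotated])
      next
        case nt: False
        have "0 \<le> of_bool (?B E) + (of_bool (?Y E < 1 / (2 * e\<^sup>2)) :: real)" by simp
        then show ?thesis using Z0 by (simp only: nt of_bool_eq(1))
      qed
    qed
  qed
  also have "\<dots> = rsE p (Edg V) (\<lambda>E. of_bool (?B E)) + rsE p (Edg V) (\<lambda>E. of_bool (?Y E < 1 / (2 * e\<^sup>2)))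
    + 2 * (e\<^sup>2 * (\<Sum>x\<in>V. rsE p (Edg V) (\<lambda>E. of_bool (short A K P x E))))"
    by (simp only: rsE_add rsE_cmult rsE_sum)
  also have "\<dots> \<le> 10 ^ 9 * ell\<^sup>2 / Lam + 2 * eta K +
      2 * (4 * exp 35 * (4 ^ (K + 3) * exp (- (ell / 2)) + exp (- (9 / 10 * (real K - 2)))) +
      exp 50 * (11943936 / 2 ^ K + 10 * ell * exp (2 * ell) * exp (- (sL / 16))) +
      exp 50 * (eta P * 4 ^ (4 * K + 1)) + 233280 * ell / sL)"
    by (intro add_mono mult_left_mono no_big_ball many_far[OF V A(1) cA K] short_mean[OF V A(1) cA(1) K P])
      (use V in auto)
  finally show ?thesis .
qed

section \<open>The diameter\<close>

definition ctr :: real where "ctr = ell / ln lam + 2 * (ell / ln (1 / ls))"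

lemma ctr_eq: "ctr = 2 * (a0 + ell / nu)"
proof -
  have "ln (1 / ls) = nu" using ls_facts by (simp add: nu_def ln_div)
  then show ?thesis unfolding ctr_def a0_def mu_def[symmetric] by simp
qed

lemma upper_length: "real ((2 * Mup K + 6) * h) \<le> ctr + (2 * real K + 8) * (11 / 10) / e"
proof -
  have h1: "h \<le> 11 / 10 / e" using h_bounds e0 by (simp add: field_simps)
  have "real ((2 * Mup K + 6) * h) = 2 * (real (Mup K) * h) + 6 * h" by (simp add: algebra_simps)
  also have "\<dots> \<le> 2 * (a0 + ell / nu + K * h + h) + 6 * h" using Mup_bounds(2)[of K] by (intro add_right_mono mult_left_mono) auto
  also have "\<dots> = ctr + (2 * real K + 8) * h" unfolding ctr_eq by (simp add: algebra_simps)
  also have "(2 * real K + 8) * h \<le> (2 * real K + 8) * (11 / 10 / e)" using mult_left_mono[OF h1, of "2 * real K + 8"] by simp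
  finally show ?thesis by simp
qed

lemma lower_length:
  assumes "real (4 * K) \<le> ell / 10" "real P \<le> ell / 10"
  shows "ctr - (4 * real K + real P + 2) * (11 / 10) / e \<le> Tlow K P"
proof -
  have h1: "h \<le> 11 / 10 / e" using h_bounds e0 by (simp add: field_simps)
  have "ctr - (4 * real K + real P + 2) * (11 / 10 / e) \<le> ctr - (4 * real K + P + 2) * h"
    using mult_left_mono[OF h1, of "4 * real K + P + 2"] by simp
  also have "\<dots> = 2 * (a0 + ell / nu - h) - real (4 * K) * h - real P * h" unfolding ctr_eq by (simp add: algebra_simps)
  also have "\<dots> \<le> 2 * (real Nf * h) - real (4 * K) * h - real P * h" using Nf_bounds(2) by simp
  also have "\<dots> = Tlow K P" unfolding Tlow_def of_nat_add Nf_sub(2)[OF assms(1)] Nf_sub(2)[OF assms(2)] by simp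
  finally show ?thesis by simp
qed

end

section \<open>Tail bounds uniform in n and \<epsilon>\<close>

text \<open>C and \<open>\<Lambda>0\<close> depend on \<eta> alone; this uniformity is what allows
  \<epsilon> to vary with n. K is fixed before P, and the threshold for e^3 n comes last.\<close>

lemma tails:
  fixes \<eta> :: real
  assumes "0 < \<eta>"
  shows "\<exists>C \<Lambda>0. \<forall>n e lam ls. 0 < e \<and> e < 1 / 10 \<and> lam = 1 + e \<and> ls < 1 \<and> ls * exp (- ls) = lam * exp (- lam) \<and> \<Lambda>0 \<le> e ^ 3 * real n \<longrightarrow>
    0 \<le> lam / real n \<and> lam / real n \<le> 1 \<and>
    rsE (lam / real n) (Edg {1..n}) (\<lambda>E. of_bool (\<exists>x\<in>{1..n}. \<exists>d. lev E {x} d \<noteq> {} \<and>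
      ln (e ^ 3 * real n) / ln lam + 2 * (ln (e ^ 3 * real n) / ln (1 / ls)) + C / e \<le> real d)) \<le> \<eta> / 2 \<and>
    rsE (lam / real n) (Edg {1..n}) (\<lambda>E. of_bool (\<forall>x\<in>{1..n}. \<forall>d. lev E {x} d \<noteq> {} \<longrightarrow>
      real d < ln (e ^ 3 * real n) / ln lam + 2 * (ln (e ^ 3 * real n) / ln (1 / ls)) - C / e)) \<le> \<eta> / 2"
proof -
  have "((\<lambda>K::nat. 64 * exp 50 * exp (- (9 / 10 * K)) + 1024 * exp 100 * 46656 * exp (- (9 / 5 * K)) :: real) \<longlongrightarrow> 0) sequentially"
    by real_asymp
  then have ev1: "\<forall>\<^sub>F K::nat in sequentially. 64 * exp 50 * exp (- (9 / 10 * K)) + 1024 * exp 100 * 46656 * exp (- (9 / 5 * K)) < \<eta> / 8"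
    using assms by (intro order_tendstoD) auto
  have "((\<lambda>K::nat. 2 * (1200 / K + exp (1 - 3 / 20 * exp (K / 2 - 16))) + 8 * exp 35 * exp (- (9 / 10 * (real K - 2)))
      + 2 * exp 50 * (11943936 * (1 / 2) ^ K) :: real) \<longlongrightarrow> 0) sequentially"
    by real_asymp
  then have ev2: "\<forall>\<^sub>F K::nat in sequentially. 2 * (1200 / K + exp (1 - 3 / 20 * exp (K / 2 - 16))) + 8 * exp 35 * exp (- (9 / 10 * (real K - 2)))
      + 2 * exp 50 * (11943936 * (1 / 2) ^ K) < \<eta> / 8"
    using assms by (intro order_tendstoD) auto
  obtain K :: nat where K: "2 \<le> K"
    "64 * exp 50 * exp (- (9 / 10 * K)) + 1024 * exp 100 * 46656 * exp (- (9 / 5 * K)) < \<eta> / 8"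
    "2 * (1200 / K + exp (1 - 3 / 20 * exp (K / 2 - 16))) + 8 * exp 35 * exp (- (9 / 10 * (real K - 2)))
      + 2 * exp 50 * (11943936 * (1 / 2) ^ K) < \<eta> / 8"
    using eventually_happens[OF eventually_conj[OF eventually_ge_at_top[of 2] eventually_conj[OF ev1 ev2]]] by auto
  \<comment> \<open>The weight of \<open>eta P\<close> in \<open>lower_tail\<close>. It depends on
    K, so P is chosen afterwards.\<close>
  define c :: real where "c = 2 * exp 50 * 4 ^ (4 * K + 1)"
  have c0: "0 < c" by (simp add: c_def)
  have "((\<lambda>P::nat. c * (1200 / P + exp (1 - 3 / 20 * exp (P / 2 - 16))) :: real) \<longlongrightarrow> 0) sequentially"
    by real_asymp
  then have ev3: "\<forall>\<^sub>F P::nat in sequentially. c * (1200 / P + exp (1 - 3 / 20 * exp (P / 2 - 16))) < \<eta> / 8"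
    using assms by (intro order_tendstoD) auto
  obtain P :: nat where P: "1 \<le> P" "c * (1200 / P + exp (1 - 3 / 20 * exp (P / 2 - 16))) < \<eta> / 8"
    using eventually_happens[OF eventually_conj[OF eventually_ge_at_top[of 1] ev3]] by auto
  define b :: real where "b = 8 * exp 35 * 4 ^ (K + 3)"
  have "((\<lambda>x::real. 10 ^ 9 * (ln x)\<^sup>2 / x + 1024 * exp 100 * (50 * (ln x)\<^sup>2 * exp (4 * ln x) * exp (- (sqrt x / 16)))) \<longlongrightarrow> 0) at_top"
    by real_asymp
  then have ev4: "\<forall>\<^sub>F x::real in at_top. 10 ^ 9 * (ln x)\<^sup>2 / x + 1024 * exp 100 * (50 * (ln x)\<^sup>2 * exp (4 * ln x) * exp (- (sqrt x / 16))) < \<eta> / 8"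
    using assms by (intro order_tendstoD) auto
  have "((\<lambda>x::real. 10 ^ 9 * (ln x)\<^sup>2 / x + 2 / ln x + b * exp (- (ln x / 2)) +
      20 * exp 50 * (ln x * exp (2 * ln x) * exp (- (sqrt x / 16))) + c / ln x + 466560 * ln x / sqrt x) \<longlongrightarrow> 0) at_top"
    by real_asymp
  then have ev5: "\<forall>\<^sub>F x::real in at_top. 10 ^ 9 * (ln x)\<^sup>2 / x + 2 / ln x + b * exp (- (ln x / 2)) +
      20 * exp 50 * (ln x * exp (2 * ln x) * exp (- (sqrt x / 16))) + c / ln x + 466560 * ln x / sqrt x < \<eta> / 8"
    using assms by (intro order_tendstoD) auto
  have ev6: "\<forall>\<^sub>F x::real in at_top. 100 + 40 * K + 10 * P \<le> ln x" by real_asymp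
  have ev7: "\<forall>\<^sub>F x::real in at_top. 10 ^ 5 * (ln x)\<^sup>2 \<le> sqrt x" by real_asymp
  obtain \<Lambda>0 where L0: "\<And>x. \<Lambda>0 \<le> x \<Longrightarrow> 10 ^ 9 * (ln x)\<^sup>2 / x + 1024 * exp 100 * (50 * (ln x)\<^sup>2 * exp (4 * ln x) * exp (- (sqrt x / 16))) < \<eta> / 8 \<and>
     10 ^ 9 * (ln x)\<^sup>2 / x + 2 / ln x + b * exp (- (ln x / 2)) +
      20 * exp 50 * (ln x * exp (2 * ln x) * exp (- (sqrt x / 16))) + c / ln x + 466560 * ln x / sqrt x < \<eta> / 8 \<and>
     100 + 40 * K + 10 * P \<le> ln x \<and> 10 ^ 5 * (ln x)\<^sup>2 \<le> sqrt x"
    using eventually_conj[OF ev4 eventually_conj[OF ev5 eventually_conj[OF ev6 ev7]]] unfolding eventually_at_top_linorder by blast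
  \<comment> \<open>Dominates the block counts of both \<open>upper_length\<close> and
    \<open>lower_length\<close>; 11 / 10 bounds e h.\<close>
  define C where "C = (6 * real K + P + 10) * (11 / 10)"
  show ?thesis
  proof (rule exI[of _ C], rule exI[of _ \<Lambda>0], intro allI impI)
    fix n :: nat and e lam ls :: real
    assume a: "0 < e \<and> e < 1 / 10 \<and> lam = 1 + e \<and> ls < 1 \<and> ls * exp (- ls) = lam * exp (- lam) \<and> \<Lambda>0 \<le> e ^ 3 * real n"
    then have L: "\<Lambda>0 \<le> e ^ 3 * real n" by blast
    interpret W: weakly_supercritical n e lam ls
      using a L0[OF L] by unfold_locales auto
    have V: "finite {1..n}" "card {1..n} = n" by simp_all
    have ell: "ln (e ^ 3 * real n) = W.ell" by (simp add: W.ell_def W.Lam_def)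
    note B = L0[OF L, folded W.Lam_def, folded W.ell_def, folded W.sL_def]
    have c1: "real (4 * K) \<le> W.ell / 10" "real P \<le> W.ell / 10" "real K \<le> W.ell" using B by simp_all
    have C1: "W.ctr - C / e \<le> W.ctr - (4 * real K + real P + 2) * (11 / 10) / e" "W.ctr + (2 * real K + 8) * (11 / 10) / e \<le> W.ctr + C / e"
      using W.e0 by (auto simp: C_def intro!: divide_right_mono)
    have "rsE W.p (Edg {1..n}) (\<lambda>E. of_bool (\<exists>x\<in>{1..n}. \<exists>d. lev E {x} d \<noteq> {} \<and> W.ctr + C / e \<le> real d))
      \<le> rsE W.p (Edg {1..n}) (\<lambda>E. of_bool (\<exists>x\<in>{1..n}. \<exists>d\<ge>(2 * W.Mup K + 6) * W.h. lev E {x} d \<noteq> {}))"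
    proof (rule rsE_of_bool_mono[OF W.p1(3,2)])
      fix E :: "nat set set" assume "\<exists>x\<in>{1..n}. \<exists>d. lev E {x} d \<noteq> {} \<and> W.ctr + C / e \<le> real d"
      then obtain x d where x: "x \<in> {1..n}" "lev E {x} d \<noteq> {}" "W.ctr + C / e \<le> real d" by blast
      have "real ((2 * W.Mup K + 6) * W.h) \<le> real d" using W.upper_length[of K] C1(2) x(3) by linarith
      then have "(2 * W.Mup K + 6) * W.h \<le> d" by (simp only: of_nat_le_iff)
      then show "\<exists>x\<in>{1..n}. \<exists>d\<ge>(2 * W.Mup K + 6) * W.h. lev E {x} d \<noteq> {}" using x by blast
    qed
    also have "\<dots> \<le> 10 ^ 9 * W.ell\<^sup>2 / W.Lam + 64 * exp 50 * exp (- (9 / 10 * K)) +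
      1024 * exp 100 * (46656 * exp (- (9 / 5 * K)) + 50 * W.ell\<^sup>2 * exp (4 * W.ell) * exp (- (W.sL / 16)))"
      by (rule W.upper_tail[OF V c1(3)])
    also have "\<dots> = (10 ^ 9 * W.ell\<^sup>2 / W.Lam + 1024 * exp 100 * (50 * W.ell\<^sup>2 * exp (4 * W.ell) * exp (- (W.sL / 16)))) +
      (64 * exp 50 * exp (- (9 / 10 * K)) + 1024 * exp 100 * 46656 * exp (- (9 / 5 * K)))"
      by (simp only: distrib_left mult.assoc ac_simps)
    also have "\<dots> \<le> \<eta> / 2" using B K(2) assms by linarith
    finally have up: "rsE W.p (Edg {1..n}) (\<lambda>E. of_bool (\<exists>x\<in>{1..n}. \<exists>d. lev E {x} d \<noteq> {} \<and> W.ctr + C / e \<le> real d)) \<le> \<eta> / 2" .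
    have "rsE W.p (Edg {1..n}) (\<lambda>E. of_bool (\<forall>x\<in>{1..n}. \<forall>d. lev E {x} d \<noteq> {} \<longrightarrow> real d < W.ctr - C / e))
      \<le> rsE W.p (Edg {1..n}) (\<lambda>E. of_bool (\<forall>x\<in>{1..n}. lev E {x} (W.Tlow K P) = {}))"
    proof (rule rsE_of_bool_mono[OF W.p1(3,2)])
      fix E :: "nat set set" assume al: "\<forall>x\<in>{1..n}. \<forall>d. lev E {x} d \<noteq> {} \<longrightarrow> real d < W.ctr - C / e"
      have "\<not> real (W.Tlow K P) < W.ctr - C / e" using W.lower_length[OF c1(1,2)] C1(1) by linarith
      then show "\<forall>x\<in>{1..n}. lev E {x} (W.Tlow K P) = {}" using al by blast
    qed
    also have "\<dots> \<le> 10 ^ 9 * W.ell\<^sup>2 / W.Lam + 2 * W.eta K +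
      2 * (4 * exp 35 * (4 ^ (K + 3) * exp (- (W.ell / 2)) + exp (- (9 / 10 * (real K - 2)))) +
      exp 50 * (11943936 / 2 ^ K + 10 * W.ell * exp (2 * W.ell) * exp (- (W.sL / 16))) +
      exp 50 * (W.eta P * 4 ^ (4 * K + 1)) + 233280 * W.ell / W.sL)"
      by (rule W.lower_tail[OF V K(1) c1(1) P(1) c1(2)])
    also have "\<dots> = (10 ^ 9 * W.ell\<^sup>2 / W.Lam + 2 / W.ell + b * exp (- (W.ell / 2)) +
      20 * exp 50 * (W.ell * exp (2 * W.ell) * exp (- (W.sL / 16))) + c / W.ell + 466560 * W.ell / W.sL) +
      (2 * (1200 / K + exp (1 - 3 / 20 * exp (K / 2 - 16))) + 8 * exp 35 * exp (- (9 / 10 * (real K - 2)))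
      + 2 * exp 50 * (11943936 * (1 / 2) ^ K)) + c * (1200 / P + exp (1 - 3 / 20 * exp (P / 2 - 16)))"
      unfolding W.eta_def b_def c_def by (simp add: power_one_over algebra_simps)
    also have "\<dots> \<le> \<eta> / 2" using B K(3) P(2) assms by linarith
    finally have lo: "rsE W.p (Edg {1..n}) (\<lambda>E. of_bool (\<forall>x\<in>{1..n}. \<forall>d. lev E {x} d \<noteq> {} \<longrightarrow> real d < W.ctr - C / e)) \<le> \<eta> / 2" .
    show "0 \<le> lam / real n \<and> lam / real n \<le> 1 \<and>
    rsE (lam / real n) (Edg {1..n}) (\<lambda>E. of_bool (\<exists>x\<in>{1..n}. \<exists>d. lev E {x} d \<noteq> {} \<and>
      ln (e ^ 3 * real n) / ln lam + 2 * (ln (e ^ 3 * real n) / ln (1 / ls)) + C / e \<le> real d)) \<le> \<eta> / 2 \<and>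
    rsE (lam / real n) (Edg {1..n}) (\<lambda>E. of_bool (\<forall>x\<in>{1..n}. \<forall>d. lev E {x} d \<noteq> {} \<longrightarrow>
      real d < ln (e ^ 3 * real n) / ln lam + 2 * (ln (e ^ 3 * real n) / ln (1 / ls)) - C / e)) \<le> \<eta> / 2"
      using up lo W.p1(3,2) unfolding ell W.ctr_def[symmetric] W.p_def by blast
  qed
qed

section \<open>Transfer to the random graph model\<close>

lemma finite_set_Pi_bernoulli:
  assumes "finite A"
  shows "finite (set_pmf (Pi_pmf A False (\<lambda>_. bernoulli_pmf q)))"
proof (rule finite_subset)
  show "set_pmf (Pi_pmf A False (\<lambda>_. bernoulli_pmf q)) \<subseteq> (\<lambda>X x. x \<in> X) ` Pow A"
  proof
    fix g assume "g \<in> set_pmf (Pi_pmf A False (\<lambda>_. bernoulli_pmf q))"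
    then have "\<forall>x. x \<notin> A \<longrightarrow> g x = False" using set_Pi_pmf_subset[OF assms] by fast
    then have "g = (\<lambda>x. x \<in> {x. g x})" "{x. g x} \<in> Pow A" by auto
    then show "g \<in> (\<lambda>X x. x \<in> X) ` Pow A" by (rule image_eqI)
  qed
qed (use assms in simp)

text \<open>Both sides satisfy the recursion of \<open>rsE_insert\<close>, one coordinate of the
  product being a Bernoulli choice. The range of q matters because \<open>bernoulli_pmf\<close>
  truncates its parameter and \<open>rsE\<close> does not.\<close>

lemma expectation_Pi_bernoulli:
  fixes F :: "'a set \<Rightarrow> real"
  assumes "finite A" and q: "0 \<le> q" "q \<le> 1"
  shows "measure_pmf.expectation (Pi_pmf A False (\<lambda>_. bernoulli_pmf q)) (\<lambda>g. F {x \<in> A. g x}) = rsE q A F"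
  using assms(1)
proof (induction A arbitrary: F rule: finite_induct)
  case (insert a A)
  let ?P = "Pi_pmf A False (\<lambda>_. bernoulli_pmf q)"
  have fin: "finite (set_pmf ?P)" using insert.hyps(1) by (rule finite_set_Pi_bernoulli)
  have upd: "measure_pmf.expectation (map_pmf (\<lambda>g. g(a := y)) ?P) (\<lambda>g. F {x \<in> insert a A. g x})
    = rsE q A (\<lambda>X. F (if y then insert a X else X))" for y
  proof -
    have "{x \<in> insert a A. (g(a := y)) x} = (if y then insert a {x \<in> A. g x} else {x \<in> A. g x})" for g
      using insert.hyps(2) by auto
    then have "measure_pmf.expectation (map_pmf (\<lambda>g. g(a := y)) ?P) (\<lambda>g. F {x \<in> insert a A. g x})
      = measure_pmf.expectation ?P (\<lambda>g. (\<lambda>X. F (if y then insert a X else X)) {x \<in> A. g x})" by simp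
    then show ?thesis using insert.IH[of "\<lambda>X. F (if y then insert a X else X)"] by simp
  qed
  have "Pi_pmf (insert a A) False (\<lambda>_. bernoulli_pmf q) = bernoulli_pmf q \<bind> (\<lambda>y. map_pmf (\<lambda>g. g(a := y)) ?P)"
    using insert.hyps by (simp add: Pi_pmf_insert' map_pmf_def)
  then have "measure_pmf.expectation (Pi_pmf (insert a A) False (\<lambda>_. bernoulli_pmf q)) (\<lambda>g. F {x \<in> insert a A. g x})
    = (\<Sum>y\<in>UNIV. pmf (bernoulli_pmf q) y *\<^sub>R measure_pmf.expectation (map_pmf (\<lambda>g. g(a := y)) ?P) (\<lambda>g. F {x \<in> insert a A. g x}))"
    using fin by (simp only:) (subst pmf_expectation_bind[of UNIV], auto)
  also have "\<dots> = rsE q (insert a A) F"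
    unfolding upd using insert.hyps q by (simp add: UNIV_bool rsE_insert)
  finally show ?case .
qed simp

lemma prob_G_np:
  assumes q: "0 \<le> q" "q \<le> 1"
  shows "measure_pmf.prob (G_np n q) {G. Q G} = rsE q (Edg {1..n}) (\<lambda>E. of_bool (Q (graph_of_edges n E)))"
proof -
  have pe: "possible_edges n = Edg {1..n}" by (simp add: possible_edges_def Edg_def)
  let ?P = "Pi_pmf (Edg {1..n}) False (\<lambda>_. bernoulli_pmf q)"
  have "measure_pmf.prob (G_np n q) {G. Q G} = measure_pmf.prob ?P {g. Q (graph_of_edges n {e \<in> Edg {1..n}. g e})}"
    by (simp add: G_np_def pe vimage_def)
  also have "\<dots> = measure_pmf.expectation ?P (indicator {g. Q (graph_of_edges n {e \<in> Edg {1..n}. g e})})"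
    by simp
  also have "indicator {g. Q (graph_of_edges n {e \<in> Edg {1..n}. g e})} =
      (\<lambda>g. (\<lambda>E. of_bool (Q (graph_of_edges n E)) :: real) {e \<in> Edg {1..n}. g e})"
    by (auto simp: indicator_def fun_eq_iff)
  finally show ?thesis using expectation_Pi_bernoulli[of "Edg {1..n}" q "\<lambda>E. of_bool (Q (graph_of_edges n E))"] q by simp
qed

lemma graph_of_edges_walk:
  assumes E: "E \<subseteq> possible_edges n" and x: "x \<in> {1..n}"
  shows "(\<exists>w. pre_digraph.awalk (graph_of_edges n E) x w y \<and> length w = k) \<longleftrightarrow> wlk E k x y"
proof -
  interpret graph "graph_of_edges n E" using E by (rule graph_graph_of_edges)
  show ?thesis
    using x
  proof (induction k arbitrary: x)
    case 0
    then have "x \<in> verts (graph_of_edges n E)" by (simp add: graph_of_edges_def)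
    then show ?case by (auto simp: awalk_Nil_iff)
  next
    case (Suc k)
    have arc: "e \<in> arcs (graph_of_edges n E) \<longleftrightarrow> {fst e, snd e} \<in> E"
      "tail (graph_of_edges n E) e = fst e" "head (graph_of_edges n E) e = snd e" for e
      by (auto simp: graph_of_edges_def case_prod_beta)
    have V: "z \<in> {1..n}" if "{x, z} \<in> E" for z using that E by (auto simp: possible_edges_def)
    have "(\<exists>w. awalk x w y \<and> length w = Suc k) \<longleftrightarrow> (\<exists>e w. awalk x (e # w) y \<and> length w = k)"
      by (auto simp: length_Suc_conv)
    also have "\<dots> \<longleftrightarrow> (\<exists>z. {x, z} \<in> E \<and> (\<exists>w. awalk z w y \<and> length w = k))"
      by (auto simp: awalk_Cons_iff arc)
    also have "\<dots> \<longleftrightarrow> wlk E (Suc k) x y" using Suc.IH V by auto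
    finally show ?case .
  qed
qed

lemma graph_dist_lev:
  assumes E: "E \<subseteq> possible_edges n" and x: "x \<in> {1..n}"
  shows "y \<in> lev E {x} k \<Longrightarrow> graph_dist (graph_of_edges n E) x y = ereal (real k)"
    and "graph_dist (graph_of_edges n E) x y < \<infinity> \<Longrightarrow> \<exists>k. y \<in> lev E {x} k"
proof -
  interpret graph "graph_of_edges n E" using E by (rule graph_graph_of_edges)
  have d: "graph_dist (graph_of_edges n E) x y = (INF w\<in>{w. awalk x w y}. ereal (real (length w)))"
    by (rule graph_dist_eq_INF_length) (rule wf_digraph_axioms)
  note walk = graph_of_edges_walk[OF E x, of y]
  show "graph_dist (graph_of_edges n E) x y = ereal (real k)" if y: "y \<in> lev E {x} k"
    unfolding d
  proof (rule antisym)
    obtain w where "awalk x w y" "length w = k" using walk[of k] y by (auto simp: lev_single_iff)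
    then show "(INF w\<in>{w. awalk x w y}. ereal (real (length w))) \<le> ereal (real k)" by (intro INF_lower2[of w]) auto
    show "ereal (real k) \<le> (INF w\<in>{w. awalk x w y}. ereal (real (length w)))"
    proof (rule INF_greatest)
      fix w assume "w \<in> {w. awalk x w y}"
      then have "wlk E (length w) x y" using walk[of "length w"] by blast
      then have "k \<le> length w" using y unfolding lev_single_iff by (meson not_le)
      then show "ereal (real k) \<le> ereal (real (length w))" by simp
    qed
  qed
  show "\<exists>k. y \<in> lev E {x} k" if fin: "graph_dist (graph_of_edges n E) x y < \<infinity>"
  proof -
    obtain w where "awalk x w y" using fin unfolding d INF_less_iff by blast
    then have "wlk E (length w) x y" using walk[of "length w"] by blast
    then show ?thesis using wlk_imp_lev[of x "{x}"] by blast
  qed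
qed

text \<open>For n \<ge> 1 the set of finite distances is nonempty, as it contains the distance 0 of
  vertex 1 to itself, so its maximum is attained by some level.\<close>

lemma diam_lev:
  assumes E: "E \<subseteq> possible_edges n" and n: "1 \<le> n"
  shows "\<exists>x\<in>{1..n}. \<exists>k. lev E {x} k \<noteq> {} \<and> diam (graph_of_edges n E) = real k"
    and "x \<in> {1..n} \<Longrightarrow> lev E {x} k \<noteq> {} \<Longrightarrow> real k \<le> diam (graph_of_edges n E)"
proof -
  let ?G = "graph_of_edges n E"
  define D where "D = {graph_dist ?G x y | x y. x \<in> verts ?G \<and> y \<in> verts ?G \<and> graph_dist ?G x y < \<infinity>}"
  have V: "verts ?G = {1..n}" by (simp add: graph_of_edges_def)
  have "D \<subseteq> (\<lambda>(x, y). graph_dist ?G x y) ` ({1..n} \<times> {1..n})" unfolding D_def V by auto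
  then have fin: "finite D" by (rule finite_subset) simp
  have EV: "E \<subseteq> Edg {1..n}" using E by (simp add: possible_edges_def Edg_def)
  have in_D: "ereal (real k) \<in> D" if x: "x \<in> {1..n}" "lev E {x} k \<noteq> {}" for x k
  proof -
    obtain y where y: "y \<in> lev E {x} k" using x by blast
    then have "y \<in> {1..n}" using lev_subset[OF EV, of "{x}" k] x(1) by blast
    moreover have "graph_dist ?G x y = ereal (real k)" using graph_dist_lev(1)[OF E x(1) y] .
    ultimately show ?thesis unfolding D_def V using x(1) by force
  qed
  have "ereal (real 0) \<in> D" using n by (intro in_D[of 1]) auto
  then have "Max D \<in> D" using fin by (intro Max_in) auto
  then obtain x y where xy: "x \<in> {1..n}" "Max D = graph_dist ?G x y" "graph_dist ?G x y < \<infinity>"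
    unfolding D_def V by blast
  then obtain k where k: "y \<in> lev E {x} k" using graph_dist_lev(2)[OF E] by blast
  have max: "Max D = ereal (real k)" using graph_dist_lev(1)[OF E xy(1) k] xy(2) by simp
  then have dk: "diam ?G = real k" unfolding diam_def D_def[symmetric] by simp
  show "\<exists>x\<in>{1..n}. \<exists>k. lev E {x} k \<noteq> {} \<and> diam ?G = real k" using xy(1) k dk by blast
  show "real k' \<le> diam ?G" if "x' \<in> {1..n}" "lev E {x'} k' \<noteq> {}" for x' k'
  proof -
    have "ereal (real k') \<le> Max D" using in_D[OF that] fin by (intro Max_ge)
    then show ?thesis unfolding max dk by simp
  qed
qed

theorem theorem1p3:
  fixes \<epsilon> lam lam_star :: "nat \<Rightarrow> real"
  assumes eps_bounds: "\<And>n. n \<ge> 1 \<Longrightarrow> 0 < \<epsilon> n \<and> \<epsilon> n < 1 / 10"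
    and eps_large: "filterlim (\<lambda>n. \<epsilon> n ^ 3 * real n) at_top sequentially"
    and lam_def: "\<And>n. n \<ge> 1 \<Longrightarrow> lam n = 1 + \<epsilon> n"
    and lam_star: "\<And>n. n \<ge> 1 \<Longrightarrow>
           lam_star n < 1 \<and> lam_star n * exp (- lam_star n) = lam n * exp (- lam n)"
  shows "bigO_in_prob
           (\<lambda>n. G_np n (lam n / real n))
           (\<lambda>n G. diam G -
              (ln (\<epsilon> n ^ 3 * real n) / ln (lam n) +
               2 * (ln (\<epsilon> n ^ 3 * real n) / ln (1 / lam_star n))))
           (\<lambda>n. 1 / \<epsilon> n)"
  unfolding bigO_in_prob_def
proof (intro allI impI)
  fix \<eta> :: real assume "0 < \<eta>"
  then obtain C \<Lambda>0 where tails: "\<And>n e lam ls. 0 < e \<and> e < 1 / 10 \<and> lam = 1 + e \<and> ls < 1 \<and> ls * exp (- ls) = lam * exp (- lam) \<and> \<Lambda>0 \<le> e ^ 3 * real n \<Longrightarrow>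
    0 \<le> lam / real n \<and> lam / real n \<le> 1 \<and>
    rsE (lam / real n) (Edg {1..n}) (\<lambda>E. of_bool (\<exists>x\<in>{1..n}. \<exists>d. lev E {x} d \<noteq> {} \<and>
      ln (e ^ 3 * real n) / ln lam + 2 * (ln (e ^ 3 * real n) / ln (1 / ls)) + C / e \<le> real d)) \<le> \<eta> / 2 \<and>
    rsE (lam / real n) (Edg {1..n}) (\<lambda>E. of_bool (\<forall>x\<in>{1..n}. \<forall>d. lev E {x} d \<noteq> {} \<longrightarrow>
      real d < ln (e ^ 3 * real n) / ln lam + 2 * (ln (e ^ 3 * real n) / ln (1 / ls)) - C / e)) \<le> \<eta> / 2"
    using tails[of \<eta>] by blast
  have "\<forall>\<^sub>F n in sequentially. 1 \<le> n \<and> \<Lambda>0 \<le> \<epsilon> n ^ 3 * real n"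
    using eventually_ge_at_top[of 1] eps_large[unfolded filterlim_at_top, rule_format, of \<Lambda>0] by (rule eventually_conj)
  then have "\<forall>\<^sub>F n in sequentially. measure_pmf.prob (G_np n (lam n / real n))
     {G. C * (1 / \<epsilon> n) < \<bar>diam G - (ln (\<epsilon> n ^ 3 * real n) / ln (lam n) + 2 * (ln (\<epsilon> n ^ 3 * real n) / ln (1 / lam_star n)))\<bar>} \<le> \<eta>"
  proof (rule eventually_mono)
    fix n assume n: "1 \<le> n \<and> \<Lambda>0 \<le> \<epsilon> n ^ 3 * real n"
    define ctr where "ctr = ln (\<epsilon> n ^ 3 * real n) / ln (lam n) + 2 * (ln (\<epsilon> n ^ 3 * real n) / ln (1 / lam_star n))"
    define q where "q = lam n / real n"
    define X where "X = (\<lambda>E. \<exists>x\<in>{1..n}. \<exists>d. lev E {x} d \<noteq> {} \<and> ctr + C / \<epsilon> n \<le> real d)"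
    define Y where "Y = (\<lambda>E. \<forall>x\<in>{1..n}. \<forall>d. lev E {x} d \<noteq> {} \<longrightarrow> real d < ctr - C / \<epsilon> n)"
    have t: "0 \<le> q" "q \<le> 1" "rsE q (Edg {1..n}) (\<lambda>E. of_bool (X E)) \<le> \<eta> / 2" "rsE q (Edg {1..n}) (\<lambda>E. of_bool (Y E)) \<le> \<eta> / 2"
      using tails[of "\<epsilon> n" "lam n" "lam_star n" n] eps_bounds[of n] lam_def[of n] lam_star[of n] n
      unfolding X_def Y_def ctr_def q_def by blast+
    have "measure_pmf.prob (G_np n q) {G. C * (1 / \<epsilon> n) < \<bar>diam G - ctr\<bar>}
      = rsE q (Edg {1..n}) (\<lambda>E. of_bool (C * (1 / \<epsilon> n) < \<bar>diam (graph_of_edges n E) - ctr\<bar>))"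
      using t(1,2) by (rule prob_G_np)
    also have "\<dots> \<le> rsE q (Edg {1..n}) (\<lambda>E. of_bool (X E) + of_bool (Y E))"
    proof (rule rsE_mono[OF t(1,2)])
      fix E assume "E \<subseteq> Edg {1..n}"
      then have E: "E \<subseteq> possible_edges n" by (simp add: possible_edges_def Edg_def)
      have n1: "1 \<le> n" using n by simp
      have "X E \<or> Y E" if dev: "C * (1 / \<epsilon> n) < \<bar>diam (graph_of_edges n E) - ctr\<bar>"
      proof (cases "ctr \<le> diam (graph_of_edges n E)")
        case True
        obtain x k where "x \<in> {1..n}" "lev E {x} k \<noteq> {}" "diam (graph_of_edges n E) = real k"
          using diam_lev(1)[OF E n1] by blast
        moreover have "ctr + C / \<epsilon> n \<le> diam (graph_of_edges n E)" using dev True by simp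
        ultimately have "X E" unfolding X_def by metis
        then show ?thesis ..
      next
        case False
        then have lt: "diam (graph_of_edges n E) < ctr - C / \<epsilon> n" using dev by simp
        have "real d < ctr - C / \<epsilon> n" if "x \<in> {1..n}" "lev E {x} d \<noteq> {}" for x d
          using diam_lev(2)[OF E n1 that] lt by linarith
        then show ?thesis unfolding Y_def by blast
      qed
      then show "of_bool (C * (1 / \<epsilon> n) < \<bar>diam (graph_of_edges n E) - ctr\<bar>) \<le> of_bool (X E) + (of_bool (Y E) :: real)"
        by (auto simp only: of_bool_def split: if_split)
    qed
    also have "\<dots> \<le> \<eta>" unfolding rsE_add using t(3,4) by linarith
    finally show "measure_pmf.prob (G_np n (lam n / real n))
     {G. C * (1 / \<epsilon> n) < \<bar>diam G - (ln (\<epsilon> n ^ 3 * real n) / ln (lam n) + 2 * (ln (\<epsilon> n ^ 3 * real n) / ln (1 / lam_star n)))\<bar>} \<le> \<eta>"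
      unfolding q_def ctr_def .
  qed
  then show "\<exists>C. \<forall>\<^sub>F n in sequentially. measure_pmf.prob (G_np n (lam n / real n))
     {G. C * (1 / \<epsilon> n) < \<bar>diam G - (ln (\<epsilon> n ^ 3 * real n) / ln (lam n) + 2 * (ln (\<epsilon> n ^ 3 * real n) / ln (1 / lam_star n)))\<bar>} \<le> \<eta>"
    by blast
qed

end
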